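(* Let $f\geq1$, $K=\mathbb{Q}_2(\zeta)$ with $\zeta$ a primitive $(2^f-1)$-th root of unity, $\mathfrak{o}$ its ring of integers, $\mathfrak{p}=2\mathfrak{o}$, $\pi=2$, and let $n\in\mathfrak{o}$. Let $\rho\in\mathfrak{o}^\times$ be the fixed unit described in the context. Let $Q$ be the polynomial in $r_1+2r_2+2r_3$ variables $$Q=\sum_{i=1}^{r_1}(b_ix_i^2+c_ix_i)+\sum_{j=1}^{r_2}(b'_jy_{j,1}y_{j,2}+c'_{j,1}y_{j,1}+c'_{j,2}y_{j,2})+\sum_{k=1}^{r_3}\big(b''_k(z_{k,1}^2+z_{k,1}z_{k,2}+\rho z_{k,2}^2)+c''_{k,1}z_{k,1}+c''_{k,2}z_{k,2}\big)$$ with $b_i,b'_j,b''_k\in\mathfrak{o}\setminus\{0\}$ and all $c$'s in $\mathfrak{o}$. Put $u_i\coloneqq\pi^{-\mathrm{ord}_{\mathfrak{p}}(b_i)}b_i$, $t_i\coloneqq\min(\mathrm{ord}_{\mathfrak{p}}(b_i),\mathrm{ord}_{\mathfrak{p}}(c_i))$, $t'_j\coloneqq\min(\mathrm{ord}_{\mathfrak{p}}(b'_j),\mathrm{ord}_{\mathfrak{p}}(c'_{j,1}),\mathrm{ord}_{\mathfrak{p}}(c'_{j,2}))$, $t''_k\coloneqq\min(\mathrm{ord}_{\mathfrak{p}}(b''_k),\mathrm{ord}_{\mathfrak{p}}(c''_{k,1}),\mathrm{ord}_{\mathfrak{p}}(c''_{k,2}))$. Let $D_{\mathfrak{p}},E_{\mathfrak{p}},N_{\mathfrak{p}}$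 be the sets of $i\in\{1,\dots,r_1\}$ with $\mathrm{ord}_{\mathfrak{p}}(b_i)>$, $=$, $<\mathrm{ord}_{\mathfrak{p}}(c_i)$ respectively; $D'_{\mathfrak{p}}$ (resp. $N'_{\mathfrak{p}}$) the set of $j$ with $\mathrm{ord}_{\mathfrak{p}}(b'_j)>\min(\mathrm{ord}_{\mathfrak{p}}(c'_{j,1}),\mathrm{ord}_{\mathfrak{p}}(c'_{j,2}))$ (resp. $\leq$); $D''_{\mathfrak{p}}$ (resp. $N''_{\mathfrak{p}}$) the set of $k$ with $\mathrm{ord}_{\mathfrak{p}}(b''_k)>\min(\mathrm{ord}_{\mathfrak{p}}(c''_{k,1}),\mathrm{ord}_{\mathfrak{p}}(c''_{k,2}))$ (resp. $\leq$). Let $\mathfrak{t}_d\coloneqq\min\big(\{t_i:i\in D_{\mathfrak{p}}\}\cup\{t_i+1:i\in E_{\mathfrak{p}}\}\cup\{t'_j:j\in D'_{\mathfrak{p}}\}\cup\{t''_k:k\in D''_{\mathfrak{p}}\}\big)$ ($=\infty$ if this set is empty). For $t\in\mathbb{Z}$ let $\mathcal{L}_{\mathfrak{p}}(t)\coloneqq\{i\in N_{\mathfrak{p}}: t_i-t+1<0\text{ and odd}\}$, $\ell_{\mathfrak{p}}(t)\coloneqq|\mathcal{L}_{\mathfrak{p}}(t)|$. Let $$\mathfrak{n}\coloneqq n+\sum_{i\in N_{\mathfrak{p}}}\frac{c_i^2}{4b_i}+\sum_{j\in N'_{\mathfrak{p}}}\frac{c'_{j,1}c'_{j,2}}{b'_j}+\sum_{k\in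 N''_{\mathfrak{p}}}\frac{\rho c_{k,1}''^2+c_{k,2}''^2-c''_{k,1}c''_{k,2}}{(4\rho-1)b''_k};$$ if $\mathfrak{n}\neq0$ write $\mathfrak{n}=\mathfrak{u}_n\pi^{\mathfrak{t}_n}$ with $\mathfrak{u}_n\in\mathfrak{o}^\times$, else $\mathfrak{t}_n\coloneqq\infty$. Define $$\tau_{\mathfrak{p}}(t)\coloneqq t+\sum_{\substack{i\in N_{\mathfrak{p}}\\t_i+1<t}}\frac{t_i-t+1}{2}+\sum_{\substack{j\in N'_{\mathfrak{p}}\\t'_j<t}}(t'_j-t)+\sum_{\substack{k\in N''_{\mathfrak{p}}\\t''_k<t}}(t''_k-t),$$ $$\delta_{\mathfrak{p}}(t)\coloneqq\prod_{i\in\mathcal{L}_{\mathfrak{p}}(t)}(-1)^{f-1}\eta(u_i)\prod_{\substack{k\in N''_{\mathfrak{p}}\\t''_k-t<0\text{ odd}}}(-1)^{\mathrm{Tr}_{K/\mathbb{Q}_2}(\rho)}.$$ For $t\in\mathbb{Z}$ let $U(t)\coloneqq\{u\in U: c_i/\pi^{t-1}\equiv ub_i^2/\pi^{2t-2}\pmod{\mathfrak{p}}\text{ for all }i\in E_{\mathfrak{p}}\text{ with }t_i+1=t\}$; if $|U(t)|=1$ let $u(t)$ be its element. Let $m(t)\coloneqq\sum_{i\in N_{\mathfrak{p}},\,t_i+1<t}u_i^{2^f-1}$ (which lies in $(1+\mathfrak{p})\cup\mathfrak{p}$). For $1\leq t\leq\min(\mathfrak{t}_d,\mathfrak{t}_n+3)$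 write $-8\mathfrak{n}/\pi^t\equiv\mathfrak{n}_0(t)+2\mathfrak{n}_1(t)\pmod{\mathfrak{p}^2}$ and $m(t)\equiv m_0(t)+2m_1(t)\pmod{\mathfrak{p}^2}$ with $\mathfrak{n}_0(t),\mathfrak{n}_1(t),m_0(t),m_1(t)\in U_0$, and define $\omega_{\mathfrak{p}}(t)$ by: (1) if $|U(t)|=0$: $\omega_{\mathfrak{p}}(t)=0$; (2) if $\ell_{\mathfrak{p}}(t)$ even, $|U(t)|=1$: $\omega_{\mathfrak{p}}(t)=\chi_{\mathfrak{p}^2}\big(m(t)-\frac{8u(t)\mathfrak{n}}{\pi^t}\big)e_{\pi}\big(\frac{m(t)}{8}-\frac{u(t)\mathfrak{n}}{\pi^t}\big)$; (3) if $\ell_{\mathfrak{p}}(t)$ even, $|U(t)|=|U|$, $m(t)\in1+\mathfrak{p}$: $\omega_{\mathfrak{p}}(t)=\chi_{\mathfrak{p}^2}\big(\mathfrak{n}_0(t)m(t)-\frac{8\mathfrak{n}}{\pi^t}\big)e_{\pi}\big(\frac{m(t)}{8}-\frac{\mathfrak{n}}{\mathfrak{n}_0(t)\pi^t}\big)$; (4) if $\ell_{\mathfrak{p}}(t)$ even, $|U(t)|=|U|$, $m(t)\in\mathfrak{p}$, $t\leq\mathfrak{t}_n+1$: $\omega_{\mathfrak{p}}(t)=\chi_{\mathfrak{p}^2}(m(t))e_{\pi}\big(\frac{m(t)}{8}\big)\big(\chi_{\mathfrak{p}^t}(\mathfrak{n})\mathrm{N}(\mathfrak{p})-1\big)$;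 (5) if $\ell_{\mathfrak{p}}(t)$ even, $|U(t)|=|U|$, $m(t)\in\mathfrak{p}$, $t\geq\mathfrak{t}_n+2$: $\omega_{\mathfrak{p}}(t)=\chi_{\pi^{t-3}\mathfrak{o}^\times}\big(\frac{\mathfrak{n}}{m(t)}\big)e_{\pi}\big(\frac{m(t)}{8}-\frac{m_1(t)\mathfrak{n}}{\mathfrak{n}_1(t)\pi^t}\big)$; (6) if $\ell_{\mathfrak{p}}(t)$ odd, $|U(t)|=1$, $m(t)\in1+\mathfrak{p}$: $\omega_{\mathfrak{p}}(t)=\frac{\chi_{\mathfrak{p}^{t-2}}(\mathfrak{n})(-1)^{f-1}\eta(m(t))}{\mathrm{N}(\mathfrak{p})^{1/2}}e_{\pi}\big(\frac{\mathfrak{n}_1(t)u(t)m(t)}{4}-\frac{u(t)\mathfrak{n}}{\pi^t}\big)$; (7) if $\ell_{\mathfrak{p}}(t)$ odd, $|U(t)|=|U|$, $m(t)\in1+\mathfrak{p}$: $\omega_{\mathfrak{p}}(t)=\frac{\chi_{\mathfrak{p}^{t-2}}(\mathfrak{n})(-1)^{f-1}\eta(m(t))}{\mathrm{N}(\mathfrak{p})^{1/2}}\big(\chi_{\mathfrak{p}^2}\big(\mathfrak{n}_1(t)m(t)-\frac{4\mathfrak{n}}{\pi^t}\big)\mathrm{N}(\mathfrak{p})-1\big)$; (8) if $\ell_{\mathfrak{p}}(t)$ odd, $m(t)\in\mathfrak{p}$: $\omega_{\mathfrak{p}}(t)=0$ if $\mathfrak{n}_0(t)^{-1}\notin U(t)$,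 and otherwise $\omega_{\mathfrak{p}}(t)=\frac{\chi_{\pi^{t-3}\mathfrak{o}^\times}(\mathfrak{n})(-1)^{f-1}}{\mathrm{N}(\mathfrak{p})^{1/2}}\eta\big(\frac{8\mathfrak{n}(1+m(t))}{\pi^t}\big)e_{\pi}\big(\frac{m_1(t)\mathfrak{n}_1(t)}{2\mathfrak{n}_0(t)}\big)$. Then $$\beta_{\mathfrak{p}}(n;Q)=1+\sum_{\substack{1\leq t\leq\min(\mathfrak{t}_d,\mathfrak{t}_n+3)\\ t\neq t_i+1\ \forall i\in N_{\mathfrak{p}}}}\omega_{\mathfrak{p}}(t)\delta_{\mathfrak{p}}(t)\mathrm{N}(\mathfrak{p})^{\tau_{\mathfrak{p}}(t)-1}.$$
   Context: $K=\mathbb{Q}_2(\zeta)$ is the unramified extension of $\mathbb{Q}_2$ of degree $f$; $\mathrm{N}(\mathfrak{p})=|\mathfrak{o}/\mathfrak{p}|=2^f$; $\mathrm{ord}_{\mathfrak{p}}$ is the normalized valuation. $U\subset K^\times$ is the cyclic group generated by $\zeta$, $U_0\coloneqq U\cup\{0\}$ (a complete set of representatives of $\mathfrak{o}/\mathfrak{p}$). For $\beta\in\mathbb{Q}_2$ let $e_2(\beta)\coloneqq e^{-2\pi i a}$ with $a\in\mathbb{Z}[1/2]$, $\beta-a\in\mathbb{Z}_2$; for $\alpha\in K$ let $e_{\pi}(\alpha)\coloneqq e_2(\mathrm{Tr}_{K/\mathbb{Q}_2}(\alpha))$. $\chi_S$ is the characteristic function of $S\subseteq K$. The map $\eta:\mathfrak{o}^\times\to\{\pm1\}$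 is $\eta(u)\coloneqq e_{\pi}\big(\frac{c-b}{2a}\big)$ where $u\equiv a+2b+4c\pmod{\mathfrak{p}^3}$ with $a\in U$, $b,c\in U_0$. $\rho\in\mathfrak{o}^\times$ is a fixed unit such that the quadratic defect of $1+4\rho$ is $4\mathfrak{o}$ (so $x^2+xy+\rho y^2$ is the anisotropic unimodular binary form). With $\mathrm{d}x$ the Haar measure on $K$ normalized by $\int_{\mathfrak{o}}\mathrm{d}x=1$, the local density of a polynomial $Q$ in $r$ variables over $\mathfrak{o}$ is $\beta_{\mathfrak{p}}(n;Q)\coloneqq\int_K\int_{\mathfrak{o}^r}e_{\pi}(\sigma(Q(\mathbf{w})-n))\,\mathrm{d}\mathbf{w}\,\mathrm{d}\sigma$.
   Formalization: In U(t) the roles of b_i and c_i are exchanged: b_i/π^{t-1} ≡ u c_i²/π^{2t-2}. In (3) ω(t)=0 if n_0(t)=0; in (5) ω(t)=0 if m(t)=0. The integral over K is the limit of integrals over p^{-T}; it converges iff the sum does, and then equality holds. *)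

theory Defs
  imports "HOL-Analysis.Analysis" "HOL-Computational_Algebra.Computational_Algebra"
begin

section \<open>The 2-adic integers and the 2-adic numbers\<close>

text \<open>The 2-adic integers are the inverse limit of the rings of integers modulo \<open>2 ^ n\<close>,
  each residue class being represented by its least non-negative element.\<close>

typedef z2 = "{x :: nat \<Rightarrow> int. \<forall>n. x n \<in> {0..<2 ^ n} \<and> x (Suc n) mod 2 ^ n = x n}"
  morphisms residue Abs_z2
  by (rule exI[of _ "\<lambda>_. 0"]) simp

setup_lifting type_definition_z2

lemma z2_compat_mod: "residue x (Suc n) mod 2 ^ n = residue x n mod 2 ^ n"
  using residue[of x] by (metis (mono_tags, lifting) mem_Collect_eq mod_mod_trivial)

lemma residue_mod [simp]: "residue x n mod 2 ^ n = residue x n"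
  using residue[of x] by simp

instantiation z2 :: comm_ring_1
begin

lift_definition zero_z2 :: z2 is "\<lambda>_. 0" by simp

lift_definition one_z2 :: z2 is "\<lambda>n. 1 mod 2 ^ n"
  by (simp add: mod_mod_cancel)

lift_definition plus_z2 :: "z2 \<Rightarrow> z2 \<Rightarrow> z2" is "\<lambda>x y n. (x n + y n) mod 2 ^ n"
  by (auto simp: mod_mod_cancel) (metis mod_add_eq)

lift_definition uminus_z2 :: "z2 \<Rightarrow> z2" is "\<lambda>x n. (- x n) mod 2 ^ n"
  by (auto simp: mod_mod_cancel) (metis mod_minus_eq)

lift_definition minus_z2 :: "z2 \<Rightarrow> z2 \<Rightarrow> z2" is "\<lambda>x y n. (x n - y n) mod 2 ^ n"
  by (auto simp: mod_mod_cancel) (metis mod_diff_eq)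

lift_definition times_z2 :: "z2 \<Rightarrow> z2 \<Rightarrow> z2" is "\<lambda>x y n. (x n * y n) mod 2 ^ n"
  by (auto simp: mod_mod_cancel) (metis mod_mult_eq)

instance
proof
  fix a b c :: z2
  show "a * b * c = a * (b * c)"
    by transfer (auto simp: fun_eq_iff mod_simps ac_simps)
  show "a * b = b * a" by transfer (simp add: mult.commute)
  have "residue a 0 = 0"
    using residue_mod[of a 0] by (simp del: residue_mod)
  then show "1 * a = a"
    by - (rule residue_inject[THEN iffD1],
      simp add: fun_eq_iff times_z2.rep_eq one_z2.rep_eq mod_mult_left_eq)
  show "a + b + c = a + (b + c)"
    by transfer (auto simp: fun_eq_iff mod_simps ac_simps)
  show "a + b = b + a" by transfer (simp add: add.commute)
  show "0 + a = a"
    by transfer (simp add: fun_eq_iff)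
  show "- a + a = 0" by transfer (auto simp: fun_eq_iff mod_simps)
  show "a - b = a + - b" by transfer (auto simp: fun_eq_iff mod_simps)
  show "(a + b) * c = a * c + b * c"
    by transfer (auto simp: fun_eq_iff mod_simps algebra_simps)
  show "(0::z2) \<noteq> 1"
  proof transfer
    show "(\<lambda>_. 0) \<noteq> (\<lambda>n. 1 mod 2 ^ n :: int)"
      by (auto simp: fun_eq_iff intro!: exI[of _ 1])
  qed
qed

end

lemma residue_mod_le:
  assumes "m \<le> n"
  shows "residue x n mod 2 ^ m = residue x m"
  using assms
proof (induction rule: dec_induct)
  case base
  show ?case by simp
next
  case (step k)
  have "residue x (Suc k) mod 2 ^ m = (residue x (Suc k) mod 2 ^ k) mod 2 ^ m"
    using step.hyps by (simp add: mod_mod_cancel le_imp_power_dvd)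
  also have "residue x (Suc k) mod 2 ^ k = residue x k"
    using z2_compat_mod[of x k] by simp
  finally show ?case using step.IH by simp
qed

instance z2 :: idom
proof
  fix a b :: z2
  assume "a \<noteq> 0" "b \<noteq> 0"
  then obtain m n where m: "residue a m \<noteq> 0" and n: "residue b n \<noteq> 0"
    by transfer (auto simp: fun_eq_iff)
  have "\<not> 2 ^ m dvd residue a (m + n)"
    using residue_mod_le[of m "m + n" a] m by (auto simp: dvd_eq_mod_eq_0)
  moreover have "\<not> 2 ^ n dvd residue b (m + n)"
    using residue_mod_le[of n "m + n" b] n by (auto simp: dvd_eq_mod_eq_0)
  ultimately have "\<not> 2 ^ (m + n) dvd residue a (m + n) * residue b (m + n)"
  proof -
    assume *: "\<not> 2 ^ m dvd residue a (m + n)" "\<not> 2 ^ n dvd residue b (m + n)"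
    show ?thesis
    proof
      assume "2 ^ (m + n) dvd residue a (m + n) * residue b (m + n)"
      moreover have "prime_elem (2 :: int)" by simp
      ultimately obtain k l where "k + l = m + n" "2 ^ k dvd residue a (m + n)"
        "2 ^ l dvd residue b (m + n)"
        using prime_elem_power_dvd_prod by blast
      moreover from \<open>k + l = m + n\<close> have "m \<le> k \<or> n \<le> l" by linarith
      ultimately show False using * by (meson power_le_dvd)
    qed
  qed
  then have "residue (a * b) (m + n) \<noteq> 0"
    by (simp add: times_z2.rep_eq dvd_eq_mod_eq_0)
  then show "a * b \<noteq> 0"
    by (auto simp: zero_z2.rep_eq)
qed

type_synonym q2 = "z2 fract"

definition q2_ints :: "q2 set"
  where "q2_ints = range (\<lambda>x. Fract x 1)"

text \<open>The value does not depend on the representative \<open>k / 2 ^ m\<close>; note the minus sign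
  in the exponent.\<close>

definition e2 :: "q2 \<Rightarrow> complex"
  where "e2 \<beta> = (THE z. \<exists>(k::int) (m::nat).
    \<beta> - of_int k / 2 ^ m \<in> q2_ints \<and> z = cis (- 2 * pi * (of_int k / 2 ^ m)))"

text \<open>\<open>(-1) ^ x\<close> for a 2-adic integer \<open>x\<close>, depending on \<open>x\<close> modulo 2 only.\<close>

definition neg_one_pow :: "q2 \<Rightarrow> complex"
  where "neg_one_pow x = (if \<exists>y\<in>q2_ints. x = 2 * y then 1 else - 1)"


section \<open>Extension fields of the 2-adic numbers\<close>

class q2_field = field +
  fixes of_q2 :: "q2 \<Rightarrow> 'a"
  assumes of_q2_1: "of_q2 1 = 1"
    and of_q2_add: "of_q2 (x + y) = of_q2 x + of_q2 y"
    and of_q2_mult: "of_q2 (x * y) = of_q2 x * of_q2 y"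

global_interpretation q2: vector_space "\<lambda>q (x :: 'k :: q2_field). of_q2 q * x"
  by unfold_locales (simp_all add: algebra_simps of_q2_1 of_q2_add of_q2_mult)

definition primitive_root_of_unity :: "nat \<Rightarrow> 'k :: field \<Rightarrow> bool"
  where "primitive_root_of_unity m z \<longleftrightarrow>
    0 < m \<and> z ^ m = 1 \<and> (\<forall>k. 0 < k \<and> k < m \<longrightarrow> z ^ k \<noteq> 1)"

definition is_subfield :: "'k :: field set \<Rightarrow> bool"
  where "is_subfield S \<longleftrightarrow> 1 \<in> S \<and>
    (\<forall>x\<in>S. \<forall>y\<in>S. x - y \<in> S \<and> x * y \<in> S) \<and> (\<forall>x\<in>S. inverse x \<in> S)"

text \<open>The field \<open>\<rat>\<^sub>2(z)\<close>.\<close>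

definition q2_adjoin :: "'k :: q2_field \<Rightarrow> 'k set"
  where "q2_adjoin z = \<Inter> {S. is_subfield S \<and> range of_q2 \<subseteq> S \<and> z \<in> S}"

text \<open>The trace of multiplication by \<open>\<alpha>\<close>, computed in some basis of the extension.\<close>

definition q2_trace :: "'k :: q2_field \<Rightarrow> q2"
  where "q2_trace \<alpha> = (let B = q2.extend_basis ({} :: 'k set)
    in \<Sum>b\<in>B. q2.representation B (\<alpha> * b) b)"

definition e_pi :: "'k :: q2_field \<Rightarrow> complex"
  where "e_pi \<alpha> = e2 (q2_trace \<alpha>)"

text \<open>The ring of integers is the integral closure of the 2-adic integers.\<close>

definition int_ring :: "'k :: q2_field set"
  where "int_ring = {x. \<exists>p :: z2 poly. lead_coeff p = 1 \<and>
    poly (map_poly (\<lambda>a. of_q2 (Fract a 1)) p) x = 0}"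

definition unit_group :: "'k :: q2_field set"
  where "unit_group = {x \<in> int_ring. x \<noteq> 0 \<and> inverse x \<in> int_ring}"

text \<open>The powers of the prime ideal \<open>\<pp> = 2\<oo>\<close>.\<close>

definition p_pow :: "int \<Rightarrow> 'k :: q2_field set"
  where "p_pow k = (\<lambda>y. 2 powi k * y) ` int_ring"

text \<open>The set \<open>2\<^sup>k\<oo>\<^sup>\<times>\<close>.\<close>

definition unit_shell :: "int \<Rightarrow> 'k :: q2_field set"
  where "unit_shell k = (\<lambda>y. 2 powi k * y) ` unit_group"

definition ord_p :: "'k :: q2_field \<Rightarrow> ereal"
  where "ord_p x = (if x = 0 then \<infinity> else ereal (of_int (THE k. x \<in> unit_shell k)))"

text \<open>\<open>N(\<pp>)\<close> is the number of residue classes modulo \<open>\<pp>\<close>.\<close>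

definition norm_p :: "'k :: q2_field itself \<Rightarrow> nat"
  where "norm_p _ = card ((\<lambda>x::'k. (+) x ` p_pow 1) ` int_ring)"

text \<open>The quadratic defect of \<open>x\<close> is the intersection of all ideals \<open>\<alpha>\<oo>\<close> with
  \<open>x - \<alpha>\<close> a square.\<close>

definition quadratic_defect :: "'k :: q2_field \<Rightarrow> 'k set"
  where "quadratic_defect x = \<Inter> {(\<lambda>y. \<alpha> * y) ` int_ring | \<alpha>. \<exists>s. x = s\<^sup>2 + \<alpha>}"

definition p_open :: "'k :: q2_field set \<Rightarrow> bool"
  where "p_open S \<longleftrightarrow> (\<forall>x\<in>S. \<exists>k. (+) x ` p_pow k \<subseteq> S)"

definition normalized_haar :: "'k :: q2_field measure \<Rightarrow> bool"
  where "normalized_haar \<mu> \<longleftrightarrow>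
    space \<mu> = UNIV \<and> sets \<mu> = sigma_sets UNIV {S. p_open S} \<and>
    (\<forall>a. \<forall>A\<in>sets \<mu>. emeasure \<mu> ((+) a ` A) = emeasure \<mu> A) \<and>
    emeasure \<mu> int_ring = 1"


section \<open>Representatives of residue classes\<close>

definition UU :: "'k :: field \<Rightarrow> 'k set"
  where "UU \<zeta> = range (\<lambda>k::int. \<zeta> powi k)"

definition UU0 :: "'k :: field \<Rightarrow> 'k set"
  where "UU0 \<zeta> = insert 0 (UU \<zeta>)"

text \<open>The pair \<open>(x\<^sub>0, x\<^sub>1)\<close> of representatives with \<open>x \<equiv> x\<^sub>0 + 2 x\<^sub>1\<close> modulo \<open>\<pp>\<^sup>2\<close>.\<close>

definition two_digits :: "'k :: q2_field \<Rightarrow> 'k \<Rightarrow> 'k \<times> 'k"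
  where "two_digits \<zeta> x = (THE d. fst d \<in> UU0 \<zeta> \<and> snd d \<in> UU0 \<zeta> \<and>
    x - (fst d + 2 * snd d) \<in> p_pow 2)"

definition eta :: "'k :: q2_field \<Rightarrow> 'k \<Rightarrow> complex"
  where "eta \<zeta> u = (THE v. \<exists>a\<in>UU \<zeta>. \<exists>b\<in>UU0 \<zeta>. \<exists>c\<in>UU0 \<zeta>.
    u - (a + 2 * b + 4 * c) \<in> p_pow 3 \<and> v = e_pi ((c - b) / (2 * a)))"


section \<open>Local densities\<close>

text \<open>The variables of a polynomial are indexed by a set \<open>V\<close>, and the polynomial is given by its
  evaluation \<open>F\<close>. The outer integral over the whole field is an improper integral, that is,
  the limit of the integrals over the compact subgroups \<open>\<pp>\<^sup>-\<^sup>T\<close>: in few variables the inner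
  integral is not absolutely integrable in \<open>\<sigma>\<close> even when the local density is finite.
  When it is absolutely integrable, the limit is the Lebesgue integral.\<close>

definition truncated_density ::
  "'k :: q2_field measure \<Rightarrow> 'v set \<Rightarrow> (('v \<Rightarrow> 'k) \<Rightarrow> 'k) \<Rightarrow> 'k \<Rightarrow> nat \<Rightarrow> complex"
  where "truncated_density \<mu> V F n T =
    (LINT \<sigma>:p_pow (- int T)|\<mu>.
      (LINT w:(V \<rightarrow>\<^sub>E int_ring)|(\<Pi>\<^sub>M v\<in>V. \<mu>). e_pi (\<sigma> * (F w - n))))"

definition local_density ::
  "'k :: q2_field measure \<Rightarrow> 'v set \<Rightarrow> (('v \<Rightarrow> 'k) \<Rightarrow> 'k) \<Rightarrow> 'k \<Rightarrow> complex"
  where "local_density \<mu> V F n = lim (truncated_density \<mu> V F n)"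


section \<open>The polynomial and its invariants\<close>

datatype var = VX nat | VY nat nat | VZ nat nat

text \<open>All indices start at 1; the second argument of \<open>cY\<close> and \<open>cZ\<close> is 1 or 2.\<close>

record 'k qpoly =
  rX :: nat
  rY :: nat
  rZ :: nat
  bX :: "nat \<Rightarrow> 'k"
  cX :: "nat \<Rightarrow> 'k"
  bY :: "nat \<Rightarrow> 'k"
  cY :: "nat \<Rightarrow> nat \<Rightarrow> 'k"
  bZ :: "nat \<Rightarrow> 'k"
  cZ :: "nat \<Rightarrow> nat \<Rightarrow> 'k"

definition vars :: "'k qpoly \<Rightarrow> var set"
  where "vars Q = VX ` {1..rX Q} \<union> {VY j s | j s. j \<in> {1..rY Q} \<and> s \<in> {1, 2}} \<union>
    {VZ k s | k s. k \<in> {1..rZ Q} \<and> s \<in> {1, 2}}"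

definition qeval :: "'k :: q2_field \<Rightarrow> 'k qpoly \<Rightarrow> (var \<Rightarrow> 'k) \<Rightarrow> 'k"
  where "qeval \<rho> Q w =
    (\<Sum>i=1..rX Q. bX Q i * (w (VX i))\<^sup>2 + cX Q i * w (VX i)) +
    (\<Sum>j=1..rY Q. bY Q j * w (VY j 1) * w (VY j 2) +
       cY Q j 1 * w (VY j 1) + cY Q j 2 * w (VY j 2)) +
    (\<Sum>k=1..rZ Q. bZ Q k * ((w (VZ k 1))\<^sup>2 + w (VZ k 1) * w (VZ k 2) + \<rho> * (w (VZ k 2))\<^sup>2) +
       cZ Q k 1 * w (VZ k 1) + cZ Q k 2 * w (VZ k 2))"

definition coeffs_ok :: "'k :: q2_field qpoly \<Rightarrow> bool"
  where "coeffs_ok Q \<longleftrightarrow>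
    (\<forall>i\<in>{1..rX Q}. bX Q i \<in> int_ring - {0} \<and> cX Q i \<in> int_ring) \<and>
    (\<forall>j\<in>{1..rY Q}. bY Q j \<in> int_ring - {0} \<and> (\<forall>s\<in>{1, 2}. cY Q j s \<in> int_ring)) \<and>
    (\<forall>k\<in>{1..rZ Q}. bZ Q k \<in> int_ring - {0} \<and> (\<forall>s\<in>{1, 2}. cZ Q k s \<in> int_ring))"

text \<open>The minima defining the \<open>t\<close>'s are finite because the leading coefficients are non-zero,
  so taking the integer part merely changes the type.\<close>

definition uX :: "'k :: q2_field qpoly \<Rightarrow> nat \<Rightarrow> 'k"
  where "uX Q i = 2 powi (- \<lfloor>real_of_ereal (ord_p (bX Q i))\<rfloor>) * bX Q i"

definition tX :: "'k :: q2_field qpoly \<Rightarrow> nat \<Rightarrow> int"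
  where "tX Q i = \<lfloor>real_of_ereal (min (ord_p (bX Q i)) (ord_p (cX Q i)))\<rfloor>"

definition tY :: "'k :: q2_field qpoly \<Rightarrow> nat \<Rightarrow> int"
  where "tY Q j =
    \<lfloor>real_of_ereal (min (ord_p (bY Q j)) (min (ord_p (cY Q j 1)) (ord_p (cY Q j 2))))\<rfloor>"

definition tZ :: "'k :: q2_field qpoly \<Rightarrow> nat \<Rightarrow> int"
  where "tZ Q k =
    \<lfloor>real_of_ereal (min (ord_p (bZ Q k)) (min (ord_p (cZ Q k 1)) (ord_p (cZ Q k 2))))\<rfloor>"

definition DpX :: "'k :: q2_field qpoly \<Rightarrow> nat set"
  where "DpX Q = {i \<in> {1..rX Q}. ord_p (bX Q i) > ord_p (cX Q i)}"

definition EpX :: "'k :: q2_field qpoly \<Rightarrow> nat set"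
  where "EpX Q = {i \<in> {1..rX Q}. ord_p (bX Q i) = ord_p (cX Q i)}"

definition NpX :: "'k :: q2_field qpoly \<Rightarrow> nat set"
  where "NpX Q = {i \<in> {1..rX Q}. ord_p (bX Q i) < ord_p (cX Q i)}"

definition DpY :: "'k :: q2_field qpoly \<Rightarrow> nat set"
  where "DpY Q = {j \<in> {1..rY Q}. ord_p (bY Q j) > min (ord_p (cY Q j 1)) (ord_p (cY Q j 2))}"

definition NpY :: "'k :: q2_field qpoly \<Rightarrow> nat set"
  where "NpY Q = {j \<in> {1..rY Q}. ord_p (bY Q j) \<le> min (ord_p (cY Q j 1)) (ord_p (cY Q j 2))}"

definition DpZ :: "'k :: q2_field qpoly \<Rightarrow> nat set"
  where "DpZ Q = {k \<in> {1..rZ Q}. ord_p (bZ Q k) > min (ord_p (cZ Q k 1)) (ord_p (cZ Q k 2))}"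

definition NpZ :: "'k :: q2_field qpoly \<Rightarrow> nat set"
  where "NpZ Q = {k \<in> {1..rZ Q}. ord_p (bZ Q k) \<le> min (ord_p (cZ Q k 1)) (ord_p (cZ Q k 2))}"

definition t_d :: "'k :: q2_field qpoly \<Rightarrow> ereal"
  where "t_d Q = Inf ((\<lambda>t::int. ereal (of_int t)) `
    (tX Q ` DpX Q \<union> (\<lambda>i. tX Q i + 1) ` EpX Q \<union> tY Q ` DpY Q \<union> tZ Q ` DpZ Q))"

definition LL :: "'k :: q2_field qpoly \<Rightarrow> int \<Rightarrow> nat set"
  where "LL Q t = {i \<in> NpX Q. tX Q i - t + 1 < 0 \<and> odd (tX Q i - t + 1)}"

definition ell :: "'k :: q2_field qpoly \<Rightarrow> int \<Rightarrow> nat"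
  where "ell Q t = card (LL Q t)"

definition frak_n :: "'k :: q2_field \<Rightarrow> 'k qpoly \<Rightarrow> 'k \<Rightarrow> 'k"
  where "frak_n \<rho> Q n = n + (\<Sum>i\<in>NpX Q. (cX Q i)\<^sup>2 / (4 * bX Q i)) +
    (\<Sum>j\<in>NpY Q. cY Q j 1 * cY Q j 2 / bY Q j) +
    (\<Sum>k\<in>NpZ Q. (\<rho> * (cZ Q k 1)\<^sup>2 + (cZ Q k 2)\<^sup>2 - cZ Q k 1 * cZ Q k 2) /
      ((4 * \<rho> - 1) * bZ Q k))"

definition t_n :: "'k :: q2_field \<Rightarrow> 'k qpoly \<Rightarrow> 'k \<Rightarrow> ereal"
  where "t_n \<rho> Q n = ord_p (frak_n \<rho> Q n)"

definition tau :: "'k :: q2_field qpoly \<Rightarrow> int \<Rightarrow> real"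
  where "tau Q t = of_int t +
    (\<Sum>i | i \<in> NpX Q \<and> tX Q i + 1 < t. of_int (tX Q i - t + 1) / 2) +
    (\<Sum>j | j \<in> NpY Q \<and> tY Q j < t. of_int (tY Q j - t)) +
    (\<Sum>k | k \<in> NpZ Q \<and> tZ Q k < t. of_int (tZ Q k - t))"

definition delta :: "nat \<Rightarrow> 'k :: q2_field \<Rightarrow> 'k \<Rightarrow> 'k qpoly \<Rightarrow> int \<Rightarrow> complex"
  where "delta f \<zeta> \<rho> Q t =
    (\<Prod>i\<in>LL Q t. (- 1) ^ (f - 1) * eta \<zeta> (uX Q i)) *
    (\<Prod>k | k \<in> NpZ Q \<and> tZ Q k - t < 0 \<and> odd (tZ Q k - t). neg_one_pow (q2_trace \<rho>))"

text \<open>For \<open>i \<in> EpX Q\<close> with \<open>tX Q i + 1 = t\<close> and \<open>\<sigma> \<equiv> u / 2\<^sup>t\<close>, the function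
  \<open>x \<mapsto> e_pi (\<sigma> (b\<^sub>i x\<^sup>2 + c\<^sub>i x))\<close> on \<open>\<oo>\<close> is trivial if and only if, with \<open>b = b\<^sub>i / 2\<^bsup>t-1\<^esup>\<close> and
  \<open>c = c\<^sub>i / 2\<^bsup>t-1\<^esup>\<close>, \<open>u b \<equiv> (u c)\<^sup>2\<close> modulo \<open>\<pp>\<close>, that is, \<open>b \<equiv> u c\<^sup>2\<close>. The condition with \<open>b\<close> and
  \<open>c\<close> interchanged is equivalent to this one for \<open>f \<le> 2\<close>, but not for \<open>f \<ge> 3\<close>, where it yields
  wrong densities already for \<open>x\<^sup>2 + c x\<close> with a unit \<open>c\<close>.\<close>

definition U_set :: "'k :: q2_field \<Rightarrow> 'k qpoly \<Rightarrow> int \<Rightarrow> 'k set"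
  where "U_set \<zeta> Q t = {u \<in> UU \<zeta>. \<forall>i\<in>EpX Q. tX Q i + 1 = t \<longrightarrow>
    bX Q i / 2 powi (t - 1) - u * (cX Q i)\<^sup>2 / 2 powi (2 * t - 2) \<in> p_pow 1}"

definition m_fun :: "nat \<Rightarrow> 'k :: q2_field qpoly \<Rightarrow> int \<Rightarrow> 'k"
  where "m_fun f Q t = (\<Sum>i | i \<in> NpX Q \<and> tX Q i + 1 < t. uX Q i ^ (2 ^ f - 1))"

text \<open>The cardinality of \<open>U_set\<close> is 0, 1 or that of \<open>UU\<close>. For \<open>f = 1\<close> the last two coincide, and
  the expressions for the two cases then agree. In the third branch the only unit
  which can contribute is the inverse of \<open>n0\<close>; there is none if \<open>n0 = 0\<close>. In the fifth branch \<open>n1 = 0\<close>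
  or \<open>m = 0\<close> makes the indicator vanish, and likewise the argument of \<open>eta\<close> in the last branch is
  a unit whenever the indicator in front does not vanish.\<close>

definition omega :: "nat \<Rightarrow> 'k :: q2_field \<Rightarrow> 'k \<Rightarrow> 'k qpoly \<Rightarrow> 'k \<Rightarrow> int \<Rightarrow> complex"
  where "omega f \<zeta> \<rho> Q n t =
   (let N = of_nat (norm_p TYPE('k)) :: complex;
        sqrtN = complex_of_real (sqrt (of_nat (norm_p TYPE('k))));
        nn = frak_n \<rho> Q n;
        n0 = fst (two_digits \<zeta> (- 8 * nn / 2 powi t));
        n1 = snd (two_digits \<zeta> (- 8 * nn / 2 powi t));
        m = m_fun f Q t;
        m1 = snd (two_digits \<zeta> m);
        Ut = U_set \<zeta> Q t;
        u = the_elem Ut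
    in
      if card Ut = 0 then 0
      else if even (ell Q t) then
        (if card Ut = 1 then
           indicator (p_pow 2) (m - 8 * u * nn / 2 powi t) *
             e_pi (m / 8 - u * nn / 2 powi t)
         else if m \<in> (+) 1 ` p_pow 1 then
           (if n0 = 0 then 0 else
             indicator (p_pow 2) (n0 * m - 8 * nn / 2 powi t) *
               e_pi (m / 8 - nn / (n0 * 2 powi t)))
         else if ereal (of_int t) \<le> t_n \<rho> Q n + 1 then
           indicator (p_pow 2) m * e_pi (m / 8) * (indicator (p_pow t) nn * N - 1)
         else
           indicator (unit_shell (t - 3)) (nn / m) *
             e_pi (m / 8 - m1 * nn / (n1 * 2 powi t)))
      else if m \<in> (+) 1 ` p_pow 1 then
        (if card Ut = 1 then
           indicator (p_pow (t - 2)) nn * (- 1) ^ (f - 1) * eta \<zeta> m / sqrtN *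
             e_pi (n1 * u * m / 4 - u * nn / 2 powi t)
         else
           indicator (p_pow (t - 2)) nn * (- 1) ^ (f - 1) * eta \<zeta> m / sqrtN *
             (indicator (p_pow 2) (n1 * m - 4 * nn / 2 powi t) * N - 1))
      else
        (if inverse n0 \<notin> Ut then 0
         else
           indicator (unit_shell (t - 3)) nn * (- 1) ^ (f - 1) / sqrtN *
             eta \<zeta> (8 * nn * (1 + m) / 2 powi t) * e_pi (m1 * n1 / (2 * n0))))"

definition t_range :: "'k :: q2_field \<Rightarrow> 'k qpoly \<Rightarrow> 'k \<Rightarrow> int set"
  where "t_range \<rho> Q n = {t. 1 \<le> t \<and> ereal (of_int t) \<le> min (t_d Q) (t_n \<rho> Q n + 3) \<and>
    (\<forall>i\<in>NpX Q. t \<noteq> tX Q i + 1)}"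

end

theory Submission
  imports Defs
begin

text \<open>The truncated density is a finite sum of the values of a product of local Gauss integrals, one for each
  block of variables, at representatives of \<open>\<pp>\<^sup>-\<^sup>T / \<oo>\<close>. On the shell of elements \<open>u w / 2\<^sup>t\<close>, where \<open>u\<close> is a root of
  unity and \<open>w\<close> is congruent to 1 modulo 2, completing the square evaluates each factor: a variable with dominant
  linear term gives 0 as soon as \<open>t\<close> is large, and the remaining factors depend on \<open>w\<close> only through
  \<open>\<eta>(w)\<^bsup>l\<^esup> e_pi ((m + u \<nu>) w / 8)\<close> with \<open>\<nu> = - 8 \<nn> / 2\<^sup>t\<close>. The unary factors come down to the sum of
  \<open>e_pi (s\<^sup>2 / 4)\<close> over the residue field, whose square is easy to compute; its sign is found by splitting off a quadratic
  extension if \<open>f\<close> is even, and from congruences modulo the prime factors of \<open>f\<close> if \<open>f\<close> is odd. Averaging over \<open>w\<close>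
  restricts \<open>m + u \<nu>\<close> modulo a power of 2, and the sum over the surviving \<open>u\<close> is \<open>\<omega>(t)\<close>. If infinitely many \<open>t\<close>
  contribute, then \<open>\<nn> = 0\<close> and the terms eventually form two geometric progressions with a common ratio, so that
  convergence of the partial sums is the same as summability.\<close>

section \<open>Arithmetic of the 2-adic numbers\<close>

text \<open>Analysis enters only through the measures of cosets: \<open>MM\<close> is a mean over
  representatives modulo a power of 2, and every integral is rewritten as such a finite mean. The
  algebra starts from the concrete ring \<open>RR\<close> generated by \<zeta> over the 2-adic
  integers, which has a basis of roots of unity; identifying it with \<open>int_ring\<close> needs
  the Frobenius, and the Frobenius needs that \<zeta> and its square satisfy the same equations
  (\<open>ev_zeta_square\<close>). The denominators 2, 4 and 8 behave differently. Modulo 2 squaring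
  is the Frobenius, so at denominator 2 a square can be replaced by a linear term; at denominator 4
  a genuine Gauss sum appears and, with it, \<eta>; at denominator 8 only one residue class
  survives, and deeper levels reduce to these two by steps of two. The closed form
  \<open>et w = e_pi ((1 - w^2) / 16)\<close> of \<eta> on principal units is a quadratic
  exponential, which is why its average against \<open>e_pi (M w / 8)\<close> is again such a Gauss
  sum. The offset 3 in the range of t is the valuation of the 8 in this phase.\<close>

lemma z2_eqI: "(\<And>n. residue x n = residue y n) \<Longrightarrow> x = y"
  by (metis ext residue_inject)

lemma residue_0 [simp]: "residue 0 n = 0"
  by (simp add: zero_z2.rep_eq)

lemma residue_add: "residue (x + y) n = (residue x n + residue y n) mod 2 ^ n"
  by (simp add: plus_z2.rep_eq)

lemma residue_diff: "residue (x - y) n = (residue x n - residue y n) mod 2 ^ n"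
  by (simp add: minus_z2.rep_eq)

lemma residue_mult: "residue (x * y) n = (residue x n * residue y n) mod 2 ^ n"
  by (simp add: times_z2.rep_eq)

lemma residue_of_int: "residue (of_int k) n = k mod 2 ^ n"
proof (induction k rule: int_induct[where k = 0])
  case base
  show ?case by simp
next
  case (step1 i)
  then show ?case by (simp add: residue_add one_z2.rep_eq mod_simps)
next
  case (step2 i)
  then show ?case by (simp add: residue_diff one_z2.rep_eq mod_simps)
qed

lemma residue_pow2: "residue (2 ^ n) m = 2 ^ n mod 2 ^ m"
  using residue_of_int[of "2 ^ n" m] by simp

lemma pow2_dvd_z2_iff: "2 ^ n dvd x \<longleftrightarrow> residue x n = 0"
proof
  assume "2 ^ n dvd x"
  then obtain y where "x = 2 ^ n * y" by (elim dvdE)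
  then show "residue x n = 0" by (simp add: residue_mult residue_pow2)
next
  assume x: "residue x n = 0"
  \<comment> \<open>Knowing x / 2^n modulo 2^m takes n + m digits of x, hence the shifted
    index.\<close>
  define y where "y = Abs_z2 (\<lambda>m. residue x (n + m) div 2 ^ n)"
  have d: "2 ^ n dvd residue x (n + m)" for m
    using residue_mod_le[of n "n + m" x] x by (simp add: dvd_eq_mod_eq_0)
  have "(\<lambda>m. residue x (n + m) div 2 ^ n) \<in>
      {x. \<forall>n. x n \<in> {0..<2 ^ n} \<and> x (Suc n) mod 2 ^ n = x n}"
  proof (clarify, intro conjI)
    fix m
    have r: "residue x (n + m) \<in> {0..<2 ^ (n + m)}" using residue[of x] by blast
    then show "residue x (n + m) div 2 ^ n \<in> {0..<2 ^ m}"
    proof -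
      obtain j where j: "residue x (n + m) = 2 ^ n * j" using d[of m] by (elim dvdE)
      have "0 \<le> 2 ^ n * j" "2 ^ n * j < 2 ^ n * 2 ^ m" using r by (simp_all add: j power_add)
      then have "0 \<le> j" "j < 2 ^ m"
        by (simp_all add: zero_le_mult_iff mult_less_cancel_left_pos)
      then show ?thesis by (simp add: j)
    qed
    have "residue x (n + Suc m) = 2 ^ n * (residue x (n + Suc m) div 2 ^ n)"
      using d[of "Suc m"] by simp
    moreover have "residue x (n + Suc m) mod 2 ^ (n + m) = residue x (n + m)"
      by (rule residue_mod_le) simp
    ultimately have "residue x (n + m) =
        (2 ^ n * (residue x (n + Suc m) div 2 ^ n)) mod (2 ^ n * 2 ^ m)"
      by (simp add: power_add)
    also have "\<dots> = 2 ^ n * (residue x (n + Suc m) div 2 ^ n mod 2 ^ m)"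
      by (rule mod_mult_mult1)
    finally show "residue x (n + Suc m) div 2 ^ n mod 2 ^ m = residue x (n + m) div 2 ^ n"
      by simp
  qed
  then have res: "residue y m = residue x (n + m) div 2 ^ n" for m
    unfolding y_def by (subst Abs_z2_inverse) auto
  have "x = 2 ^ n * y"
  proof (rule z2_eqI)
    fix m
    have "residue (2 ^ n * y) m = (2 ^ n * (residue x (n + m) div 2 ^ n)) mod 2 ^ m"
      by (simp add: residue_mult residue_pow2 res mod_simps)
    also have "\<dots> = residue x (n + m) mod 2 ^ m" using d[of m] by simp
    also have "\<dots> = residue x m" by (rule residue_mod_le) simp
    finally show "residue x m = residue (2 ^ n * y) m" by simp
  qed
  then show "2 ^ n dvd x" by simp
qed

text \<open>Completeness, phrased for series in powers of 2: the partial sums are compatible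
  residues. Later limits come from telescoping series and inverses from geometric ones.\<close>

lemma z2_complete: "\<exists>x :: z2. \<forall>n. 2 ^ n dvd x - (\<Sum>i<n. 2 ^ i * d i)"
proof -
  define S where "S n = (\<Sum>i<n. 2 ^ i * d i)" for n
  define x where "x = Abs_z2 (\<lambda>n. residue (S n) n)"
  have "residue (S (Suc n)) (Suc n) mod 2 ^ n = residue (S n) n" for n
  proof -
    have "residue (S (Suc n)) (Suc n) mod 2 ^ n = residue (S (Suc n)) n"
      by (rule residue_mod_le) simp
    also have "\<dots> = residue (S n) n"
      by (simp add: S_def residue_add residue_mult residue_pow2)
    finally show ?thesis .
  qed
  then have "residue x n = residue (S n) n" for n
    unfolding x_def using residue by (subst Abs_z2_inverse) auto
  then have "\<forall>n. 2 ^ n dvd x - S n"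
    by (auto simp: pow2_dvd_z2_iff residue_diff)
  then show ?thesis unfolding S_def by blast
qed

lemma z2_separated: "(\<And>n. 2 ^ n dvd (x :: z2)) \<Longrightarrow> x = 0"
  by (rule z2_eqI) (simp add: pow2_dvd_z2_iff)

lemma z2_parity: "2 dvd x \<or> 2 dvd x - (1 :: z2)"
proof -
  have "residue x 1 \<in> {0..<2 ^ 1}" using residue[of x] by blast
  then have "residue x 1 = 0 \<or> residue x 1 = 1" by auto
  then show ?thesis
    using pow2_dvd_z2_iff[of 1 x] pow2_dvd_z2_iff[of 1 "x - 1"]
    by (auto simp: residue_diff one_z2.rep_eq)
qed

lemma z2_two_not_dvd_one: "\<not> 2 dvd (1 :: z2)"
  using pow2_dvd_z2_iff[of 1 1] by (simp add: one_z2.rep_eq)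

text \<open>An odd number is 1 - 2w, whose inverse is the geometric series in 2w.\<close>

lemma z2_odd_unit:
  assumes "\<not> 2 dvd (x :: z2)"
  obtains y where "x * y = 1"
proof -
  from assms z2_parity have "2 dvd x - 1" by blast
  then obtain z where z: "x - 1 = 2 * z" by (elim dvdE)
  define w where "w = - z"
  have x: "x = 1 - 2 * w" using z by (simp add: w_def algebra_simps)
  obtain y where y: "\<And>n. 2 ^ n dvd y - (\<Sum>i<n. 2 ^ i * w ^ i)"
    using z2_complete[of "\<lambda>i. w ^ i"] by blast
  have "2 ^ n dvd x * y - 1" for n
  proof -
    obtain r where r: "y = (\<Sum>i<n. 2 ^ i * w ^ i) + 2 ^ n * r"
      using y[of n] by (metis add_diff_cancel_left' diff_add_cancel dvdE add.commute)
    have "x * (\<Sum>i<n. 2 ^ i * w ^ i) = 1 - (2 * w) ^ n"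
      unfolding x using one_diff_power_eq[of "2 * w" n] by (simp only: power_mult_distrib)
    then have "x * y - 1 = 2 ^ n * (x * r - w ^ n)"
      by (simp add: r algebra_simps power_mult_distrib)
    then show ?thesis by simp
  qed
  then have "x * y - 1 = 0" by (rule z2_separated)
  then show ?thesis using that by simp
qed

lemma z2_decomp:
  assumes "(x :: z2) \<noteq> 0"
  obtains k u where "x = 2 ^ k * u" "\<not> 2 dvd u"
proof -
  have ex: "\<exists>n. \<not> 2 ^ n dvd x" using assms z2_separated by blast
  define n where "n = (LEAST n. \<not> 2 ^ n dvd x)"
  have n: "\<not> 2 ^ n dvd x" using LeastI_ex[OF ex] by (simp add: n_def)
  then have "n \<noteq> 0" by (intro notI) simp
  then obtain k where k: "n = Suc k" using not0_implies_Suc by blast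
  then have "2 ^ k dvd x" using not_less_Least[of k "\<lambda>n. \<not> 2 ^ n dvd x"] by (auto simp: n_def)
  then obtain u where u: "x = 2 ^ k * u" by (elim dvdE)
  have "\<not> 2 dvd u"
    using n unfolding k u by (auto simp: mult.assoc)
  with u show ?thesis by (rule that)
qed

lemma z2_of_nat_neq_0: "n > 0 \<Longrightarrow> (of_nat n :: z2) \<noteq> 0"
proof
  assume "n > 0" "(of_nat n :: z2) = 0"
  then have "int n mod 2 ^ n = 0" using residue_of_int[of "int n" n] by simp
  moreover have "int n mod 2 ^ n = int n" by (rule mod_pos_pos_trivial) auto
  ultimately show False using \<open>n > 0\<close> by simp
qed

lemma z2_two_neq_0 [simp]: "(2 :: z2) \<noteq> 0"
  using z2_of_nat_neq_0[of 2] by simp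

lemma z2_pow2_dvd_of_int_iff: "(2 :: z2) ^ n dvd of_int k \<longleftrightarrow> 2 ^ n dvd k"
  by (simp add: pow2_dvd_z2_iff residue_of_int dvd_eq_mod_eq_0)

section \<open>The 2-adic integers inside their field of fractions\<close>

lemma Fract_one_hom:
  "Fract (0 :: 'a :: idom) 1 = 0" "Fract (1 :: 'a) 1 = 1"
  "Fract (x + y) 1 = Fract (x :: 'a) 1 + Fract y 1"
  "Fract (x - y) 1 = Fract x 1 - Fract y 1"
  "Fract (x * y) 1 = Fract x 1 * Fract y 1"
  "Fract (- x) 1 = - Fract x 1"
  by (simp_all add: Zero_fract_def One_fract_def)

lemma Fract_one_power: "Fract ((x :: 'a :: idom) ^ n) 1 = Fract x 1 ^ n"
  by (induction n) (simp_all add: Fract_one_hom)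

lemma Fract_one_of_int: "Fract (of_int k :: 'a :: idom) 1 = of_int k"
proof (induction k rule: int_induct[where k = 0])
qed (simp_all add: Fract_one_hom)

lemma Fract_one_two: "Fract (2 :: 'a :: idom) 1 = 2"
  using Fract_one_of_int[of 2] by simp

lemma Fract_one_inject [simp]: "Fract (x :: 'a :: idom) 1 = Fract y 1 \<longleftrightarrow> x = y"
  by (simp add: eq_fract)

lemma q2_two_neq_0 [simp]: "(2 :: q2) \<noteq> 0"
  by (metis Fract_one_two Fract_one_hom(1) Fract_one_inject z2_two_neq_0)

lemma q2_ints_closed [intro]:
  "0 \<in> q2_ints" "1 \<in> q2_ints"
  "x \<in> q2_ints \<Longrightarrow> y \<in> q2_ints \<Longrightarrow> x + y \<in> q2_ints"
  "x \<in> q2_ints \<Longrightarrow> y \<in> q2_ints \<Longrightarrow> x - y \<in> q2_ints"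
  "x \<in> q2_ints \<Longrightarrow> y \<in> q2_ints \<Longrightarrow> x * y \<in> q2_ints"
  "x \<in> q2_ints \<Longrightarrow> - x \<in> q2_ints"
  "of_int k \<in> q2_ints"
proof -
  show "0 \<in> q2_ints" "1 \<in> q2_ints" "of_int k \<in> q2_ints"
    unfolding q2_ints_def by (metis Fract_one_hom(1) Fract_one_hom(2) Fract_one_of_int rangeI)+
  show "x \<in> q2_ints \<Longrightarrow> y \<in> q2_ints \<Longrightarrow> x + y \<in> q2_ints"
    "x \<in> q2_ints \<Longrightarrow> y \<in> q2_ints \<Longrightarrow> x - y \<in> q2_ints"
    "x \<in> q2_ints \<Longrightarrow> y \<in> q2_ints \<Longrightarrow> x * y \<in> q2_ints"
    "x \<in> q2_ints \<Longrightarrow> - x \<in> q2_ints"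
    unfolding q2_ints_def by (auto simp flip: Fract_one_hom)
qed

text \<open>The odd part of a denominator is a unit, so powers of 2 suffice as denominators.\<close>

lemma q2_decomp:
  obtains a k where "(x :: q2) = Fract a 1 / 2 ^ k"
proof (cases x)
  case (Fract a b)
  obtain k u where u: "b = 2 ^ k * u" "\<not> 2 dvd u" using z2_decomp[OF Fract(2)] .
  obtain v where v: "u * v = 1" using z2_odd_unit[OF u(2)] .
  have "x = Fract (a * v) (2 ^ k)"
    unfolding Fract(1) using Fract(2) u(1) v by (simp add: eq_fract algebra_simps)
  also have "\<dots> = Fract (a * v) 1 / Fract (2 ^ k) 1" by simp
  finally show ?thesis using that by (simp add: Fract_one_power Fract_one_two)
qed

lemma q2_nonint_decomp:
  assumes "x \<notin> q2_ints"
  obtains u k where "x = Fract u 1 / 2 ^ Suc k" "\<not> 2 dvd u"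
proof -
  obtain a k where a: "x = Fract a 1 / 2 ^ k" using q2_decomp .
  have "a \<noteq> 0" using assms a by (auto simp: Fract_one_hom)
  then obtain l u where u: "a = 2 ^ l * u" "\<not> 2 dvd u" using z2_decomp by blast
  have x: "x = 2 ^ l * Fract u 1 / 2 ^ k"
    by (simp add: a u Fract_one_hom Fract_one_power Fract_one_two)
  have "l < k"
  proof (rule ccontr)
    assume "\<not> l < k"
    then have "x = Fract (2 ^ (l - k) * u) 1"
      by (simp add: x Fract_one_hom Fract_one_power Fract_one_two power_diff)
    then show False using assms by (auto simp: q2_ints_def)
  qed
  then obtain j where "k = l + Suc j" using less_imp_Suc_add by auto
  then have "x = Fract u 1 / 2 ^ Suc j" by (simp add: x power_add)
  then show ?thesis using that u(2) by blast
qed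

lemma of_int_div_pow2_in_q2_ints_iff: "of_int k / 2 ^ n \<in> q2_ints \<longleftrightarrow> 2 ^ n dvd k"
proof
  assume "of_int k / 2 ^ n \<in> q2_ints"
  then obtain a :: z2 where "of_int k / 2 ^ n = Fract a 1" by (auto simp: q2_ints_def)
  then have "of_int k = Fract a 1 * 2 ^ n" by (simp add: divide_eq_eq)
  then have "Fract (of_int k) 1 = Fract (a * 2 ^ n) 1"
    by (simp add: Fract_one_of_int Fract_one_hom Fract_one_power Fract_one_two)
  then have "of_int k = a * 2 ^ n" by simp
  then show "2 ^ n dvd k" by (metis dvd_triv_right z2_pow2_dvd_of_int_iff)
next
  assume "2 ^ n dvd k"
  then obtain j where "k = 2 ^ n * j" by (elim dvdE)
  then show "of_int k / 2 ^ n \<in> q2_ints" by auto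
qed

section \<open>The additive character of the 2-adic numbers\<close>

lemma cis_2pi_eqI:
  assumes "x - y = of_int k" shows "cis (- 2 * pi * x) = cis (- 2 * pi * y)"
proof -
  have "- 2 * pi * x = - 2 * pi * y + 2 * pi * of_int (- k)"
    using assms by (simp add: algebra_simps)
  then show ?thesis
    by (metis Ints_of_int cis_mult cis_multiple_2pi mult.right_neutral)
qed

text \<open>Two dyadic approximations of the same number differ by a dyadic rational that is a
  2-adic integer, hence by an ordinary integer, which the exponential ignores; so the definite
  description in \<open>e2\<close> is unique.\<close>

lemma e2_eqI:
  assumes "\<beta> - of_int k / 2 ^ m \<in> q2_ints"
  shows "e2 \<beta> = cis (- 2 * pi * (of_int k / 2 ^ m))"
  unfolding e2_def
proof (rule the_equality)
  fix z assume "\<exists>k m. \<beta> - of_int k / 2 ^ m \<in> q2_ints \<and> z = cis (- 2 * pi * (of_int k / 2 ^ m))"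
  then obtain k' m' where k': "\<beta> - of_int k' / 2 ^ m' \<in> q2_ints"
    and z: "z = cis (- 2 * pi * (of_int k' / 2 ^ m'))" by blast
  have "(\<beta> - of_int k / 2 ^ m) - (\<beta> - of_int k' / 2 ^ m') \<in> q2_ints"
    using assms k' by blast
  also have "(\<beta> - of_int k / 2 ^ m) - (\<beta> - of_int k' / 2 ^ m') =
      of_int (k' * 2 ^ m - k * 2 ^ m') / 2 ^ (m + m')"
    by (simp add: field_simps power_add)
  finally have "2 ^ (m + m') dvd k' * 2 ^ m - k * 2 ^ m'"
    by (simp only: of_int_div_pow2_in_q2_ints_iff)
  then obtain j where "k' * 2 ^ m - k * 2 ^ m' = 2 ^ (m + m') * j" by (elim dvdE)
  then have "real_of_int (k' * 2 ^ m - k * 2 ^ m') = 2 ^ (m + m') * real_of_int j"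
    by (metis of_int_mult of_int_numeral of_int_power)
  then have "of_int k' / 2 ^ m' - of_int k / 2 ^ m = real_of_int j"
    by (simp add: field_simps power_add)
  then show "z = cis (- 2 * pi * (of_int k / 2 ^ m))"
    unfolding z by (rule cis_2pi_eqI)
qed (use assms in blast)

lemma q2_dyadic_approx:
  obtains k m where "\<beta> - of_int k / 2 ^ m \<in> q2_ints"
proof -
  obtain a m where a: "\<beta> = Fract a 1 / 2 ^ m" using q2_decomp .
  have "2 ^ m dvd a - of_int (residue a m)"
    by (simp add: pow2_dvd_z2_iff residue_diff residue_of_int)
  then obtain b where "a - of_int (residue a m) = 2 ^ m * b" by (elim dvdE)
  then have "a = 2 ^ m * b + of_int (residue a m)" by (simp add: algebra_simps)
  then have "Fract a 1 = 2 ^ m * Fract b 1 + of_int (residue a m)"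
    by (metis Fract_one_hom(3) Fract_one_hom(5) Fract_one_of_int Fract_one_power Fract_one_two)
  then have "\<beta> - of_int (residue a m) / 2 ^ m = Fract b 1"
    by (simp add: a field_simps)
  then have "\<beta> - of_int (residue a m) / 2 ^ m \<in> q2_ints" by (auto simp: q2_ints_def)
  then show ?thesis by (rule that)
qed

lemma e2_add: "e2 (x + y) = e2 x * e2 y"
proof -
  obtain k m where k: "x - of_int k / 2 ^ m \<in> q2_ints" using q2_dyadic_approx .
  obtain k' m' where k': "y - of_int k' / 2 ^ m' \<in> q2_ints" using q2_dyadic_approx .
  have "(x - of_int k / 2 ^ m) + (y - of_int k' / 2 ^ m') \<in> q2_ints" using k k' by blast
  also have "(x - of_int k / 2 ^ m) + (y - of_int k' / 2 ^ m') =
      (x + y) - of_int (k * 2 ^ m' + k' * 2 ^ m) / 2 ^ (m + m')"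
    by (simp add: field_simps power_add)
  finally have "e2 (x + y) = cis (- 2 * pi * (of_int (k * 2 ^ m' + k' * 2 ^ m) / 2 ^ (m + m')))"
    by (rule e2_eqI)
  also have "\<dots> = e2 x * e2 y"
    unfolding e2_eqI[OF k] e2_eqI[OF k'] cis_mult
    by (rule arg_cong[where f = cis]) (simp add: field_simps power_add)
  finally show ?thesis .
qed

text \<open>The kernel is no larger than the integers because the cosine equals 1 only at multiples
  of 2 pi. This exactness is what makes \<open>e_pi\<close> non-degenerate later.\<close>

lemma e2_eq_1_iff: "e2 x = 1 \<longleftrightarrow> x \<in> q2_ints"
proof -
  obtain k m where k: "x - of_int k / 2 ^ m \<in> q2_ints" using q2_dyadic_approx .
  have "e2 x = 1 \<longleftrightarrow> 2 ^ m dvd k"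
  proof
    assume "e2 x = 1"
    then have "cos (2 * pi * (of_int k / 2 ^ m)) = 1"
      by (simp add: e2_eqI[OF k] complex_eq_iff)
    then obtain j :: int where "2 * pi * (of_int k / 2 ^ m) = of_int j * 2 * pi"
      unfolding cos_one_2pi_int by auto
    then have "real_of_int k = of_int (j * 2 ^ m)" by (simp add: field_simps)
    then have "k = j * 2 ^ m" by (simp only: of_int_eq_iff)
    then show "2 ^ m dvd k" by simp
  next
    assume "2 ^ m dvd k"
    then obtain j where "k = 2 ^ m * j" by (elim dvdE)
    then show "e2 x = 1"
      using cis_2pi_eqI[of "of_int k / 2 ^ m" 0 j] by (simp add: e2_eqI[OF k])
  qed
  also have "\<dots> \<longleftrightarrow> of_int k / 2 ^ m \<in> q2_ints" by (simp add: of_int_div_pow2_in_q2_ints_iff)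
  also have "\<dots> \<longleftrightarrow> x \<in> q2_ints"
    using k by (metis add_diff_cancel_left' diff_add_cancel q2_ints_closed(3) q2_ints_closed(4) add.commute)
  finally show ?thesis .
qed

lemma norm_e2 [simp]: "norm (e2 x) = 1"
proof -
  obtain k m where k: "x - of_int k / 2 ^ m \<in> q2_ints" using q2_dyadic_approx .
  show ?thesis by (simp add: e2_eqI[OF k])
qed

lemma e2_of_int_div: "e2 (of_int k / 2 ^ m) = cis (- 2 * pi * (of_int k / 2 ^ m))"
  by (rule e2_eqI) (simp add: q2_ints_closed)

section \<open>The ring of integers of the unramified extension\<close>

lemma of_q2_0 [simp]: "of_q2 0 = (0 :: 'k :: q2_field)"
  using of_q2_add[of 0 0, where 'a = 'k] by (metis add_cancel_right_right add_0)

lemma of_q2_1' [simp]: "of_q2 1 = (1 :: 'k :: q2_field)"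
  by (rule of_q2_1)

lemma of_q2_minus: "of_q2 (- x) = - (of_q2 x :: 'k :: q2_field)"
  using of_q2_add[of x "- x", where 'a = 'k] by (simp add: eq_neg_iff_add_eq_0 add.commute)

lemma of_q2_diff: "of_q2 (x - y) = (of_q2 x - of_q2 y :: 'k :: q2_field)"
  using of_q2_add[of x "- y", where 'a = 'k] by (simp add: of_q2_minus)

lemma of_q2_eq_0_iff [simp]: "of_q2 x = (0 :: 'k :: q2_field) \<longleftrightarrow> x = 0"
proof
  assume "of_q2 x = (0 :: 'k)"
  show "x = 0"
  proof (rule ccontr)
    assume "x \<noteq> 0"
    then have "of_q2 x * of_q2 (inverse x) = (1 :: 'k)" by (simp flip: of_q2_mult)
    then show False using \<open>of_q2 x = (0 :: 'k)\<close> by simp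
  qed
qed simp

lemma of_q2_inject [simp]: "of_q2 x = (of_q2 y :: 'k :: q2_field) \<longleftrightarrow> x = y"
  using of_q2_eq_0_iff[of "x - y", where 'k = 'k] by (simp add: of_q2_diff)

lemma of_q2_divide: "of_q2 (x / y) = (of_q2 x / of_q2 y :: 'k :: q2_field)"
proof (cases "y = 0")
  case False
  then have "of_q2 (x / y) * of_q2 y = (of_q2 x :: 'k)" by (simp flip: of_q2_mult)
  then show ?thesis using False by (simp add: field_simps)
qed simp

lemma of_q2_power: "of_q2 (x ^ n) = (of_q2 x ^ n :: 'k :: q2_field)"
  by (induction n) (simp_all add: of_q2_mult)

lemma of_q2_of_nat: "of_q2 (of_nat n) = (of_nat n :: 'k :: q2_field)"
  by (induction n) (simp_all add: of_q2_add)

lemma of_q2_numeral [simp]: "of_q2 (numeral n) = (numeral n :: 'k :: q2_field)"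
  using of_q2_of_nat[of "numeral n"] by simp

lemma two_neq_0 [simp]: "(2 :: 'k :: q2_field) \<noteq> 0"
  using of_q2_eq_0_iff[of 2, where 'k = 'k] by simp

lemma q2_field_of_nat_eq_0_iff: "of_nat n = (0 :: 'k :: q2_field) \<longleftrightarrow> n = 0"
proof -
  have "(of_nat n :: q2) = Fract (of_nat n) 1"
    using Fract_one_of_int[of "int n", where 'a = z2] by simp
  then have "(of_nat n :: q2) = 0 \<longleftrightarrow> n = 0"
    using z2_of_nat_neq_0[of n] by (metis Fract_one_hom(1) Fract_one_inject gr0I of_nat_0)
  then show ?thesis using of_q2_eq_0_iff[of "of_nat n", where 'k = 'k] by (simp add: of_q2_of_nat)
qed

section \<open>Evaluation of 2-adic polynomials and spans over the 2-adic integers\<close>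

definition of_z2 :: "z2 \<Rightarrow> 'k :: q2_field"
  where "of_z2 a = of_q2 (Fract a 1)"

lemma of_z2_hom:
  "of_z2 0 = (0 :: 'k :: q2_field)" "of_z2 1 = (1 :: 'k)"
  "of_z2 (x + y) = (of_z2 x + of_z2 y :: 'k)" "of_z2 (x - y) = (of_z2 x - of_z2 y :: 'k)"
  "of_z2 (x * y) = (of_z2 x * of_z2 y :: 'k)" "of_z2 (- x) = (- of_z2 x :: 'k)"
  "of_z2 2 = (2 :: 'k)"
  by (simp_all only: of_z2_def Fract_one_hom Fract_one_two of_q2_add of_q2_diff of_q2_mult
    of_q2_minus of_q2_0 of_q2_1 of_q2_numeral)

declare of_z2_hom(1,2,7) [simp]

lemma of_z2_power: "of_z2 (x ^ n) = (of_z2 x ^ n :: 'k :: q2_field)"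
  by (induction n) (simp_all add: of_z2_hom)

lemma of_z2_inject [simp]: "of_z2 x = (of_z2 y :: 'k :: q2_field) \<longleftrightarrow> x = y"
  by (simp add: of_z2_def)

lemma of_z2_eq_0_iff [simp]: "of_z2 x = (0 :: 'k :: q2_field) \<longleftrightarrow> x = 0"
  using of_z2_inject[of x 0, where 'k = 'k] by (simp del: of_z2_inject)

lemma of_z2_of_nat: "of_z2 (of_nat n) = (of_nat n :: 'k :: q2_field)"
  by (induction n) (simp_all add: of_z2_hom)

definition ev :: "z2 poly \<Rightarrow> 'k :: q2_field \<Rightarrow> 'k"
  where "ev p x = poly (map_poly of_z2 p) x"

lemma ev_0 [simp]: "ev 0 x = 0"
  by (simp add: ev_def)

lemma ev_pCons: "ev (pCons a p) x = of_z2 a + x * ev p x"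
  by (simp add: ev_def map_poly_pCons)

lemma ev_1 [simp]: "ev 1 x = 1"
  using ev_pCons[of 1 0 x] by (simp add: one_pCons)

lemma ev_add: "ev (p + p') x = ev p x + ev p' x"
proof -
  have "map_poly of_z2 (p + p') = (map_poly of_z2 p + map_poly of_z2 p' :: 'a poly)"
    by (rule poly_eqI) (simp add: coeff_map_poly of_z2_hom)
  then show ?thesis by (simp add: ev_def)
qed

lemma ev_smult: "ev (smult c p) x = of_z2 c * ev p x"
proof -
  have "map_poly of_z2 (smult c p) = (smult (of_z2 c) (map_poly of_z2 p) :: 'a poly)"
    by (rule poly_eqI) (simp add: coeff_map_poly of_z2_hom)
  then show ?thesis by (simp add: ev_def)
qed

lemma ev_minus: "ev (- p) x = - ev p x"
  using ev_smult[of "- 1" p x] by (simp add: of_z2_hom)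

lemma ev_diff: "ev (p - p') x = ev p x - ev p' x"
  using ev_add[of p "- p'" x] by (simp add: ev_minus)

lemma ev_mult: "ev (p * p') x = ev p x * ev p' x"
  by (induction p) (simp_all add: ev_pCons ev_add ev_smult algebra_simps)

lemma ev_monom: "ev (monom c n) x = of_z2 c * x ^ n"
  by (induction n) (simp_all add: monom_0 monom_Suc ev_pCons)

lemma ev_sum: "ev (sum p A) x = (\<Sum>i\<in>A. ev (p i) x)"
  by (induction A rule: infinite_finite_induct) (simp_all add: ev_add)

lemma ev_altdef: "ev p x = (\<Sum>i\<le>degree p. of_z2 (coeff p i) * x ^ i)"
proof -
  have "ev p x = ev (\<Sum>i\<le>degree p. monom (coeff p i) i) x" by (simp add: poly_as_sum_of_monoms)
  then show ?thesis by (simp only: ev_sum ev_monom)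
qed

text \<open>The sum runs over all of S, so the notion is meant for finite S.\<close>

definition z2_span :: "'k :: q2_field set \<Rightarrow> 'k set"
  where "z2_span S = {\<Sum>e\<in>S. of_z2 (a e) * e | a. True}"

lemma z2_spanI: "x = (\<Sum>e\<in>S. of_z2 (a e) * e) \<Longrightarrow> x \<in> z2_span S"
  by (auto simp: z2_span_def)

lemma z2_span_0: "0 \<in> z2_span S"
  by (rule z2_spanI[where a = "\<lambda>_. 0"]) simp

lemma z2_span_add: "x \<in> z2_span S \<Longrightarrow> y \<in> z2_span S \<Longrightarrow> x + y \<in> z2_span S"
  unfolding z2_span_def
  by clarify (rule exI[where x = "\<lambda>e. _ e + _ e"], simp add: of_z2_hom distrib_right sum.distrib)

lemma z2_span_base:
  assumes "finite S" "u \<in> S"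
  shows "of_z2 c * u \<in> z2_span S"
proof (rule z2_spanI[where a = "\<lambda>e. if e = u then c else 0"])
  have "(\<Sum>e\<in>S. of_z2 (if e = u then c else 0) * e) = (\<Sum>e\<in>S. if e = u then of_z2 c * u else 0)"
    by (intro sum.cong) auto
  then show "of_z2 c * u = (\<Sum>e\<in>S. of_z2 (if e = u then c else 0) * e)"
    using assms by simp
qed

lemma z2_span_sum: "(\<And>i. i \<in> A \<Longrightarrow> g i \<in> z2_span S) \<Longrightarrow> sum g A \<in> z2_span S"
  by (induction A rule: infinite_finite_induct) (auto intro: z2_span_0 z2_span_add)

text \<open>The powers of z are m distinct roots of X^m - 1, which has no more.\<close>

lemma primitive_root_roots:
  fixes z :: "'a :: field"
  assumes "primitive_root_of_unity m z"
  shows "{x. x ^ m = 1} = (\<lambda>i. z ^ i) ` {..<m}" and "inj_on (\<lambda>i. z ^ i) {..<m}"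
proof -
  have m: "m > 0" "z ^ m = 1" and neq: "\<And>k. 0 < k \<Longrightarrow> k < m \<Longrightarrow> z ^ k \<noteq> 1"
    using assms by (auto simp: primitive_root_of_unity_def)
  have z0: "z \<noteq> 0" using m by (auto simp: power_0_left)
  show inj: "inj_on (\<lambda>i. z ^ i) {..<m}"
  proof (rule linorder_inj_onI')
    fix i j :: nat assume *: "i \<in> {..<m}" "j \<in> {..<m}" "i < j"
    have "z ^ (j - i) \<noteq> 1" using * by (intro neq) auto
    moreover have "z ^ j = z ^ i * z ^ (j - i)" using * by (simp flip: power_add)
    ultimately show "z ^ i \<noteq> z ^ j" using z0 by simp
  qed
  define p :: "'a poly" where "p = monom 1 m - 1"
  have poly_p: "poly p x = x ^ m - 1" for x by (simp add: p_def poly_monom)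
  have "coeff p m = 1" using m by (simp add: p_def)
  then have p0: "p \<noteq> 0" by auto
  have "degree p \<le> m" unfolding p_def by (intro degree_diff_le degree_monom_le) simp
  then have card: "card {x. x ^ m = (1 :: 'a)} \<le> m"
    using card_poly_roots_bound[OF p0] by (simp add: poly_p)
  have fin: "finite {x. x ^ m = (1 :: 'a)}" using poly_roots_finite[OF p0] by (simp add: poly_p)
  have sub: "(\<lambda>i. z ^ i) ` {..<m} \<subseteq> {x. x ^ m = 1}"
    using m(2) by clarify (metis mult.commute power_mult power_one)
  show "{x. x ^ m = 1} = (\<lambda>i. z ^ i) ` {..<m}"
    by (rule card_subset_eq[OF fin sub, symmetric])
      (use card card_mono[OF fin sub] card_image[OF inj] in simp)
qed

text \<open>A geometric sum whose ratio z^j differs from 1 but has m-th power 1.\<close>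

lemma primitive_root_power_sum:
  fixes z :: "'a :: field"
  assumes z: "primitive_root_of_unity m z" and j: "0 < j" "j < m"
  shows "(\<Sum>u\<in>{u :: 'a. u ^ m = 1}. u ^ j) = 0"
proof -
  have "(\<Sum>u\<in>{u :: 'a. u ^ m = 1}. u ^ j) = (\<Sum>i<m. (z ^ j) ^ i)"
    unfolding primitive_root_roots[OF z] sum.reindex[OF primitive_root_roots(2)[OF z]] comp_def
    by (simp only: power_mult[symmetric] mult.commute)
  moreover have "(1 - z ^ j) * (\<Sum>i<m. (z ^ j) ^ i) = 1 - (z ^ j) ^ m"
    by (rule one_diff_power_eq[symmetric])
  moreover have "(z ^ j) ^ m = 1"
    using z by (metis mult.commute power_mult power_one primitive_root_of_unity_def)
  moreover have "z ^ j \<noteq> 1" using z j by (auto simp: primitive_root_of_unity_def)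
  ultimately show ?thesis by simp
qed

section \<open>Roots of unity and the ring they generate\<close>

locale unram =
  fixes f :: nat and \<zeta> :: "'k :: q2_field"
  assumes f: "1 \<le> f"
    and prim: "primitive_root_of_unity (2 ^ f - 1) \<zeta>"
    and adjoin: "(UNIV :: 'k set) = q2_adjoin \<zeta>"
begin

abbreviation "TT \<equiv> UU \<zeta>"
abbreviation "TT0 \<equiv> UU0 \<zeta>"

abbreviation q :: nat where "q \<equiv> 2 ^ f"

text \<open>The ring generated by \<zeta> over the 2-adic integers. It is proved to be the ring of
  integers only in \<open>int_ring_eq\<close>; until then all arithmetic takes place here.\<close>

definition RR :: "'k set" where "RR = range (\<lambda>p. ev p \<zeta>)"

definition pp :: "nat \<Rightarrow> 'k set" where "pp n = {x. x / 2 ^ n \<in> RR}"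

lemma q_ge_2: "q \<ge> 2"
  using f power_increasing[of 1 f "2 :: nat"] by simp

lemma zeta_power: "\<zeta> ^ (q - 1) = 1" and zeta_power_neq: "0 < k \<Longrightarrow> k < q - 1 \<Longrightarrow> \<zeta> ^ k \<noteq> 1"
  using prim by (auto simp: primitive_root_of_unity_def)

lemma zeta_neq_0: "\<zeta> \<noteq> 0"
  using zeta_power q_ge_2 by (auto simp: power_0_left)

lemma inj_zeta: "inj_on (\<lambda>i. \<zeta> ^ i) {..<q - 1}"
  by (rule primitive_root_roots(2)[OF prim])

lemma UU_eq_image: "TT = (\<lambda>i. \<zeta> ^ i) ` {..<q - 1}"
  and UU_eq_roots: "TT = {x. x ^ (q - 1) = 1}"
proof -
  have im: "(\<lambda>i. \<zeta> ^ i) ` {..<q - 1} = {x. x ^ (q - 1) = 1}"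
    by (rule primitive_root_roots(1)[OF prim, symmetric])
  have "\<zeta> ^ i \<in> TT" for i unfolding UU_def by (rule range_eqI[of _ _ "int i"]) simp
  then have "(\<lambda>i. \<zeta> ^ i) ` {..<q - 1} \<subseteq> TT" by blast
  moreover have "TT \<subseteq> {x. x ^ (q - 1) = 1}"
  proof (clarsimp simp: UU_def)
    fix k :: int
    have "(\<zeta> powi k) ^ (q - 1) = (\<zeta> ^ (q - 1)) powi k"
      by (metis mult.commute power_int_mult power_int_of_nat)
    then show "(\<zeta> powi k) ^ (q - Suc 0) = 1" using zeta_power by simp
  qed
  ultimately show "TT = (\<lambda>i. \<zeta> ^ i) ` {..<q - 1}" "TT = {x. x ^ (q - 1) = 1}"
    using im by blast+
qed

lemma finite_UU [simp]: "finite TT" and card_UU: "card TT = q - 1"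
  using card_image[OF inj_zeta] by (simp_all add: UU_eq_image)

lemma UU_zeta_power [simp]: "\<zeta> ^ i \<in> TT"
  using zeta_power by (simp add: UU_eq_roots) (metis One_nat_def mult.commute power_mult power_one)

lemma UU_1 [simp]: "1 \<in> TT"
  using UU_zeta_power[of 0] by simp

lemma UU_mult: "x \<in> TT \<Longrightarrow> y \<in> TT \<Longrightarrow> x * y \<in> TT"
  and UU_inverse: "x \<in> TT \<Longrightarrow> inverse x \<in> TT"
  and UU_power: "x \<in> TT \<Longrightarrow> x ^ n \<in> TT"
  by (simp_all add: UU_eq_roots power_mult_distrib power_inverse)
    (metis mult.commute power_mult power_one)

lemma UU_divide: "x \<in> TT \<Longrightarrow> y \<in> TT \<Longrightarrow> x / y \<in> TT"
  by (simp add: divide_inverse UU_mult UU_inverse)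

lemma UU_neq_0: "x \<in> TT \<Longrightarrow> x \<noteq> 0"
  using q_ge_2 by (auto simp: UU_eq_roots power_0_left split: if_splits)

lemma zero_notin_UU [simp]: "0 \<notin> TT"
  using UU_neq_0 by blast

lemma UU_power_q: "x \<in> TT \<Longrightarrow> x ^ q = x"
proof -
  assume "x \<in> TT"
  then have "x ^ Suc (q - 1) = x" unfolding UU_eq_roots power_Suc by simp
  moreover have "Suc (q - 1) = q" using q_ge_2 by simp
  ultimately show "x ^ q = x" by metis
qed

lemma UU0_eq_roots: "TT0 = {x. x ^ q = x}"
proof -
  have q: "q = Suc (q - 1)" using q_ge_2 by simp
  have "x \<in> TT0" if "x ^ q = x" for x
  proof -
    have "x * x ^ (q - 1) = x" using that q by (metis power_Suc)
    then show ?thesis by (auto simp: UU0_def UU_eq_roots)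
  qed
  then show ?thesis using UU_power_q by (auto simp: UU0_def)
qed

lemma UU_sub_UU0: "x \<in> TT \<Longrightarrow> x \<in> TT0" and UU0_0 [simp]: "0 \<in> TT0" and UU0_1 [simp]: "1 \<in> TT0"
  and UU_iff_UU0: "x \<in> TT \<longleftrightarrow> x \<in> TT0 \<and> x \<noteq> 0"
  and finite_UU0 [simp]: "finite TT0"
  by (auto simp: UU0_def)

lemma UU0_mult: "x \<in> TT0 \<Longrightarrow> y \<in> TT0 \<Longrightarrow> x * y \<in> TT0"
  and UU0_power: "n > 0 \<Longrightarrow> x \<in> TT0 \<Longrightarrow> x ^ n \<in> TT0"
  and UU0_divide: "x \<in> TT0 \<Longrightarrow> y \<in> TT0 \<Longrightarrow> x / y \<in> TT0"
  by (auto simp: UU0_def UU_mult UU_power UU_divide)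

lemma card_UU0: "card TT0 = q"
  using q_ge_2 by (simp add: UU0_def card_UU)

lemma RR_closed [intro]:
  "0 \<in> RR" "1 \<in> RR"
  "x \<in> RR \<Longrightarrow> y \<in> RR \<Longrightarrow> x + y \<in> RR" "x \<in> RR \<Longrightarrow> y \<in> RR \<Longrightarrow> x - y \<in> RR"
  "x \<in> RR \<Longrightarrow> y \<in> RR \<Longrightarrow> x * y \<in> RR" "x \<in> RR \<Longrightarrow> - x \<in> RR" "\<zeta> \<in> RR" "of_z2 a \<in> RR"
proof -
  show "0 \<in> RR" "1 \<in> RR" "\<zeta> \<in> RR" "of_z2 a \<in> RR"
    unfolding RR_def
    by (auto intro: range_eqI[of _ _ 0] range_eqI[of _ _ 1] range_eqI[of _ _ "pCons 0 1"]
      range_eqI[of _ _ "pCons a 0"] simp: ev_pCons)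
  show "x \<in> RR \<Longrightarrow> y \<in> RR \<Longrightarrow> x + y \<in> RR" "x \<in> RR \<Longrightarrow> y \<in> RR \<Longrightarrow> x - y \<in> RR"
    "x \<in> RR \<Longrightarrow> y \<in> RR \<Longrightarrow> x * y \<in> RR" "x \<in> RR \<Longrightarrow> - x \<in> RR"
    unfolding RR_def by (auto simp flip: ev_add ev_diff ev_mult ev_minus)
qed

lemma RR_power [intro]: "x \<in> RR \<Longrightarrow> x ^ n \<in> RR"
  by (induction n) auto

lemma RR_sum [intro]: "(\<And>i. i \<in> A \<Longrightarrow> g i \<in> RR) \<Longrightarrow> sum g A \<in> RR"
  by (induction A rule: infinite_finite_induct) auto

lemma RR_of_nat [intro]: "of_nat n \<in> RR"
  by (induction n) auto

lemma RR_numeral [intro]: "numeral n \<in> RR"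
  using RR_of_nat[of "numeral n"] by simp

declare RR_closed(1,2,7,8) [simp] RR_numeral [simp] RR_of_nat [simp]

lemma RR_numeral_power [simp]: "numeral n ^ k \<in> RR"
  by (intro RR_power RR_numeral)

lemma RR_UU: "x \<in> TT \<Longrightarrow> x \<in> RR"
  by (auto simp: UU_eq_image)

lemma RR_UU0: "x \<in> TT0 \<Longrightarrow> x \<in> RR"
  by (auto simp: UU0_def RR_UU)

section \<open>An integral basis of roots of unity\<close>

lemma z2_span_sub_RR: "S \<subseteq> TT \<Longrightarrow> z2_span S \<subseteq> RR"
  unfolding z2_span_def by clarify (intro RR_sum RR_closed(5,8) RR_UU, blast)

lemma RR_eq_z2_span: "RR = z2_span TT"
proof
  show "RR \<subseteq> z2_span TT"
    unfolding RR_def ev_altdef by clarify (intro z2_span_sum z2_span_base finite_UU UU_zeta_power)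
qed (simp add: z2_span_sub_RR)

text \<open>Among the subsets of \<open>TT\<close> that span, take one of least cardinality. A
  relation, divided by the highest power of 2 common to its coefficients, has an odd coefficient,
  which is a unit; so one element is a combination of the others and could be dropped.\<close>

lemma ex_basis: "\<exists>S. S \<subseteq> TT \<and> z2_span S = RR \<and>
  (\<forall>a. (\<Sum>e\<in>S. of_z2 (a e) * e) = 0 \<longrightarrow> (\<forall>e\<in>S. a e = 0))"
proof -
  have "\<exists>S. (S \<subseteq> TT \<and> z2_span S = RR) \<and>
      (\<forall>S'. S' \<subseteq> TT \<and> z2_span S' = RR \<longrightarrow> card S \<le> card S')"
    using ex_has_least_nat[of "\<lambda>S. S \<subseteq> TT \<and> z2_span S = RR" "TT" card]
    by (simp flip: RR_eq_z2_span)
  then obtain S where "(S \<subseteq> TT \<and> z2_span S = RR) \<and>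
      (\<forall>S'. S' \<subseteq> TT \<and> z2_span S' = RR \<longrightarrow> card S \<le> card S')" by (elim exE)
  then have S: "S \<subseteq> TT" "z2_span S = RR"
    and min: "\<And>S'. S' \<subseteq> TT \<Longrightarrow> z2_span S' = RR \<Longrightarrow> card S \<le> card S'" by simp_all
  have fin: "finite S" by (rule finite_subset[OF S(1) finite_UU])
  have "\<forall>e\<in>S. a e = 0" if a: "(\<Sum>e\<in>S. of_z2 (a e) * e) = 0" for a
  proof (rule ccontr)
    assume "\<not> (\<forall>e\<in>S. a e = 0)"
    then have ex: "\<exists>n. \<exists>e\<in>S. \<not> 2 ^ n dvd a e" using z2_separated by blast
    define n where "n = (LEAST n. \<exists>e\<in>S. \<not> 2 ^ n dvd a e)"
    obtain e0 where e0: "e0 \<in> S" "\<not> 2 ^ n dvd a e0" using LeastI_ex[OF ex] by (auto simp: n_def)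
    then have "n \<noteq> 0" by (intro notI) simp
    then obtain k where k: "n = Suc k" using not0_implies_Suc by blast
    then have "\<forall>e\<in>S. 2 ^ k dvd a e"
      using not_less_Least[of k "\<lambda>n. \<exists>e\<in>S. \<not> 2 ^ n dvd a e"] by (auto simp: n_def)
    then have "\<forall>e\<in>S. \<exists>b. a e = 2 ^ k * b" by (auto elim: dvdE)
    then obtain b where b: "\<And>e. e \<in> S \<Longrightarrow> a e = 2 ^ k * b e" by metis
    have "\<not> 2 dvd b e0" using e0 b[of e0] by (auto simp: k mult.assoc)
    then obtain v where v: "b e0 * v = 1" using z2_odd_unit by blast
    have "2 ^ k * (\<Sum>e\<in>S. of_z2 (b e) * e) = (0 :: 'k)"
      using a by (simp add: b of_z2_hom of_z2_power sum_distrib_left mult.assoc)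
    then have "(\<Sum>e\<in>S. of_z2 (b e) * e) = 0" by simp
    then have "of_z2 (b e0) * e0 + (\<Sum>e\<in>S - {e0}. of_z2 (b e) * e) = 0"
      using e0 fin by (simp add: sum.remove)
    then have "of_z2 v * (of_z2 (b e0) * e0 + (\<Sum>e\<in>S - {e0}. of_z2 (b e) * e)) = 0" by simp
    moreover have "of_z2 v * of_z2 (b e0) = (1 :: 'k)"
      using v by (simp flip: of_z2_hom add: mult.commute)
    ultimately have e0_eq: "e0 = - (of_z2 v * (\<Sum>e\<in>S - {e0}. of_z2 (b e) * e))"
      by (simp add: distrib_left eq_neg_iff_add_eq_0 flip: mult.assoc)
    have "z2_span S \<subseteq> z2_span (S - {e0})"
    proof
      fix x assume "x \<in> z2_span S"
      then obtain c where "x = (\<Sum>e\<in>S. of_z2 (c e) * e)" by (auto simp: z2_span_def)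
      then have "x = of_z2 (c e0) * e0 + (\<Sum>e\<in>S - {e0}. of_z2 (c e) * e)"
        using e0 fin by (simp add: sum.remove)
      also have "of_z2 (c e0) * e0 = (\<Sum>e\<in>S - {e0}. of_z2 (- (c e0 * v * b e)) * e)"
        by (subst e0_eq) (simp add: sum_distrib_left sum_negf of_z2_hom mult.assoc)
      finally have "x = (\<Sum>e\<in>S - {e0}. of_z2 (c e - c e0 * v * b e) * e)"
        by (simp add: sum.distrib[symmetric] of_z2_hom algebra_simps)
      then show "x \<in> z2_span (S - {e0})" by (rule z2_spanI)
    qed
    moreover have "z2_span (S - {e0}) \<subseteq> RR" using S by (intro z2_span_sub_RR) auto
    ultimately have "card S \<le> card (S - {e0})" using S by (intro min) auto
    then show False using e0 fin by (metis card_Diff1_less not_le)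
  qed
  then show ?thesis using S by blast
qed

text \<open>An integral basis made of roots of unity, so that squaring its members defines the
  Frobenius (\<open>frob\<close>).\<close>

definition CC :: "'k set" where
  "CC = (SOME S. S \<subseteq> TT \<and> z2_span S = RR \<and>
    (\<forall>a. (\<Sum>e\<in>S. of_z2 (a e) * e) = 0 \<longrightarrow> (\<forall>e\<in>S. a e = 0)))"

lemma CC_props: "CC \<subseteq> TT \<and> z2_span CC = RR \<and>
    (\<forall>a. (\<Sum>e\<in>CC. of_z2 (a e) * e) = 0 \<longrightarrow> (\<forall>e\<in>CC. a e = 0))"
  unfolding CC_def by (rule someI_ex[OF ex_basis])

lemma CC_sub: "CC \<subseteq> TT" and CC_span: "z2_span CC = RR"
  and CC_indep: "(\<Sum>e\<in>CC. of_z2 (a e) * e) = 0 \<Longrightarrow> e \<in> CC \<Longrightarrow> a e = 0"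
  using CC_props by simp_all

lemma finite_CC [simp]: "finite CC"
  by (rule finite_subset[OF CC_sub finite_UU])

lemma RR_coord:
  assumes "x \<in> RR"
  obtains a where "x = (\<Sum>e\<in>CC. of_z2 (a e) * e)"
  using assms unfolding CC_span[symmetric] z2_span_def by auto

lemma CC_in_RR [intro]: "(\<Sum>e\<in>CC. of_z2 (a e) * e) \<in> RR"
  using CC_span by (auto simp: z2_span_def)

text \<open>Independence lets congruences be read off coordinates; through this lemma separation and
  completeness pass from \<open>z2\<close> to \<open>RR\<close>.\<close>

lemma coord_pp_iff: "(\<Sum>e\<in>CC. of_z2 (a e) * e) \<in> pp n \<longleftrightarrow> (\<forall>e\<in>CC. 2 ^ n dvd a e)"
proof
  assume "(\<Sum>e\<in>CC. of_z2 (a e) * e) \<in> pp n"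
  then obtain b where "(\<Sum>e\<in>CC. of_z2 (a e) * e) / 2 ^ n = (\<Sum>e\<in>CC. of_z2 (b e) * e)"
    unfolding pp_def using RR_coord by blast
  then have "(\<Sum>e\<in>CC. of_z2 (a e) * e) = 2 ^ n * (\<Sum>e\<in>CC. of_z2 (b e) * e)"
    by (simp add: field_simps)
  then have "(\<Sum>e\<in>CC. of_z2 (a e - 2 ^ n * b e) * e) = 0"
    by (simp add: of_z2_hom of_z2_power left_diff_distrib sum_subtractf sum_distrib_left mult.assoc)
  then have "\<And>e. e \<in> CC \<Longrightarrow> a e - 2 ^ n * b e = 0" by (rule CC_indep)
  then show "\<forall>e\<in>CC. 2 ^ n dvd a e" by (metis dvd_triv_left right_minus_eq)
next
  assume "\<forall>e\<in>CC. 2 ^ n dvd a e"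
  then have "\<forall>e\<in>CC. \<exists>b. a e = 2 ^ n * b" by (auto elim: dvdE)
  then obtain b where b: "\<And>e. e \<in> CC \<Longrightarrow> a e = 2 ^ n * b e" by metis
  have "(\<Sum>e\<in>CC. of_z2 (a e) * e) / 2 ^ n = (\<Sum>e\<in>CC. of_z2 (b e) * e)"
    by (simp add: b of_z2_hom of_z2_power sum_divide_distrib mult.assoc)
  then show "(\<Sum>e\<in>CC. of_z2 (a e) * e) \<in> pp n" by (auto simp: pp_def)
qed

section \<open>Congruences modulo powers of 2, separation and completeness\<close>

lemma pp_0: "pp 0 = RR"
  by (simp add: pp_def)

lemma pp_closed [intro]:
  "0 \<in> pp n" "x \<in> pp n \<Longrightarrow> y \<in> pp n \<Longrightarrow> x + y \<in> pp n"
  "x \<in> pp n \<Longrightarrow> y \<in> pp n \<Longrightarrow> x - y \<in> pp n" "x \<in> pp n \<Longrightarrow> - x \<in> pp n"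
  by (auto simp: pp_def add_divide_distrib diff_divide_distrib)

lemma pp_mult: "x \<in> pp m \<Longrightarrow> y \<in> pp n \<Longrightarrow> x * y \<in> pp (m + n)"
proof -
  assume "x \<in> pp m" "y \<in> pp n"
  then have "(x / 2 ^ m) * (y / 2 ^ n) \<in> RR" unfolding pp_def by blast
  then show ?thesis by (simp add: pp_def power_add)
qed

lemma pp_mult_left [intro]: "x \<in> RR \<Longrightarrow> y \<in> pp n \<Longrightarrow> x * y \<in> pp n"
  using pp_mult[of x 0 y n] by (simp add: pp_0)

lemma pp_mult_right [intro]: "x \<in> pp n \<Longrightarrow> y \<in> RR \<Longrightarrow> x * y \<in> pp n"
  using pp_mult[of x n y 0] by (simp add: pp_0)

lemma pp_pow2 [intro]: "x \<in> RR \<Longrightarrow> 2 ^ n * x \<in> pp n"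
  by (simp add: pp_def)

lemma pp_two [intro]: "x \<in> RR \<Longrightarrow> 2 * x \<in> pp 1"
  using pp_pow2[of x 1] by simp

lemma pp_Suc_D: "x \<in> pp (Suc n) \<Longrightarrow> x \<in> pp n"
proof -
  assume "x \<in> pp (Suc n)"
  then have "2 * (x / 2 ^ Suc n) \<in> RR" unfolding pp_def by blast
  then show ?thesis by (simp add: pp_def)
qed

lemma pp_antimono: "m \<le> n \<Longrightarrow> x \<in> pp n \<Longrightarrow> x \<in> pp m"
  by (induction rule: dec_induct) (auto dest: pp_Suc_D)

lemma pp_RR: "x \<in> pp n \<Longrightarrow> x \<in> RR"
  using pp_antimono[of 0 n] by (simp add: pp_0)

lemma pp_obtain:
  assumes "x \<in> pp n"
  obtains y where "y \<in> RR" "x = 2 ^ n * y"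
  using assms that[of "x / 2 ^ n"] by (auto simp: pp_def)

lemma pp_cong_trans: "x - y \<in> pp n \<Longrightarrow> y - z \<in> pp n \<Longrightarrow> x - z \<in> pp n"
  using pp_closed(2)[of "x - y" n "y - z"] by simp

lemma pp_cong_sym: "x - y \<in> pp n \<Longrightarrow> y - x \<in> pp n"
  using pp_closed(4)[of "x - y" n] by simp

lemma RR_separated:
  assumes "\<And>n. x \<in> pp n"
  shows "x = 0"
proof -
  have "x \<in> RR" using assms pp_RR by blast
  then obtain a where a: "x = (\<Sum>e\<in>CC. of_z2 (a e) * e)" using RR_coord by blast
  have "a e = 0" if "e \<in> CC" for e
    using assms that coord_pp_iff[of a] unfolding a by (blast intro: z2_separated)
  then show ?thesis by (simp add: a)
qed

text \<open>The coordinates of the coefficients are summed by \<open>z2_complete\<close>, one basis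
  element at a time.\<close>

lemma RR_complete:
  assumes "\<And>i. d i \<in> RR"
  obtains x where "x \<in> RR" "\<And>n. x - (\<Sum>i<n. 2 ^ i * d i) \<in> pp n"
proof -
  have "\<forall>i. \<exists>a. d i = (\<Sum>e\<in>CC. of_z2 (a e) * e)" using assms RR_coord by metis
  then obtain a where a: "\<And>i. d i = (\<Sum>e\<in>CC. of_z2 (a i e) * e)" by metis
  have "\<forall>e. \<exists>x. \<forall>n. 2 ^ n dvd x - (\<Sum>i<n. 2 ^ i * a i e)" by (intro allI z2_complete)
  then obtain X where X: "\<And>e n. 2 ^ n dvd X e - (\<Sum>i<n. 2 ^ i * a i e)" by metis
  have ofs: "of_z2 (sum g A) = (\<Sum>x\<in>A. of_z2 (g x) :: 'k)" for g and A :: "nat set"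
    by (induction A rule: infinite_finite_induct) (simp_all add: of_z2_hom)
  define x where "x = (\<Sum>e\<in>CC. of_z2 (X e) * e)"
  have "x - (\<Sum>i<n. 2 ^ i * d i) \<in> pp n" for n
  proof -
    have "(\<Sum>i<n. 2 ^ i * d i) = (\<Sum>e\<in>CC. \<Sum>i<n. 2 ^ i * (of_z2 (a i e) * e))"
      by (subst sum.swap) (simp add: a sum_distrib_left)
    then have "x - (\<Sum>i<n. 2 ^ i * d i) = (\<Sum>e\<in>CC. of_z2 (X e - (\<Sum>i<n. 2 ^ i * a i e)) * e)"
      by (simp add: x_def of_z2_hom left_diff_distrib sum_subtractf ofs of_z2_power
        sum_distrib_right mult.assoc)
    then show ?thesis using X by (simp only: coord_pp_iff) blast
  qed
  moreover have "x \<in> RR" by (auto simp: x_def)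
  ultimately show ?thesis using that by blast
qed

text \<open>If 1 were divisible by 2, it would be divisible by every power of 2 and hence be
  0.\<close>

lemma one_notin_pp: "1 \<notin> pp 1"
proof
  assume *: "1 \<in> pp 1"
  have "1 \<in> pp n" for n
  proof (induction n)
    case (Suc n)
    then show ?case using pp_mult[OF * Suc] by simp
  qed (auto simp: pp_0)
  then have "(1 :: 'k) = 0" by (rule RR_separated)
  then show False by simp
qed

text \<open>An odd factor is invertible, so only powers of 2 matter, and for these the claim reduces
  to 1 not being even.\<close>

lemma of_z2_pp_iff: "of_z2 a \<in> pp n \<longleftrightarrow> 2 ^ n dvd a"
proof
  assume *: "of_z2 a \<in> pp n"
  show "2 ^ n dvd a"
  proof (cases "a = 0")
    case False
    then obtain k u where u: "a = 2 ^ k * u" "\<not> 2 dvd u" using z2_decomp by blast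
    obtain v where v: "u * v = 1" using z2_odd_unit[OF u(2)] .
    have "of_z2 a * of_z2 v \<in> pp n" using * by blast
    moreover have "of_z2 a * of_z2 v = (of_z2 (2 ^ k * (u * v)) :: 'k)"
      by (simp only: u(1) of_z2_hom(5) mult.assoc)
    ultimately have k: "2 ^ k \<in> pp n" by (simp add: v of_z2_power)
    have "n \<le> k"
    proof (rule ccontr)
      assume "\<not> n \<le> k"
      then have "2 ^ k \<in> pp (k + 1)" using k pp_antimono[of "k + 1" n] by auto
      then have "1 \<in> pp 1" by (simp add: pp_def)
      then show False using one_notin_pp by simp
    qed
    then show ?thesis by (simp add: u le_imp_power_dvd)
  qed simp
next
  assume "2 ^ n dvd a"
  then obtain b where "a = 2 ^ n * b" by (elim dvdE)
  then show "of_z2 a \<in> pp n" by (simp add: of_z2_hom of_z2_power pp_pow2 RR_closed)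
qed

lemma of_q2_in_RR_iff: "of_q2 y \<in> RR \<longleftrightarrow> y \<in> q2_ints"
proof
  assume *: "of_q2 y \<in> RR"
  show "y \<in> q2_ints"
  proof (rule ccontr)
    assume "y \<notin> q2_ints"
    then obtain u k where u: "y = Fract u 1 / 2 ^ Suc k" "\<not> 2 dvd u" using q2_nonint_decomp by blast
    have "of_q2 y = of_z2 u / (2 ^ Suc k :: 'k)" by (simp only: u of_q2_divide of_q2_power of_q2_numeral of_z2_def)
    then have "of_z2 u \<in> pp (Suc k)" using * by (simp add: pp_def)
    then have "2 ^ Suc k dvd u" by (simp only: of_z2_pp_iff)
    then show False using u(2) by (auto simp: dvd_mult_left)
  qed
next
  assume "y \<in> q2_ints"
  then show "of_q2 y \<in> RR" by (auto simp: q2_ints_def simp flip: of_z2_def)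
qed

section \<open>Teichmueller representatives and units\<close>

lemma square_cong:
  assumes "x - y \<in> pp (Suc n)" "y \<in> RR"
  shows "x\<^sup>2 - y\<^sup>2 \<in> pp (Suc (Suc n))"
proof -
  have "(x - y) + 2 * y \<in> pp 1"
    using pp_antimono[of 1 "Suc n", OF _ assms(1)] assms(2) by (intro pp_closed(2) pp_two) auto
  then have "(x - y) * (x + y) \<in> pp (Suc n + 1)" using assms(1)
    by (intro pp_mult) (simp_all add: algebra_simps)
  then show ?thesis by (simp add: power2_eq_square algebra_simps)
qed

text \<open>Each squaring gains one power of 2, because x + y = (x - y) + 2y is even as soon as x -
  y is.\<close>

lemma power_pow2_cong:
  assumes "x - y \<in> pp (Suc n)" "y \<in> RR"
  shows "x ^ (2 ^ k) - y ^ (2 ^ k) \<in> pp (Suc n + k)"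
proof (induction k)
  case (Suc k)
  have "(x ^ 2 ^ k)\<^sup>2 - (y ^ 2 ^ k)\<^sup>2 \<in> pp (Suc (Suc (n + k)))"
    using Suc assms by (intro square_cong) auto
  then show ?case by (simp add: power_mult[symmetric] mult.commute)
qed (use assms in simp)

lemma freshman:
  assumes "x \<in> RR" "y \<in> RR"
  shows "(x + y) ^ (2 ^ k) - (x ^ (2 ^ k) + y ^ (2 ^ k)) \<in> pp 1"
proof (induction k)
  case (Suc k)
  define X Y where "X = x ^ 2 ^ k" and "Y = y ^ 2 ^ k"
  have XY: "X \<in> RR" "Y \<in> RR" using assms by (auto simp: X_def Y_def)
  have "((x + y) ^ 2 ^ k)\<^sup>2 - (X + Y)\<^sup>2 \<in> pp 1"
    using square_cong[of "(x + y) ^ 2 ^ k" "X + Y" 0] Suc XY pp_Suc_D[of _ 1]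
    by (auto simp: X_def Y_def)
  then have "((x + y) ^ 2 ^ k)\<^sup>2 - (X + Y)\<^sup>2 + 2 * (X * Y) \<in> pp 1" using XY by blast
  then have "((x + y) ^ 2 ^ k)\<^sup>2 - (X\<^sup>2 + Y\<^sup>2) \<in> pp 1"
    by (simp add: power2_eq_square algebra_simps)
  then show ?case unfolding X_def Y_def by (simp add: power_mult[symmetric] mult.commute)
qed (auto)

lemma of_z2_square_cong: "(of_z2 a)\<^sup>2 - of_z2 a \<in> pp 1"
proof -
  have "2 dvd a * (a - 1)" using z2_parity[of a] by (auto intro: dvd_mult dvd_mult2)
  then have "2 ^ 1 dvd a\<^sup>2 - a" by (simp add: power2_eq_square algebra_simps)
  then have "of_z2 (a\<^sup>2 - a) \<in> pp 1" by (simp only: of_z2_pp_iff)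
  then show ?thesis by (simp add: of_z2_hom of_z2_power)
qed

lemma of_z2_pow2_cong: "(of_z2 a) ^ (2 ^ k) - of_z2 a \<in> pp 1"
proof (induction k)
  case (Suc k)
  have "((of_z2 a) ^ 2 ^ k)\<^sup>2 - (of_z2 a)\<^sup>2 \<in> pp 1"
    using square_cong[of "of_z2 a ^ 2 ^ k" "of_z2 a" 0] Suc pp_Suc_D[of _ 1] by auto
  then have "((of_z2 a) ^ 2 ^ k)\<^sup>2 - of_z2 a \<in> pp 1"
    using of_z2_square_cong by (rule pp_cong_trans)
  then show ?case by (simp add: power_mult[symmetric] mult.commute)
qed auto

text \<open>Induction over polynomials in \<zeta>: \<open>freshman\<close> splits the power,
  Fermat's congruence handles the 2-adic coefficient, and \<zeta>^q = \<zeta>.\<close>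

lemma power_q_cong: "x \<in> RR \<Longrightarrow> x ^ q - x \<in> pp 1"
proof -
  have "ev p \<zeta> ^ q - ev p \<zeta> \<in> pp 1" for p
  proof (induction p)
    case 0
    show ?case using q_ge_2 by (auto simp: power_0_left)
  next
    case (pCons a p)
    define y where "y = ev p \<zeta>"
    have y: "y \<in> RR" by (auto simp: y_def RR_def)
    have "(of_z2 a + \<zeta> * y) ^ q - (of_z2 a ^ q + (\<zeta> * y) ^ q) \<in> pp 1"
      using y by (intro freshman) auto
    moreover have "of_z2 a ^ q - of_z2 a \<in> pp 1" by (rule of_z2_pow2_cong)
    moreover have "\<zeta> * (y ^ q - y) \<in> pp 1" using pCons by (auto simp: y_def)
    ultimately have "(of_z2 a + \<zeta> * y) ^ q - (of_z2 a ^ q + (\<zeta> * y) ^ q) +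
        (of_z2 a ^ q - of_z2 a) + \<zeta> * (y ^ q - y) \<in> pp 1" by blast
    moreover have "(\<zeta> * y) ^ q = \<zeta> * y ^ q"
      using UU_power_q[of \<zeta>] UU_zeta_power[of 1] by (simp add: power_mult_distrib)
    then have "(of_z2 a + \<zeta> * y) ^ q - (of_z2 a ^ q + (\<zeta> * y) ^ q) +
        (of_z2 a ^ q - of_z2 a) + \<zeta> * (y ^ q - y) = (of_z2 a + \<zeta> * y) ^ q - (of_z2 a + \<zeta> * y)"
      by (simp only: right_diff_distrib) simp
    ultimately show ?case by (simp only: ev_pCons y_def)
  qed
  then show "x \<in> RR \<Longrightarrow> x ^ q - x \<in> pp 1" by (auto simp: RR_def)
qed

text \<open>The representative is the limit of x^(q^n), reached as a telescoping series: consecutive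
  terms agree to increasing order because each q-th power improves a congruence by f.\<close>

lemma teichmueller_ex:
  assumes x: "x \<in> RR"
  obtains s where "s \<in> TT0" "x - s \<in> pp 1"
proof -
  define X where "X n = x ^ (q ^ n)" for n
  have X: "X n \<in> RR" for n using x by (auto simp: X_def)
  have XS: "X (Suc n) = X n ^ q" for n by (simp add: X_def power_mult[symmetric] mult.commute)
  have step: "X (Suc n) - X n \<in> pp (Suc n)" for n
  proof (induction n)
    case 0
    show ?case using power_q_cong[OF x] by (simp add: X_def)
  next
    case (Suc n)
    have "X (Suc n) ^ q - X n ^ q \<in> pp (Suc n + f)" using power_pow2_cong Suc X by blast
    then have "X (Suc n) ^ q - X n ^ q \<in> pp (Suc (Suc n))"
      using f by (intro pp_antimono[of "Suc (Suc n)" "Suc n + f"]) auto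
    then show ?case by (simp only: XS)
  qed
  define d where "d n = (X (Suc n) - X n) / 2 ^ n" for n
  have d: "d n \<in> RR" for n using pp_Suc_D[OF step[of n]] by (simp add: d_def pp_def)
  obtain t where t: "t \<in> RR" "\<And>n. t - (\<Sum>i<n. 2 ^ i * d i) \<in> pp n" using RR_complete d by blast
  have sum_d: "(\<Sum>i<n. 2 ^ i * d i) = X n - x" for n
    by (induction n) (simp_all add: d_def X_def)
  define s where "s = t + x"
  have s: "s \<in> RR" using t x by (auto simp: s_def)
  have sX: "s - X n \<in> pp n" for n using t(2)[of n] unfolding sum_d s_def by (simp add: algebra_simps)
  have "s ^ q - s \<in> pp (Suc n)" for n
  proof -
    have "s ^ q - X (Suc n) ^ q \<in> pp (Suc n + f)" using power_pow2_cong sX X by blast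
    then have "s ^ q - X (Suc n) ^ q \<in> pp (Suc n)" by (rule pp_antimono[rotated]) simp
    moreover have "X (Suc n) ^ q - s \<in> pp (Suc n)"
      using pp_cong_sym[OF sX[of "Suc (Suc n)"]] pp_Suc_D XS by metis
    ultimately show ?thesis by (rule pp_cong_trans)
  qed
  then have "s ^ q - s = 0" by (intro RR_separated) (blast dest: pp_Suc_D)
  then have "s \<in> TT0" by (simp add: UU0_eq_roots)
  moreover have "x - s \<in> pp 1"
  proof -
    have "s - X 1 \<in> pp 1" using sX by blast
    moreover have "X 1 - x \<in> pp 1" using step[of 0] by (simp add: X_def)
    ultimately have "s - x \<in> pp 1" by (rule pp_cong_trans)
    then show ?thesis by (rule pp_cong_sym)
  qed
  ultimately show ?thesis by (rule that)
qed

lemma UU0_power_q_pow: "s \<in> TT0 \<Longrightarrow> s ^ (2 ^ (f * n)) = s"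
proof (induction n)
  case (Suc n)
  have "s ^ 2 ^ (f * Suc n) = (s ^ (2 ^ (f * n))) ^ q" by (simp add: power_add power_mult[symmetric] mult.commute)
  then show ?case using Suc by (simp add: UU0_eq_roots)
qed simp

text \<open>Raising to the power q^n leaves both elements fixed while improving the congruence
  arbitrarily.\<close>

lemma teichmueller_unique:
  assumes "s \<in> TT0" "t \<in> TT0" "s - t \<in> pp 1"
  shows "s = t"
proof -
  have "s - t \<in> pp n" for n
  proof -
    have "s ^ (2 ^ (f * n)) - t ^ (2 ^ (f * n)) \<in> pp (Suc 0 + f * n)"
      using assms by (intro power_pow2_cong) (auto simp: RR_UU0)
    then have "s - t \<in> pp (Suc 0 + f * n)" using assms by (simp add: UU0_power_q_pow)
    then show ?thesis by (rule pp_antimono[rotated]) (use f mult_le_mono1[of 1 f n] in linarith)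
  qed
  then have "s - t = 0" by (rule RR_separated)
  then show ?thesis by simp
qed

text \<open>The element is a root of unity times 1 - 2w, and the second factor is inverted by a
  geometric series.\<close>

lemma RR_unit:
  assumes x: "x \<in> RR" "x \<notin> pp 1"
  shows "inverse x \<in> RR"
proof -
  obtain s where s: "s \<in> TT0" "x - s \<in> pp 1" using teichmueller_ex x by blast
  have "s \<noteq> 0" using s x by auto
  then have sU: "s \<in> TT" using s by (simp add: UU_iff_UU0)
  define w where "w = - ((x - s) / 2 * inverse s)"
  have "(x - s) / 2 \<in> RR" using s(2) by (simp add: pp_def)
  then have "w \<in> RR" using RR_UU[OF UU_inverse[OF sU]] unfolding w_def by (intro RR_closed)
  have xw: "x = s * (1 - 2 * w)" using \<open>s \<noteq> 0\<close> by (simp add: w_def field_simps)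
  obtain y where y: "y \<in> RR" "\<And>n. y - (\<Sum>i<n. 2 ^ i * w ^ i) \<in> pp n"
    using RR_complete[of "\<lambda>i. w ^ i"] \<open>w \<in> RR\<close> by blast
  have "(1 - 2 * w) * y - 1 \<in> pp n" for n
  proof -
    have "(1 - 2 * w) * (y - (\<Sum>i<n. 2 ^ i * w ^ i)) - 2 ^ n * w ^ n \<in> pp n"
      using y(2)[of n] \<open>w \<in> RR\<close> by blast
    moreover have "(1 - 2 * w) * (\<Sum>i<n. 2 ^ i * w ^ i) = 1 - 2 ^ n * w ^ n"
      using one_diff_power_eq[of "2 * w" n] by (simp only: power_mult_distrib)
    ultimately show ?thesis by (simp add: right_diff_distrib)
  qed
  then have "(1 - 2 * w) * y - 1 = 0" by (rule RR_separated)
  then have "(s * inverse s) * ((1 - 2 * w) * y) = 1" using \<open>s \<noteq> 0\<close> by simp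
  then have "x * (inverse s * y) = 1" by (simp only: xw mult_ac)
  then have "inverse x = inverse s * y" by (metis inverse_unique)
  then show ?thesis using RR_UU[OF UU_inverse[OF sU]] y by auto
qed

lemma pp_prime:
  assumes "x \<in> RR" "y \<in> RR" "x * y \<in> pp 1"
  shows "x \<in> pp 1 \<or> y \<in> pp 1"
proof (rule ccontr)
  assume "\<not> (x \<in> pp 1 \<or> y \<in> pp 1)"
  then have "inverse x \<in> RR" "inverse y \<in> RR" "x \<noteq> 0" "y \<noteq> 0" using assms RR_unit by auto
  then have "(inverse x * inverse y) * (x * y) \<in> pp 1" using assms by blast
  moreover have "(inverse x * inverse y) * (x * y) = 1"
    using \<open>x \<noteq> 0\<close> \<open>y \<noteq> 0\<close> by (simp add: field_simps)
  ultimately show False using one_notin_pp by metis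
qed

section \<open>Denominators and the degree of the extension\<close>

lemma RR_decomp:
  assumes "x \<in> RR" "x \<noteq> 0"
  obtains k u where "x = 2 ^ k * u" "u \<in> RR" "u \<notin> pp 1"
proof -
  have ex: "\<exists>n. x \<notin> pp n" using assms RR_separated by blast
  define n where "n = (LEAST n. x \<notin> pp n)"
  have n: "x \<notin> pp n" using LeastI_ex[OF ex] by (simp add: n_def)
  then have "n \<noteq> 0" using assms pp_0 by (intro notI) simp
  then obtain k where k: "n = Suc k" using not0_implies_Suc by blast
  then have "x \<in> pp k" using not_less_Least[of k "\<lambda>n. x \<notin> pp n"] by (auto simp: n_def)
  then obtain u where u: "u \<in> RR" "x = 2 ^ k * u" by (rule pp_obtain)
  have "u \<notin> pp 1"
  proof
    assume "u \<in> pp 1"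
    then have "2 ^ k * u \<in> pp n" using pp_mult[of "2 ^ k" k u 1] pp_pow2[of 1 k] by (auto simp: k)
    then show False using n u by simp
  qed
  with u show ?thesis using that by blast
qed

text \<open>Elements with a power of 2 as denominator form a subfield containing the 2-adic numbers
  and \<zeta>, hence everything by the assumption \<open>adjoin\<close>.\<close>

lemma field_eq: "\<exists>k. x * 2 ^ k \<in> RR"
proof -
  define S :: "'k set" where "S = {x. \<exists>k. x * 2 ^ k \<in> RR}"
  have "is_subfield S"
    unfolding is_subfield_def
  proof (intro conjI ballI)
    show "1 \<in> S" by (auto simp: S_def intro: exI[of _ 0])
    fix x y assume "x \<in> S" "y \<in> S"
    then obtain k l where kl: "x * 2 ^ k \<in> RR" "y * 2 ^ l \<in> RR" by (auto simp: S_def)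
    have "(x * 2 ^ k) * 2 ^ l - (y * 2 ^ l) * 2 ^ k \<in> RR" using kl by blast
    then show "x - y \<in> S" unfolding S_def by (auto intro!: exI[of _ "k + l"] simp: power_add algebra_simps)
    have "(x * 2 ^ k) * (y * 2 ^ l) \<in> RR" using kl by blast
    then show "x * y \<in> S" unfolding S_def by (auto intro!: exI[of _ "k + l"] simp: power_add algebra_simps)
  next
    fix x assume "x \<in> S"
    show "inverse x \<in> S"
    proof (cases "x = 0")
      case False
      obtain k where "x * 2 ^ k \<in> RR" using \<open>x \<in> S\<close> by (auto simp: S_def)
      then obtain l u where u: "x * 2 ^ k = 2 ^ l * u" "u \<in> RR" "u \<notin> pp 1"
        using RR_decomp False by (metis mult_eq_0_iff power_eq_0_iff two_neq_0)
      have "u \<noteq> 0" using u by auto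
      then have "inverse x * 2 ^ l = 2 ^ k * inverse u" using u(1) False by (simp add: field_simps)
      moreover have "2 ^ k * inverse u \<in> RR" using RR_unit[OF u(2,3)] by (intro RR_closed) simp
      ultimately show ?thesis unfolding S_def by (auto intro!: exI[of _ l])
    qed (auto simp: S_def intro!: exI[of _ 0])
  qed
  moreover have "range of_q2 \<subseteq> S"
  proof clarify
    fix y :: q2
    obtain a k where "y = Fract a 1 / 2 ^ k" using q2_decomp .
    then have "of_q2 y * 2 ^ k = (of_z2 a :: 'k)" by (simp add: of_q2_divide of_q2_power of_z2_def)
    then show "of_q2 y \<in> S" by (auto simp: S_def intro!: exI[of _ k])
  qed
  moreover have "\<zeta> \<in> S" by (auto simp: S_def intro!: exI[of _ 0])
  ultimately have "q2_adjoin \<zeta> \<subseteq> S" by (auto simp: q2_adjoin_def)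
  then show ?thesis using adjoin by (auto simp: S_def)
qed

lemma nonRR_decomp:
  assumes "x \<notin> RR"
  obtains k u where "x = u / 2 ^ Suc k" "u \<in> RR" "u \<notin> pp 1"
proof -
  obtain k where k: "x * 2 ^ k \<in> RR" using field_eq by blast
  have "x \<noteq> 0" using assms by auto
  then obtain l u where u: "x * 2 ^ k = 2 ^ l * u" "u \<in> RR" "u \<notin> pp 1"
    using RR_decomp k by (metis mult_eq_0_iff power_eq_0_iff two_neq_0)
  have "l < k"
  proof (rule ccontr)
    assume "\<not> l < k"
    then have "x = 2 ^ (l - k) * u" using u(1) by (simp add: power_diff field_simps)
    then show False using assms u by auto
  qed
  then obtain j where j: "k = l + Suc j" using less_imp_Suc_add by auto
  have "x = u / 2 ^ Suc j" using u(1) unfolding j by (simp add: power_add field_simps)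
  then show ?thesis using u that by blast
qed

text \<open>The combinations of basis elements with coefficients 0 and 1 represent every residue
  class modulo 2 exactly once, and so do the 2^f elements of \<open>TT0\<close>.\<close>

lemma card_CC: "card CC = f"
proof -
  define F :: "('k \<Rightarrow> z2) \<Rightarrow> 'k" where "F a = (\<Sum>e\<in>CC. of_z2 (a e) * e)" for a
  define T where "T x = (SOME s. s \<in> TT0 \<and> x - s \<in> pp 1)" for x
  have T: "T x \<in> TT0" "x - T x \<in> pp 1" if "x \<in> RR" for x
    using someI_ex[of "\<lambda>s. s \<in> TT0 \<and> x - s \<in> pp 1"] teichmueller_ex[OF that] unfolding T_def by blast+
  have z01: "a = b" if "a \<in> {0, 1}" "b \<in> {0, 1}" "2 dvd a - b" for a b :: z2
    using that z2_two_not_dvd_one dvd_minus_iff[of 2 "1 :: z2"] by auto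
  have "bij_betw (\<lambda>a. T (F a)) (CC \<rightarrow>\<^sub>E {0, 1}) TT0"
  proof (rule bij_betw_imageI)
    show "inj_on (\<lambda>a. T (F a)) (CC \<rightarrow>\<^sub>E {0, 1})"
    proof (rule inj_onI)
      fix a b assume ab: "a \<in> CC \<rightarrow>\<^sub>E {0, 1}" "b \<in> CC \<rightarrow>\<^sub>E {0, 1}" and eq: "T (F a) = T (F b)"
      have "F a - T (F a) \<in> pp 1" "T (F a) - F b \<in> pp 1"
        using T(2)[of "F a"] pp_cong_sym[OF T(2)[of "F b"]] eq by (auto simp: F_def)
      then have "F a - F b \<in> pp 1" by (rule pp_cong_trans)
      also have "F a - F b = (\<Sum>e\<in>CC. of_z2 (a e - b e) * e)"
        by (simp add: F_def of_z2_hom left_diff_distrib sum_subtractf)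
      finally have "\<forall>e\<in>CC. 2 ^ 1 dvd a e - b e" by (simp only: coord_pp_iff)
      then have "\<forall>e\<in>CC. a e = b e"
        by (intro ballI z01 PiE_mem[OF ab(1)] PiE_mem[OF ab(2)]) simp_all
      then show "a = b" using ab by (metis PiE_ext)
    qed
    show "(\<lambda>a. T (F a)) ` (CC \<rightarrow>\<^sub>E {0, 1}) = TT0"
    proof (intro equalityI subsetI)
      fix s assume s: "s \<in> TT0"
      then obtain a where a: "s = F a" using RR_coord[OF RR_UU0[OF s]] unfolding F_def by auto
      define b :: "'k \<Rightarrow> z2" where "b = restrict (\<lambda>e. if 2 dvd a e then 0 else 1) CC"
      have "s - F b = (\<Sum>e\<in>CC. of_z2 (a e - b e) * e)"
        by (simp add: a F_def of_z2_hom left_diff_distrib sum_subtractf)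
      moreover have "\<forall>e\<in>CC. 2 ^ 1 dvd a e - b e" using z2_parity by (auto simp: b_def)
      ultimately have "s - F b \<in> pp 1" by (simp only: coord_pp_iff)
      moreover have "F b - T (F b) \<in> pp 1" by (rule T) (auto simp: F_def)
      ultimately have "s - T (F b) \<in> pp 1" by (rule pp_cong_trans)
      then have "s = T (F b)" using s T(1)[of "F b"] by (intro teichmueller_unique) (auto simp: F_def)
      moreover have "b \<in> CC \<rightarrow>\<^sub>E {0, 1}" by (auto simp: b_def)
      ultimately show "s \<in> (\<lambda>a. T (F a)) ` (CC \<rightarrow>\<^sub>E {0, 1})" by blast
    qed (use T(1) in \<open>auto simp: F_def\<close>)
  qed
  then have "card (CC \<rightarrow>\<^sub>E ({0, 1} :: z2 set)) = q" using bij_betw_same_card card_UU0 by metis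
  then have "2 ^ card CC = (2 :: nat) ^ f" by (simp add: card_PiE numeral_2_eq_2)
  then show ?thesis using power_inject_exp[of "2 :: nat"] by auto
qed

text \<open>Clearing denominators turns a relation over the field into one over the 2-adic
  integers.\<close>

lemma CC_independent: "q2.independent CC"
proof -
  have "u v = 0" if u: "(\<Sum>v\<in>CC. of_q2 (u v) * v) = 0" and v: "v \<in> CC" for u v
  proof -
    have "\<exists>k. \<forall>v\<in>S. 2 ^ k * u v \<in> q2_ints" if "finite S" for S using that
    proof (induction S)
      case (insert x S)
      then obtain k where k: "\<forall>v\<in>S. 2 ^ k * u v \<in> q2_ints" by blast
      obtain a l where a: "u x = Fract a 1 / 2 ^ l" using q2_decomp .
      have pw: "2 ^ j \<in> q2_ints" for j using q2_ints_closed(7)[of "2 ^ j"] by simp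
      have "2 ^ (k + l) * u v \<in> q2_ints" if "v \<in> S" for v
      proof -
        have "2 ^ l * (2 ^ k * u v) \<in> q2_ints" using that k pw by blast
        then show ?thesis by (simp add: power_add mult_ac)
      qed
      moreover have "2 ^ (k + l) * u x \<in> q2_ints"
      proof -
        have "Fract a 1 \<in> q2_ints" by (simp add: q2_ints_def)
        then have "2 ^ k * Fract a 1 \<in> q2_ints" using pw by blast
        then show ?thesis by (simp add: a power_add)
      qed
      ultimately show ?case by blast
    qed simp
    then obtain k where "\<forall>v\<in>CC. 2 ^ k * u v \<in> q2_ints" using finite_CC by blast
    then have "\<forall>v\<in>CC. \<exists>a. 2 ^ k * u v = Fract a 1" by (auto simp: q2_ints_def)
    then obtain a where a: "\<And>v. v \<in> CC \<Longrightarrow> 2 ^ k * u v = Fract (a v) 1" by metis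
    have "of_z2 (a v) = 2 ^ k * (of_q2 (u v) :: 'k)" if "v \<in> CC" for v
      using a[OF that, symmetric] by (simp add: of_z2_def of_q2_mult of_q2_power)
    then have "(\<Sum>v\<in>CC. of_z2 (a v) * v) = 2 ^ k * (\<Sum>v\<in>CC. of_q2 (u v) * v)"
      by (simp add: sum_distrib_left mult.assoc)
    then have "a v = 0" using CC_indep[of a v] u v by simp
    then show "u v = 0" using a[OF v] by (simp add: Fract_one_hom(1))
  qed
  then show ?thesis by (auto simp: q2.dependent_finite)
qed

lemma CC_q2_span: "q2.span CC = UNIV"
proof (intro equalityI subsetI UNIV_I)
  fix x :: 'k
  obtain k where "x * 2 ^ k \<in> RR" using field_eq by blast
  then obtain a where "x * 2 ^ k = (\<Sum>e\<in>CC. of_z2 (a e) * e)" using RR_coord by blast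
  then have "x = (\<Sum>e\<in>CC. of_z2 (a e) * e) / 2 ^ k" by (simp add: field_simps)
  then have "x = (\<Sum>e\<in>CC. of_q2 (Fract (a e) 1 / 2 ^ k) * e)"
    by (simp add: sum_divide_distrib of_q2_divide of_q2_power flip: of_z2_def)
  also have "\<dots> \<in> q2.span CC" by (intro q2.span_sum q2.span_scale q2.span_base)
  finally show "x \<in> q2.span CC" .
qed

end

context unram
begin

section \<open>Frobenius and trace\<close>

lemma pp_sum: "(\<And>i. i \<in> A \<Longrightarrow> g i \<in> pp n) \<Longrightarrow> sum g A \<in> pp n"
  by (induction A rule: infinite_finite_induct) auto

lemma ev_pp:
  assumes "\<And>i. 2 ^ n dvd coeff p i" and x: "x \<in> RR"
  shows "ev p x \<in> pp n"
proof -
  have "of_z2 (coeff p i) \<in> pp n" for i using assms(1)[of i] by (simp only: of_z2_pp_iff)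
  then have "of_z2 (coeff p i) * x ^ i \<in> pp n" for i using x by (intro pp_mult_right RR_power)
  then show ?thesis unfolding ev_altdef by (intro pp_sum)
qed

lemma ev_RR [intro]: "x \<in> RR \<Longrightarrow> ev p x \<in> RR"
  using ev_pp[of 0 p x] by (simp add: pp_0)

lemma ev_square_cong:
  assumes "x \<in> RR"
  shows "(ev p x)\<^sup>2 - ev p (x\<^sup>2) \<in> pp 1"
proof (induction p)
  case (pCons a p)
  define y where "y = ev p x"
  have y: "y \<in> RR" using assms by (auto simp: y_def)
  have "((of_z2 a)\<^sup>2 - of_z2 a) + 2 * (of_z2 a * x * y) + x\<^sup>2 * (y\<^sup>2 - ev p (x\<^sup>2)) \<in> pp 1"
    using pCons(2) assms y unfolding y_def[symmetric]
    by (intro pp_closed(2) pp_two pp_mult_left of_z2_square_cong RR_closed RR_power)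
  then show ?case by (simp add: ev_pCons y_def[symmetric] power2_eq_square algebra_simps)
qed auto

text \<open>Nakayama's lemma for the submodule spanned by the powers of \<open>\<zeta>\<close> below the
  \<open>j\<close>-th one.\<close>

lemma nakayama:
  assumes h0: "ev h \<zeta> = 0" and hj: "coeff h j = 1" and high: "\<And>i. i > j \<Longrightarrow> 2 dvd coeff h i"
  shows "\<exists>p. degree p = j \<and> lead_coeff p = 1 \<and> ev p \<zeta> = 0"
proof -
  have zR: "\<zeta> \<in> RR" by simp
  define P where "P = {p :: z2 poly. \<forall>i\<ge>j. coeff p i = 0}"
  have cut: "\<exists>p'\<in>P. ev p \<zeta> - ev p' \<zeta> \<in> pp 1" if "\<And>i. i \<ge> j \<Longrightarrow> 2 dvd coeff p i" for p
  proof
    show "poly_cutoff j p \<in> P" by (simp add: P_def coeff_poly_cutoff)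
    have "ev (p - poly_cutoff j p) \<zeta> \<in> pp 1"
      by (intro ev_pp zR) (use that in \<open>simp add: coeff_poly_cutoff\<close>)
    then show "ev p \<zeta> - ev (poly_cutoff j p) \<zeta> \<in> pp 1" by (simp add: ev_diff)
  qed
  \<comment> \<open>For j = 0 the hypotheses make h congruent to 1 modulo 2, so its value 0 at
    \<zeta> would make 1 even.\<close>
  have j0: "j \<noteq> 0"
  proof
    assume "j = 0"
    have "2 ^ 1 dvd coeff (h - 1) i" for i
      using hj high[of i] \<open>j = 0\<close> by (cases i) auto
    then have "ev (h - 1) \<zeta> \<in> pp 1" by (intro ev_pp zR)
    then have "- 1 \<in> pp 1" by (simp add: ev_diff h0)
    then show False using one_notin_pp pp_closed(4)[of "- 1" 1] by simp
  qed
  have red: "\<exists>p'\<in>P. ev p \<zeta> - ev p' \<zeta> \<in> pp 1" for p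
  proof (induction p)
    case 0
    show ?case by (rule cut) simp
  next
    case (pCons a p)
    then obtain p' where p': "p' \<in> P" "ev p \<zeta> - ev p' \<zeta> \<in> pp 1" by blast
    \<comment> \<open>Multiplication by \<zeta> can create a term of degree j; subtracting the right
      multiple of h cancels it and leaves only even coefficients above, without changing the value
      at \<zeta>.\<close>
    define p2 where "p2 = pCons a p' - smult (coeff p' (j - 1)) h"
    have "2 dvd coeff p2 i" if "i \<ge> j" for i
    proof (cases "i = j")
      case True
      then show ?thesis using j0 hj by (cases j) (simp_all add: p2_def)
    next
      case False
      then show ?thesis using that p'(1) high[of i] by (cases i) (auto simp: p2_def P_def)
    qed
    then obtain p3 where p3: "p3 \<in> P" "ev p2 \<zeta> - ev p3 \<zeta> \<in> pp 1" using cut by blast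
    have "\<zeta> * (ev p \<zeta> - ev p' \<zeta>) + (ev p2 \<zeta> - ev p3 \<zeta>) \<in> pp 1"
      using p'(2) p3(2) by (intro pp_closed(2) pp_mult_left zR)
    then have "ev (pCons a p) \<zeta> - ev p3 \<zeta> \<in> pp 1"
      by (simp add: p2_def ev_diff ev_smult ev_pCons h0 algebra_simps)
    then show ?case using p3(1) by blast
  qed
  have "\<forall>x. \<exists>p. x \<in> RR \<longrightarrow> p \<in> P \<and> x - ev p \<zeta> \<in> pp 1"
    using red unfolding RR_def by blast
  then obtain pl where pl: "\<And>x. x \<in> RR \<Longrightarrow> pl x \<in> P" "\<And>x. x \<in> RR \<Longrightarrow> x - ev (pl x) \<zeta> \<in> pp 1"
    by metis
  \<comment> \<open>Iterating the reduction expands \<zeta>^j as a series in powers of 2 whose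
    coefficients are values of polynomials of degree below j; the limits of their coefficients
    produce y.\<close>
  define nx where "nx x = (x - ev (pl x) \<zeta>) / 2" for x
  have nx: "nx x \<in> RR" if "x \<in> RR" for x using pl(2)[OF that] by (simp add: nx_def pp_def)
  have nx2: "2 * nx x = x - ev (pl x) \<zeta>" for x
    by (simp only: nx_def times_divide_eq_right nonzero_mult_div_cancel_left[OF two_neq_0])
  define X where "X n = (nx ^^ n) (\<zeta> ^ j)" for n
  have X: "X n \<in> RR" for n by (induction n) (auto simp: X_def nx)
  have XS: "X n = ev (pl (X n)) \<zeta> + 2 * X (Suc n)" for n by (simp add: X_def nx2)
  have Xsum: "\<zeta> ^ j = (\<Sum>i<n. 2 ^ i * ev (pl (X i)) \<zeta>) + 2 ^ n * X n" for n
  proof (induction n)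
    case (Suc n)
    then show ?case using arg_cong[OF XS[of n], of "\<lambda>z. 2 ^ n * z"] by (simp add: algebra_simps)
  qed (simp add: X_def)
  have "\<forall>k. \<exists>x. \<forall>n. 2 ^ n dvd x - (\<Sum>i<n. 2 ^ i * coeff (pl (X i)) k)"
    by (intro allI z2_complete)
  then obtain Y where Y: "\<And>k n. 2 ^ n dvd Y k - (\<Sum>i<n. 2 ^ i * coeff (pl (X i)) k)" by metis
  define y where "y = (\<Sum>k<j. monom (Y k) k)"
  have cy: "coeff y k = (if k < j then Y k else 0)" for k
    by (simp add: y_def coeff_sum)
  have "\<zeta> ^ j - ev y \<zeta> \<in> pp n" for n
  proof -
    define D where "D = y - (\<Sum>i<n. smult (2 ^ i) (pl (X i)))"
    have "2 ^ n dvd coeff D k" for k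
    proof (cases "k < j")
      case True
      then show ?thesis using Y[of n k] by (simp add: D_def cy coeff_sum)
    next
      case False
      then have "coeff (pl (X i)) k = 0" for i using pl(1)[OF X] by (auto simp: P_def)
      then show ?thesis using False by (simp add: D_def cy coeff_sum)
    qed
    then have "ev D \<zeta> \<in> pp n" by (intro ev_pp zR)
    then have "2 ^ n * X n - ev D \<zeta> \<in> pp n" using X by (intro pp_closed(3) pp_pow2)
    moreover have "ev D \<zeta> = ev y \<zeta> - (\<Sum>i<n. 2 ^ i * ev (pl (X i)) \<zeta>)"
      by (simp add: D_def ev_diff ev_sum ev_smult of_z2_power)
    ultimately show ?thesis using Xsum[of n] by (simp add: algebra_simps)
  qed
  then have *: "\<zeta> ^ j - ev y \<zeta> = 0" by (rule RR_separated)
  define p where "p = monom 1 j - y"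
  have cp: "coeff p k = (if k = j then 1 else if k < j then - Y k else 0)" for k
    by (auto simp: p_def cy)
  have "degree p = j"
  proof (rule antisym)
    show "degree p \<le> j" by (rule degree_le) (simp add: cp)
    show "j \<le> degree p" by (rule le_degree) (simp add: cp)
  qed
  moreover have "ev p \<zeta> = 0" using * by (simp add: p_def ev_diff ev_monom)
  ultimately show ?thesis by (intro exI[of _ p]) (simp add: cp)
qed

text \<open>Conjugacy of \<zeta> and its square is read off the monic polynomial g of least degree
  that kills \<zeta>. It divides X^(q-1) - 1, say with cofactor h. If h vanished at the square of
  \<zeta>, then h(\<zeta>) would be even, and so would be the derivative of X^(q-1) - 1 at \<zeta>,
  which is a unit; hence g vanishes at the square.\<close>

lemma ev_zeta_square:
  assumes "ev p \<zeta> = 0"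
  shows "ev p (\<zeta>\<^sup>2) = 0"
proof -
  have zR: "\<zeta> \<in> RR" by simp
  define A where "A n \<longleftrightarrow> (\<exists>p. degree p = n \<and> lead_coeff p = 1 \<and> ev p \<zeta> = 0)" for n
  define F :: "z2 poly" where "F = monom 1 (q - 1) - 1"
  have q1: "q - 1 > 0" using q_ge_2 by linarith
  have evF: "ev F x = x ^ (q - 1) - 1" for x :: 'k by (simp add: F_def ev_diff ev_monom)
  have cF: "coeff F (q - 1) = 1" using q1 by (simp add: F_def)
  have degF: "degree F = q - 1"
  proof (rule antisym)
    show "degree F \<le> q - 1" unfolding F_def by (intro degree_diff_le degree_monom_le) simp
    show "q - 1 \<le> degree F" by (rule le_degree, subst cF) simp
  qed
  have "A (q - 1)" unfolding A_def using degF cF zeta_power by (intro exI[of _ F]) (simp add: evF)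
  define d where "d = (LEAST n. A n)"
  have "A d" unfolding d_def by (rule LeastI) fact
  have dmin: "\<not> A j" if "j < d" for j using not_less_Least that by (simp add: d_def)
  obtain g where g: "degree g = d" "lead_coeff g = 1" "ev g \<zeta> = 0" using \<open>A d\<close> by (auto simp: A_def)
  have g0: "g \<noteq> 0" using g by auto
  \<comment> \<open>Otherwise remove the content of r: after scaling, the highest odd coefficient of
    the remaining factor s is 1, and \<open>nakayama\<close> gives a monic polynomial of degree
    below d.\<close>
  have low: "r = 0" if r: "ev r \<zeta> = 0" "degree r < d" for r
  proof (rule ccontr)
    assume "r \<noteq> 0"
    then have "coeff r (degree r) \<noteq> 0" by simp
    then have ex: "\<exists>n. \<exists>i. \<not> 2 ^ n dvd coeff r i" using z2_separated by metis
    define n where "n = (LEAST n. \<exists>i. \<not> 2 ^ n dvd coeff r i)"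
    obtain i0 where i0: "\<not> 2 ^ n dvd coeff r i0" using LeastI_ex[OF ex] by (auto simp: n_def)
    then have "n \<noteq> 0" by (intro notI) simp
    then obtain k where k: "n = Suc k" using not0_implies_Suc by metis
    then have "\<forall>i. 2 ^ k dvd coeff r i"
      using not_less_Least[of k "\<lambda>n. \<exists>i. \<not> 2 ^ n dvd coeff r i"] by (auto simp: n_def)
    then have "[:2 ^ k:] dvd r" by (simp add: const_poly_dvd_iff)
    then obtain s where s: "r = [:2 ^ k:] * s" by (elim dvdE)
    then have cs: "coeff r i = 2 ^ k * coeff s i" for i by simp
    have s0: "ev s \<zeta> = 0" using r(1) by (simp add: s ev_smult of_z2_power)
    have "\<not> 2 dvd coeff s i0" using i0 by (auto simp: k cs mult.assoc)
    define Od where "Od = {i. \<not> 2 dvd coeff s i}"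
    have Od: "Od \<subseteq> {..degree r}"
    proof
      fix i assume "i \<in> Od"
      then have "coeff s i \<noteq> 0" by (auto simp: Od_def)
      then have "coeff r i \<noteq> 0" by (simp add: cs)
      then show "i \<in> {..degree r}" using le_degree by auto
    qed
    then have "finite Od" by (rule finite_subset) simp
    define j where "j = Max Od"
    have "j \<in> Od" unfolding j_def using \<open>finite Od\<close> \<open>\<not> 2 dvd coeff s i0\<close>
      by (intro Max_in) (auto simp: Od_def)
    then have oj: "\<not> 2 dvd coeff s j" by (simp add: Od_def)
    obtain v where v: "coeff s j * v = 1" using z2_odd_unit[OF oj] .
    have "2 dvd coeff s i" if "i > j" for i
    proof (rule ccontr)
      assume "\<not> 2 dvd coeff s i"
      then have "i \<le> j" unfolding j_def using \<open>finite Od\<close> by (intro Max_ge) (auto simp: Od_def)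
      then show False using that by simp
    qed
    then have "A j"
      unfolding A_def
      by (intro nakayama[of "smult v s"]) (use s0 v in \<open>auto simp: ev_smult mult.commute\<close>)
    moreover have "j < d" using Od \<open>j \<in> Od\<close> r(2) by auto
    ultimately show False using dmin by simp
  qed
  have div: "\<exists>k. p = g * k" if "ev p \<zeta> = 0" for p
  proof -
    obtain k r where kr: "pseudo_divmod p g = (k, r)" by fastforce
    have "p = g * k + r" using pseudo_divmod(1)[OF g0 kr] g(2) by simp
    moreover have "r = 0 \<or> degree r < d" using pseudo_divmod(2)[OF g0 kr] g(1) by simp
    moreover have "ev r \<zeta> = 0"
    proof -
      have "ev p \<zeta> = ev g \<zeta> * ev k \<zeta> + ev r \<zeta>" using \<open>p = g * k + r\<close> by (simp add: ev_add ev_mult)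
      then show ?thesis using that g(3) by simp
    qed
    ultimately have "r = 0" using low by blast
    then show ?thesis using \<open>p = g * k + r\<close> by auto
  qed
  obtain h where h: "F = g * h" using div[of F] zeta_power by (auto simp: evF)
  have "ev h (\<zeta>\<^sup>2) \<noteq> 0"
  proof
    assume h2: "ev h (\<zeta>\<^sup>2) = 0"
    have hz: "ev h \<zeta> \<in> RR" by auto
    have "(ev h \<zeta>)\<^sup>2 \<in> pp 1" using ev_square_cong[OF zR, of h] by (simp add: h2)
    then have "ev h \<zeta> \<in> pp 1" using pp_prime[OF hz hz] by (auto simp: power2_eq_square)
    moreover have "ev (pderiv F) \<zeta> = ev (pderiv g) \<zeta> * ev h \<zeta>"
      by (simp add: h pderiv_mult ev_add ev_mult g(3))
    ultimately have "ev (pderiv F) \<zeta> \<in> pp 1" by (auto intro!: pp_mult_left)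
    moreover have "ev (pderiv F) \<zeta> = of_nat (q - 1) * \<zeta> ^ (q - 1 - 1)"
      by (simp add: F_def pderiv_diff pderiv_monom ev_monom of_z2_of_nat del: of_nat_diff One_nat_def)
    ultimately have "of_nat (q - 1) * \<zeta> ^ (q - 1 - 1) * \<zeta> \<in> pp 1" by (auto intro!: pp_mult_right)
    moreover have "\<zeta> ^ (q - 1 - 1) * \<zeta> = \<zeta> ^ (q - 1)" using q1 by (metis power_minus_mult)
    ultimately have *: "of_nat (q - 1) \<in> pp 1" by (simp only: mult.assoc zeta_power mult_1_right)
    have "2 * 2 ^ (f - 1) \<in> pp 1" by (intro pp_two) simp
    moreover have "2 * 2 ^ (f - 1) = (of_nat (q - 1) + 1 :: 'k)"
    proof -
      have "2 * 2 ^ (f - 1) = (2 ^ f :: 'k)" using f by (metis power_Suc Suc_diff_1 less_eq_Suc_le One_nat_def)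
      also have "\<dots> = of_nat (Suc (q - 1))" using q1 by simp
      finally show ?thesis by (simp only: of_nat_Suc add.commute)
    qed
    ultimately have "of_nat (q - 1) + 1 - of_nat (q - 1) \<in> pp 1" using * by (intro pp_closed(3)) simp_all
    then show False using one_notin_pp by simp
  qed
  moreover have "ev g (\<zeta>\<^sup>2) * ev h (\<zeta>\<^sup>2) = 0"
  proof -
    have "(\<zeta>\<^sup>2) ^ (q - 1) = 1" using zeta_power by (metis mult.commute power_mult power_one)
    then show ?thesis using evF[of "\<zeta>\<^sup>2"] by (simp add: h ev_mult)
  qed
  ultimately have "ev g (\<zeta>\<^sup>2) = 0" by simp
  then show ?thesis using div[OF assms] by (auto simp: ev_mult)
qed

section \<open>The Frobenius automorphism and its fixed elements\<close>

abbreviation crd :: "'k \<Rightarrow> 'k \<Rightarrow> q2" where "crd \<equiv> q2.representation CC"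

text \<open>The Frobenius, defined linearly by squaring the basis. Linearity is then immediate,
  while multiplicativity rests on \<open>frob_ev\<close>.\<close>

definition frob :: "'k \<Rightarrow> 'k" where "frob x = (\<Sum>c\<in>CC. of_q2 (crd x c) * c\<^sup>2)"

lemma crd_sum: "(\<Sum>c\<in>CC. of_q2 (crd x c) * c) = x"
  using q2.sum_representation_eq[OF CC_independent, of x CC] CC_q2_span by simp

lemma crd_add: "crd (x + y) c = crd x c + crd y c"
  using q2.representation_add[OF CC_independent, of y x] CC_q2_span by simp

lemma crd_scale: "crd (of_q2 r * x) c = r * crd x c"
  using q2.representation_scale[OF CC_independent, of x r] CC_q2_span by simp

lemma crd_basis: "b \<in> CC \<Longrightarrow> crd b c = (if c = b then 1 else 0)"
  using q2.representation_basis[OF CC_independent, of b] by auto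

lemma frob_add: "frob (x + y) = frob x + frob y"
  by (simp add: frob_def crd_add of_q2_add distrib_right sum.distrib)

lemma frob_scale: "frob (of_q2 r * x) = of_q2 r * frob x"
  unfolding frob_def crd_scale of_q2_mult sum_distrib_left mult.assoc ..

lemma frob_0 [simp]: "frob 0 = 0"
  using frob_scale[of 0 0] by simp

lemma frob_sum: "frob (sum g A) = (\<Sum>i\<in>A. frob (g i))"
  by (induction A rule: infinite_finite_induct) (simp_all add: frob_add)

lemma frob_CC: "c \<in> CC \<Longrightarrow> frob c = c\<^sup>2"
proof -
  assume c: "c \<in> CC"
  have "frob c = (\<Sum>c'\<in>CC. if c' = c then c\<^sup>2 else 0)"
    unfolding frob_def by (intro sum.cong) (use c in \<open>auto simp: crd_basis\<close>)
  then show ?thesis using c by simp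
qed

text \<open>Basis elements are powers of \<zeta>, so the expansion in the basis is another
  polynomial P with the same value at \<zeta>; by \<open>ev_zeta_square\<close> the two also agree
  at the square of \<zeta>.\<close>

lemma frob_ev: "frob (ev p \<zeta>) = ev p (\<zeta>\<^sup>2)"
proof -
  have "ev p \<zeta> \<in> RR" by (auto simp: RR_def)
  then obtain a where a: "ev p \<zeta> = (\<Sum>e\<in>CC. of_z2 (a e) * e)" by (rule RR_coord)
  have "\<forall>e\<in>CC. \<exists>i. e = \<zeta> ^ i" using CC_sub by (auto simp: UU_eq_image)
  then obtain i where i: "\<And>e. e \<in> CC \<Longrightarrow> e = \<zeta> ^ i e" by metis
  define P where "P = (\<Sum>e\<in>CC. monom (a e) (i e))"
  have "ev P \<zeta> = ev p \<zeta>"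
    unfolding P_def ev_sum ev_monom a by (intro sum.cong refl) (metis i)
  then have "ev (p - P) \<zeta> = 0" by (simp add: ev_diff)
  then have "ev (p - P) (\<zeta>\<^sup>2) = 0" by (rule ev_zeta_square)
  then have "ev p (\<zeta>\<^sup>2) = ev P (\<zeta>\<^sup>2)" by (simp add: ev_diff)
  also have "\<dots> = (\<Sum>e\<in>CC. of_z2 (a e) * e\<^sup>2)"
    unfolding P_def ev_sum ev_monom
    by (intro sum.cong refl arg_cong2[where f = "(*)"]) (metis i power_mult mult.commute)
  also have "\<dots> = frob (ev p \<zeta>)"
    unfolding a frob_sum of_z2_def frob_scale by (intro sum.cong refl) (simp add: frob_CC)
  finally show ?thesis by simp
qed

lemma RR_ev: "x \<in> RR \<Longrightarrow> \<exists>p. x = ev p \<zeta>"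
  by (auto simp: RR_def)

lemma frob_RR [intro]: "x \<in> RR \<Longrightarrow> frob x \<in> RR"
  using RR_ev[of x] ev_RR[OF RR_power[OF RR_closed(7)]] by (auto simp: frob_ev)

lemma frob_div_pow2: "frob (x / 2 ^ k) = frob x / 2 ^ k"
  using frob_scale[of "1 / 2 ^ k" x] by (simp add: of_q2_divide of_q2_power)

text \<open>On \<open>RR\<close> this is evaluation of a product of polynomials at the square of
  \<zeta>; denominators are powers of 2 and pass through by linearity.\<close>

lemma frob_mult: "frob (x * y) = frob x * frob y"
proof -
  have RRm: "frob (x * y) = frob x * frob y" if "x \<in> RR" "y \<in> RR" for x y
  proof -
    obtain p where p: "x = ev p \<zeta>" using RR_ev[OF \<open>x \<in> RR\<close>] by blast
    obtain p' where p': "y = ev p' \<zeta>" using RR_ev[OF \<open>y \<in> RR\<close>] by blast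
    show ?thesis unfolding p p' by (simp only: ev_mult[symmetric] frob_ev)
  qed
  obtain k where k: "x * 2 ^ k \<in> RR" using field_eq by blast
  obtain l where l: "y * 2 ^ l \<in> RR" using field_eq by blast
  have "x * y = (x * 2 ^ k) * (y * 2 ^ l) / 2 ^ (k + l)" by (simp add: power_add)
  then have "frob (x * y) = frob ((x * 2 ^ k) * (y * 2 ^ l) / 2 ^ (k + l))" by (rule arg_cong)
  also have "\<dots> = frob (x * 2 ^ k) * frob (y * 2 ^ l) / 2 ^ (k + l)"
    by (simp only: frob_div_pow2 RRm[OF k l])
  also have "\<dots> = frob (x * 2 ^ k / 2 ^ k) * frob (y * 2 ^ l / 2 ^ l)"
    by (simp only: frob_div_pow2 power_add times_divide_times_eq)
  finally show ?thesis by (simp only: nonzero_mult_div_cancel_right[OF power_not_zero[OF two_neq_0]])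
qed

lemma frob_UU0: "u \<in> TT0 \<Longrightarrow> frob u = u\<^sup>2"
proof -
  have "frob (\<zeta> ^ i) = (\<zeta> ^ i)\<^sup>2" for i
  proof -
    have "frob (\<zeta> ^ i) = (\<zeta>\<^sup>2) ^ i" using frob_ev[of "monom 1 i"] by (simp add: ev_monom)
    also have "\<dots> = (\<zeta> ^ i)\<^sup>2" unfolding power_mult[symmetric] by (rule arg_cong[OF mult.commute])
    finally show ?thesis .
  qed
  moreover assume "u \<in> TT0"
  then have "u = 0 \<or> (\<exists>i. u = \<zeta> ^ i)" unfolding UU0_def UU_eq_image by blast
  ultimately show "frob u = u\<^sup>2" by (elim disjE exE) simp_all
qed

lemma frob_pp: "x \<in> pp n \<Longrightarrow> frob x \<in> pp n"
  unfolding pp_def by (simp only: mem_Collect_eq frob_div_pow2[symmetric] frob_RR)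

lemma frob_1 [simp]: "frob 1 = 1"
  using frob_UU0[of 1] by simp

lemma frob_of_q2 [simp]: "frob (of_q2 r) = of_q2 r"
  using frob_scale[of r 1] by simp

lemma frob_minus: "frob (- x) = - frob x"
  using frob_add[of "- x" x] by (simp add: eq_neg_iff_add_eq_0)

lemma frob_diff: "frob (x - y) = frob x - frob y"
  using frob_add[of x "- y"] by (simp add: frob_minus)

lemma frob_pow_add: "(frob ^^ n) (x + y) = (frob ^^ n) x + (frob ^^ n) y"
  and frob_pow_mult: "(frob ^^ n) (x * y) = (frob ^^ n) x * (frob ^^ n) y"
  and frob_pow_of_q2: "(frob ^^ n) (of_q2 r) = of_q2 r"
  by (induction n) (simp_all add: frob_add frob_mult)

lemma frob_pow_RR: "x \<in> RR \<Longrightarrow> (frob ^^ n) x \<in> RR"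
  by (induction n) (simp_all add: frob_RR)

lemma frob_pow_0: "(frob ^^ n) 0 = 0"
  by (induction n) auto

lemma frob_pow_sum: "(frob ^^ n) (sum g A) = (\<Sum>i\<in>A. (frob ^^ n) (g i))"
  by (induction A rule: infinite_finite_induct) (simp_all add: frob_pow_add frob_pow_0)

lemma frob_pow_UU0: "u \<in> TT0 \<Longrightarrow> (frob ^^ n) u = u ^ (2 ^ n)"
proof (induction n)
  case (Suc n)
  then have "(frob ^^ Suc n) u = (u ^ 2 ^ n)\<^sup>2" by (simp add: frob_UU0 UU0_power)
  then show ?case by (metis mult.commute power_Suc power_mult)
qed simp

lemma frob_pow_f: "(frob ^^ f) x = x"
proof -
  have "(frob ^^ f) (\<Sum>c\<in>CC. of_q2 (crd x c) * c) = (\<Sum>c\<in>CC. of_q2 (crd x c) * c)"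
    unfolding frob_pow_sum frob_pow_mult frob_pow_of_q2
    by (intro sum.cong refl arg_cong2[where f = "(*)"])
      (use CC_sub in \<open>auto simp: frob_pow_UU0 UU_sub_UU0 UU_power_q\<close>)
  then show ?thesis by (simp only: crd_sum)
qed

text \<open>The first digit s of a fixed element satisfies s = s^2, so it is 0 or 1, and (x - s) / 2
  is again fixed.\<close>

lemma frob_fixed_approx: "x \<in> RR \<Longrightarrow> frob x = x \<Longrightarrow> \<exists>a. x - of_z2 a \<in> pp n"
proof (induction n arbitrary: x)
  case 0
  then show ?case by (auto simp: pp_0)
next
  case (Suc n)
  obtain s where s: "s \<in> TT0" "x - s \<in> pp 1" using teichmueller_ex Suc by blast
  have "frob (x - s) \<in> pp 1" using s(2) by (rule frob_pp)
  then have "x - s\<^sup>2 \<in> pp 1" by (simp add: frob_diff Suc frob_UU0 s)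
  then have "s - s\<^sup>2 \<in> pp 1" using pp_cong_trans[OF pp_cong_sym[OF s(2)]] by blast
  then have "s = s\<^sup>2" using s by (intro teichmueller_unique) (auto simp: UU0_power)
  then have s01: "s = 0 \<or> s = 1" by (simp add: power2_eq_square)
  then obtain b where b: "s = of_z2 b" using of_z2_hom(1,2) by metis
  define y where "y = (x - s) / 2"
  have "y \<in> RR" using s(2) by (simp add: y_def pp_def)
  moreover have "frob y = y"
    using frob_div_pow2[of "x - s" 1] s01 Suc by (auto simp: y_def frob_diff)
  ultimately obtain a where a: "y - of_z2 a \<in> pp n" using Suc.IH by blast
  have "2 * (y - of_z2 a) \<in> pp (1 + n)" using a pp_two[of 1] by (intro pp_mult) auto
  moreover have "2 * (y - of_z2 a) = x - of_z2 (b + 2 * a)" by (simp add: y_def b of_z2_hom)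
  ultimately show ?case by auto
qed

lemma frob_fixed_RR:
  assumes "x \<in> RR" "frob x = x"
  shows "\<exists>a. x = of_z2 a"
proof -
  have "\<forall>n. \<exists>a. x - of_z2 a \<in> pp n" using frob_fixed_approx assms by blast
  then obtain a where a: "\<And>n. x - of_z2 (a n) \<in> pp n" by metis
  have "2 ^ n dvd a (Suc n) - a n" for n
  proof -
    have "of_z2 (a (Suc n)) - x \<in> pp n" using pp_cong_sym[OF a] pp_Suc_D by blast
    then have "of_z2 (a (Suc n)) - of_z2 (a n) \<in> pp n" using a[of n] by (rule pp_cong_trans)
    then show ?thesis by (simp only: of_z2_hom(4)[symmetric] of_z2_pp_iff)
  qed
  then have "\<forall>n. \<exists>d. a (Suc n) - a n = 2 ^ n * d" by (auto elim: dvdE)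
  then obtain d where d: "\<And>n. a (Suc n) - a n = 2 ^ n * d n" by metis
  have sum_d: "(\<Sum>i<n. 2 ^ i * d i) = a n - a 0" for n
    by (induction n) (simp_all add: d[symmetric])
  obtain t where t: "\<And>n. 2 ^ n dvd t - (\<Sum>i<n. 2 ^ i * d i)" using z2_complete by metis
  have "x - of_z2 (t + a 0) \<in> pp n" for n
  proof -
    have "2 ^ n dvd a n - (t + a 0)" using t[of n] dvd_minus_iff[of "2 ^ n" "t - (a n - a 0)"]
      unfolding sum_d by (simp add: algebra_simps)
    then have "of_z2 (a n) - of_z2 (t + a 0) \<in> pp n"
      by (simp only: of_z2_hom(4)[symmetric] of_z2_pp_iff)
    with a show ?thesis by (rule pp_cong_trans)
  qed
  then have "x - of_z2 (t + a 0) = 0" by (rule RR_separated)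
  then show ?thesis by auto
qed

lemma frob_fixed:
  assumes "frob x = x"
  shows "\<exists>r. x = of_q2 r"
proof -
  obtain k where k: "x * 2 ^ k \<in> RR" using field_eq by blast
  have "frob (x * 2 ^ k) = x * 2 ^ k"
    using frob_div_pow2[of "x * 2 ^ k" k] assms by (simp add: field_simps)
  then obtain a where "x * 2 ^ k = of_z2 a" using frob_fixed_RR k by blast
  then have "x = of_q2 (Fract a 1 / 2 ^ k)"
    by (simp add: of_q2_divide of_q2_power field_simps flip: of_z2_def)
  then show ?thesis by blast
qed

text \<open>Basis independence of the trace, stated with coordinate functionals instead of a basis
  set: it is applied to \<open>CC\<close> and to the family of its squares, while
  \<open>q2_trace\<close> itself uses an arbitrarily chosen basis.\<close>

lemma q2_trace_eq_sum:
  assumes I: "finite I"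
    and co_add: "\<And>i x y. co i (x + y) = co i x + co i y"
    and co_scale: "\<And>i r x. co i (of_q2 r * x) = r * co i x"
    and expand: "\<And>x. x = (\<Sum>i\<in>I. of_q2 (co i x) * e i)"
  shows "q2_trace (\<alpha> :: 'k) = (\<Sum>i\<in>I. co i (\<alpha> * e i))"
proof -
  define B where "B = q2.extend_basis ({} :: 'k set)"
  have indB: "q2.independent B" and spanB: "q2.span B = UNIV"
    unfolding B_def using q2.independent_extend_basis[OF q2.independent_empty]
      q2.span_extend_basis[OF q2.independent_empty] by blast+
  have finB: "finite B"
    using q2.independent_span_bound[OF finite_CC indB] CC_q2_span by simp
  define rp where "rp = q2.representation B"
  have rp_sum: "(\<Sum>b\<in>B. of_q2 (rp x b) * b) = x" for x
    using q2.sum_representation_eq[OF indB, of x B] spanB finB by (simp add: rp_def)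
  have rp_add: "rp (x + y) b = rp x b + rp y b" for x y b
    using q2.representation_add[OF indB, of y x] spanB by (simp add: rp_def)
  have rp_scale: "rp (of_q2 r * x) b = r * rp x b" for r x b
    using q2.representation_scale[OF indB, of x r] spanB by (simp add: rp_def)
  have co_0: "co i 0 = 0" for i using co_scale[of i 0 0] by simp
  have rp_0: "rp 0 b = 0" for b using rp_scale[of 0 0] by simp
  have co_sum: "co i (sum g A) = (\<Sum>x\<in>A. co i (g x))" for i g and A :: "'k set"
    by (induction A rule: infinite_finite_induct) (simp_all add: co_add co_0)
  have rp_sum2: "rp (sum g A) b = (\<Sum>x\<in>A. rp (g x) b)" for b g and A :: "'b set"
    by (induction A rule: infinite_finite_induct) (simp_all add: rp_add rp_0)
  have rp_sum3: "rp (sum g A) b = (\<Sum>x\<in>A. rp (g x) b)" for b g and A :: "'k set"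
    by (induction A rule: infinite_finite_induct) (simp_all add: rp_add rp_0)
  have "co i (\<alpha> * e i) = (\<Sum>b\<in>B. rp (e i) b * (\<Sum>b'\<in>B. rp (\<alpha> * b) b' * co i b'))" for i
  proof -
    have "\<alpha> * e i = (\<Sum>b\<in>B. of_q2 (rp (e i) b) * (\<Sum>b'\<in>B. of_q2 (rp (\<alpha> * b) b') * b'))"
      unfolding rp_sum by (subst rp_sum[of "e i", symmetric]) (simp add: sum_distrib_left mult_ac)
    then have "co i (\<alpha> * e i) =
        co i (\<Sum>b\<in>B. of_q2 (rp (e i) b) * (\<Sum>b'\<in>B. of_q2 (rp (\<alpha> * b) b') * b'))"
      by (rule arg_cong)
    then show ?thesis by (simp only: co_sum co_scale)
  qed
  then have "(\<Sum>i\<in>I. co i (\<alpha> * e i)) =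
      (\<Sum>i\<in>I. \<Sum>b\<in>B. \<Sum>b'\<in>B. rp (\<alpha> * b) b' * (co i b' * rp (e i) b))"
    by (simp add: sum_distrib_left mult_ac)
  also have "\<dots> = (\<Sum>b\<in>B. \<Sum>b'\<in>B. \<Sum>i\<in>I. rp (\<alpha> * b) b' * (co i b' * rp (e i) b))"
    by (subst sum.swap, intro sum.cong refl, rule sum.swap)
  also have "\<dots> = (\<Sum>b\<in>B. \<Sum>b'\<in>B. rp (\<alpha> * b) b' * rp b' b)"
  proof (intro sum.cong refl)
    fix b b'
    have "rp b' b = rp (\<Sum>i\<in>I. of_q2 (co i b') * e i) b" using expand[of b'] by (rule arg_cong)
    also have "\<dots> = (\<Sum>i\<in>I. co i b' * rp (e i) b)" by (simp only: rp_sum2 rp_scale)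
    finally show "(\<Sum>i\<in>I. rp (\<alpha> * b) b' * (co i b' * rp (e i) b)) = rp (\<alpha> * b) b' * rp b' b"
      by (simp add: sum_distrib_left)
  qed
  also have "\<dots> = (\<Sum>b\<in>B. rp (\<alpha> * b) b)"
  proof (intro sum.cong refl)
    fix b assume b: "b \<in> B"
    have "(\<Sum>b'\<in>B. rp (\<alpha> * b) b' * rp b' b) = rp (\<Sum>b'\<in>B. of_q2 (rp (\<alpha> * b) b') * b') b"
      by (simp only: rp_sum3 rp_scale)
    then show "(\<Sum>b'\<in>B. rp (\<alpha> * b) b' * rp b' b) = rp (\<alpha> * b) b" by (simp only: rp_sum)
  qed
  finally show ?thesis by (simp add: q2_trace_def Let_def B_def rp_def)
qed

lemma q2_trace_crd: "q2_trace (\<alpha> :: 'k) = (\<Sum>c\<in>CC. crd (\<alpha> * c) c)"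
  by (rule q2_trace_eq_sum) (simp_all add: crd_add crd_scale crd_sum)

lemma trace_add: "q2_trace (x + y :: 'k) = q2_trace x + q2_trace y"
  by (simp add: q2_trace_crd distrib_right crd_add sum.distrib)

lemma trace_scale: "q2_trace (of_q2 r * x :: 'k) = r * q2_trace x"
  by (simp add: q2_trace_crd mult.assoc crd_scale sum_distrib_left)

lemma trace_0 [simp]: "q2_trace (0 :: 'k) = 0"
  using trace_scale[of 0 0] by simp

lemma trace_sum: "q2_trace (sum g A :: 'k) = (\<Sum>i\<in>A. q2_trace (g i))"
  by (induction A rule: infinite_finite_induct) (simp_all add: trace_add)

lemma trace_1: "q2_trace (1 :: 'k) = of_nat f"
  by (simp add: q2_trace_crd crd_basis card_CC)

text \<open>The trace is computed in the family of squares of \<open>CC\<close>, with coordinates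
  pulled back along the inverse \<open>frob ^^ (f - 1)\<close> of the Frobenius; the diagonal
  entries become those of x in \<open>CC\<close>.\<close>

lemma trace_frob: "q2_trace (frob x) = q2_trace x"
proof -
  have ff: "frob ((frob ^^ (f - 1)) x) = x" "(frob ^^ (f - 1)) (frob x) = x" for x
    using frob_pow_f[of x] f funpow_swap1[of frob "f - 1" x]
    by (metis Suc_diff_1 comp_apply funpow.simps(2) less_eq_Suc_le One_nat_def)+
  have "q2_trace (frob x) = (\<Sum>c\<in>CC. crd ((frob ^^ (f - 1)) (frob x * c\<^sup>2)) c)"
  proof (rule q2_trace_eq_sum)
    fix z show "z = (\<Sum>c\<in>CC. of_q2 (crd ((frob ^^ (f - 1)) z) c) * c\<^sup>2)"
      using ff(1)[of z] by (simp add: frob_def)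
  qed (simp_all add: frob_pow_add frob_pow_mult frob_pow_of_q2 crd_add crd_scale)
  also have "\<dots> = (\<Sum>c\<in>CC. crd (x * c) c)"
    by (intro sum.cong refl) (simp only: frob_CC[symmetric] frob_mult[symmetric] ff(2))
  finally show ?thesis by (simp add: q2_trace_crd)
qed

lemma trace_frob_pow: "q2_trace ((frob ^^ n) x) = q2_trace x"
  by (induction n) (simp_all add: trace_frob)

text \<open>The sum T of the conjugates is fixed, hence a 2-adic number r; taking traces, f Tr(x) =
  Tr(T) = f r.\<close>

lemma trace_eq: "of_q2 (q2_trace x) = (\<Sum>i<f. (frob ^^ i) x)"
proof -
  define T where "T = (\<Sum>i<f. (frob ^^ i) x)"
  have "frob T = (\<Sum>i<f. (frob ^^ Suc i) x)" by (simp add: T_def frob_sum)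
  also have "\<dots> = T"
  proof -
    have "(\<Sum>i<f. (frob ^^ Suc i) x) + (frob ^^ 0) x = (\<Sum>i<f. (frob ^^ i) x) + (frob ^^ f) x"
      using sum.lessThan_Suc_shift[of "\<lambda>i. (frob ^^ i) x" f] sum.lessThan_Suc[of "\<lambda>i. (frob ^^ i) x" f]
      by (simp only: add.commute)
    then show ?thesis by (simp add: frob_pow_f T_def)
  qed
  finally obtain r where r: "T = of_q2 r" using frob_fixed by blast
  have "of_nat f * q2_trace x = q2_trace T" by (simp add: T_def trace_sum trace_frob_pow)
  also have "\<dots> = r * of_nat f" using trace_scale[of r 1] by (simp add: r trace_1)
  finally have "of_nat f * (q2_trace x - r) = 0" by (simp add: algebra_simps)
  moreover have "(of_nat f :: q2) \<noteq> 0"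
    using q2_field_of_nat_eq_0_iff[of f, where 'k = 'k] f of_q2_of_nat[of f, where 'k = 'k] by auto
  ultimately show ?thesis using r by (simp add: T_def)
qed

lemma trace_RR: "x \<in> RR \<Longrightarrow> q2_trace x \<in> q2_ints"
  using trace_eq[of x] of_q2_in_RR_iff[of "q2_trace x"] by (auto intro: frob_pow_RR)

lemma sum_UU_power: "0 < j \<Longrightarrow> j < q - 1 \<Longrightarrow> (\<Sum>u\<in>TT. u ^ j) = 0"
  unfolding UU_eq_roots by (rule primitive_root_power_sum[OF prim])

text \<open>If all these traces were even, so would be the sum of Tr(u) / u over the roots of unity.
  Expanding the trace in conjugates gives the power sums with exponents 2^i - 1, which vanish except
  for i = 0, leaving the odd number q - 1.\<close>

lemma ex_odd_trace: "\<exists>u\<in>TT. q2_trace u / 2 \<notin> q2_ints"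
proof (rule ccontr)
  assume "\<not> ?thesis"
  then have even: "of_q2 (q2_trace u) \<in> pp 1" if "u \<in> TT" for u
    using that of_q2_in_RR_iff[of "q2_trace u / 2"] by (simp add: pp_def of_q2_divide)
  have "(\<Sum>u\<in>TT. inverse u * of_q2 (q2_trace u)) \<in> pp 1"
    by (intro pp_sum pp_mult_left RR_UU UU_inverse even)
  also have "(\<Sum>u\<in>TT. inverse u * of_q2 (q2_trace u)) = (\<Sum>u\<in>TT. \<Sum>i<f. u ^ (2 ^ i - 1))"
  proof (intro sum.cong refl)
    fix u assume u: "u \<in> TT"
    have "inverse u * u ^ 2 ^ i = u ^ (2 ^ i - 1)" for i :: nat
      using UU_neq_0[OF u] power_minus_mult[of "2 ^ i" u] by (simp add: field_simps)
    then show "inverse u * of_q2 (q2_trace u) = (\<Sum>i<f. u ^ (2 ^ i - 1))"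
      using u by (simp add: trace_eq frob_pow_UU0 UU_sub_UU0 sum_distrib_left)
  qed
  also have "\<dots> = (\<Sum>i<f. \<Sum>u\<in>TT. u ^ (2 ^ i - 1))" by (rule sum.swap)
  also have "\<dots> = (\<Sum>i<f. if i = 0 then of_nat (q - 1) else 0)"
  proof (intro sum.cong refl)
    fix i assume i: "i \<in> {..<f}"
    show "(\<Sum>u\<in>TT. u ^ (2 ^ i - 1)) = (if i = 0 then of_nat (q - 1) else 0)"
    proof (cases "i = 0")
      case False
      then have "(2 :: nat) ^ 0 < 2 ^ i" "(2 :: nat) ^ i < 2 ^ f"
        using i by (intro power_strict_increasing; simp)+
      then have i1: "1 < (2 :: nat) ^ i" and i2: "(2 :: nat) ^ i < q" by simp_all
      have "0 < 2 ^ i - (1 :: nat)" using i1 by (simp only: zero_less_diff)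
      moreover have "2 ^ i - 1 < q - 1" using i1 i2 by (intro diff_less_mono less_imp_le)
      ultimately
      have "(\<Sum>u\<in>TT. u ^ (2 ^ i - 1)) = 0" by (rule sum_UU_power)
      then show ?thesis using False by simp
    qed (simp add: card_UU)
  qed
  also have "\<dots> = of_nat (q - 1)" using f by simp
  finally have *: "of_nat (q - 1) \<in> pp 1" .
  have "2 * 2 ^ (f - 1) \<in> pp 1" by (intro pp_two) simp
  moreover have "2 * 2 ^ (f - 1) = (of_nat (q - 1) + 1 :: 'k)"
  proof -
    have "2 * 2 ^ (f - 1) = (2 ^ f :: 'k)" using f by (metis power_Suc Suc_diff_1 less_eq_Suc_le One_nat_def)
    also have "\<dots> = of_nat (Suc (q - 1))" using q_ge_2 by simp
    finally show ?thesis by (simp only: of_nat_Suc add.commute)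
  qed
  ultimately have "of_nat (q - 1) + 1 - of_nat (q - 1) \<in> pp 1" using * by (intro pp_closed(3)) simp_all
  then show False using one_notin_pp by simp
qed

text \<open>The product of X minus the conjugates of x has Frobenius-fixed coefficients in
  \<open>RR\<close>, which are 2-adic integers by \<open>frob_fixed_RR\<close>.\<close>

lemma RR_sub_int_ring: "RR \<subseteq> int_ring"
proof
  fix x assume x: "x \<in> RR"
  define P where "P = (\<Prod>i<f. [:- (frob ^^ i) x, 1:])"
  have cRR: "\<forall>i. coeff (\<Prod>j\<in>A. [:- (frob ^^ j) x, 1:]) i \<in> RR" for A :: "nat set"
  proof (induction A rule: infinite_finite_induct)
    case (insert j A)
    show ?case
    proof
      fix i
      show "coeff (\<Prod>j\<in>insert j A. [:- (frob ^^ j) x, 1:]) i \<in> RR"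
        using insert frob_pow_RR[OF x] by (cases i) (auto simp: coeff_pCons split: nat.split)
    qed
  qed (auto simp: coeff_1)
  define fr where "fr = map_poly frob"
  have cfr: "coeff (fr p) i = frob (coeff p i)" for p i by (simp add: fr_def coeff_map_poly)
  have fr_mult: "fr (p * p') = fr p * fr p'" for p p'
    by (rule poly_eqI) (simp add: cfr coeff_mult frob_sum frob_mult)
  have fr_prod: "fr (\<Prod>j\<in>A. p j) = (\<Prod>j\<in>A. fr (p j))" for p and A :: "nat set"
    by (induction A rule: infinite_finite_induct) (simp_all add: fr_mult, simp_all add: fr_def)
  have fr_lin: "fr [:- a, 1:] = [:- frob a, 1:]" for a
    by (simp add: fr_def map_poly_pCons frob_minus)
  have "fr P = (\<Prod>i<f. [:- (frob ^^ Suc i) x, 1:])" by (simp add: P_def fr_prod fr_lin)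
  also have "\<dots> = P"
  proof -
    have "[:- (frob ^^ 0) x, 1:] * (\<Prod>i<f. [:- (frob ^^ Suc i) x, 1:]) =
        P * [:- (frob ^^ f) x, 1:]"
      using prod.lessThan_Suc_shift[of "\<lambda>i. [:- (frob ^^ i) x, 1:]" f]
        prod.lessThan_Suc[of "\<lambda>i. [:- (frob ^^ i) x, 1:]" f] by (simp add: P_def)
    then have "[:- x, 1:] * (\<Prod>i<f. [:- (frob ^^ Suc i) x, 1:]) = [:- x, 1:] * P"
      by (simp only: frob_pow_f funpow_0 mult.commute)
    then show ?thesis by (subst (asm) mult_cancel_left) simp
  qed
  finally have "frob (coeff P i) = coeff P i" for i using cfr by metis
  then have ex: "\<exists>a. coeff P i = of_z2 a" for i
    using cRR[of "{..<f}"] by (intro frob_fixed_RR) (simp_all add: P_def)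
  \<comment> \<open>A section of the embedding of \<open>z2\<close>, used to pull P back
    coefficientwise.\<close>
  define g where "g c = (SOME a. of_z2 a = (c :: 'k))" for c
  have g: "of_z2 (g (coeff P i)) = coeff P i" for i
    using someI_ex[of "\<lambda>a. of_z2 a = coeff P i"] ex[of i] by (auto simp: g_def)
  have g0: "g 0 = 0" by (simp add: g_def)
  define p where "p = map_poly g P"
  have pP: "map_poly of_z2 p = P"
    by (rule poly_eqI) (simp add: p_def coeff_map_poly g0 g)
  have deg: "degree P = degree p" unfolding pP[symmetric] by (rule degree_map_poly) simp
  have "lead_coeff P = 1" unfolding P_def by (subst lead_coeff_prod) simp
  then have "lead_coeff p = 1" using pP deg
    by (metis coeff_map_poly of_z2_hom(1) of_z2_hom(2) of_z2_inject)
  moreover have "poly P x = 0"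
  proof -
    have "poly [:- (frob ^^ 0) x, 1:] x = 0" by simp
    then show ?thesis unfolding P_def poly_prod using f by (intro prod_zero) (auto intro!: bexI[of _ 0])
  qed
  ultimately show "x \<in> int_ring"
    unfolding int_ring_def using pP by (auto simp: of_z2_def[abs_def] intro!: exI[of _ p])
qed

text \<open>If x = u / 2^(k+1) with u a unit, clearing denominators in the monic equation makes u^n
  even.\<close>

lemma int_ring_sub_RR: "int_ring \<subseteq> RR"
proof
  fix x :: 'k assume "x \<in> int_ring"
  then obtain p where p: "lead_coeff p = 1" "ev p x = 0"
    by (auto simp: int_ring_def ev_def of_z2_def[abs_def])
  show "x \<in> RR"
  proof (rule ccontr)
    assume "x \<notin> RR"
    then obtain k u where u: "x = u / 2 ^ Suc k" "u \<in> RR" "u \<notin> pp 1" by (rule nonRR_decomp)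
    define n where "n = degree p"
    define w where "w = (2 :: 'k) ^ Suc k"
    have w: "w \<in> pp 1" "w \<in> RR" "w \<noteq> 0" using pp_two[of "2 ^ k"] pp_RR[OF pp_two[of "2 ^ k"]] by (simp_all add: w_def)
    have wx: "w * x = u" using w by (simp add: u w_def)
    have "0 = w ^ n * ev p x" by (simp add: p)
    also have "\<dots> = w ^ n * (\<Sum>i<n. of_z2 (coeff p i) * x ^ i) + w ^ n * x ^ n"
      using p(1) by (simp add: ev_altdef n_def lessThan_Suc_atMost[symmetric] distrib_left)
    also have "w ^ n * x ^ n = u ^ n" by (simp only: power_mult_distrib[symmetric] wx)
    also have "w ^ n * (\<Sum>i<n. of_z2 (coeff p i) * x ^ i) =
        (\<Sum>i<n. w * (w ^ (n - i - 1) * of_z2 (coeff p i) * u ^ i))"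
    proof (unfold sum_distrib_left, intro sum.cong refl)
      fix i assume "i \<in> {..<n}"
      then have n: "n = Suc (n - i - 1) + i" by simp
      have "w ^ n * (of_z2 (coeff p i) * x ^ i) =
          w ^ Suc (n - i - 1) * of_z2 (coeff p i) * (w ^ i * x ^ i)"
        by (subst n, subst power_add) (simp only: mult_ac)
      also have "w ^ i * x ^ i = u ^ i" by (simp only: power_mult_distrib[symmetric] wx)
      finally show "w ^ n * (of_z2 (coeff p i) * x ^ i) =
          w * (w ^ (n - i - 1) * of_z2 (coeff p i) * u ^ i)" by (simp only: power_Suc mult_ac)
    qed
    finally have "u ^ n = - (\<Sum>i<n. w * (w ^ (n - i - 1) * of_z2 (coeff p i) * u ^ i))"
      by (simp add: eq_neg_iff_add_eq_0 add.commute)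
    also have "\<dots> \<in> pp 1"
      using w u by (intro pp_closed(4) pp_sum pp_mult_right RR_closed RR_power) auto
    finally have "u ^ n \<in> pp 1" .
    then have "inverse u ^ n * u ^ n \<in> pp 1" using RR_unit[OF u(2,3)] by (intro pp_mult_left RR_power)
    moreover have "u \<noteq> 0" using u by auto
    ultimately show False using one_notin_pp by (simp add: power_mult_distrib[symmetric])
  qed
qed

lemma int_ring_eq: "int_ring = RR"
  using RR_sub_int_ring int_ring_sub_RR by blast

end

context unram
begin

section \<open>The additive character\<close>

lemma e_pi_add: "e_pi (x + y :: 'k) = e_pi x * e_pi y"
  by (simp add: e_pi_def trace_add e2_add)

lemma e_pi_RR: "x \<in> RR \<Longrightarrow> e_pi x = 1"
  by (simp add: e_pi_def e2_eq_1_iff trace_RR)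

lemma e_pi_0 [simp]: "e_pi (0 :: 'k) = 1"
  by (simp add: e_pi_RR)

lemma norm_e_pi [simp]: "norm (e_pi (x :: 'k)) = 1"
  by (simp add: e_pi_def)

lemma e_pi_neq_0 [simp]: "e_pi (x :: 'k) \<noteq> 0"
  using norm_e_pi[of x] by (metis norm_zero zero_neq_one)

lemma e_pi_minus: "e_pi (- x :: 'k) = cnj (e_pi x)"
proof -
  have "e_pi (- x) * e_pi x = 1" by (simp flip: e_pi_add)
  moreover have "cnj (e_pi x) * e_pi x = 1"
    using complex_norm_square[of "e_pi x"] by (simp add: mult.commute)
  ultimately show ?thesis by (metis e_pi_neq_0 mult_right_cancel)
qed

lemma e_pi_minus_mult [simp]: "e_pi (x :: 'k) * cnj (e_pi x) = 1"
  by (simp flip: e_pi_minus e_pi_add)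

lemma e_pi_diff: "e_pi (x - y :: 'k) = e_pi x * cnj (e_pi y)"
  using e_pi_add[of x "- y"] by (simp add: e_pi_minus)

lemma e_pi_cong: "x - y \<in> RR \<Longrightarrow> e_pi x = e_pi y"
  using e_pi_add[of "x - y" y] by (simp add: e_pi_RR)

lemma e_pi_sum: "finite A \<Longrightarrow> e_pi (sum g A :: 'k) = (\<Prod>i\<in>A. e_pi (g i))"
  by (induction A rule: finite_induct) (simp_all add: e_pi_add)

lemma e_pi_frob: "e_pi (frob x) = e_pi x"
  by (simp add: e_pi_def trace_frob)

lemma trace_half: "q2_trace (x / 2 :: 'k) = q2_trace x / 2"
  using trace_scale[of "1 / 2" x] by (simp add: of_q2_divide)

text \<open>Scaling by a multiple of 2^k / u moves c to u0 / 2, where u0 is a root of unity of odd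
  trace.\<close>

lemma e_pi_nondeg:
  assumes "c \<notin> RR"
  shows "\<exists>y\<in>RR. e_pi (c * y) \<noteq> 1"
proof -
  obtain u0 where u0: "u0 \<in> TT" "q2_trace u0 / 2 \<notin> q2_ints" using ex_odd_trace by blast
  have e0: "e_pi (u0 / 2) \<noteq> 1" using u0(2) by (simp add: e_pi_def trace_half e2_eq_1_iff)
  obtain k u where u: "c = u / 2 ^ Suc k" "u \<in> RR" "u \<notin> pp 1" using nonRR_decomp[OF assms] .
  have "u \<noteq> 0" using u by auto
  then have "c * (2 ^ k * (u0 * inverse u)) = u0 / 2" by (simp add: u field_simps)
  moreover have "2 ^ k * (u0 * inverse u) \<in> RR"
    using RR_unit[OF u(2,3)] RR_UU[OF u0(1)] by (intro RR_closed) simp_all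
  ultimately show ?thesis using e0 by metis
qed

lemma pp_1_half: "x \<in> pp 1 \<longleftrightarrow> x / 2 \<in> RR"
  by (simp add: pp_def)

text \<open>Only the Teichmueller digit modulo 2 matters, and squaring it is the Frobenius, which
  preserves the trace. This is how squares become linear at denominator 2.\<close>

lemma e_pi_half_square: "x \<in> RR \<Longrightarrow> e_pi (x\<^sup>2 / 2) = e_pi (x / 2)"
proof -
  assume x: "x \<in> RR"
  obtain s where s: "s \<in> TT0" "x - s \<in> pp 1" using teichmueller_ex[OF x] .
  have h: "(x - s) / 2 \<in> RR" using s(2) unfolding pp_1_half .
  have "x\<^sup>2 / 2 - s\<^sup>2 / 2 = (x - s) / 2 * (x + s)" by (simp add: power2_eq_square field_simps)
  also have "\<dots> \<in> RR" using h x RR_UU0[OF s(1)] by (intro RR_closed)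
  finally have "e_pi (x\<^sup>2 / 2) = e_pi (s\<^sup>2 / 2)" by (rule e_pi_cong)
  also have "s\<^sup>2 / 2 = frob (s / 2)" using frob_div_pow2[of s 1] by (simp add: frob_UU0 s)
  also have "e_pi \<dots> = e_pi (s / 2)" by (rule e_pi_frob)
  also have "\<dots> = e_pi (x / 2)"
    by (rule e_pi_cong[symmetric]) (use h in \<open>simp add: diff_divide_distrib\<close>)
  finally show ?thesis .
qed

lemma e_pi_half_pm: "x \<in> RR \<Longrightarrow> e_pi (x / 2) = 1 \<or> e_pi (x / 2) = - 1"
proof -
  assume "x \<in> RR"
  then have "e_pi (x / 2) * e_pi (x / 2) = 1" by (simp flip: e_pi_add add: e_pi_RR)
  then show ?thesis by (metis power2_eq_1_iff power2_eq_square)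
qed

lemma e_pi_half_cnj: "x \<in> RR \<Longrightarrow> cnj (e_pi (x / 2)) = e_pi (x / 2)"
  using e_pi_half_pm by fastforce

lemma neg_one_pow_trace: "x \<in> RR \<Longrightarrow> neg_one_pow (q2_trace x) = e_pi (x / 2)"
proof -
  assume x: "x \<in> RR"
  have "(\<exists>y\<in>q2_ints. q2_trace x = 2 * y) \<longleftrightarrow> q2_trace x / 2 \<in> q2_ints"
    by (auto simp: field_simps intro!: bexI[of _ "q2_trace x / 2"])
  also have "\<dots> \<longleftrightarrow> e_pi (x / 2) = 1" by (simp add: e_pi_def trace_half e2_eq_1_iff)
  finally show ?thesis using e_pi_half_pm[OF x] by (auto simp: neg_one_pow_def)
qed

text \<open>Since s^q = s, the power q / 2 inverts squaring.\<close>

lemma UU0_sqrt: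
  assumes "s \<in> TT0"
  obtains t where "t \<in> TT0" "t\<^sup>2 = s"
proof
  show "s ^ 2 ^ (f - 1) \<in> TT0" using assms by (intro UU0_power) simp_all
  have "(s ^ 2 ^ (f - 1))\<^sup>2 = s ^ (2 ^ (f - 1) * 2)" by (simp only: power_mult)
  also have "(2 :: nat) ^ (f - 1) * 2 = q" using f by (metis power_minus_mult less_eq_Suc_le One_nat_def)
  finally show "(s ^ 2 ^ (f - 1))\<^sup>2 = s" using assms by (simp add: UU0_eq_roots)
qed

lemma UU_sqrt:
  assumes "s \<in> TT"
  obtains t where "t \<in> TT" "t\<^sup>2 = s"
proof -
  obtain t where t: "t \<in> TT0" "t\<^sup>2 = s" using UU0_sqrt[OF UU_sub_UU0[OF assms]] .
  then have "t \<in> TT" using assms by (auto simp: UU_iff_UU0)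
  then show ?thesis using t that by blast
qed

lemma e_pi_div_pow2_square: "s \<in> TT0 \<Longrightarrow> e_pi (s\<^sup>2 / 2 ^ k) = e_pi (s / 2 ^ k)"
  using e_pi_frob[of "s / 2 ^ k"] by (simp add: frob_div_pow2 frob_UU0)

section \<open>Mean values of locally constant functions on the integers\<close>

text \<open>Representatives modulo 2^T as digit expansions with the lowest digit outermost, so that
  a recursion step splits off the residue modulo 2.\<close>

primrec reps :: "nat \<Rightarrow> 'k set" where
  "reps 0 = {0}"
| "reps (Suc T) = (\<lambda>(s, y). s + 2 * y) ` (TT0 \<times> reps T)"

lemma reps_RR: "x \<in> reps T \<Longrightarrow> x \<in> RR"
proof (induction T arbitrary: x)
  case (Suc T)
  then obtain s y where "x = s + 2 * y" "s \<in> TT0" "y \<in> reps T" by auto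
  then show ?case using Suc.IH[of y] RR_UU0[of s] by (simp add: RR_closed)
qed simp

lemma finite_reps [simp]: "finite (reps T)"
  by (induction T) auto

lemma digit_unique:
  assumes "s \<in> TT0" "s' \<in> TT0" "y \<in> RR" "y' \<in> RR" "s + 2 * y - (s' + 2 * y') \<in> pp 1"
  shows "s = s'"
proof -
  have "(s + 2 * y - (s' + 2 * y')) + 2 * (y' - y) \<in> pp 1"
    using assms by (intro pp_closed(2) pp_two) auto
  then have "s - s' \<in> pp 1" by (simp add: algebra_simps)
  then show ?thesis using assms by (intro teichmueller_unique)
qed

lemma inj_digit: "inj_on (\<lambda>(s, y). s + 2 * y) (TT0 \<times> reps T)"
proof (rule inj_onI, clarify)
  fix s y s' y' assume *: "s \<in> TT0" "y \<in> reps T" "s' \<in> TT0" "y' \<in> reps T"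
    "s + 2 * y = s' + 2 * y'"
  have "s = s'" using * by (intro digit_unique[of s s' y y']) (auto intro: reps_RR)
  then show "s = s' \<and> y = y'" using * by simp
qed

lemma sum_reps_Suc: "(\<Sum>x\<in>reps (Suc T). g x) = (\<Sum>s\<in>TT0. \<Sum>y\<in>reps T. g (s + 2 * y))"
  unfolding reps.simps sum.reindex[OF inj_digit] sum.cartesian_product comp_def
  by (simp add: case_prod_unfold)

lemma card_reps: "card (reps T) = q ^ T"
  by (induction T) (simp_all add: card_image[OF inj_digit] card_cartesian_product card_UU0)

lemma zero_in_reps: "0 \<in> reps T"
proof (induction T)
  case (Suc T)
  then show ?case by (auto intro!: image_eqI[of _ _ "(0, 0)"])
qed simp

lemma pp_Suc_half: "2 * x \<in> pp (Suc n) \<longleftrightarrow> x \<in> pp n"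
  by (simp add: pp_def)

lemma reps_unique: "x \<in> reps T \<Longrightarrow> x' \<in> reps T \<Longrightarrow> x - x' \<in> pp T \<Longrightarrow> x = x'"
proof (induction T arbitrary: x x')
  case (Suc T)
  obtain s y where x: "x = s + 2 * y" "s \<in> TT0" "y \<in> reps T" using Suc by auto
  obtain s' y' where x': "x' = s' + 2 * y'" "s' \<in> TT0" "y' \<in> reps T" using Suc by auto
  have "x - x' \<in> pp 1" using Suc(4) pp_antimono[of 1 "Suc T"] by simp
  then have s: "s = s'"
    using x x' by (intro digit_unique[of s s' y y']) (auto intro: reps_RR)
  have "2 * (y - y') \<in> pp (Suc T)" using Suc(4) by (simp add: x x' s algebra_simps)
  then have "y - y' \<in> pp T" by (simp only: pp_Suc_half)
  then have "y = y'" using Suc.IH[of y y'] x x' by blast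
  then show ?case by (simp add: x x' s)
qed simp

lemma reps_ex: "x \<in> RR \<Longrightarrow> \<exists>r\<in>reps T. x - r \<in> pp T"
proof (induction T arbitrary: x)
  case (Suc T)
  obtain s where s: "s \<in> TT0" "x - s \<in> pp 1" using teichmueller_ex[OF Suc(2)] .
  obtain y where y: "y \<in> RR" "x - s = 2 ^ 1 * y" using pp_obtain[OF s(2)] .
  obtain r where r: "r \<in> reps T" "y - r \<in> pp T" using Suc.IH[OF y(1)] by blast
  have "2 * (y - r) \<in> pp (Suc T)" using r by (simp only: pp_Suc_half)
  moreover have "2 * (y - r) = x - (s + 2 * r)" using y(2) by (simp add: algebra_simps)
  ultimately have "x - (s + 2 * r) \<in> pp (Suc T)" by metis
  moreover have "s + 2 * r \<in> reps (Suc T)" using s r by (auto intro!: image_eqI[of _ _ "(s, r)"])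
  ultimately show ?case by blast
qed (simp add: pp_0)

definition per :: "nat \<Rightarrow> ('k \<Rightarrow> complex) \<Rightarrow> bool"
  where "per T g \<longleftrightarrow> (\<forall>x\<in>RR. \<forall>y\<in>RR. g (x + 2 ^ T * y) = g x)"

definition lc :: "('k \<Rightarrow> complex) \<Rightarrow> bool" where "lc g \<longleftrightarrow> (\<exists>T. per T g)"

definition mean :: "nat \<Rightarrow> ('k \<Rightarrow> complex) \<Rightarrow> complex"
  where "mean T g = (\<Sum>x\<in>reps T. g x) / of_nat q ^ T"

text \<open>The Haar mean over the integers as a finite mean; for locally constant functions any
  admissible level gives the same value (\<open>MM_eq\<close>).\<close>

definition MM :: "('k \<Rightarrow> complex) \<Rightarrow> complex"
  where "MM g = mean (SOME T. per T g) g"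

lemma perD: "per T g \<Longrightarrow> x \<in> RR \<Longrightarrow> x' \<in> RR \<Longrightarrow> x - x' \<in> pp T \<Longrightarrow> g x = g x'"
proof -
  assume g: "per T g" and x: "x \<in> RR" "x' \<in> RR" "x - x' \<in> pp T"
  obtain y where "y \<in> RR" "x - x' = 2 ^ T * y" using pp_obtain[OF x(3)] .
  then have "x = x' + 2 ^ T * y" "y \<in> RR" by (simp_all add: algebra_simps)
  then show ?thesis using g x by (simp add: per_def)
qed

lemma per_Suc: "per T g \<Longrightarrow> per (Suc T) g"
  unfolding per_def
proof (intro ballI)
  fix x y assume *: "\<forall>x\<in>RR. \<forall>y\<in>RR. g (x + 2 ^ T * y) = g x" "x \<in> RR" "y \<in> RR"
  have "2 * y \<in> RR" using * by (intro RR_closed) simp_all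
  then have "g (x + 2 ^ T * (2 * y)) = g x" using * by blast
  then show "g (x + 2 ^ Suc T * y) = g x" by (simp add: mult_ac)
qed

lemma per_mono: "T \<le> T' \<Longrightarrow> per T g \<Longrightarrow> per T' g"
  by (induction rule: dec_induct) (auto dest: per_Suc)

lemma per_digit: "per (Suc T) g \<Longrightarrow> s \<in> RR \<Longrightarrow> per T (\<lambda>y. g (s + 2 * y))"
  unfolding per_def
proof (intro ballI)
  fix x y assume *: "\<forall>x\<in>RR. \<forall>y\<in>RR. g (x + 2 ^ Suc T * y) = g x" "s \<in> RR" "x \<in> RR" "y \<in> RR"
  have "s + 2 * x \<in> RR" using * by (intro RR_closed) simp_all
  then have "g ((s + 2 * x) + 2 ^ Suc T * y) = g (s + 2 * x)" using * by blast
  then show "g (s + 2 * (x + 2 ^ T * y)) = g (s + 2 * x)" by (simp add: algebra_simps)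
qed

lemma mean_Suc: "mean (Suc T) g = (\<Sum>s\<in>TT0. mean T (\<lambda>y. g (s + 2 * y))) / of_nat q"
  by (simp add: mean_def sum_reps_Suc sum_divide_distrib mult.commute del: reps.simps)

lemma mean_0: "mean 0 g = g 0"
  by (simp add: mean_def)

lemma mean_per_Suc: "per T g \<Longrightarrow> mean (Suc T) g = mean T g"
proof (induction T arbitrary: g)
  case 0
  have "g (s + 2 * 0) = g 0" if "s \<in> TT0" for s
    using RR_UU0[OF that] by (intro perD[OF 0]) (simp_all add: pp_0)
  then have "(\<Sum>s\<in>TT0. mean 0 (\<lambda>y. g (s + 2 * y))) = (\<Sum>s\<in>TT0. g 0)"
    by (intro sum.cong refl) (simp only: mean_0)
  then have "mean (Suc 0) g = (\<Sum>s\<in>TT0. g 0) / of_nat q" by (simp only: mean_Suc)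
  then show ?case by (simp add: mean_0 card_UU0)
next
  case (Suc T)
  have "mean (Suc (Suc T)) g = (\<Sum>s\<in>TT0. mean (Suc T) (\<lambda>y. g (s + 2 * y))) / of_nat q"
    by (rule mean_Suc)
  also have "\<dots> = (\<Sum>s\<in>TT0. mean T (\<lambda>y. g (s + 2 * y))) / of_nat q"
    by (intro arg_cong2[where f = "(/)"] sum.cong refl Suc.IH per_digit Suc.prems RR_UU0)
  also have "\<dots> = mean (Suc T) g" by (rule mean_Suc[symmetric])
  finally show ?case .
qed

lemma mean_per_le: "T \<le> T' \<Longrightarrow> per T g \<Longrightarrow> mean T' g = mean T g"
proof (induction rule: dec_induct)
  case (step n)
  then show ?case using mean_per_Suc[OF per_mono[of T n]] by simp
qed simp

lemma MM_eq: "per T g \<Longrightarrow> MM g = mean T g"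
proof -
  assume T: "per T g"
  define S where "S = (SOME T. per T g)"
  have S: "per S g" unfolding S_def using T by (rule someI)
  have "mean S g = mean (max S T) g" by (rule mean_per_le[symmetric, OF _ S]) simp
  also have "\<dots> = mean T g" by (rule mean_per_le[OF _ T]) simp
  finally show ?thesis by (simp add: MM_def S_def)
qed

lemma per_cong: "(\<And>x. x \<in> RR \<Longrightarrow> g x = h x) \<Longrightarrow> per T g \<longleftrightarrow> per T h"
  unfolding per_def
proof (intro ball_cong refl)
  fix x y assume *: "\<And>x. x \<in> RR \<Longrightarrow> g x = h x" "x \<in> RR" "y \<in> RR"
  have "x + 2 ^ T * y \<in> RR" using * by (intro RR_closed) simp_all
  then show "g (x + 2 ^ T * y) = g x \<longleftrightarrow> h (x + 2 ^ T * y) = h x" using * by simp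
qed

text \<open>Functions agreeing on \<open>RR\<close> have the same periods, so \<open>SOME\<close>
  selects the same level on both sides.\<close>

lemma MM_cong: "(\<And>x. x \<in> RR \<Longrightarrow> g x = h x) \<Longrightarrow> MM g = MM h"
proof -
  assume *: "\<And>x. x \<in> RR \<Longrightarrow> g x = h x"
  have "(\<lambda>T. per T g) = (\<lambda>T. per T h)" by (intro ext per_cong *)
  moreover have "mean T g = mean T h" for T
    unfolding mean_def by (intro arg_cong2[where f = "(/)"] sum.cong refl * reps_RR)
  ultimately show ?thesis by (simp only: MM_def)
qed

lemma MM_cmult: "MM (\<lambda>x. c * g x) = c * MM g"
proof (cases "c = 0")
  case False
  then have "(\<lambda>T. per T (\<lambda>x. c * g x)) = (\<lambda>T. per T g)" by (simp add: per_def)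
  then show ?thesis by (simp add: MM_def mean_def sum_distrib_left)
qed (simp add: MM_def mean_def)

lemma MM_cmult_right: "MM (\<lambda>x. g x * c) = MM g * c"
  using MM_cmult[of c g] by (simp add: mult.commute)

lemma MM_cnj: "MM (\<lambda>x. cnj (g x)) = cnj (MM g)"
  by (simp add: MM_def mean_def per_def)

lemma MM_const [simp]: "MM (\<lambda>x. c) = c"
  using MM_eq[of 0 "\<lambda>x. c"] by (simp add: per_def mean_def)

lemma lc_const [simp]: "lc (\<lambda>x. c)"
  by (simp add: lc_def per_def)

lemma lc_mult: "lc g \<Longrightarrow> lc h \<Longrightarrow> lc (\<lambda>x. g x * h x)"
proof -
  assume "lc g" "lc h"
  then obtain T T' where "per T g" "per T' h" by (auto simp: lc_def)
  then have "per (max T T') g" "per (max T T') h" by (auto intro: per_mono[rotated])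
  then have "per (max T T') (\<lambda>x. g x * h x)" by (simp add: per_def)
  then show ?thesis by (auto simp: lc_def)
qed

lemma lc_affine: "lc g \<Longrightarrow> a \<in> RR \<Longrightarrow> b \<in> RR \<Longrightarrow> lc (\<lambda>x. g (a * x + b))"
proof -
  assume g: "lc g" and ab: "a \<in> RR" "b \<in> RR"
  then obtain T where T: "per T g" by (auto simp: lc_def)
  have "per T (\<lambda>x. g (a * x + b))"
    unfolding per_def
  proof (intro ballI)
    fix x y assume xy: "x \<in> RR" "y \<in> RR"
    have "a * x + b \<in> RR" "a * y \<in> RR" using xy ab by (auto intro: RR_closed)
    then have "g ((a * x + b) + 2 ^ T * (a * y)) = g (a * x + b)" using T unfolding per_def by blast
    then show "g (a * (x + 2 ^ T * y) + b) = g (a * x + b)" by (simp add: algebra_simps)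
  qed
  then show ?thesis by (auto simp: lc_def)
qed

text \<open>A map that is injective modulo 2^T permutes the finitely many classes.\<close>

lemma mean_reindex:
  assumes g: "per T g" and h: "\<And>x. x \<in> RR \<Longrightarrow> h x \<in> RR"
    and inj: "\<And>x x'. x \<in> RR \<Longrightarrow> x' \<in> RR \<Longrightarrow> h x - h x' \<in> pp T \<Longrightarrow> x - x' \<in> pp T"
  shows "mean T (\<lambda>x. g (h x)) = mean T g"
proof -
  have "\<forall>x. \<exists>r. x \<in> reps T \<longrightarrow> r \<in> reps T \<and> h x - r \<in> pp T"
    using reps_ex[OF h[OF reps_RR]] by blast
  then obtain k where k: "\<And>x. x \<in> reps T \<Longrightarrow> k x \<in> reps T" "\<And>x. x \<in> reps T \<Longrightarrow> h x - k x \<in> pp T"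
    by metis
  have "inj_on k (reps T)"
  proof (rule inj_onI)
    fix x x' assume x: "x \<in> reps T" "x' \<in> reps T" "k x = k x'"
    have "h x - h x' \<in> pp T"
      using pp_cong_trans[OF k(2)[OF x(1)]] pp_cong_sym[OF k(2)[OF x(2)]] x(3) by simp
    then have "x - x' \<in> pp T" by (rule inj[OF reps_RR[OF x(1)] reps_RR[OF x(2)]])
    then show "x = x'" using x by (intro reps_unique)
  qed
  then have "bij_betw k (reps T) (reps T)"
    using k(1) by (intro bij_betw_imageI endo_inj_surj) auto
  then have "(\<Sum>x\<in>reps T. g x) = (\<Sum>x\<in>reps T. g (k x))" by (rule sum.reindex_bij_betw[symmetric])
  also have "\<dots> = (\<Sum>x\<in>reps T. g (h x))"
    by (intro sum.cong refl perD[OF g, symmetric] k h reps_RR[of _ T])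
  finally show ?thesis by (simp add: mean_def)
qed

lemma MM_shift: "lc g \<Longrightarrow> a \<in> RR \<Longrightarrow> MM (\<lambda>x. g (x + a)) = MM g"
proof -
  assume g: "lc g" and a: "a \<in> RR"
  then obtain T where T: "per T g" by (auto simp: lc_def)
  have T': "per T (\<lambda>x. g (x + a))"
    unfolding per_def
  proof (intro ballI)
    fix x y assume "x \<in> RR" "y \<in> RR"
    then have "g ((x + a) + 2 ^ T * y) = g (x + a)" using T a unfolding per_def by blast
    then show "g (x + 2 ^ T * y + a) = g (x + a)" by (simp add: add_ac)
  qed
  show ?thesis unfolding MM_eq[OF T] MM_eq[OF T']
    by (rule mean_reindex[OF T]) (use a in auto)
qed

lemma MM_scale: "lc g \<Longrightarrow> v \<in> RR \<Longrightarrow> v \<notin> pp 1 \<Longrightarrow> MM (\<lambda>x. g (v * x)) = MM g"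
proof -
  assume g: "lc g" and v: "v \<in> RR" "v \<notin> pp 1"
  then obtain T where T: "per T g" by (auto simp: lc_def)
  have T': "per T (\<lambda>x. g (v * x))"
    unfolding per_def
  proof (intro ballI)
    fix x y assume "x \<in> RR" "y \<in> RR"
    then have "g (v * x + 2 ^ T * (v * y)) = g (v * x)" using T v unfolding per_def by blast
    then show "g (v * (x + 2 ^ T * y)) = g (v * x)" by (simp add: algebra_simps)
  qed
  have "v \<noteq> 0" using v by auto
  show ?thesis unfolding MM_eq[OF T] MM_eq[OF T']
  proof (rule mean_reindex[OF T])
    fix x x' assume "v * x - v * x' \<in> pp T"
    then have "inverse v * (v * x - v * x') \<in> pp T" using RR_unit[OF v] by blast
    then show "x - x' \<in> pp T" using \<open>v \<noteq> 0\<close> by (simp add: right_diff_distrib[symmetric] mult.assoc[symmetric])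
  qed (use v in blast)
qed

lemma MM_split: "lc g \<Longrightarrow> MM g = (\<Sum>s\<in>TT0. MM (\<lambda>y. g (s + 2 * y))) / of_nat q"
proof -
  assume "lc g"
  then obtain T where T: "per T g" by (auto simp: lc_def)
  have "MM g = mean (Suc T) g" by (rule MM_eq[OF per_Suc[OF T]])
  also have "\<dots> = (\<Sum>s\<in>TT0. mean T (\<lambda>y. g (s + 2 * y))) / of_nat q" by (rule mean_Suc)
  also have "\<dots> = (\<Sum>s\<in>TT0. MM (\<lambda>y. g (s + 2 * y))) / of_nat q"
    by (intro arg_cong2[where f = "(/)"] sum.cong refl MM_eq[symmetric] per_digit per_Suc T RR_UU0)
  finally show ?thesis .
qed

text \<open>By translation invariance the mean equals c times itself. Most of the vanishing results
  below exhibit such a translation.\<close>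

lemma MM_eq_0:
  assumes "lc g" "a \<in> RR" "\<And>x. x \<in> RR \<Longrightarrow> g (x + a) = c * g x" "c \<noteq> 1"
  shows "MM g = 0"
proof -
  have "MM g = MM (\<lambda>x. g (x + a))" using MM_shift assms by simp
  also have "\<dots> = MM (\<lambda>x. c * g x)" by (rule MM_cong) (rule assms)
  also have "\<dots> = c * MM g" by (rule MM_cmult)
  finally have "(1 - c) * MM g = 0" by (simp add: algebra_simps)
  then show ?thesis using assms(4) by simp
qed

lemma common_denom: "\<exists>T. 2 ^ T * a \<in> RR \<and> 2 ^ T * b \<in> RR"
proof -
  obtain k l where kl: "a * 2 ^ k \<in> RR" "b * 2 ^ l \<in> RR" using field_eq by metis
  have "2 ^ l * (a * 2 ^ k) \<in> RR" "2 ^ k * (b * 2 ^ l) \<in> RR" using kl by (auto intro: RR_closed)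
  then show ?thesis by (intro exI[of _ "k + l"]) (simp add: power_add mult_ac)
qed

lemma per_e_pi_quad:
  assumes a: "2 ^ T * a \<in> RR" and b: "2 ^ T * b \<in> RR"
  shows "per T (\<lambda>x. e_pi (a * x\<^sup>2 + b * x + c))"
  unfolding per_def
proof (intro ballI e_pi_cong)
  fix x y assume xy: "x \<in> RR" "y \<in> RR"
  have "2 * x * y + 2 ^ T * y\<^sup>2 \<in> RR" using xy by (intro RR_closed RR_power) simp_all
  then have "(2 ^ T * a) * (2 * x * y + 2 ^ T * y\<^sup>2) + (2 ^ T * b) * y \<in> RR"
    by (rule RR_closed(3)[OF RR_closed(5)[OF a] RR_closed(5)[OF b xy(2)]])
  then show "a * (x + 2 ^ T * y)\<^sup>2 + b * (x + 2 ^ T * y) + c - (a * x\<^sup>2 + b * x + c) \<in> RR"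
    by (simp add: power2_eq_square algebra_simps)
qed

lemma lc_e_pi_quad: "lc (\<lambda>x. e_pi (a * x\<^sup>2 + b * x + c))"
  using common_denom[of a b] per_e_pi_quad unfolding lc_def by blast

lemma lc_e_pi_sq: "lc (\<lambda>x. e_pi (a * x\<^sup>2))" and lc_e_pi_lin: "lc (\<lambda>x. e_pi (b * x))"
  and lc_e_pi_sq_lin: "lc (\<lambda>x. e_pi (a * x\<^sup>2 + b * x))"
  using lc_e_pi_quad[of a 0 0] lc_e_pi_quad[of 0 b 0] lc_e_pi_quad[of a b 0] by simp_all

lemma MM_char: "MM (\<lambda>x. e_pi (c * x)) = (if c \<in> RR then 1 else 0)"
proof (cases "c \<in> RR")
  case True
  then have "MM (\<lambda>x. e_pi (c * x)) = MM (\<lambda>x. 1)" by (intro MM_cong e_pi_RR) blast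
  then show ?thesis using True by simp
next
  case False
  then obtain y where y: "y \<in> RR" "e_pi (c * y) \<noteq> 1" using e_pi_nondeg by blast
  have "MM (\<lambda>x. e_pi (c * x)) = 0"
    by (rule MM_eq_0[OF lc_e_pi_lin y(1) _ y(2)]) (simp add: distrib_left e_pi_add mult.commute)
  then show ?thesis using False by simp
qed

lemma MM_char_half: "c \<in> RR \<Longrightarrow> MM (\<lambda>x. e_pi (c * x / 2)) = (if c \<in> pp 1 then 1 else 0)"
  using MM_char[of "c / 2"] unfolding pp_1_half by simp

lemma MM_indicator_pp: "MM (\<lambda>x. if x \<in> pp k then 1 else 0) = 1 / of_nat q ^ k"
proof -
  have "per k (\<lambda>x. if x \<in> pp k then 1 else 0)"
    unfolding per_def
  proof (intro ballI)
    fix x y assume "x \<in> RR" "y \<in> RR"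
    then have "2 ^ k * y \<in> pp k" by blast
    then have "x + 2 ^ k * y \<in> pp k \<longleftrightarrow> x \<in> pp k"
      using pp_closed(2)[of x k "2 ^ k * y"] pp_closed(3)[of "x + 2 ^ k * y" k "2 ^ k * y"] by auto
    then show "(if x + 2 ^ k * y \<in> pp k then 1 else 0) = (if x \<in> pp k then 1 else 0 :: complex)" by simp
  qed
  then have "MM (\<lambda>x. if x \<in> pp k then 1 else 0) = mean k (\<lambda>x. if x \<in> pp k then 1 else 0)"
    by (rule MM_eq)
  also have "(\<Sum>x\<in>reps k. if x \<in> pp k then 1 else 0 :: complex) = (\<Sum>x\<in>reps k. if x = 0 then 1 else 0)"
    by (intro sum.cong refl) (use reps_unique[OF _ zero_in_reps, of _ k] in auto)
  then have "mean k (\<lambda>x. if x \<in> pp k then 1 else 0) = 1 / of_nat q ^ k"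
    by (simp add: mean_def zero_in_reps)
  finally show ?thesis .
qed

lemma lc_MM:
  assumes "\<And>x. x \<in> RR \<Longrightarrow> per T (\<lambda>y. g x y)"
  shows "per T (\<lambda>y. MM (\<lambda>x. g x y))"
  unfolding per_def by (intro ballI MM_cong) (use assms in \<open>auto simp: per_def\<close>)

text \<open>The period in y has to be independent of x, so T clears the denominators of b, c and
  h.\<close>

lemma lc_MM_e_pi: "lc (\<lambda>y. MM (\<lambda>x. e_pi (a * x\<^sup>2 + b * x * y + c * y\<^sup>2 + d * x + h * y)))"
proof -
  obtain T1 where T1: "2 ^ T1 * b \<in> RR" "2 ^ T1 * h \<in> RR" using common_denom by blast
  obtain T2 where T2: "2 ^ T2 * c \<in> RR" using common_denom by blast
  define T where "T = T1 + T2"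
  have "2 ^ T2 * (2 ^ T1 * b) \<in> RR" "2 ^ T2 * (2 ^ T1 * h) \<in> RR" "2 ^ T1 * (2 ^ T2 * c) \<in> RR"
    using T1 T2 by (auto intro: RR_closed)
  then have T: "2 ^ T * b \<in> RR" "2 ^ T * h \<in> RR" "2 ^ T * c \<in> RR" by (simp_all add: T_def power_add mult_ac)
  have "per T (\<lambda>y. e_pi (c * y\<^sup>2 + (b * x + h) * y + (a * x\<^sup>2 + d * x)))" if "x \<in> RR" for x
  proof (rule per_e_pi_quad)
    have "(2 ^ T * b) * x + 2 ^ T * h \<in> RR" by (intro RR_closed(3) RR_closed(5)[OF T(1) that] T(2))
    then show "2 ^ T * (b * x + h) \<in> RR" by (simp add: algebra_simps)
  qed (rule T)
  then have "per T (\<lambda>y. MM (\<lambda>x. e_pi (c * y\<^sup>2 + (b * x + h) * y + (a * x\<^sup>2 + d * x))))"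
    by (rule lc_MM)
  moreover have "c * y\<^sup>2 + (b * x + h) * y + (a * x\<^sup>2 + d * x) =
      a * x\<^sup>2 + b * x * y + c * y\<^sup>2 + d * x + h * y" for x y
    by (simp add: algebra_simps)
  ultimately show ?thesis unfolding lc_def by (intro exI[of _ T]) simp
qed

end

section \<open>The sign of the quadratic Gauss sum\<close>

lemma sum_lessThan_add: "(\<Sum>i<m + (n :: nat). g i) = (\<Sum>i<m. g i) + (\<Sum>i<n. g (i + m) :: 'a :: comm_monoid_add)"
  by (induction n) (simp_all add: add_ac)

lemma q2_field_numeral_neq_0 [simp]: "(numeral n :: 'k :: q2_field) \<noteq> 0"
  using q2_field_of_nat_eq_0_iff[of "numeral n", where 'k = 'k] by simp

section \<open>Congruences between Gaussian integers\<close>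

definition gauss_int :: "complex set" where "gauss_int = {z. Re z \<in> \<int> \<and> Im z \<in> \<int>}"

lemma gauss_int_closed:
  "0 \<in> gauss_int" "1 \<in> gauss_int" "\<i> \<in> gauss_int"
  "x \<in> gauss_int \<Longrightarrow> y \<in> gauss_int \<Longrightarrow> x + y \<in> gauss_int"
  "x \<in> gauss_int \<Longrightarrow> y \<in> gauss_int \<Longrightarrow> x - y \<in> gauss_int"
  "x \<in> gauss_int \<Longrightarrow> y \<in> gauss_int \<Longrightarrow> x * y \<in> gauss_int"
  "x \<in> gauss_int \<Longrightarrow> - x \<in> gauss_int" "of_nat n \<in> gauss_int"
  by (auto simp: gauss_int_def)

lemma gauss_int_power: "x \<in> gauss_int \<Longrightarrow> x ^ n \<in> gauss_int"
  by (induction n) (auto intro: gauss_int_closed)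

lemma gauss_int_sum: "(\<And>i. i \<in> A \<Longrightarrow> g i \<in> gauss_int) \<Longrightarrow> sum g A \<in> gauss_int"
  by (induction A rule: infinite_finite_induct) (auto intro: gauss_int_closed)

text \<open>Congruence modulo p in the Gaussian integers. The Gauss sums below take their values
  there, being sums of fourth roots of unity.\<close>

definition gcong :: "nat \<Rightarrow> complex \<Rightarrow> complex \<Rightarrow> bool"
  where "gcong p x y \<longleftrightarrow> (\<exists>z\<in>gauss_int. x - y = of_nat p * z)"

lemma gcong_refl: "gcong p x x"
  unfolding gcong_def by (intro bexI[of _ 0]) (auto intro: gauss_int_closed)

lemma gcong_trans: "gcong p x y \<Longrightarrow> gcong p y z \<Longrightarrow> gcong p x z"
  unfolding gcong_def
proof clarify
  fix a b assume "a \<in> gauss_int" "b \<in> gauss_int" "x - y = of_nat p * a" "y - z = of_nat p * b"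
  then show "\<exists>c\<in>gauss_int. x - z = of_nat p * c"
    by (intro bexI[of _ "a + b"] gauss_int_closed) (simp_all add: algebra_simps)
qed

lemma gcong_add: "gcong p x y \<Longrightarrow> gcong p x' y' \<Longrightarrow> gcong p (x + x') (y + y')"
  unfolding gcong_def
proof clarify
  fix a b assume "a \<in> gauss_int" "b \<in> gauss_int" "x - y = of_nat p * a" "x' - y' = of_nat p * b"
  then show "\<exists>c\<in>gauss_int. x + x' - (y + y') = of_nat p * c"
    by (intro bexI[of _ "a + b"] gauss_int_closed) (simp_all add: algebra_simps)
qed

lemma gcong_sym: "gcong p x y \<Longrightarrow> gcong p y x"
  unfolding gcong_def
proof clarify
  fix a assume "a \<in> gauss_int" "x - y = of_nat p * a"
  then show "\<exists>c\<in>gauss_int. y - x = of_nat p * c"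
    by (intro bexI[of _ "- a"] gauss_int_closed) (simp_all add: algebra_simps)
qed

lemma gcong_binomial:
  assumes p: "prime p" and xy: "x \<in> gauss_int" "y \<in> gauss_int"
  shows "gcong p ((x + y) ^ p) (x ^ p + y ^ p)"
proof -
  have p1: "p \<ge> 1" using p prime_ge_1_nat by blast
  have "{..p} = insert 0 (insert p {1..<p})" using p1 by auto
  moreover have "0 \<notin> insert p {1..<p}" "p \<notin> {1..<p}" using p1 by auto
  ultimately have "(x + y) ^ p = y ^ p + (x ^ p + (\<Sum>k=1..<p. of_nat (p choose k) * x ^ k * y ^ (p - k)))"
    unfolding binomial_ring by simp
  moreover have "of_nat (p choose k) = (of_nat p * of_nat ((p choose k) div p) :: complex)" if "k \<in> {1..<p}" for k
  proof -
    have "p dvd (p choose k)" using that p by (intro dvd_choose_prime) auto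
    then show ?thesis by (metis dvd_mult_div_cancel of_nat_mult)
  qed
  ultimately have "(x + y) ^ p - (x ^ p + y ^ p) =
      of_nat p * (\<Sum>k=1..<p. of_nat ((p choose k) div p) * x ^ k * y ^ (p - k))"
    by (simp add: sum_distrib_left mult.assoc)
  then show ?thesis unfolding gcong_def
    using xy by (intro bexI[of _ "\<Sum>k=1..<p. of_nat ((p choose k) div p) * x ^ k * y ^ (p - k)"]
      gauss_int_sum gauss_int_closed gauss_int_power)
qed

lemma gcong_sum_power:
  assumes p: "prime p" and "finite A" "\<And>i. i \<in> A \<Longrightarrow> g i \<in> gauss_int"
  shows "gcong p ((\<Sum>i\<in>A. g i) ^ p) (\<Sum>i\<in>A. g i ^ p)"
  using assms(2,3)
proof (induction A rule: finite_induct)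
  case empty
  have "p > 0" using p prime_gt_0_nat by blast
  then show ?case by (simp add: power_0_left gcong_refl)
next
  case (insert a A)
  have "gcong p ((g a + (\<Sum>i\<in>A. g i)) ^ p) (g a ^ p + (\<Sum>i\<in>A. g i) ^ p)"
    using insert by (intro gcong_binomial p gauss_int_sum) auto
  moreover have "gcong p (g a ^ p + (\<Sum>i\<in>A. g i) ^ p) (g a ^ p + (\<Sum>i\<in>A. g i ^ p))"
    using insert by (intro gcong_add gcong_refl) auto
  ultimately show ?case using insert by (auto intro: gcong_trans)
qed

text \<open>Orbits of an action of a group of prime order contribute multiples of \<open>p\<close>.\<close>

lemma gcong_sum_fixed_points:
  assumes p: "prime p" and A: "finite A" and \<sigma>: "\<And>x. x \<in> A \<Longrightarrow> \<sigma> x \<in> A"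
    and ord: "\<And>x. x \<in> A \<Longrightarrow> (\<sigma> ^^ p) x = x" and g: "\<And>x. x \<in> A \<Longrightarrow> g (\<sigma> x) = g x"
    and gi: "\<And>x. x \<in> A \<Longrightarrow> g x \<in> gauss_int"
  shows "gcong p (\<Sum>x\<in>A. g x) (\<Sum>x | x \<in> A \<and> \<sigma> x = x. g x)"
proof -
  define N where "N = {x \<in> A. \<sigma> x \<noteq> x}"
  define orb where "orb x = (\<lambda>k. (\<sigma> ^^ k) x) ` {..<p}" for x
  have p0: "p > 0" using p prime_gt_0_nat by blast
  have powA: "(\<sigma> ^^ k) x \<in> A" if "x \<in> A" for k x using that by (induction k) (auto intro: \<sigma>)
  have gpow: "g ((\<sigma> ^^ k) x) = g x" if "x \<in> A" for k x
    using that by (induction k) (simp_all add: g powA)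
  have mult: "(\<sigma> ^^ (p * k)) x = x" if "x \<in> A" for k x
    using that by (induction k) (simp_all add: funpow_add ord)
  have pmod: "(\<sigma> ^^ k) x = (\<sigma> ^^ (k mod p)) x" if "x \<in> A" for k x
  proof -
    have "(\<sigma> ^^ k) x = (\<sigma> ^^ (k mod p + p * (k div p))) x" by simp
    also have "\<dots> = (\<sigma> ^^ (k mod p)) ((\<sigma> ^^ (p * (k div p))) x)" by (simp only: funpow_add comp_apply)
    finally show ?thesis using mult[OF that] by simp
  qed
  \<comment> \<open>An exponent k prime to p can be inverted modulo p, so a point fixed by the k-th
    iterate is fixed by \<sigma>; hence orbits have 1 or p elements.\<close>
  have fix1: "\<sigma> x = x" if x: "x \<in> A" and k: "0 < k" "k < p" "(\<sigma> ^^ k) x = x" for x k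
  proof -
    have "coprime k p" using p k by (metis coprime_commute nat_dvd_not_less prime_imp_coprime)
    then obtain a b where a: "k * a = p * b + 1"
      using bezout_nat[of k p] k(1) by (auto simp: coprime_iff_gcd_eq_1)
    have "(\<sigma> ^^ (k * a)) x = x" for a
      by (induction a) (simp_all add: funpow_add k)
    then have "x = (\<sigma> ^^ ((k * a) mod p)) x" using pmod[OF x, of "k * a"] by simp
    also have "(k * a) mod p = 1" using prime_gt_1_nat[OF p] mod_mult_self4[of p b 1] by (simp only: a mod_less)
    finally show ?thesis by simp
  qed
  have inj: "inj_on (\<lambda>k. (\<sigma> ^^ k) x) {..<p}" if "x \<in> N" for x
  proof (rule linorder_inj_onI')
    fix i j assume ij: "i \<in> {..<p}" "j \<in> {..<p}" "i < j"
    have x: "x \<in> A" "\<sigma> x \<noteq> x" using that by (auto simp: N_def)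
    show "(\<sigma> ^^ i) x \<noteq> (\<sigma> ^^ j) x"
    proof
      assume eq: "(\<sigma> ^^ i) x = (\<sigma> ^^ j) x"
      have "(\<sigma> ^^ (p - i)) ((\<sigma> ^^ i) x) = x" 
        using ij funpow_add[of "p - i" i \<sigma>] ord[OF x(1)] by (simp add: fun_eq_iff)
      moreover have "(\<sigma> ^^ (p - i)) ((\<sigma> ^^ j) x) = (\<sigma> ^^ (j - i)) x"
      proof -
        have "(\<sigma> ^^ (p - i)) ((\<sigma> ^^ j) x) = (\<sigma> ^^ ((p - i) + j)) x" by (simp only: funpow_add comp_apply)
        also have "(p - i) + j = (j - i) + p" using ij by auto
        also have "(\<sigma> ^^ ((j - i) + p)) x = (\<sigma> ^^ (j - i)) x" by (simp only: funpow_add comp_apply ord[OF x(1)])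
        finally show ?thesis .
      qed
      ultimately have "(\<sigma> ^^ (j - i)) x = x" using eq by simp
      then have "\<sigma> x = x" using ij by (intro fix1[OF x(1), of "j - i"]) auto
      then show False using x by simp
    qed
  qed
  have orbN: "orb x \<subseteq> N" if "x \<in> N" for x
  proof
    fix y assume "y \<in> orb x"
    then obtain k where k: "k < p" "y = (\<sigma> ^^ k) x" by (auto simp: orb_def)
    have x: "x \<in> A" "\<sigma> x \<noteq> x" using that by (auto simp: N_def)
    have "\<sigma> y \<noteq> y"
    proof
      assume "\<sigma> y = y"
      have "(\<sigma> ^^ (p - k)) y = x" 
        unfolding k(2) using k(1) funpow_add[of "p - k" k \<sigma>] ord[OF x(1)] by (simp add: fun_eq_iff)
      moreover have "(\<sigma> ^^ j) y = y" for j using \<open>\<sigma> y = y\<close> by (induction j) simp_all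
      ultimately have "y = x" by simp
      then show False using \<open>\<sigma> y = y\<close> x by simp
    qed
    then show "y \<in> N" using powA[OF x(1)] k by (simp add: N_def)
  qed
  have orb_self: "x \<in> orb x" for x unfolding orb_def using p0 by (auto intro!: image_eqI[of _ _ 0])
  have orb_eq: "orb y = orb x" if x: "x \<in> N" and y: "y \<in> orb x" for x y
  proof -
    have xA: "x \<in> A" using x by (simp add: N_def)
    have "orb y \<subseteq> orb x"
    proof
      fix z assume "z \<in> orb y"
      then obtain j k where "z = (\<sigma> ^^ j) ((\<sigma> ^^ k) x)" using y by (auto simp: orb_def)
      then have "z = (\<sigma> ^^ ((j + k) mod p)) x" using pmod[OF xA, of "j + k"] by (simp add: funpow_add)
      then show "z \<in> orb x" using p0 by (auto simp: orb_def)
    qed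
    moreover have "card (orb y) = p" "card (orb x) = p"
      using card_image[OF inj] x orbN[OF x] y by (auto simp: orb_def)
    moreover have "finite (orb x)" by (simp add: orb_def)
    ultimately show ?thesis by (intro card_subset_eq) auto
  qed
  have finN: "finite N" using A by (simp add: N_def)
  have UN: "\<Union> (orb ` N) = N" using orbN orb_self by auto
  have "(\<Sum>x\<in>N. g x) = (\<Sum>C\<in>orb ` N. \<Sum>x\<in>C. g x)"
  proof (subst UN[symmetric], rule sum.Union_disjoint[unfolded comp_def])
    show "\<forall>C\<in>orb ` N. finite C" by (simp add: orb_def)
    show "\<forall>C\<in>orb ` N. \<forall>D\<in>orb ` N. C \<noteq> D \<longrightarrow> C \<inter> D = {}"
    proof (intro ballI impI)
      fix C D assume "C \<in> orb ` N" "D \<in> orb ` N" and neq: "C \<noteq> D"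
      then obtain x y where xy: "x \<in> N" "y \<in> N" "C = orb x" "D = orb y" by blast
      show "C \<inter> D = {}"
      proof (rule ccontr)
        assume "C \<inter> D \<noteq> {}"
        then obtain z where "z \<in> orb x" "z \<in> orb y" using xy by auto
        then show False using orb_eq[OF xy(1)] orb_eq[OF xy(2)] neq xy by metis
      qed
    qed
  qed
  also have "\<dots> = (\<Sum>C\<in>orb ` N. of_nat p * g (SOME x. x \<in> N \<and> C = orb x))"
  proof (intro sum.cong refl)
    fix C assume "C \<in> orb ` N"
    define x where "x = (SOME x. x \<in> N \<and> C = orb x)"
    have x: "x \<in> N" "C = orb x"
      using someI_ex[of "\<lambda>x. x \<in> N \<and> C = orb x"] \<open>C \<in> orb ` N\<close> by (auto simp: x_def)
    have "(\<Sum>y\<in>C. g y) = (\<Sum>k<p. g ((\<sigma> ^^ k) x))"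
      unfolding x(2) orb_def by (simp add: sum.reindex[OF inj[OF x(1)]])
    also have "\<dots> = (\<Sum>k<p. g x)" using x by (simp add: gpow N_def)
    finally show "(\<Sum>y\<in>C. g y) = of_nat p * g (SOME x. x \<in> N \<and> C = orb x)" by (simp add: x_def)
  qed
  also have "\<dots> = of_nat p * (\<Sum>C\<in>orb ` N. g (SOME x. x \<in> N \<and> C = orb x))"
    by (simp add: sum_distrib_left)
  finally have N: "(\<Sum>x\<in>N. g x) = of_nat p * (\<Sum>C\<in>orb ` N. g (SOME x. x \<in> N \<and> C = orb x))" .
  have "(\<Sum>C\<in>orb ` N. g (SOME x. x \<in> N \<and> C = orb x)) \<in> gauss_int"
  proof (intro gauss_int_sum gi)
    fix C assume "C \<in> orb ` N"
    then show "(SOME x. x \<in> N \<and> C = orb x) \<in> A"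
      using someI_ex[of "\<lambda>x. x \<in> N \<and> C = orb x"] by (auto simp: N_def)
  qed
  moreover have "(\<Sum>x\<in>A. g x) = (\<Sum>x | x \<in> A \<and> \<sigma> x = x. g x) + (\<Sum>x\<in>N. g x)"
  proof -
    have "A = {x \<in> A. \<sigma> x = x} \<union> N" by (auto simp: N_def)
    then show ?thesis using A sum.union_disjoint[of "{x \<in> A. \<sigma> x = x}" N g] by (auto simp: N_def)
  qed
  ultimately show ?thesis unfolding gcong_def using N by auto
qed

text \<open>If x = -y, then p divides 2y, so p^2 divides 4 times 2^d, which is impossible for odd
  p.\<close>

lemma gcong_sign:
  assumes p: "prime p" "odd p" and x: "x\<^sup>2 = y\<^sup>2" "gcong p x y" and y: "(norm y)\<^sup>2 = 2 ^ d"
  shows "x = y"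
proof (rule ccontr)
  assume "x \<noteq> y"
  then have "x = - y" using x(1) by (metis power2_eq_iff)
  then obtain z where z: "z \<in> gauss_int" "- 2 * y = of_nat p * z"
    using x(2) by (auto simp: gcong_def)
  obtain a b where ab: "Re z = of_int a" "Im z = of_int b"
    using z(1) by (auto simp: gauss_int_def elim!: Ints_cases)
  have "(norm (- 2 * y))\<^sup>2 = (norm (of_nat p * z))\<^sup>2" using z(2) by simp
  then have "4 * 2 ^ d = real (p ^ 2) * (of_int a ^ 2 + of_int b ^ 2)"
    using y cmod_power2[of z] by (simp add: norm_mult power_mult_distrib ab)
  then have "real_of_int (4 * 2 ^ d) = real_of_int (int (p ^ 2) * (a ^ 2 + b ^ 2))" by simp
  then have "4 * 2 ^ d = int (p ^ 2) * (a ^ 2 + b ^ 2)" by (simp only: of_int_eq_iff)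
  then have "int p dvd 4 * 2 ^ d" by (simp add: power2_eq_square mult.assoc)
  then have "int p dvd 2 ^ (d + 2)" by (simp add: power_add mult.commute)
  then have "p dvd 2 ^ (d + 2)" by (metis of_nat_dvd_iff of_nat_numeral of_nat_power)
  then have "p dvd 2" using p(1) prime_dvd_power by blast
  then have "p = 2" using p(1) by (metis primes_dvd_imp_eq two_is_prime_nat)
  then show False using p(2) by simp
qed

lemma fourth_root_gauss_int:
  assumes "z ^ 4 = 1"
  shows "z \<in> gauss_int"
proof -
  have "(z\<^sup>2 - 1) * (z\<^sup>2 + 1) = 0" using assms by (simp add: power2_eq_square power4_eq_xxxx algebra_simps)
  then have "z\<^sup>2 = 1 \<or> z\<^sup>2 = \<i>\<^sup>2" by (auto simp: eq_neg_iff_add_eq_0)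
  then have "z = 1 \<or> z = - 1 \<or> z = \<i> \<or> z = - \<i>" by (metis power2_eq_iff power_one)
  then show ?thesis by (auto intro: gauss_int_closed)
qed

context unram
begin

section \<open>Subextensions fixed by powers of the Frobenius\<close>

definition Kd :: "nat \<Rightarrow> 'k set" where "Kd d = {x. (frob ^^ d) x = x}"

text \<open>For d dividing f this is the trace from the fixed field \<open>Kd d\<close> of the d-th
  Frobenius power down to the 2-adic numbers; \<open>ed d\<close> is the corresponding additive
  character.\<close>

definition td :: "nat \<Rightarrow> 'k \<Rightarrow> q2" where "td d x = (SOME r. of_q2 r = (\<Sum>i<d. (frob ^^ i) x))"

definition ed :: "nat \<Rightarrow> 'k \<Rightarrow> complex" where "ed d x = e2 (td d x)"

text \<open>For d dividing f, the Teichmueller representatives of the residue field with 2^d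
  elements.\<close>

definition Fd :: "nat \<Rightarrow> 'k set" where "Fd d = TT0 \<inter> Kd d"

lemma frob_pow_minus: "(frob ^^ n) (- x) = - (frob ^^ n) x"
  by (induction n) (simp_all add: frob_minus)

lemma Kd_closed:
  "x \<in> Kd d \<Longrightarrow> y \<in> Kd d \<Longrightarrow> x + y \<in> Kd d" "x \<in> Kd d \<Longrightarrow> y \<in> Kd d \<Longrightarrow> x - y \<in> Kd d"
  "x \<in> Kd d \<Longrightarrow> y \<in> Kd d \<Longrightarrow> x * y \<in> Kd d" "of_q2 r \<in> Kd d" "x \<in> Kd d \<Longrightarrow> - x \<in> Kd d"
  using frob_pow_add[of d x "- y"]
  by (simp_all add: Kd_def frob_pow_add frob_pow_mult frob_pow_of_q2 frob_pow_minus)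

lemma Kd_numeral: "numeral n \<in> Kd d" "1 \<in> Kd d" "0 \<in> Kd d"
  using Kd_closed(4)[of "numeral n" d] Kd_closed(4)[of 1 d] Kd_closed(4)[of 0 d] by simp_all

lemma Kd_div: "x \<in> Kd d \<Longrightarrow> x / 2 ^ n \<in> Kd d"
  using Kd_closed(3)[OF _ Kd_closed(4)[of "1 / 2 ^ n" d], of x] by (simp add: of_q2_divide of_q2_power)

lemma Kd_power: "x \<in> Kd d \<Longrightarrow> x ^ n \<in> Kd d"
  by (induction n) (auto intro: Kd_closed Kd_numeral)

lemma Kd_half: "x \<in> Kd d \<Longrightarrow> x / 2 \<in> Kd d" and Kd_quarter: "x \<in> Kd d \<Longrightarrow> x / 4 \<in> Kd d"
  using Kd_div[of x d 1] Kd_div[of x d 2] by simp_all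

lemma sum_frob_shift:
  assumes "x \<in> Kd d"
  shows "(\<Sum>i<d. (frob ^^ Suc i) x) = (\<Sum>i<d. (frob ^^ i) x)"
proof -
  have "(\<Sum>i<d. (frob ^^ Suc i) x) + (frob ^^ 0) x = (\<Sum>i<d. (frob ^^ i) x) + (frob ^^ d) x"
    using sum.lessThan_Suc_shift[of "\<lambda>i. (frob ^^ i) x" d] sum.lessThan_Suc[of "\<lambda>i. (frob ^^ i) x" d]
    by (simp only: add.commute)
  then show ?thesis using assms by (simp add: Kd_def)
qed

lemma td_eq:
  assumes "x \<in> Kd d"
  shows "of_q2 (td d x) = (\<Sum>i<d. (frob ^^ i) x)"
proof -
  have "frob (\<Sum>i<d. (frob ^^ i) x) = (\<Sum>i<d. (frob ^^ i) x)"
    unfolding frob_sum using sum_frob_shift[OF assms] by simp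
  then obtain r where "of_q2 r = (\<Sum>i<d. (frob ^^ i) x)" using frob_fixed by metis
  then show ?thesis unfolding td_def by (rule someI)
qed

lemma td_eqI: "x \<in> Kd d \<Longrightarrow> of_q2 r = (\<Sum>i<d. (frob ^^ i) x) \<Longrightarrow> td d x = r"
  using td_eq[of x d] of_q2_inject[where 'k = 'k] by metis

lemma td_add: "x \<in> Kd d \<Longrightarrow> y \<in> Kd d \<Longrightarrow> td d (x + y) = td d x + td d y"
  by (rule td_eqI) (simp_all add: Kd_closed of_q2_add td_eq frob_pow_add sum.distrib)

lemma td_scale: "x \<in> Kd d \<Longrightarrow> td d (of_q2 r * x) = r * td d x"
  by (rule td_eqI) (simp_all add: Kd_closed of_q2_mult td_eq frob_pow_mult frob_pow_of_q2 sum_distrib_left)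

lemma td_frob: "x \<in> Kd d \<Longrightarrow> td d (frob x) = td d x"
proof (rule td_eqI)
  assume x: "x \<in> Kd d"
  then show "frob x \<in> Kd d" by (simp add: Kd_def funpow_swap1[symmetric])
  show "of_q2 (td d x) = (\<Sum>i<d. (frob ^^ i) (frob x))"
    using sum_frob_shift[OF x] td_eq[OF x] by (simp add: funpow_swap1)
qed

lemma td_RR: "x \<in> Kd d \<Longrightarrow> x \<in> RR \<Longrightarrow> td d x \<in> q2_ints"
  using td_eq[of x d] of_q2_in_RR_iff[of "td d x"] by (auto intro: frob_pow_RR)

lemma td_1: "td d 1 = of_nat d"
  by (rule td_eqI) (use frob_pow_of_q2[of _ 1] in \<open>simp_all add: Kd_numeral of_q2_of_nat\<close>)

lemma ed_add: "x \<in> Kd d \<Longrightarrow> y \<in> Kd d \<Longrightarrow> ed d (x + y) = ed d x * ed d y"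
  by (simp add: ed_def td_add e2_add)

lemma ed_RR: "x \<in> Kd d \<Longrightarrow> x \<in> RR \<Longrightarrow> ed d x = 1"
  by (simp add: ed_def e2_eq_1_iff td_RR)

lemma ed_cong: "x \<in> Kd d \<Longrightarrow> y \<in> Kd d \<Longrightarrow> x - y \<in> RR \<Longrightarrow> ed d x = ed d y"
  using ed_add[of "x - y" d y] ed_RR[of "x - y" d] by (simp add: Kd_closed)

lemma ed_neq_0 [simp]: "ed d x \<noteq> 0"
  unfolding ed_def by (metis norm_e2 norm_zero zero_neq_one)

lemma ed_f: "ed f x = e_pi x"
  using td_eqI[of x f "q2_trace x"] trace_eq[of x] by (simp add: ed_def e_pi_def Kd_def frob_pow_f)

lemma td_half: "x \<in> Kd d \<Longrightarrow> td d (x / 2) = td d x / 2"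
  using td_scale[of x d "1 / 2"] by (simp only: of_q2_divide of_q2_1 of_q2_numeral times_divide_eq_left mult_1_left)

lemma ed_half_iff: "x \<in> Kd d \<Longrightarrow> ed d (x / 2) = 1 \<longleftrightarrow> td d x / 2 \<in> q2_ints"
  by (simp add: ed_def e2_eq_1_iff td_half)

lemma ed_half_inv: "x \<in> Kd d \<Longrightarrow> x \<in> RR \<Longrightarrow> ed d (x / 2) * ed d (x / 2) = 1"
  using ed_add[of "x / 2" d "x / 2"] by (simp add: Kd_half ed_RR)

lemma Fd_iff: "s \<in> Fd d \<longleftrightarrow> s \<in> TT0 \<and> s ^ (2 ^ d) = s"
  by (auto simp: Fd_def Kd_def frob_pow_UU0)

lemma finite_Fd [simp]: "finite (Fd d)"
  by (simp add: Fd_def)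

lemma Fd_mem: "s \<in> Fd d \<Longrightarrow> s \<in> RR" "s \<in> Fd d \<Longrightarrow> s \<in> Kd d" "s \<in> Fd d \<Longrightarrow> s \<in> TT0"
  by (auto simp: Fd_def RR_UU0)

lemma frob_pow_pp: "x \<in> pp n \<Longrightarrow> (frob ^^ d) x \<in> pp n"
  by (induction d) (simp_all add: frob_pp)

lemma Fd_teich:
  assumes "x \<in> RR" "x \<in> Kd d"
  obtains s where "s \<in> Fd d" "x - s \<in> pp 1"
proof -
  obtain s where s: "s \<in> TT0" "x - s \<in> pp 1" using teichmueller_ex[OF assms(1)] .
  have "(frob ^^ d) (x + - s) \<in> pp 1" using frob_pow_pp[OF s(2)] by simp
  then have "x - s ^ (2 ^ d) \<in> pp 1"
    using assms(2) s unfolding frob_pow_add frob_pow_minus by (simp add: Kd_def frob_pow_UU0)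
  then have "s - s ^ (2 ^ d) \<in> pp 1" using pp_cong_trans[OF pp_cong_sym[OF s(2)]] by blast
  then have "s = s ^ (2 ^ d)" using s by (intro teichmueller_unique UU0_power) auto
  then have "s \<in> Fd d" using s by (simp add: Fd_iff)
  then show ?thesis using s that by blast
qed

lemma ed_half_square:
  assumes "x \<in> RR" "x \<in> Kd d"
  shows "ed d (x\<^sup>2 / 2) = ed d (x / 2)"
proof -
  obtain s where s: "s \<in> Fd d" "x - s \<in> pp 1" using Fd_teich[OF assms] .
  have h: "(x - s) / 2 \<in> RR" using s(2) unfolding pp_1_half .
  have K: "x\<^sup>2 / 2 \<in> Kd d" "s\<^sup>2 / 2 \<in> Kd d" "s / 2 \<in> Kd d" "x / 2 \<in> Kd d"
    using assms(2) Fd_mem(2)[OF s(1)] by (auto intro: Kd_half Kd_power)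
  have "x\<^sup>2 / 2 - s\<^sup>2 / 2 = (x - s) / 2 * (x + s)" by (simp add: power2_eq_square field_simps)
  also have "\<dots> \<in> RR" using h assms(1) Fd_mem(1)[OF s(1)] by (intro RR_closed)
  finally have "ed d (x\<^sup>2 / 2) = ed d (s\<^sup>2 / 2)" using K by (intro ed_cong)
  also have "s\<^sup>2 / 2 = frob (s / 2)"
    using frob_div_pow2[of s 1] Fd_mem(3)[OF s(1)] by (simp add: frob_UU0)
  also have "ed d \<dots> = ed d (s / 2)" using K by (simp add: ed_def td_frob)
  also have "\<dots> = ed d (x / 2)"
    by (rule ed_cong[symmetric]) (use h K in \<open>simp_all add: diff_divide_distrib\<close>)
  finally show ?thesis .
qed

text \<open>\<open>Fd d\<close> is not closed under addition, so translation is carried out modulo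
  2, on functions that depend only on the class modulo 2.\<close>

lemma sum_Fd_shift:
  assumes a: "a \<in> RR" "a \<in> Kd d"
    and g: "\<And>x y. x \<in> RR \<Longrightarrow> x \<in> Kd d \<Longrightarrow> y \<in> RR \<Longrightarrow> y \<in> Kd d \<Longrightarrow> x - y \<in> pp 1 \<Longrightarrow> g x = g y"
  shows "(\<Sum>s\<in>Fd d. g (s + a)) = (\<Sum>s\<in>Fd d. g s)"
proof -
  have "\<forall>s\<in>Fd d. \<exists>t. t \<in> Fd d \<and> (s + a) - t \<in> pp 1"
    using Fd_teich a Fd_mem Kd_closed(1) RR_closed(3) by metis
  then obtain k where k: "\<And>s. s \<in> Fd d \<Longrightarrow> k s \<in> Fd d" "\<And>s. s \<in> Fd d \<Longrightarrow> (s + a) - k s \<in> pp 1" by metis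
  have "inj_on k (Fd d)"
  proof (rule inj_onI)
    fix s t assume st: "s \<in> Fd d" "t \<in> Fd d" "k s = k t"
    have "(s + a) - (t + a) \<in> pp 1"
      by (rule pp_cong_trans[OF k(2)[OF st(1)]]) (unfold st(3), rule pp_cong_sym[OF k(2)[OF st(2)]])
    then have "s - t \<in> pp 1" by simp
    then show "s = t" using st by (intro teichmueller_unique) (auto dest: Fd_mem)
  qed
  then have "bij_betw k (Fd d) (Fd d)" using k(1) by (intro bij_betw_imageI endo_inj_surj) auto
  then have "(\<Sum>s\<in>Fd d. g s) = (\<Sum>s\<in>Fd d. g (k s))" by (rule sum.reindex_bij_betw[symmetric])
  also have "\<dots> = (\<Sum>s\<in>Fd d. g (s + a))"
  proof (intro sum.cong refl g[symmetric] k)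
    fix s assume "s \<in> Fd d"
    then show "s + a \<in> RR" "s + a \<in> Kd d" "k s \<in> RR" "k s \<in> Kd d"
      using a Fd_mem Fd_mem[OF k(1)] by (auto intro: RR_closed Kd_closed)
  qed
  finally show ?thesis ..
qed

section \<open>Character sums over the residue field of a subextension\<close>

context
  fixes d :: nat
  assumes d: "d > 0" "d dvd f"
begin

text \<open>2^d - 1 divides 2^f - 1, so a power of \<zeta> has the required order.\<close>

lemma Fd_prim:
  obtains \<xi> :: 'k where "primitive_root_of_unity (2 ^ d - 1) \<xi>"
    "Fd d - {0} = {u. u ^ (2 ^ d - 1) = 1}"
proof -
  have "(2 :: int) ^ d - 1 dvd 2 ^ f - 1"
  proof -
    obtain m where "f = d * m" using d by (elim dvdE)
    then have "(2 :: int) ^ f - 1 = (2 ^ d) ^ m - 1" by (simp add: power_mult)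
    also have "\<dots> = (2 ^ d - 1) * (\<Sum>i<m. (2 ^ d) ^ i)" by (rule power_diff_1_eq)
    finally show ?thesis by simp
  qed
  then have "int (2 ^ d - 1) dvd int (2 ^ f - 1)" by (simp add: of_nat_diff)
  then have "(2 :: nat) ^ d - 1 dvd q - 1" by (simp only: of_nat_dvd_iff)
  then obtain c where c: "q - 1 = (2 ^ d - 1) * c" by (elim dvdE)
  define D where "D = (2 :: nat) ^ d - 1"
  have "(2 :: nat) ^ 1 \<le> 2 ^ d" using d by (intro power_increasing) auto
  then have D0: "D > 0" by (simp add: D_def)
  have c0: "c > 0" using c q_ge_2 by (intro gr0I) auto
  have cD: "q - 1 = D * c" using c by (simp add: D_def)
  define \<xi> where "\<xi> = \<zeta> ^ c"
  have prim: "primitive_root_of_unity D \<xi>"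
    unfolding primitive_root_of_unity_def
  proof (intro conjI allI impI)
    show "\<xi> ^ D = 1" unfolding \<xi>_def power_mult[symmetric] using zeta_power cD by (simp add: mult.commute)
    fix k assume k: "0 < k \<and> k < D"
    then have "0 < c * k" "c * k < q - 1" using c0 cD by (auto simp: mult.commute)
    then show "\<xi> ^ k \<noteq> 1" unfolding \<xi>_def power_mult[symmetric] by (rule zeta_power_neq)
  qed (rule D0)
  have DS: "2 ^ d = Suc D" using D0 by (simp add: D_def)
  have "Fd d - {0} = {u. u ^ D = 1}"
  proof (intro equalityI subsetI)
    fix u assume u: "u \<in> Fd d - {0}"
    then have "u \<in> Fd d" "u \<noteq> 0" by simp_all
    then have "u ^ Suc D = u" "u \<noteq> 0" by (simp_all only: DS[symmetric] Fd_iff simp_thms)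
    then show "u \<in> {u. u ^ D = 1}" by simp
  next
    fix u :: 'k assume u: "u \<in> {u. u ^ D = 1}"
    then have "u ^ (q - 1) = 1" unfolding cD power_mult by simp
    then have "u \<in> TT" by (simp add: UU_eq_roots)
    then show "u \<in> Fd d - {0}" using u by (auto simp: Fd_iff DS UU_sub_UU0)
  qed
  then show ?thesis using prim that unfolding D_def by blast
qed

lemma card_Fd: "card (Fd d) = 2 ^ d"
proof -
  obtain \<xi> :: 'k where \<xi>: "primitive_root_of_unity (2 ^ d - 1) \<xi>" "Fd d - {0} = {u. u ^ (2 ^ d - 1) = 1}"
    using Fd_prim .
  have "Fd d - {0} = (\<lambda>i. \<xi> ^ i) ` {..<2 ^ d - 1}"
    using \<xi>(2) primitive_root_roots(1)[OF \<xi>(1)] by (rule trans)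
  then have "card (Fd d - {0}) = 2 ^ d - 1"
    using card_image[OF primitive_root_roots(2)[OF \<xi>(1)]] by simp
  moreover have "0 \<in> Fd d" by (simp add: Fd_iff)
  ultimately have "card (Fd d) = Suc (2 ^ d - 1)" using card_Suc_Diff1[OF finite_Fd] by metis
  also have "Suc (2 ^ d - 1) = 2 ^ d" by simp
  finally show ?thesis .
qed

text \<open>The power-sum argument of \<open>ex_odd_trace\<close>, carried out in the
  subextension.\<close>

lemma ex_odd_td: "\<exists>u\<in>Fd d. ed d (u / 2) \<noteq> 1"
proof (rule ccontr)
  assume "\<not> ?thesis"
  then have even: "of_q2 (td d u) \<in> pp 1" if "u \<in> Fd d" for u
    using that of_q2_in_RR_iff[of "td d u / 2"] ed_half_iff[of u d] Fd_mem
    by (simp add: pp_def of_q2_divide)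
  obtain \<xi> :: 'k where \<xi>: "primitive_root_of_unity (2 ^ d - 1) \<xi>" "Fd d - {0} = {u. u ^ (2 ^ d - 1) = 1}"
    using Fd_prim .
  define U where "U = Fd d - {0}"
  have UUU: "u \<in> TT" if "u \<in> U" for u using that by (auto simp: U_def Fd_iff UU_iff_UU0)
  have "(\<Sum>u\<in>U. inverse u * of_q2 (td d u)) \<in> pp 1"
    by (intro pp_sum pp_mult_left RR_UU UU_inverse UUU even) (auto simp: U_def)
  also have "(\<Sum>u\<in>U. inverse u * of_q2 (td d u)) = (\<Sum>u\<in>U. \<Sum>i<d. u ^ (2 ^ i - 1))"
  proof (intro sum.cong refl)
    fix u assume u: "u \<in> U"
    have "inverse u * u ^ 2 ^ i = u ^ (2 ^ i - 1)" for i :: nat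
      using UU_neq_0[OF UUU[OF u]] power_minus_mult[of "2 ^ i" u] by (simp add: field_simps)
    moreover have "u \<in> Kd d" "u \<in> TT0" using u Fd_mem by (auto simp: U_def)
    ultimately show "inverse u * of_q2 (td d u) = (\<Sum>i<d. u ^ (2 ^ i - 1))"
      by (simp add: td_eq frob_pow_UU0 sum_distrib_left)
  qed
  also have "\<dots> = (\<Sum>i<d. \<Sum>u\<in>U. u ^ (2 ^ i - 1))" by (rule sum.swap)
  also have "\<dots> = (\<Sum>i<d. if i = 0 then of_nat (2 ^ d - 1) else 0)"
  proof (intro sum.cong refl)
    fix i assume i: "i \<in> {..<d}"
    show "(\<Sum>u\<in>U. u ^ (2 ^ i - 1)) = (if i = 0 then of_nat (2 ^ d - 1) else 0)"
    proof (cases "i = 0")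
      case True
      have "card U = 2 ^ d - 1" unfolding U_def by (subst card_Diff_singleton) (simp_all add: card_Fd Fd_iff)
      then show ?thesis using True by simp
    next
      case False
      then have "(2 :: nat) ^ 0 < 2 ^ i" "(2 :: nat) ^ i < 2 ^ d"
        using i by (intro power_strict_increasing; simp)+
      then have i1: "1 < (2 :: nat) ^ i" and i2: "(2 :: nat) ^ i < 2 ^ d" by simp_all
      have "0 < 2 ^ i - (1 :: nat)" using i1 by (simp only: zero_less_diff)
      moreover have "2 ^ i - 1 < 2 ^ d - (1 :: nat)" using i1 i2 by (intro diff_less_mono less_imp_le)
      ultimately have "(\<Sum>u\<in>U. u ^ (2 ^ i - 1)) = 0"
        unfolding U_def \<xi>(2) by (rule primitive_root_power_sum[OF \<xi>(1)])
      then show ?thesis using False by simp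
    qed
  qed
  also have "\<dots> = of_nat (2 ^ d - 1)" using d by simp
  finally have *: "of_nat (2 ^ d - 1) \<in> pp 1" .
  have "2 * 2 ^ (d - 1) \<in> pp 1" by (intro pp_two) simp
  moreover have "2 * 2 ^ (d - 1) = (of_nat (2 ^ d - 1) + 1 :: 'k)"
  proof -
    have "2 * 2 ^ (d - 1) = (2 ^ d :: 'k)" using d by (metis power_Suc Suc_diff_1)
    also have "\<dots> = of_nat (Suc (2 ^ d - 1))" by simp
    finally show ?thesis by (simp only: of_nat_Suc add.commute)
  qed
  ultimately have "of_nat (2 ^ d - 1) + 1 - of_nat (2 ^ d - 1) \<in> pp 1"
    using * by (intro pp_closed(3)) simp_all
  then show False using one_notin_pp by simp
qed

text \<open>For odd c, translation by u / c, where u has odd trace, multiplies the sum by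
  \<open>ed d (u / 2)\<close>, which is not 1.\<close>

lemma sum_Fd_char:
  assumes c: "c \<in> RR" "c \<in> Kd d"
  shows "(\<Sum>s\<in>Fd d. ed d (c * s / 2)) = (if c \<in> pp 1 then 2 ^ d else 0)"
proof -
  have KK: "c * x / 2 \<in> Kd d" if "x \<in> Kd d" for x using c that by (intro Kd_half Kd_closed)
  show ?thesis
  proof (cases "c \<in> pp 1")
    case True
    then have "c / 2 \<in> RR" unfolding pp_1_half .
    then have "ed d (c * s / 2) = 1" if "s \<in> Fd d" for s
      using RR_closed(5)[of "c / 2" s] Fd_mem[OF that] by (intro ed_RR KK) simp_all
    then show ?thesis using True by (simp add: card_Fd)
  next
    case False
    obtain u where u: "u \<in> Fd d" "ed d (u / 2) \<noteq> 1" using ex_odd_td by blast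
    have c0: "c \<noteq> 0" using False by auto
    define a where "a = u * inverse c"
    have "(frob ^^ d) (inverse c) * c = 1"
      using frob_pow_mult[of d "inverse c" c] c c0 frob_pow_of_q2[of d 1] by (simp add: Kd_def)
    then have "inverse c \<in> Kd d" using c0 by (simp add: Kd_def field_simps)
    then have a: "a \<in> RR" "a \<in> Kd d"
      using Fd_mem[OF u(1)] RR_unit[OF c(1) False] by (auto simp: a_def intro: Kd_closed RR_closed)
    have ca: "c * a = u" using c0 by (simp add: a_def)
    have "(\<Sum>s\<in>Fd d. ed d (c * s / 2)) = (\<Sum>s\<in>Fd d. ed d (c * (s + a) / 2))"
    proof (rule sum_Fd_shift[OF a, symmetric])
      fix x y assume xy: "x \<in> RR" "x \<in> Kd d" "y \<in> RR" "y \<in> Kd d" "x - y \<in> pp 1"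
      have "(x - y) / 2 \<in> RR" using xy(5) unfolding pp_1_half .
      then have "c * ((x - y) / 2) \<in> RR" using c by blast
      then show "ed d (c * x / 2) = ed d (c * y / 2)"
        using xy by (intro ed_cong KK) (simp_all add: field_simps)
    qed
    also have "\<dots> = (\<Sum>s\<in>Fd d. ed d (u / 2) * ed d (c * s / 2))"
    proof (intro sum.cong refl)
      fix s assume s: "s \<in> Fd d"
      have "c * (s + a) / 2 = u / 2 + c * s / 2" by (simp add: distrib_left ca add_divide_distrib)
      then show "ed d (c * (s + a) / 2) = ed d (u / 2) * ed d (c * s / 2)"
        by (simp only: ed_add[OF Kd_half[OF Fd_mem(2)[OF u(1)]] KK[OF Fd_mem(2)[OF s]]])
    qed
    also have "\<dots> = ed d (u / 2) * (\<Sum>s\<in>Fd d. ed d (c * s / 2))" by (simp add: sum_distrib_left)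
    finally have "(1 - ed d (u / 2)) * (\<Sum>s\<in>Fd d. ed d (c * s / 2)) = 0" by (simp add: algebra_simps)
    then show ?thesis using u(2) False by simp
  qed
qed

lemma ed_quarter_add:
  assumes "x \<in> Kd d" "y \<in> Kd d"
  shows "ed d ((x + y)\<^sup>2 / 4) = ed d (x\<^sup>2 / 4) * ed d (y\<^sup>2 / 4) * ed d (x * y / 2)"
proof -
  have "(x + y)\<^sup>2 / 4 = x\<^sup>2 / 4 + y\<^sup>2 / 4 + x * y / 2" by (simp add: power2_sum field_simps)
  then show ?thesis
    using assms by (simp only: ed_add Kd_closed Kd_quarter Kd_half Kd_power)
qed

lemma ed_quarter_cong:
  assumes "x \<in> Kd d" "y \<in> Kd d" "x \<in> RR" "y \<in> RR" "x - y \<in> pp 1"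
  shows "ed d (x\<^sup>2 / 4) = ed d (y\<^sup>2 / 4)"
proof (rule ed_cong)
  have "x\<^sup>2 - y\<^sup>2 \<in> pp 2" using square_cong[of x y 0] assms by (simp add: numeral_2_eq_2)
  then show "x\<^sup>2 / 4 - y\<^sup>2 / 4 \<in> RR" by (simp add: pp_def diff_divide_distrib)
qed (use assms in \<open>auto intro: Kd_quarter Kd_power\<close>)

definition "GG = (\<Sum>s\<in>Fd d. ed d (s\<^sup>2 / 4))"

text \<open>In the double sum over s and s' put r = s + s'. The cross term becomes (r + 1) s / 2
  because s^2 / 2 may be replaced by s / 2, and the sum over s leaves only r = 1.\<close>

lemma GG_square: "GG\<^sup>2 = 2 ^ d * ed d (1 / 4)"
proof -
  have "GG\<^sup>2 = (\<Sum>s\<in>Fd d. ed d (s\<^sup>2 / 4) * GG)" by (simp add: GG_def power2_eq_square sum_distrib_right)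
  also have "\<dots> = (\<Sum>s\<in>Fd d. \<Sum>r\<in>Fd d. ed d (r\<^sup>2 / 4) * ed d ((r + 1) * s / 2))"
  proof (intro sum.cong refl)
    fix s assume s: "s \<in> Fd d"
    have sK: "s \<in> Kd d" "s \<in> RR" "- s \<in> Kd d" "- s \<in> RR" using Fd_mem[OF s] by (auto intro: Kd_closed RR_closed)
    have "GG = (\<Sum>r\<in>Fd d. ed d ((r + - s)\<^sup>2 / 4))"
      unfolding GG_def by (rule sum_Fd_shift[OF sK(4,3), symmetric]) (rule ed_quarter_cong)
    then have "ed d (s\<^sup>2 / 4) * GG = (\<Sum>r\<in>Fd d. ed d (s\<^sup>2 / 4) * ed d ((r + - s)\<^sup>2 / 4))"
      by (simp add: sum_distrib_left)
    also have "\<dots> = (\<Sum>r\<in>Fd d. ed d (r\<^sup>2 / 4) * ed d ((r + 1) * s / 2))"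
    proof (intro sum.cong refl)
      fix r assume r: "r \<in> Fd d"
      note rK = Fd_mem[OF r]
      have rsK: "r + - s \<in> Kd d" "r + - s \<in> RR" using rK sK by (auto intro: Kd_closed RR_closed)
      define w where "w = s * (r + - s)"
      have w: "w \<in> Kd d" "w \<in> RR" using sK rsK by (auto simp: w_def intro: Kd_closed RR_closed)
      have "ed d (r\<^sup>2 / 4) = ed d ((s + (r + - s))\<^sup>2 / 4)" by simp
      also have "\<dots> = ed d (s\<^sup>2 / 4) * ed d ((r + - s)\<^sup>2 / 4) * ed d (w / 2)"
        unfolding w_def by (rule ed_quarter_add[OF sK(1) rsK(1)])
      finally have 1: "ed d (r\<^sup>2 / 4) * ed d (w / 2) = ed d (s\<^sup>2 / 4) * ed d ((r + - s)\<^sup>2 / 4)"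
        using ed_half_inv[OF w] by (simp add: mult.assoc)
      have "ed d ((r + 1) * s / 2) = ed d (r * s / 2) * ed d (s / 2)"
        using rK sK by (simp add: distrib_right add_divide_distrib ed_add Kd_half Kd_closed)
      also have "\<dots> = ed d (r * s / 2) * ed d (s\<^sup>2 / 2)" using sK by (simp add: ed_half_square)
      also have "\<dots> = ed d (r * s / 2 + s\<^sup>2 / 2)"
        using rK sK by (simp add: ed_add Kd_half Kd_closed Kd_power)
      also have "\<dots> = ed d (w / 2)"
      proof (rule ed_cong)
        have "s\<^sup>2 \<in> RR" using sK by auto
        then show "r * s / 2 + s\<^sup>2 / 2 - w / 2 \<in> RR"
          by (simp add: w_def power2_eq_square field_simps)
      qed (use rK sK w in \<open>auto intro!: Kd_half Kd_closed Kd_power\<close>)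
      finally show "ed d (s\<^sup>2 / 4) * ed d ((r + - s)\<^sup>2 / 4) = ed d (r\<^sup>2 / 4) * ed d ((r + 1) * s / 2)"
        using 1 by simp
    qed
    finally show "ed d (s\<^sup>2 / 4) * GG = (\<Sum>r\<in>Fd d. ed d (r\<^sup>2 / 4) * ed d ((r + 1) * s / 2))" .
  qed
  also have "\<dots> = (\<Sum>r\<in>Fd d. \<Sum>s\<in>Fd d. ed d (r\<^sup>2 / 4) * ed d ((r + 1) * s / 2))" by (rule sum.swap)
  also have "\<dots> = (\<Sum>r\<in>Fd d. ed d (r\<^sup>2 / 4) * (if r = 1 then 2 ^ d else 0))"
  proof (intro sum.cong refl)
    fix r assume r: "r \<in> Fd d"
    have "(\<Sum>s\<in>Fd d. ed d ((r + 1) * s / 2)) = (if r + 1 \<in> pp 1 then 2 ^ d else 0)"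
      using Fd_mem[OF r] by (intro sum_Fd_char) (auto intro: Kd_closed Kd_numeral)
    moreover have "r + 1 \<in> pp 1 \<longleftrightarrow> r = 1"
    proof
      assume "r + 1 \<in> pp 1"
      then have "(r + 1) - 2 * 1 \<in> pp 1" by (intro pp_closed(3) pp_two) simp_all
      then have "r - 1 \<in> pp 1" by simp
      then show "r = 1" using Fd_mem[OF r] by (intro teichmueller_unique) auto
    next
      assume "r = 1"
      then show "r + 1 \<in> pp 1" using pp_two[of 1] by simp
    qed
    ultimately show "(\<Sum>s\<in>Fd d. ed d (r\<^sup>2 / 4) * ed d ((r + 1) * s / 2)) =
        ed d (r\<^sup>2 / 4) * (if r = 1 then 2 ^ d else 0)" by (simp add: sum_distrib_left[symmetric])
  qed
  also have "\<dots> = (\<Sum>r\<in>Fd d. if r = 1 then 2 ^ d * ed d (1 / 4) else 0)"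
    by (intro sum.cong refl) auto
  also have "\<dots> = 2 ^ d * ed d (1 / 4)" by (simp add: Fd_iff)
  finally show ?thesis .
qed

end

lemma ed_one_div: "ed d (1 / 2 ^ k) = cis (- 2 * pi * (of_nat d / 2 ^ k))"
proof -
  have "td d (1 / 2 ^ k) = 1 / 2 ^ k * of_nat d"
    using td_scale[of 1 d "1 / 2 ^ k"] Kd_numeral by (simp add: td_1 of_q2_divide of_q2_power)
  then show ?thesis using e2_of_int_div[of "int d" k] by (simp add: ed_def)
qed

end

section \<open>Evaluation of the Gauss sum\<close>

context unram
begin

abbreviation "rootq \<equiv> complex_of_real (sqrt (of_nat q))"

lemma one_minus_i_power: "(1 - \<i>) ^ d = complex_of_real (sqrt 2 ^ d) * cis (- 2 * pi * (of_nat d / 8))"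
proof -
  have "1 - \<i> = complex_of_real (sqrt 2) * cis (- pi / 4)"
    by (simp add: complex_eq_iff cos_45 sin_45)
  then have "(1 - \<i>) ^ d = complex_of_real (sqrt 2 ^ d) * cis (of_nat d * (- pi / 4))"
    by (simp only: power_mult_distrib Complex.DeMoivre of_real_power)
  also have "of_nat d * (- pi / 4) = - 2 * pi * (of_nat d / 8)" by simp
  finally show ?thesis .
qed

text \<open>Induction over the divisors d. For a prime p dividing d and m = d / p, raising to the
  power 2^m is an action of order p on \<open>Fd d\<close> with fixed points \<open>Fd m\<close>,
  where \<open>ed d\<close> is the p-th power of \<open>ed m\<close>. So \<open>GG d\<close> is
  congruent modulo p to the p-th power of \<open>GG m\<close>, that is, to (1 - i)^d. The squares
  agree by \<open>GG_square\<close>, and \<open>gcong_sign\<close> settles the sign since p is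
  odd.\<close>

lemma GG_odd:
  assumes "odd f"
  shows "d > 0 \<Longrightarrow> d dvd f \<Longrightarrow> GG d = (1 - \<i>) ^ d"
proof (induction d rule: less_induct)
  case (less d)
  note d = less.prems
  have i4: "ed d (1 / 4) = (- \<i>) ^ d" for d
  proof -
    have "(- \<i>) ^ d = cis (- pi / 2) ^ d" by (simp add: complex_eq_iff)
    also have "\<dots> = cis (of_nat d * (- pi / 2))" by (rule Complex.DeMoivre)
    also have "of_nat d * (- pi / 2) = - 2 * pi * (of_nat d / 2 ^ 2)" by simp
    finally show ?thesis using ed_one_div[of d 2] by simp
  qed
  have sq: "(GG d)\<^sup>2 = ((1 - \<i>) ^ d)\<^sup>2"
  proof -
    have "((1 - \<i>) ^ d)\<^sup>2 = ((1 - \<i>)\<^sup>2) ^ d" by (simp only: power_mult[symmetric] mult.commute)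
    also have "(1 - \<i>)\<^sup>2 = 2 * (- \<i>)" by (simp add: power2_eq_square algebra_simps)
    also have "(2 * (- \<i>)) ^ d = 2 ^ d * (- \<i>) ^ d" by (rule power_mult_distrib)
    finally show ?thesis using GG_square[OF d] i4 by simp
  qed
  show ?case
  proof (cases "d = 1")
    case True
    have "Fd 1 = {0, 1}"
    proof (intro equalityI subsetI)
      fix s assume "s \<in> Fd 1"
      then have "s\<^sup>2 = s" by (simp add: Fd_iff)
      then show "s \<in> {0, 1}" by (simp add: power2_eq_square)
    qed (auto simp: Fd_iff)
    then have "GG 1 = ed 1 0 + ed 1 (1 / 4)" using GG_def[OF d] unfolding True by simp
    moreover have "ed 1 0 = 1" using ed_RR[of 0 1] by (simp add: Kd_numeral)
    ultimately show ?thesis using i4[of 1] True by simp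
  next
    case False
    then obtain p where p: "prime p" "p dvd d" using prime_factor_nat by blast
    then obtain m where m: "d = p * m" by (elim dvdE)
    have "p dvd f" using p d dvd_trans by blast
    then have oddp: "odd p" using \<open>odd f\<close> dvd_trans by blast
    have m0: "m > 0" "m dvd f" "m < d"
      using d m prime_gt_1_nat[OF p(1)] by (auto simp: dvd_mult_right intro: dvd_trans)
    have IH: "GG m = (1 - \<i>) ^ m" using less.IH m0 by blast
    have fourth: "ed d (s\<^sup>2 / 4) \<in> gauss_int" if "s \<in> RR" "s \<in> Kd d" for s d
    proof (rule fourth_root_gauss_int)
      define t where "t = s\<^sup>2 / 4"
      have "t \<in> Kd d" unfolding t_def by (intro Kd_quarter Kd_power that)
      then have t: "t \<in> Kd d" "t + t \<in> Kd d" using Kd_closed(1)[of t d t] by blast+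
      have "ed d t ^ 4 = (ed d t * ed d t) * (ed d t * ed d t)" by (simp add: power4_eq_xxxx)
      also have "\<dots> = ed d ((t + t) + (t + t))" by (simp only: ed_add[OF t(1) t(1)] ed_add[OF t(2) t(2)])
      also have "(t + t) + (t + t) = s\<^sup>2" by (simp add: t_def)
      also have "ed d (s\<^sup>2) = 1" using that by (intro ed_RR Kd_power RR_power)
      finally show "ed d (s\<^sup>2 / 4) ^ 4 = 1" by (simp add: t_def)
    qed
    have KmKd: "x \<in> Kd d" if "x \<in> Kd m" for x
    proof -
      have "((frob ^^ m) ^^ j) x = x" for j using that by (induction j) (simp_all add: Kd_def)
      from this[of p] show ?thesis by (simp add: Kd_def m funpow_mult mult.commute)
    qed
    \<comment> \<open>For an element of \<open>Kd m\<close>, the d = p m conjugates run p times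
      through the first m, so the trace is multiplied by p.\<close>
    have edm: "ed d x = ed m x ^ p" if x: "x \<in> Kd m" for x
    proof -
      have "(\<Sum>i<m * j. (frob ^^ i) x) = of_nat j * (\<Sum>i<m. (frob ^^ i) x)" for j
      proof (induction j)
        case (Suc j)
        have jx: "((frob ^^ m) ^^ j) x = x" for j using x by (induction j) (simp_all add: Kd_def)
        have "(\<Sum>i<m * Suc j. (frob ^^ i) x) = (\<Sum>i<m * j + m. (frob ^^ i) x)" by (simp add: add.commute)
        also have "\<dots> = (\<Sum>i<m * j. (frob ^^ i) x) + (\<Sum>i<m. (frob ^^ (i + m * j)) x)"
          by (rule sum_lessThan_add)
        also have "(\<Sum>i<m. (frob ^^ (i + m * j)) x) = (\<Sum>i<m. (frob ^^ i) x)"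
          using jx by (simp add: funpow_add funpow_mult)
        finally show ?case using Suc by (simp add: algebra_simps)
      qed simp
      from this[of p] have "td d x = of_nat p * td m x"
        using x KmKd[OF x] by (intro td_eqI) (simp_all add: of_q2_mult of_q2_of_nat td_eq m mult.commute)
      moreover have "e2 (of_nat j * y) = e2 y ^ j" for j y
        by (induction j) (simp_all add: distrib_right e2_add e2_eq_1_iff q2_ints_closed)
      ultimately show ?thesis by (simp add: ed_def)
    qed
    define \<sigma> where "\<sigma> s = s ^ (2 ^ m)" for s :: 'k
    have \<sigma>frob: "\<sigma> s = (frob ^^ m) s" if "s \<in> Fd d" for s
      using Fd_mem[OF that] by (simp add: \<sigma>_def frob_pow_UU0)
    have "gcong p (\<Sum>s\<in>Fd d. ed d (s\<^sup>2 / 4)) (\<Sum>s | s \<in> Fd d \<and> \<sigma> s = s. ed d (s\<^sup>2 / 4))"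
    proof (rule gcong_sum_fixed_points[OF p(1)])
      fix s assume s: "s \<in> Fd d"
      show "\<sigma> s \<in> Fd d" using s by (simp add: Fd_iff \<sigma>_def UU0_power) (metis mult.commute power_mult)
      show "(\<sigma> ^^ p) s = s"
      proof -
        have "(\<sigma> ^^ j) s = s ^ (2 ^ (m * j))" for j
          by (induction j) (simp_all add: \<sigma>_def power_add power_mult[symmetric] mult.commute)
        then show ?thesis using s by (simp add: Fd_iff m mult.commute)
      qed
      have "\<sigma> s ^ 2 / 4 = (frob ^^ m) (s\<^sup>2 / 4)"
      proof -
        have "(frob ^^ m) (s\<^sup>2 / 4) = (frob ^^ m) (of_q2 (1 / 4) * (s * s))"
          by (simp add: of_q2_divide power2_eq_square)
        also have "\<dots> = of_q2 (1 / 4) * (\<sigma> s * \<sigma> s)"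
          by (simp only: frob_pow_mult frob_pow_of_q2 \<sigma>frob[OF s])
        finally show ?thesis by (simp add: of_q2_divide power2_eq_square)
      qed
      moreover have "td d ((frob ^^ j) x) = td d x" if "x \<in> Kd d" for j x
      proof (induction j)
        case (Suc j)
        have "(frob ^^ j) x \<in> Kd d"
          using that by (simp add: Kd_def funpow_add[symmetric, THEN fun_cong, simplified] add.commute)
            (metis add.commute comp_apply funpow_add)
        then show ?case using Suc by (simp add: td_frob)
      qed simp
      ultimately show "ed d (\<sigma> s ^ 2 / 4) = ed d (s\<^sup>2 / 4)"
        using Fd_mem[OF s] by (simp add: ed_def Kd_quarter Kd_power)
      show "ed d (s\<^sup>2 / 4) \<in> gauss_int" using Fd_mem[OF s] by (intro fourth)
    qed simp
    also have "{s. s \<in> Fd d \<and> \<sigma> s = s} = Fd m"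
      using KmKd by (auto simp: Fd_iff \<sigma>_def) (metis Fd_def Fd_iff IntD2 IntI Fd_iff)
    also have "(\<Sum>s\<in>Fd m. ed d (s\<^sup>2 / 4)) = (\<Sum>s\<in>Fd m. ed m (s\<^sup>2 / 4) ^ p)"
      by (intro sum.cong refl edm Kd_quarter Kd_power Fd_mem)
    finally have 1: "gcong p (GG d) (\<Sum>s\<in>Fd m. ed m (s\<^sup>2 / 4) ^ p)" by (simp add: GG_def[OF d])
    have "gcong p ((\<Sum>s\<in>Fd m. ed m (s\<^sup>2 / 4)) ^ p) (\<Sum>s\<in>Fd m. ed m (s\<^sup>2 / 4) ^ p)"
      by (intro gcong_sum_power p fourth Fd_mem) simp
    moreover have "(\<Sum>s\<in>Fd m. ed m (s\<^sup>2 / 4)) ^ p = (1 - \<i>) ^ d"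
      unfolding GG_def[OF m0(1,2), symmetric] IH m power_mult[symmetric]
      by (rule arg_cong[OF mult.commute])
    ultimately have "gcong p (\<Sum>s\<in>Fd m. ed m (s\<^sup>2 / 4) ^ p) ((1 - \<i>) ^ d)"
      by (metis gcong_sym)
    with 1 have "gcong p (GG d) ((1 - \<i>) ^ d)" by (rule gcong_trans)
    moreover have "(norm ((1 - \<i>) ^ d))\<^sup>2 = 2 ^ d"
    proof -
      have "(norm ((1 - \<i>) ^ d))\<^sup>2 = (sqrt 2 ^ d)\<^sup>2" by (simp add: one_minus_i_power norm_mult norm_power)
      also have "\<dots> = ((sqrt 2)\<^sup>2) ^ d" unfolding power_mult[symmetric] by (rule arg_cong[OF mult.commute])
      finally show ?thesis by simp
    qed
    ultimately show ?thesis using gcong_sign[OF p(1) oddp sq] by blast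
  qed
qed

text \<open>For \<open>f = 2d\<close> write the representatives as \<open>a + b\<theta>\<close>, where \<open>\<theta>\<close> has relative trace 1 over the
  subfield of degree \<open>d\<close>: the sum over \<open>a\<close> is linear and leaves only \<open>b = 1\<close>.\<close>

lemma GG_even:
  assumes fd: "f = 2 * d"
  shows "GG f = - (2 ^ d) * ed d (1 / 4)"
proof -
  have d: "d > 0" "d dvd f" using fd f by auto
  have KfU: "x \<in> Kd f" for x by (simp add: Kd_def frob_pow_f)
  have dd: "(frob ^^ d) ((frob ^^ d) x) = x" for x
    using frob_pow_f[of x] unfolding fd mult_2 funpow_add comp_apply .
  have tK: "x + (frob ^^ d) x \<in> Kd d" for x
    by (simp add: Kd_def frob_pow_add dd add.commute)
  \<comment> \<open>Transitivity of the trace through the quadratic extension.\<close>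
  have red: "e_pi x = ed d (x + (frob ^^ d) x)" for x
  proof -
    have "of_q2 (td d (x + (frob ^^ d) x)) = (\<Sum>i<d. (frob ^^ i) x) + (\<Sum>i<d. (frob ^^ (i + d)) x)"
      by (simp add: td_eq[OF tK] frob_pow_add sum.distrib funpow_add)
    also have "\<dots> = (\<Sum>i<d + d. (frob ^^ i) x)"
      by (rule sum_lessThan_add[symmetric])
    also have "\<dots> = of_q2 (q2_trace x)" by (simp add: trace_eq fd mult_2)
    finally show ?thesis by (simp add: ed_def e_pi_def)
  qed
  obtain u where u: "u \<in> TT" "e_pi (u / 2) \<noteq> 1"
    using ex_odd_trace by (auto simp: e_pi_def trace_half e2_eq_1_iff)
  have uR: "u \<in> RR" using u RR_UU by blast
  \<comment> \<open>The relative trace of u. It is a unit because the character is non-trivial at u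
    / 2, so dividing u by it produces an element of relative trace 1.\<close>
  define w where "w = u + (frob ^^ d) u"
  have w: "w \<in> RR" "w \<in> Kd d" using uR frob_pow_RR tK by (auto simp: w_def)
  have w1: "w \<notin> pp 1"
  proof
    assume "w \<in> pp 1"
    then have "w / 2 \<in> RR" unfolding pp_1_half .
    then have "ed d (w / 2) = 1" using w by (intro ed_RR Kd_half)
    moreover have "u / 2 + (frob ^^ d) (u / 2) = w / 2"
    proof -
      have "(frob ^^ d) (of_q2 (1 / 2) * u) = of_q2 (1 / 2) * (frob ^^ d) u"
        by (simp only: frob_pow_mult frob_pow_of_q2)
      then show ?thesis by (simp add: of_q2_divide w_def add_divide_distrib)
    qed
    ultimately show False using u(2) unfolding red by metis
  qed
  have w0: "w \<noteq> 0" using w1 by auto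
  define \<theta> \<theta>' where "\<theta> = u * inverse w" and "\<theta>' = (frob ^^ d) \<theta>"
  have \<theta>R: "\<theta> \<in> RR" using uR RR_unit[OF w(1) w1] by (auto simp: \<theta>_def)
  have "\<theta>' * w = (frob ^^ d) u"
    using frob_pow_mult[of d \<theta> w] w w0 by (simp add: \<theta>'_def \<theta>_def Kd_def mult.assoc)
  then have "(\<theta> + \<theta>') * w = w" using w0 by (simp add: distrib_right \<theta>_def w_def mult.assoc)
  then have t1: "\<theta> + \<theta>' = 1" using w0 by simp
  have Fdf: "Fd f = TT0" by (auto simp: Fd_def KfU)
  have zK: "a * \<theta> + (frob ^^ d) (a * \<theta>) = a" if "a \<in> Kd d" for a
    using that t1 by (simp add: frob_pow_mult Kd_def \<theta>'_def distrib_left[symmetric])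
  have "\<forall>z. \<exists>s. z \<in> Fd d \<times> Fd d \<longrightarrow> s \<in> TT0 \<and> (fst z + snd z * \<theta>) - s \<in> pp 1"
  proof
    fix z
    show "\<exists>s. z \<in> Fd d \<times> Fd d \<longrightarrow> s \<in> TT0 \<and> (fst z + snd z * \<theta>) - s \<in> pp 1"
    proof (cases "z \<in> Fd d \<times> Fd d")
      case True
      then have "fst z + snd z * \<theta> \<in> RR" 
        by (intro RR_closed(3,5) Fd_mem(1)[of _ d] \<theta>R) auto
      then show ?thesis using teichmueller_ex by metis
    qed simp
  qed
  then obtain k where k: "\<And>z. z \<in> Fd d \<times> Fd d \<Longrightarrow> k z \<in> TT0"
    "\<And>z. z \<in> Fd d \<times> Fd d \<Longrightarrow> (fst z + snd z * \<theta>) - k z \<in> pp 1" by metis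
  \<comment> \<open>The relative trace of a + b\<theta> is 2a + b, so b and then a can be recovered
    modulo 2.\<close>
  have inj: "inj_on k (Fd d \<times> Fd d)"
  proof (rule inj_onI)
    fix z z' assume z: "z \<in> Fd d \<times> Fd d" "z' \<in> Fd d \<times> Fd d" "k z = k z'"
    define a b where "a = fst z - fst z'" and "b = snd z - snd z'"
    have ab: "a \<in> Kd d" "b \<in> Kd d" "a \<in> RR" "b \<in> RR"
      using z Fd_mem[of _ d] by (auto simp: a_def b_def intro: Kd_closed RR_closed)
    have "(fst z + snd z * \<theta>) - (fst z' + snd z' * \<theta>) \<in> pp 1"
      by (rule pp_cong_trans[OF k(2)[OF z(1)]]) (unfold z(3), rule pp_cong_sym[OF k(2)[OF z(2)]])
    then have x: "a + b * \<theta> \<in> pp 1" by (simp add: a_def b_def algebra_simps)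
    have "(a + b * \<theta>) + (frob ^^ d) (a + b * \<theta>) - 2 * a \<in> pp 1"
      by (rule pp_closed(3)[OF pp_closed(2)[OF x frob_pow_pp[OF x]] pp_two[OF ab(3)]])
    moreover have "(a + b * \<theta>) + (frob ^^ d) (a + b * \<theta>) - 2 * a = b"
      using ab zK[OF ab(2)] by (simp add: frob_pow_add Kd_def algebra_simps)
    ultimately have b: "b \<in> pp 1" by simp
    then have "(a + b * \<theta>) - b * \<theta> \<in> pp 1" using x \<theta>R by (intro pp_closed(3) pp_mult_right)
    then have "a \<in> pp 1" by simp
    then have "fst z = fst z'" "snd z = snd z'"
      using b z Fd_mem(3)[of _ d] by (auto intro!: teichmueller_unique simp: a_def b_def)
    then show "z = z'" by (rule prod_eqI)
  qed
  have "card (k ` (Fd d \<times> Fd d)) = card TT0"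
    unfolding card_image[OF inj] card_cartesian_product card_Fd[OF d] card_UU0
    by (simp add: fd mult_2 power_add)
  then have im: "k ` (Fd d \<times> Fd d) = TT0" using k(1) by (intro card_subset_eq) auto
  have psi: "ed f (s\<^sup>2 / 4) = e_pi (s\<^sup>2 / 4)" for s by (rule ed_f)
  have "GG f = (\<Sum>s\<in>TT0. e_pi (s\<^sup>2 / 4))"
    using GG_def[of f] f by (simp add: Fdf psi)
  also have "\<dots> = (\<Sum>z\<in>Fd d \<times> Fd d. e_pi ((k z)\<^sup>2 / 4))"
    unfolding im[symmetric] by (simp add: sum.reindex[OF inj])
  also have "\<dots> = (\<Sum>z\<in>Fd d \<times> Fd d. ed d ((snd z + 1) * fst z / 2) * e_pi ((snd z * \<theta>)\<^sup>2 / 4))"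
  proof (intro sum.cong refl)
    fix z assume z: "z \<in> Fd d \<times> Fd d"
    define a b where "a = fst z" and "b = snd z"
    have ab: "a \<in> Fd d" "b \<in> Fd d" using z by (auto simp: a_def b_def)
    note aK = Fd_mem[OF ab(1)] and bK = Fd_mem[OF ab(2)]
    have x: "a + b * \<theta> \<in> RR" using aK bK \<theta>R by (auto intro: RR_closed)
    have "e_pi ((k z)\<^sup>2 / 4) = e_pi ((a + b * \<theta>)\<^sup>2 / 4)"
    proof (rule e_pi_cong)
      have "(a + b * \<theta>)\<^sup>2 - (k z)\<^sup>2 \<in> pp 2"
        using square_cong[of "a + b * \<theta>" "k z" 0] k[OF z] RR_UU0 by (simp add: a_def b_def numeral_2_eq_2)
      then have "- ((a + b * \<theta>)\<^sup>2 - (k z)\<^sup>2) \<in> pp 2" by (rule pp_closed(4))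
      then show "(k z)\<^sup>2 / 4 - (a + b * \<theta>)\<^sup>2 / 4 \<in> RR" by (simp add: pp_def diff_divide_distrib)
    qed
    also have "(a + b * \<theta>)\<^sup>2 / 4 = a\<^sup>2 / 4 + (b * \<theta>)\<^sup>2 / 4 + a * b * \<theta> / 2"
      by (simp add: power2_sum field_simps)
    also have "e_pi \<dots> = e_pi (a\<^sup>2 / 4) * e_pi ((b * \<theta>)\<^sup>2 / 4) * e_pi (a * b * \<theta> / 2)"
      by (simp only: e_pi_add)
    also have "e_pi (a\<^sup>2 / 4) = ed d (a\<^sup>2 / 2)"
    proof -
      have "a\<^sup>2 / 4 \<in> Kd d" using aK by (intro Kd_quarter Kd_power)
      then have "(frob ^^ d) (a\<^sup>2 / 4) = a\<^sup>2 / 4" by (simp only: Kd_def mem_Collect_eq)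
      moreover have "a\<^sup>2 / 4 + a\<^sup>2 / 4 = a\<^sup>2 / 2" by (simp add: field_simps)
      ultimately show ?thesis by (simp only: red)
    qed
    also have "\<dots> = ed d (a / 2)" using aK by (intro ed_half_square)
    also have "e_pi (a * b * \<theta> / 2) = ed d (a * b / 2)"
    proof -
      have "a * b / 2 \<in> Kd d" using aK bK by (intro Kd_half Kd_closed)
      moreover have "a * b * \<theta> / 2 = a * b / 2 * \<theta>" by simp
      ultimately show ?thesis by (simp only: red zK)
    qed
    also have "ed d (a / 2) * e_pi ((b * \<theta>)\<^sup>2 / 4) * ed d (a * b / 2) =
        ed d (a * b / 2 + a / 2) * e_pi ((b * \<theta>)\<^sup>2 / 4)"
      using aK bK by (subst ed_add) (auto intro: Kd_half Kd_closed)
    also have "a * b / 2 + a / 2 = (b + 1) * a / 2" by (simp add: field_simps)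
    finally show "e_pi ((k z)\<^sup>2 / 4) = ed d ((snd z + 1) * fst z / 2) * e_pi ((snd z * \<theta>)\<^sup>2 / 4)"
      by (simp add: a_def b_def)
  qed
  also have "\<dots> = (\<Sum>a\<in>Fd d. \<Sum>b\<in>Fd d. ed d ((b + 1) * a / 2) * e_pi ((b * \<theta>)\<^sup>2 / 4))"
    by (simp add: sum.cartesian_product case_prod_unfold)
  also have "\<dots> = (\<Sum>b\<in>Fd d. \<Sum>a\<in>Fd d. ed d ((b + 1) * a / 2) * e_pi ((b * \<theta>)\<^sup>2 / 4))"
    by (rule sum.swap)
  also have "\<dots> = (\<Sum>b\<in>Fd d. if b = 1 then 2 ^ d * e_pi (\<theta>\<^sup>2 / 4) else 0)"
  proof (intro sum.cong refl)
    fix b assume b: "b \<in> Fd d"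
    have "(\<Sum>a\<in>Fd d. ed d ((b + 1) * a / 2)) = (if b + 1 \<in> pp 1 then 2 ^ d else 0)"
      using Fd_mem[OF b] by (intro sum_Fd_char d) (auto intro: Kd_closed Kd_numeral)
    moreover have "b + 1 \<in> pp 1 \<longleftrightarrow> b = 1"
    proof
      assume "b + 1 \<in> pp 1"
      then have "(b + 1) - 2 * 1 \<in> pp 1" by (intro pp_closed(3) pp_two) simp_all
      then have "b - 1 \<in> pp 1" by simp
      then show "b = 1" using Fd_mem[OF b] by (intro teichmueller_unique) auto
    next
      assume "b = 1"
      then show "b + 1 \<in> pp 1" using pp_two[of 1] by simp
    qed
    ultimately show "(\<Sum>a\<in>Fd d. ed d ((b + 1) * a / 2) * e_pi ((b * \<theta>)\<^sup>2 / 4)) =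
        (if b = 1 then 2 ^ d * e_pi (\<theta>\<^sup>2 / 4) else 0)" by (simp add: sum_distrib_right[symmetric])
  qed
  also have "\<dots> = 2 ^ d * e_pi (\<theta>\<^sup>2 / 4)" by (simp add: Fd_iff)
  also have "e_pi (\<theta>\<^sup>2 / 4) = - ed d (1 / 4)"
  proof -
    \<comment> \<open>The relative norm of \<theta>. Since \<theta> and \<theta>' add up to 1, the
      sum of their squares is 1 - 2N, so the remaining sign is the character at N / 2.\<close>
    define N where "N = \<theta> * \<theta>'"
    have th': "\<theta>' = 1 - \<theta>" using t1 by (simp add: algebra_simps)
    have NK: "N \<in> Kd d" by (simp add: N_def Kd_def frob_pow_mult \<theta>'_def dd mult.commute)
    have NR: "N \<in> RR" using \<theta>R frob_pow_RR by (auto simp: N_def \<theta>'_def)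
    have "\<theta>\<^sup>2 / 4 + (frob ^^ d) (\<theta>\<^sup>2 / 4) = \<theta>\<^sup>2 / 4 + \<theta>'\<^sup>2 / 4"
    proof -
      have "(frob ^^ d) (of_q2 (1 / 4) * (\<theta> * \<theta>)) = of_q2 (1 / 4) * (\<theta>' * \<theta>')"
        by (simp only: frob_pow_mult frob_pow_of_q2 \<theta>'_def)
      then show ?thesis by (simp add: of_q2_divide power2_eq_square)
    qed
    also have "\<dots> = 1 / 4 - N / 2" by (simp add: N_def th' power2_eq_square field_simps)
    finally have "e_pi (\<theta>\<^sup>2 / 4) = ed d (1 / 4 - N / 2)" by (simp only: red)
    also have "\<dots> = ed d (1 / 4 + N / 2)"
    proof (rule ed_cong)
      show "1 / 4 - N / 2 - (1 / 4 + N / 2) \<in> RR" using NR by (simp add: field_simps) (use NR in blast)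
    qed (use NK in \<open>auto intro!: Kd_closed Kd_half Kd_quarter Kd_numeral\<close>)
    also have "\<dots> = ed d (1 / 4) * ed d (N / 2)"
      using NK by (intro ed_add Kd_half Kd_quarter Kd_numeral)
    also have "ed d (N / 2) = - 1"
    proof -
      have fr2: "x\<^sup>2 - frob x \<in> pp 1" if x: "x \<in> RR" for x
        using RR_ev[OF x] ev_square_cong[of \<zeta>] by (auto simp: frob_ev)
      \<comment> \<open>N = \<theta> - \<theta>^2, and modulo 2 squaring is the Frobenius, so the
        trace of N telescopes to \<theta> - \<theta>', which is 1 modulo 2.\<close>
      have "(\<Sum>i<d. (frob ^^ i) N) - (\<theta> - \<theta>') \<in> pp 1"
      proof -
        have "(\<Sum>i<d. (frob ^^ i) N) = (\<Sum>i<d. (frob ^^ i) \<theta> - ((frob ^^ i) \<theta>)\<^sup>2)"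
        proof (intro sum.cong refl)
          fix i
          have "N = \<theta> + - (\<theta> * \<theta>)" by (simp add: N_def th' algebra_simps)
          then show "(frob ^^ i) N = (frob ^^ i) \<theta> - ((frob ^^ i) \<theta>)\<^sup>2"
            by (simp only: frob_pow_add frob_pow_minus frob_pow_mult power2_eq_square diff_conv_add_uminus)
        qed
        moreover have "\<theta> - \<theta>' = (\<Sum>i<d. (frob ^^ i) \<theta> - (frob ^^ Suc i) \<theta>)"
          using sum_lessThan_telescope'[of "\<lambda>i. (frob ^^ i) \<theta>" d] by (simp add: \<theta>'_def)
        ultimately have "(\<Sum>i<d. (frob ^^ i) N) - (\<theta> - \<theta>') =
            (\<Sum>i<d. ((frob ^^ i) \<theta> - ((frob ^^ i) \<theta>)\<^sup>2) - ((frob ^^ i) \<theta> - (frob ^^ Suc i) \<theta>))"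
          by (simp only: sum_subtractf)
        also have "\<dots> = (\<Sum>i<d. - (((frob ^^ i) \<theta>)\<^sup>2 - frob ((frob ^^ i) \<theta>)))"
          by (intro sum.cong refl) simp
        also have "\<dots> \<in> pp 1" by (intro pp_sum pp_closed(4) fr2 frob_pow_RR \<theta>R)
        finally show ?thesis .
      qed
      then have T1: "of_q2 (td d N) - (\<theta> - \<theta>') \<in> pp 1" by (simp add: td_eq[OF NK])
      have "ed d (N / 2) \<noteq> 1"
      proof
        assume "ed d (N / 2) = 1"
        then have "td d N / 2 \<in> q2_ints" using ed_half_iff[OF NK] by simp
        then have "of_q2 (td d N) \<in> pp 1"
          using of_q2_in_RR_iff[of "td d N / 2"] by (simp add: pp_def of_q2_divide)
        then have "of_q2 (td d N) - (of_q2 (td d N) - (\<theta> - \<theta>')) - 2 * \<theta> \<in> pp 1"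
          by (rule pp_closed(3)[OF pp_closed(3)[OF _ T1] pp_two[OF \<theta>R]])
        then have "- (of_q2 (td d N) - (of_q2 (td d N) - (\<theta> - \<theta>')) - 2 * \<theta>) \<in> pp 1" by (rule pp_closed(4))
        moreover have "- (of_q2 (td d N) - (of_q2 (td d N) - (\<theta> - \<theta>')) - 2 * \<theta>) = 1"
          by (simp add: th')
        ultimately show False using one_notin_pp by simp
      qed
      moreover have "ed d (N / 2) * ed d (N / 2) = 1" using ed_half_inv[OF NK NR] .
      ultimately show ?thesis by (metis power2_eq_1_iff power2_eq_square)
    qed
    finally show ?thesis by simp
  qed
  finally show ?thesis by simp
qed

text \<open>Both parities of f fit one formula: \<open>e_pi (1 / 8)\<close> is the f-th power of
  exp(-2 pi i / 8), so sqrt(q) times it is (1 - i)^f, the value of the Gauss sum for odd f, and the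
  negative of this is the value for even f.\<close>

lemma MM_psi: "MM (\<lambda>x. e_pi (x\<^sup>2 / 4)) =
  (- 1) ^ (f - 1) / rootq * e_pi (1 / 8 :: 'k)"
proof -
  have Fdf: "Fd f = TT0" by (auto simp: Fd_def Kd_def frob_pow_f)
  have per1: "per 1 (\<lambda>x. e_pi (x\<^sup>2 / 4))"
    unfolding per_def
  proof (intro ballI e_pi_cong)
    fix x y assume xy: "x \<in> RR" "y \<in> RR"
    have "x * y + y\<^sup>2 \<in> RR" using xy by (auto intro: RR_closed)
    moreover have "(x + 2 ^ 1 * y)\<^sup>2 = x\<^sup>2 + 4 * (x * y + y\<^sup>2)"
      by (simp add: power2_eq_square algebra_simps)
    then have "(x + 2 ^ 1 * y)\<^sup>2 / 4 - x\<^sup>2 / 4 = x * y + y\<^sup>2"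
      by (simp only: add_divide_distrib nonzero_mult_div_cancel_left[OF q2_field_numeral_neq_0]) simp
    ultimately show "(x + 2 ^ 1 * y)\<^sup>2 / 4 - x\<^sup>2 / 4 \<in> RR" by simp
  qed
  have "MM (\<lambda>x. e_pi (x\<^sup>2 / 4)) = (\<Sum>s\<in>TT0. e_pi (s\<^sup>2 / 4)) / of_nat q"
    using MM_eq[OF per1] mean_Suc[of 0 "\<lambda>x. e_pi (x\<^sup>2 / 4)"] by (simp add: mean_0)
  also have "(\<Sum>s\<in>TT0. e_pi (s\<^sup>2 / 4)) = GG f" using GG_def[of f] f by (simp add: Fdf ed_f)
  finally have 1: "MM (\<lambda>x. e_pi (x\<^sup>2 / 4)) = GG f / of_nat q" .
  have e8: "e_pi (1 / 8 :: 'k) = cis (- 2 * pi * (of_nat f / 8))"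
    using ed_one_div[of f 3] by (simp add: ed_f)
  have sq: "complex_of_real (sqrt 2 ^ f) = rootq"
    by (simp add: real_sqrt_power)
  have "GG f = (- 1) ^ (f - 1) * rootq * e_pi (1 / 8 :: 'k)"
  proof (cases "odd f")
    case True
    then show ?thesis
      using GG_odd[OF True, of f] f one_minus_i_power[of f] sq e8 by simp
  next
    case False
    then have "even f" by simp
    then obtain d where d: "f = 2 * d" by (elim dvdE)
    have "(- 1 :: complex) ^ (f - 1) = - 1" using False f by simp
    moreover have "complex_of_real (sqrt 2 ^ f) = 2 ^ d"
      by (simp add: d power_mult)
    moreover have "ed d (1 / 4) = cis (- 2 * pi * (of_nat f / 8))"
      using ed_one_div[of d 2] by (simp add: d field_simps)
    ultimately show ?thesis using GG_even[OF d] sq e8 by simp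
  qed
  then have "MM (\<lambda>x. e_pi (x\<^sup>2 / 4)) =
      (- 1) ^ (f - 1) * (rootq / of_nat q) * e_pi (1 / 8 :: 'k)"
    unfolding 1 by simp
  also have "rootq / of_nat q = 1 / rootq"
  proof -
    have "rootq * rootq = of_nat q"
      by (simp flip: of_real_mult)
    then show ?thesis by (simp add: divide_eq_eq eq_divide_eq)
  qed
  finally show ?thesis by simp
qed

end

context unram
begin

section \<open>Units and the character \<open>\<eta>\<close>\<close>

lemma p_pow_iff: "x \<in> p_pow k \<longleftrightarrow> x / 2 powi k \<in> RR"
proof -
  have "x \<in> p_pow k \<longleftrightarrow> (\<exists>y\<in>RR. x = 2 powi k * y)" by (auto simp: p_pow_def int_ring_eq)
  also have "\<dots> \<longleftrightarrow> x / 2 powi k \<in> RR"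
  proof
    assume "x / 2 powi k \<in> RR"
    then show "\<exists>y\<in>RR. x = 2 powi k * y" by (intro bexI[of _ "x / 2 powi k"]) simp_all
  qed auto
  finally show ?thesis .
qed

lemma p_pow_nat: "p_pow (int n) = pp n"
  by (auto simp: p_pow_iff pp_def)

lemma p_pow_numeral: "p_pow (numeral n) = pp (numeral n)" "p_pow 1 = pp 1"
  using p_pow_nat[of "numeral n"] p_pow_nat[of 1] by simp_all

text \<open>The principal units; every unit is a root of unity times one of them
  (\<open>unit_decomp\<close>).\<close>

definition pu :: "'k \<Rightarrow> bool" where "pu w \<longleftrightarrow> w - 1 \<in> pp 1"

lemma pu_obtain:
  assumes "pu w"
  obtains y where "y \<in> RR" "w = 1 + 2 * y"
proof -
  obtain y where "y \<in> RR" "w - 1 = 2 ^ 1 * y" using pp_obtain assms unfolding pu_def by blast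
  then show ?thesis using that[of y] by (simp add: algebra_simps)
qed

lemma pu_RR: "pu w \<Longrightarrow> w \<in> RR"
  by (elim pu_obtain) (auto intro: RR_closed)

lemma pu_notin_pp: "pu w \<Longrightarrow> w \<notin> pp 1"
proof
  assume "pu w" "w \<in> pp 1"
  then have "w - (w - 1) \<in> pp 1" using pp_closed(3)[of w 1 "w - 1"] by (simp only: pu_def)
  then show False using one_notin_pp by simp
qed

lemma pu_1 [simp]: "pu 1"
  by (auto simp: pu_def)

lemma pu_I: "y \<in> RR \<Longrightarrow> pu (1 + 2 * y)"
  using pp_two[of y] by (simp add: pu_def)

lemma pu_mult: "pu w \<Longrightarrow> pu w' \<Longrightarrow> pu (w * w')"
proof -
  assume w: "pu w" "pu w'"
  have "w * (w' - 1) + (w - 1) \<in> pp 1"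
    using w pu_RR[OF w(1)] unfolding pu_def by (intro pp_closed(2) pp_mult_left)
  then show ?thesis by (simp add: pu_def algebra_simps)
qed

lemma pu_inverse: "pu w \<Longrightarrow> pu (inverse w)"
proof -
  assume w: "pu w"
  have "w \<noteq> 0" using pu_notin_pp[OF w] by auto
  have "- (inverse w * (w - 1)) \<in> pp 1"
    using w RR_unit[OF pu_RR[OF w] pu_notin_pp[OF w]] unfolding pu_def by (intro pp_closed(4) pp_mult_left)
  then show ?thesis using \<open>w \<noteq> 0\<close> by (simp add: pu_def algebra_simps)
qed

lemma UU_notin_pp: "u \<in> TT \<Longrightarrow> u \<notin> pp 1"
proof
  assume u: "u \<in> TT" "u \<in> pp 1"
  then have "inverse u * u \<in> pp 1" by (intro pp_mult_left RR_UU UU_inverse)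
  then show False using UU_neq_0[OF u(1)] one_notin_pp by simp
qed

lemma unit_decomp:
  assumes "v \<in> RR" "v \<notin> pp 1"
  obtains \<alpha> w where "\<alpha> \<in> TT" "pu w" "v = \<alpha> * w"
proof -
  obtain s where s: "s \<in> TT0" "v - s \<in> pp 1" using teichmueller_ex[OF assms(1)] .
  have "s \<noteq> 0" using s assms by auto
  then have sU: "s \<in> TT" using s by (simp add: UU_iff_UU0)
  have "inverse s * (v - s) \<in> pp 1" using s sU by (intro pp_mult_left RR_UU UU_inverse)
  then have "pu (v / s)" using \<open>s \<noteq> 0\<close> by (simp add: pu_def field_simps)
  then show ?thesis using that[of s "v / s"] sU \<open>s \<noteq> 0\<close> by simp
qed

text \<open>A closed form of \<eta> on principal units, identified in \<open>eta_eq\<close>. It is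
  multiplicative because the product of (1 - w^2) / 4 and (1 - w'^2) / 4 is integral.\<close>

definition et :: "'k \<Rightarrow> complex" where "et w = e_pi ((1 - w\<^sup>2) / 16)"

lemma et_eq: "et (1 + 2 * y) = e_pi (- (y\<^sup>2 + y) / 4)"
proof -
  have "(1 - (1 + 2 * y)\<^sup>2) / 16 = - (y\<^sup>2 + y) / 4" by (simp add: power2_eq_square field_simps)
  then show ?thesis by (simp only: et_def)
qed

lemma pu_square_quarter: "pu w \<Longrightarrow> (1 - w\<^sup>2) / 4 \<in> RR"
proof (elim pu_obtain)
  fix y assume "y \<in> RR" "w = 1 + 2 * y"
  then have "(1 - w\<^sup>2) / 4 = - (y\<^sup>2 + y)" by (simp add: power2_eq_square field_simps)
  moreover have "- (y\<^sup>2 + y) \<in> RR" using \<open>y \<in> RR\<close> by (intro RR_closed RR_power)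
  ultimately show ?thesis by (simp only:)
qed

lemma et_mult: "pu w \<Longrightarrow> pu w' \<Longrightarrow> et (w * w') = et w * et w'"
proof -
  assume w: "pu w" "pu w'"
  have "- ((1 - w\<^sup>2) / 4 * ((1 - w'\<^sup>2) / 4)) \<in> RR" using pu_square_quarter w by blast
  moreover have "- ((1 - w\<^sup>2) / 4 * ((1 - w'\<^sup>2) / 4)) =
      (1 - (w * w')\<^sup>2) / 16 - ((1 - w\<^sup>2) / 16 + (1 - w'\<^sup>2) / 16)"
    by (simp add: field_simps)
  ultimately show ?thesis unfolding et_def e_pi_add[symmetric] by (intro e_pi_cong) simp
qed

text \<open>The doubled exponent is -(y^2 + y) / 2, where the character is trivial by
  \<open>e_pi_half_square\<close>.\<close>

lemma et_square: "pu w \<Longrightarrow> et w * et w = 1"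
proof (elim pu_obtain)
  fix y assume y: "y \<in> RR" "w = 1 + 2 * y"
  have "et w * et w = e_pi (- (y\<^sup>2 + y) / 4 + - (y\<^sup>2 + y) / 4)" by (simp only: y(2) et_eq e_pi_add)
  also have "- (y\<^sup>2 + y) / 4 + - (y\<^sup>2 + y) / 4 = - (y\<^sup>2 / 2) - y / 2" by (simp add: field_simps)
  also have "e_pi \<dots> = cnj (e_pi (y\<^sup>2 / 2)) * cnj (e_pi (y / 2))" by (simp only: e_pi_diff e_pi_minus)
  also have "\<dots> = e_pi (y / 2) * cnj (e_pi (y / 2))" using y by (simp add: e_pi_half_square e_pi_half_cnj)
  finally show ?thesis by simp
qed

lemma et_cnj: "pu w \<Longrightarrow> cnj (et w) = et w"
proof -
  assume "pu w"
  then have "et w = 1 \<or> et w = - 1" using et_square by (metis power2_eq_1_iff power2_eq_square)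
  then show ?thesis by auto
qed

text \<open>Any digits a, b, c of \<alpha>w force a = \<alpha>. With \<beta> = b / a and \<gamma> =
  c / a the exponent of \<open>et w\<close> reduces to -(\<beta>^2 + \<beta>) / 4 - \<gamma> / 2;
  the Frobenius replaces \<beta>^2 by \<beta>, and the sign of \<gamma> / 2 is immaterial modulo
  integers.\<close>

lemma eta_eq:
  assumes \<alpha>: "\<alpha> \<in> TT" and w: "pu w"
  shows "eta \<zeta> (\<alpha> * w) = et w"
proof -
  define v where "v = \<alpha> * w"
  have \<alpha>0: "\<alpha> \<noteq> 0" using UU_neq_0[OF \<alpha>] .
  have vR: "v \<in> RR" using RR_UU[OF \<alpha>] pu_RR[OF w] by (auto simp: v_def)
  have v\<alpha>: "v - \<alpha> \<in> pp 1"
  proof -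
    have "\<alpha> * (w - 1) \<in> pp 1" using w RR_UU[OF \<alpha>] unfolding pu_def by (intro pp_mult_left)
    then show ?thesis by (simp add: v_def algebra_simps)
  qed
  have val: "e_pi ((c - b) / (2 * a)) = et w"
    if abc: "a \<in> TT" "b \<in> TT0" "c \<in> TT0" "v - (a + 2 * b + 4 * c) \<in> pp 3" for a b c
  proof -
    have "v - (a + 2 * b + 4 * c) \<in> pp 1" using abc(4) pp_antimono[of 1 3] by simp
    moreover have "b + 2 * c \<in> RR"
      using RR_UU0[OF abc(2)] RR_UU0[OF abc(3)] by (intro RR_closed(3,5)) simp_all
    ultimately have "v - (a + 2 * b + 4 * c) + 2 * (b + 2 * c) \<in> pp 1"
      using pp_closed(2)[OF _ pp_two] by blast
    then have "v - a \<in> pp 1" by (simp add: algebra_simps)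
    then have "\<alpha> - a \<in> pp 1" using pp_cong_trans[OF pp_cong_sym[OF v\<alpha>]] by blast
    then have a: "a = \<alpha>" using teichmueller_unique[OF UU_sub_UU0[OF \<alpha>] UU_sub_UU0[OF abc(1)]] by simp
    define \<beta> \<gamma> where "\<beta> = b / a" and "\<gamma> = c / a"
    have bg: "\<beta> \<in> TT0" "\<gamma> \<in> TT0" using abc by (auto simp: \<beta>_def \<gamma>_def UU0_divide UU_sub_UU0)
    note bgR = RR_UU0[OF bg(1)] RR_UU0[OF bg(2)]
    have "inverse \<alpha> * (v - (a + 2 * b + 4 * c)) \<in> pp 3"
      using abc \<alpha> by (intro pp_mult_left RR_UU UU_inverse)
    also have "inverse \<alpha> * (v - (a + 2 * b + 4 * c)) = w - (1 + 2 * \<beta> + 4 * \<gamma>)"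
      using \<alpha>0 by (simp add: v_def a \<beta>_def \<gamma>_def field_simps)
    finally obtain z where z: "z \<in> RR" "w - (1 + 2 * \<beta> + 4 * \<gamma>) = 2 ^ 3 * z" by (rule pp_obtain)
    define y where "y = \<beta> + 2 * \<gamma> + 4 * z"
    have "w = 1 + 2 * y" using z(2) by (simp add: y_def algebra_simps)
    then have "et w = e_pi (- (y\<^sup>2 + y) / 4)" by (simp only: et_eq)
    also have "\<dots> = e_pi (- (\<beta>\<^sup>2 / 4) - \<beta> / 4 - \<gamma> / 2)"
    proof (rule e_pi_cong)
      have "- (y\<^sup>2 + y) / 4 - (- (\<beta>\<^sup>2 / 4) - \<beta> / 4 - \<gamma> / 2) =
          - (\<beta> * \<gamma> + \<gamma>\<^sup>2 + 2 * \<beta> * z + 4 * \<gamma> * z + 4 * z\<^sup>2 + z)"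
        by (simp add: y_def power2_eq_square field_simps)
      also have "\<dots> \<in> RR" using bgR z by (intro RR_closed RR_power) simp_all
      finally show "- (y\<^sup>2 + y) / 4 - (- (\<beta>\<^sup>2 / 4) - \<beta> / 4 - \<gamma> / 2) \<in> RR" .
    qed
    also have "\<dots> = cnj (e_pi (\<beta>\<^sup>2 / 4)) * cnj (e_pi (\<beta> / 4)) * cnj (e_pi (\<gamma> / 2))"
      by (simp only: e_pi_diff e_pi_minus)
    also have "e_pi (\<beta>\<^sup>2 / 4) = e_pi (\<beta> / 4)" using e_pi_div_pow2_square[OF bg(1), of 2] by simp
    also have "cnj (e_pi (\<beta> / 4)) * cnj (e_pi (\<beta> / 4)) * cnj (e_pi (\<gamma> / 2)) =
        e_pi (- (\<beta> / 4) - \<beta> / 4 - \<gamma> / 2)" by (simp only: e_pi_diff e_pi_minus)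
    also have "\<dots> = e_pi ((c - b) / (2 * a))"
    proof (rule e_pi_cong)
      have "- (\<beta> / 4) - \<beta> / 4 - \<gamma> / 2 - (\<gamma> - \<beta>) / 2 = - \<gamma>" by (simp add: field_simps)
      moreover have "(\<gamma> - \<beta>) / 2 = (c - b) / (2 * a)" by (simp add: \<beta>_def \<gamma>_def diff_divide_distrib mult.commute)
      ultimately show "- (\<beta> / 4) - \<beta> / 4 - \<gamma> / 2 - (c - b) / (2 * a) \<in> RR"
        using bgR RR_closed(6) by metis
    qed
    finally show ?thesis by simp
  qed
  obtain r where r: "r \<in> reps 3" "v - r \<in> pp 3" using reps_ex[OF vR] by blast
  obtain s y where s: "s \<in> TT0" "y \<in> reps 2" "r = s + 2 * y"
    using r(1) by (auto simp: numeral_3_eq_3 numeral_2_eq_2)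
  obtain b y' where b: "b \<in> TT0" "y' \<in> reps 1" "y = b + 2 * y'" using s(2) by (auto simp: numeral_2_eq_2)
  obtain c where c: "c \<in> TT0" "y' = c" using b(2) by auto
  have r_eq: "r = s + 2 * b + 4 * c" using s b c by simp
  have "s \<noteq> 0"
  proof
    assume "s = 0"
    then have "r = 2 * y" using s by simp
    then have "r \<in> pp 1" using reps_RR[OF s(2)] by blast
    moreover have "v - r \<in> pp 1" using r(2) pp_antimono[of 1 3] by simp
    ultimately have "(v - r) + r - (v - \<alpha>) \<in> pp 1" using pp_closed(3)[OF pp_closed(2) v\<alpha>] by blast
    then show False using UU_notin_pp[OF \<alpha>] by simp
  qed
  then have sU: "s \<in> TT" using s by (simp add: UU_iff_UU0)
  have "eta \<zeta> v = et w"
    unfolding eta_def p_pow_numeral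
  proof (rule the_equality)
    show "\<exists>a\<in>TT. \<exists>b\<in>TT0. \<exists>c\<in>TT0. v - (a + 2 * b + 4 * c) \<in> pp 3 \<and> et w = e_pi ((c - b) / (2 * a))"
      using val[OF sU b(1) c(1)] r(2) sU b(1) c(1) unfolding r_eq by metis
    fix z assume "\<exists>a\<in>TT. \<exists>b\<in>TT0. \<exists>c\<in>TT0. v - (a + 2 * b + 4 * c) \<in> pp 3 \<and> z = e_pi ((c - b) / (2 * a))"
    then show "z = et w" using val by metis
  qed
  then show ?thesis by (simp only: v_def)
qed

lemma eta_pu: "pu w \<Longrightarrow> eta \<zeta> w = et w"
  using eta_eq[of 1 w] by simp

text \<open>The exponent q - 1 serves to remove roots of unity; here it is seen not to disturb the
  phase of a principal unit. For f > 1, w^q is 1 modulo 8, so w^(q-1) acts as the inverse of w, and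
  w exceeds its inverse by 4t / w, where t = y^2 + y has trivial character at denominator 2.\<close>

lemma e_pi_eighth_power:
  assumes w: "pu w" and m: "m \<in> RR" "m \<in> pp 1 \<or> pu m"
  shows "e_pi (m * w ^ (q - 1) / 8) = e_pi (m * w / 8)"
proof (cases "f = 1")
  case False
  obtain y where y: "y \<in> RR" "w = 1 + 2 * y" using pu_obtain[OF w] .
  define t where "t = y\<^sup>2 + y"
  have t: "t \<in> RR" using y by (auto simp: t_def intro: RR_closed)
  have w2: "w\<^sup>2 = 1 + 4 * t" by (simp add: y t_def power2_eq_square algebra_simps)
  have pw: "x ^ n - 1 \<in> pp 3" if "x - 1 \<in> pp 3" "x \<in> RR" for x n
  proof (induction n)
    case (Suc n)
    have "x * (x ^ n - 1) + (x - 1) \<in> pp 3" using Suc that by (intro pp_closed(2) pp_mult_left)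
    then show ?case by (simp add: algebra_simps)
  qed auto
  have "w ^ 4 = (1 + 4 * t)\<^sup>2" unfolding w2[symmetric] by (simp add: power4_eq_xxxx power2_eq_square)
  then have "w ^ 4 - 1 = 2 ^ 3 * (t + 2 * t\<^sup>2)" by (simp only:) (simp add: power2_eq_square algebra_simps)
  moreover have "2 ^ 3 * (t + 2 * t\<^sup>2) \<in> pp 3" using t by (intro pp_pow2 RR_closed RR_power) simp_all
  ultimately have w4: "w ^ 4 - 1 \<in> pp 3" by metis
  have "q = 2 ^ (2 + (f - 2))" using f False by (intro arg_cong[where f = "\<lambda>n. 2 ^ n"]) simp
  then have q4: "q = 4 * 2 ^ (f - 2)" unfolding power_add by simp
  have wq: "w ^ q - 1 \<in> pp 3" unfolding q4 power_mult by (rule pw[OF w4 RR_power[OF pu_RR[OF w]]])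
  obtain z where z: "z \<in> RR" "w ^ q - 1 = 2 ^ 3 * z" using pp_obtain[OF wq] .
  define i where "i = inverse w"
  have w0: "w \<noteq> 0" using pu_notin_pp[OF w] by auto
  have iR: "i \<in> RR" "pu i" using pu_inverse[OF w] pu_RR by (auto simp: i_def)
  have wq1: "w ^ (q - 1) * w = w ^ q" by (rule power_minus_mult) simp
  have "i * w = 1" using w0 by (simp add: i_def)
  then have "w ^ (q - 1) = w ^ (q - 1) * (i * w)" by (simp only: mult_1_right)
  also have "\<dots> = i * w ^ q" unfolding wq1[symmetric] by (simp only: mult_ac)
  also have "w ^ q = 1 + 8 * z"
  proof -
    have "w ^ q = 1 + (w ^ q - 1)" by simp
    also have "\<dots> = 1 + 8 * z" unfolding z(2) by simp
    finally show ?thesis .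
  qed
  finally have "w ^ (q - 1) = i * (1 + 8 * z)" .
  moreover have "w = i * (1 + 4 * t)" using w0 w2 by (simp add: i_def power2_eq_square field_simps)
  ultimately have "m * w ^ (q - 1) / 8 - m * w / 8 = m * (i * (1 + 8 * z)) / 8 - m * (i * (1 + 4 * t)) / 8"
    by metis
  also have "\<dots> = m * i * z - m * t * (i - 1) / 2 - m * t / 2"
    by (simp add: field_simps)
  finally have "m * w ^ (q - 1) / 8 = m * w / 8 + (m * i * z - m * t * (i - 1) / 2) - m * t / 2"
    by (simp add: algebra_simps)
  then obtain B where eq: "m * w ^ (q - 1) / 8 = m * w / 8 + B - m * t / 2"
    and B: "B = m * i * z - m * t * (i - 1) / 2" by blast
  have "(i - 1) / 2 \<in> RR" using iR(2) unfolding pu_def pp_1_half .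
  then have "m * i * z - m * t * ((i - 1) / 2) \<in> RR" using m t z iR by (intro RR_closed)
  then have 1: "B \<in> RR" by (simp add: B)
  have et: "e_pi (t / 2) = 1"
  proof -
    have "e_pi (t / 2) = e_pi (y\<^sup>2 / 2) * e_pi (y / 2)" by (simp add: t_def add_divide_distrib e_pi_add)
    also have "\<dots> = e_pi (y / 2) * cnj (e_pi (y / 2))" using y by (simp add: e_pi_half_square e_pi_half_cnj)
    finally show ?thesis by simp
  qed
  have "e_pi (m * t / 2) = 1"
    using m(2)
  proof
    assume "m \<in> pp 1"
    then have "m / 2 * t \<in> RR" using t unfolding pp_1_half by blast
    then show ?thesis by (simp add: e_pi_RR)
  next
    assume "pu m"
    then have "(m - 1) / 2 * t \<in> RR" using t unfolding pu_def pp_1_half by blast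
    then have "e_pi (m * t / 2) = e_pi (t / 2)" by (intro e_pi_cong) (simp add: field_simps)
    then show ?thesis using et by simp
  qed
  then show ?thesis unfolding eq e_pi_diff e_pi_add using e_pi_RR[OF 1] by simp
qed simp

section \<open>Quadratic Gauss integrals\<close>

lemma gauss_integral_RR: "c \<in> RR \<Longrightarrow> MM (\<lambda>x. e_pi (c * x\<^sup>2)) = 1"
proof -
  assume "c \<in> RR"
  then have "MM (\<lambda>x. e_pi (c * x\<^sup>2)) = MM (\<lambda>x. 1)" by (intro MM_cong e_pi_RR) blast
  then show ?thesis by simp
qed

text \<open>Squaring is additive modulo 2, so a quadratic phase with denominator 2 is linear, with a
  square root of v modulo 2 as coefficient.\<close>

lemma e_pi_half_unit_square:
  assumes \<alpha>: "\<kappa> \<in> RR" and v: "v - \<kappa>\<^sup>2 \<in> pp 1" and x: "x \<in> RR"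
  shows "e_pi (v * x\<^sup>2 / 2) = e_pi (\<kappa> * x / 2)"
proof -
  have "(v - \<kappa>\<^sup>2) / 2 * x\<^sup>2 \<in> RR" using v x unfolding pp_1_half by blast
  then have "e_pi (v * x\<^sup>2 / 2) = e_pi ((\<kappa> * x)\<^sup>2 / 2)"
    by (intro e_pi_cong) (simp add: field_simps)
  also have "\<dots> = e_pi (\<kappa> * x / 2)" using \<alpha> x by (intro e_pi_half_square) blast
  finally show ?thesis .
qed

lemma sqrt_mod_2:
  assumes "v \<in> RR"
  obtains \<kappa> where "\<kappa> \<in> TT0" "v - \<kappa>\<^sup>2 \<in> pp 1" "v \<notin> pp 1 \<Longrightarrow> \<kappa> \<in> TT"
proof -
  obtain s where s: "s \<in> TT0" "v - s \<in> pp 1" using teichmueller_ex[OF assms] .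
  obtain \<kappa> where \<kappa>: "\<kappa> \<in> TT0" "\<kappa>\<^sup>2 = s" using UU0_sqrt[OF s(1)] .
  have "\<kappa> \<in> TT" if "v \<notin> pp 1"
  proof -
    have "s \<noteq> 0" using s that by auto
    then show ?thesis using \<kappa> by (auto simp: UU_iff_UU0)
  qed
  then show ?thesis using that[of \<kappa>] \<kappa> s by simp
qed

lemma gauss_integral_1:
  assumes v: "v \<in> RR" "v \<notin> pp 1"
  shows "MM (\<lambda>x. e_pi (v / 2 * x\<^sup>2)) = 0"
proof -
  obtain \<kappa> where k: "\<kappa> \<in> TT0" "v - \<kappa>\<^sup>2 \<in> pp 1" "\<kappa> \<in> TT" using sqrt_mod_2[OF v(1)] v(2) by blast
  have "MM (\<lambda>x. e_pi (v / 2 * x\<^sup>2)) = MM (\<lambda>x. e_pi (\<kappa> * x / 2))"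
    using e_pi_half_unit_square[OF RR_UU0[OF k(1)] k(2)] by (intro MM_cong) simp
  also have "\<dots> = 0" using MM_char_half[OF RR_UU0[OF k(1)]] UU_notin_pp[OF k(3)] by simp
  finally show ?thesis .
qed

text \<open>Every root of unity here is the square of another one, so it can be absorbed into
  x.\<close>

lemma gauss_integral_teich:
  assumes "\<alpha> \<in> TT"
  shows "MM (\<lambda>x. e_pi (\<alpha> * c * x\<^sup>2)) = MM (\<lambda>x. e_pi (c * x\<^sup>2))"
proof -
  obtain \<kappa> where k: "\<kappa> \<in> TT" "\<kappa>\<^sup>2 = \<alpha>" using UU_sqrt[OF assms] .
  have "MM (\<lambda>x. e_pi (c * x\<^sup>2)) = MM (\<lambda>x. e_pi (c * (\<kappa> * x)\<^sup>2))"
    by (rule MM_scale[symmetric, OF lc_e_pi_sq RR_UU UU_notin_pp]) (rule k)+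
  also have "\<dots> = MM (\<lambda>x. e_pi (\<alpha> * c * x\<^sup>2))" by (simp add: k(2)[symmetric] power_mult_distrib mult_ac)
  finally show ?thesis ..
qed

text \<open>With w = 1 + 2y, the extra phase y x^2 / 2 is linear, namely t x / 2 with t^2 congruent
  to y modulo 2; it amounts to a translation by t of the case w = 1.\<close>

lemma gauss_integral_2:
  assumes w: "pu w"
  shows "MM (\<lambda>x. e_pi (w / 4 * x\<^sup>2)) =
    (- 1) ^ (f - 1) / rootq * et w * e_pi (w / 8)"
proof -
  obtain y where y: "y \<in> RR" "w = 1 + 2 * y" using pu_obtain[OF w] .
  obtain s where s: "s \<in> TT0" "y - s \<in> pp 1" using teichmueller_ex[OF y(1)] .
  obtain t where t: "t \<in> TT0" "t\<^sup>2 = s" using UU0_sqrt[OF s(1)] .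
  note tR = RR_UU0[OF t(1)]
  define psi where "psi x = e_pi (x\<^sup>2 / 4)" for x :: 'k
  have psi_lc: "lc psi" using lc_e_pi_sq[of "1 / 4"] by (simp add: psi_def[abs_def])
  have h: "e_pi (w / 4 * x\<^sup>2) = cnj (psi t) * psi (x + t)" if x: "x \<in> RR" for x
  proof -
    have "w / 4 * x\<^sup>2 = x\<^sup>2 / 4 + y * x\<^sup>2 / 2" by (simp add: y field_simps)
    then have "e_pi (w / 4 * x\<^sup>2) = psi x * e_pi (y * x\<^sup>2 / 2)" by (simp only: e_pi_add psi_def)
    also have "e_pi (y * x\<^sup>2 / 2) = e_pi (t * x / 2)"
      using s(2) t x tR by (intro e_pi_half_unit_square) simp_all
    also have "psi x * e_pi (t * x / 2) = (psi t * cnj (psi t)) * (psi x * e_pi (t * x / 2))"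
      by (simp only: psi_def e_pi_minus_mult mult_1_left)
    also have "\<dots> = cnj (psi t) * (psi x * psi t * e_pi (t * x / 2))" by (simp only: mult_ac)
    also have "psi x * psi t * e_pi (t * x / 2) = psi (x + t)"
      unfolding psi_def e_pi_add[symmetric]
      by (rule arg_cong[where f = e_pi]) (simp add: power2_eq_square field_simps)
    finally show ?thesis .
  qed
  have "MM (\<lambda>x. e_pi (w / 4 * x\<^sup>2)) = MM (\<lambda>x. cnj (psi t) * psi (x + t))" by (intro MM_cong h)
  also have "\<dots> = cnj (psi t) * MM psi" unfolding MM_cmult MM_shift[OF psi_lc tR] ..
  also have "MM psi = (- 1) ^ (f - 1) / rootq * e_pi (1 / 8 :: 'k)"
    using MM_psi by (simp add: psi_def[abs_def])
  finally have 1: "MM (\<lambda>x. e_pi (w / 4 * x\<^sup>2)) =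
      (- 1) ^ (f - 1) / rootq * (cnj (psi t) * e_pi (1 / 8 :: 'k))" by simp
  have "psi t = e_pi (s / 4)" by (simp add: psi_def t)
  also have "\<dots> = e_pi (s\<^sup>2 / 4)" using e_pi_div_pow2_square[OF s(1), of 2] by simp
  also have "\<dots> = e_pi (y\<^sup>2 / 4)"
  proof (rule e_pi_cong[symmetric])
    have "y\<^sup>2 - s\<^sup>2 \<in> pp 2" using square_cong[of y s 0] s RR_UU0[OF s(1)] by (simp add: numeral_2_eq_2)
    then show "y\<^sup>2 / 4 - s\<^sup>2 / 4 \<in> RR" by (simp add: pp_def diff_divide_distrib)
  qed
  finally have "cnj (psi t) * e_pi (1 / 8 :: 'k) = e_pi (- (y\<^sup>2 / 4) + 1 / 8)"
    by (simp add: e_pi_add e_pi_minus e_pi_diff)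
  also have "- (y\<^sup>2 / 4) + 1 / 8 = (1 - w\<^sup>2) / 16 + w / 8"
    by (simp add: y power2_eq_square field_simps)
  also have "e_pi \<dots> = et w * e_pi (w / 8)" by (simp only: e_pi_add et_def)
  finally show ?thesis unfolding 1 by (simp add: mult_ac)
qed

text \<open>Writing x = s + 2y makes the phase linear in y with coefficient (s + 1) / 2, so only the
  digit s = 1 survives.\<close>

lemma gauss_integral_3:
  assumes w: "pu w"
  shows "MM (\<lambda>x. e_pi (w / 8 * x\<^sup>2)) = e_pi (w / 8) / of_nat q"
proof -
  have wR: "w \<in> RR" using pu_RR[OF w] .
  have "MM (\<lambda>y. e_pi (w / 8 * (s + 2 * y)\<^sup>2)) = (if s = 1 then e_pi (w / 8) else 0)" if s: "s \<in> TT0" for s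
  proof -
    have sR: "s \<in> RR" using RR_UU0[OF s] .
    have "e_pi (w / 8 * (s + 2 * y)\<^sup>2) = e_pi (w / 8 * s\<^sup>2) * e_pi ((s + 1) * y / 2)" if y: "y \<in> RR" for y
    proof -
      have "w / 8 * (s + 2 * y)\<^sup>2 = w / 8 * s\<^sup>2 + w * (s * y + y\<^sup>2) / 2"
        by (simp add: power2_eq_square field_simps)
      then have "e_pi (w / 8 * (s + 2 * y)\<^sup>2) = e_pi (w / 8 * s\<^sup>2) * e_pi (w * (s * y + y\<^sup>2) / 2)"
        by (simp only: e_pi_add)
      also have "e_pi (w * (s * y + y\<^sup>2) / 2) = e_pi (s * y / 2 + y\<^sup>2 / 2)"
      proof (rule e_pi_cong)
        have "(w - 1) / 2 * (s * y + y\<^sup>2) \<in> RR"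
          using w sR y unfolding pu_def pp_1_half by (intro RR_closed RR_power)
        moreover have "(w - 1) / 2 * (s * y + y\<^sup>2) = w * (s * y + y\<^sup>2) / 2 - (s * y / 2 + y\<^sup>2 / 2)"
          by (simp add: field_simps)
        ultimately show "w * (s * y + y\<^sup>2) / 2 - (s * y / 2 + y\<^sup>2 / 2) \<in> RR" by (simp only:)
      qed
      also have "\<dots> = e_pi (s * y / 2 + y / 2)" using y by (simp only: e_pi_add e_pi_half_square)
      also have "s * y / 2 + y / 2 = (s + 1) * y / 2" by (simp add: field_simps)
      finally show ?thesis .
    qed
    then have "MM (\<lambda>y. e_pi (w / 8 * (s + 2 * y)\<^sup>2)) = MM (\<lambda>y. e_pi (w / 8 * s\<^sup>2) * e_pi ((s + 1) * y / 2))"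
      by (intro MM_cong)
    also have "\<dots> = e_pi (w / 8 * s\<^sup>2) * (if s + 1 \<in> pp 1 then 1 else 0)"
      unfolding MM_cmult using MM_char_half[of "s + 1"] sR by (simp add: RR_closed)
    also have "s + 1 \<in> pp 1 \<longleftrightarrow> s = 1"
    proof
      assume "s + 1 \<in> pp 1"
      then have "(s + 1) - 2 * 1 \<in> pp 1" by (intro pp_closed(3) pp_two) simp_all
      then have "s - 1 \<in> pp 1" by simp
      then show "s = 1" using s by (intro teichmueller_unique) auto
    next
      assume "s = 1"
      then show "s + 1 \<in> pp 1" using pp_two[of 1] by simp
    qed
    finally show ?thesis by simp
  qed
  then have "MM (\<lambda>x. e_pi (w / 8 * x\<^sup>2)) = (\<Sum>s\<in>TT0. if s = 1 then e_pi (w / 8) else 0) / of_nat q"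
    unfolding MM_split[OF lc_e_pi_sq[of "w / 8"]] by (intro arg_cong2[where f = "(/)"] sum.cong refl)
  then show ?thesis by simp
qed

lemma half_char_witness:
  assumes "v \<in> RR" "v \<notin> pp 1"
  obtains r where "r \<in> RR" "e_pi (v * r / 2) \<noteq> 1"
proof -
  have "v / 2 \<notin> RR" using assms unfolding pp_1_half by blast
  then obtain r where "r \<in> RR" "e_pi (v / 2 * r) \<noteq> 1" using e_pi_nondeg by blast
  then show ?thesis using that[of r] by simp
qed

lemma RR_unit_mult:
  assumes "v \<in> RR" "v \<notin> pp 1" "v' \<in> RR" "v' \<notin> pp 1"
  shows "v * v' \<in> RR" "v * v' \<notin> pp 1"
  using assms pp_prime[OF assms(1,3)] by auto

text \<open>A unit digit s of x = s + 2y is killed by translating y by 2^(k+1) r; for s = 0 the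
  substitution x = 2y removes two powers of 2.\<close>

lemma gauss_integral_rec:
  assumes v: "v \<in> RR" "v \<notin> pp 1"
  shows "MM (\<lambda>x. e_pi (v / 2 ^ (k + 4) * x\<^sup>2)) = MM (\<lambda>x. e_pi (v / 2 ^ (k + 2) * x\<^sup>2)) / of_nat q"
proof -
  have "MM (\<lambda>y. e_pi (v / 2 ^ (k + 4) * (s + 2 * y)\<^sup>2)) = 0" if s: "s \<in> TT0" "s \<noteq> 0" for s
  proof -
    have sU: "s \<in> TT" using s by (simp add: UU_iff_UU0)
    obtain r where r: "r \<in> RR" "e_pi (v * s * r / 2) \<noteq> 1"
      using half_char_witness[OF RR_unit_mult[OF v RR_UU[OF sU] UU_notin_pp[OF sU]]] .
    have "lc (\<lambda>y. e_pi (v / 2 ^ (k + 4) * (2 * y + s)\<^sup>2))"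
      using lc_affine[OF lc_e_pi_sq[of "v / 2 ^ (k + 4)"], of 2 s] RR_UU[OF sU] by simp
    then have "lc (\<lambda>y. e_pi (v / 2 ^ (k + 4) * (s + 2 * y)\<^sup>2))" by (simp only: add.commute)
    then show ?thesis
    proof (rule MM_eq_0[of _ "2 ^ (k + 1) * r" "e_pi (v * s * r / 2)"])
      show "2 ^ (k + 1) * r \<in> RR" by (intro RR_closed(5) RR_numeral_power r)
      show "e_pi (v * s * r / 2) \<noteq> 1" by (rule r)
      fix y assume y: "y \<in> RR"
      have "v / 2 ^ (k + 4) * (s + 2 * (y + 2 ^ (k + 1) * r))\<^sup>2 -
          (v * s * r / 2 + v / 2 ^ (k + 4) * (s + 2 * y)\<^sup>2) = v * y * r + 2 ^ k * v * r\<^sup>2"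
        by (simp add: power2_eq_square power_add field_simps)
      moreover have "v * y * r + 2 ^ k * v * r\<^sup>2 \<in> RR" using v y r by (intro RR_closed RR_power) simp_all
      ultimately show "e_pi (v / 2 ^ (k + 4) * (s + 2 * (y + 2 ^ (k + 1) * r))\<^sup>2) =
          e_pi (v * s * r / 2) * e_pi (v / 2 ^ (k + 4) * (s + 2 * y)\<^sup>2)"
        unfolding e_pi_add[symmetric] by (intro e_pi_cong) (simp only:)
    qed
  qed
  then have "(\<Sum>s\<in>TT0. MM (\<lambda>y. e_pi (v / 2 ^ (k + 4) * (s + 2 * y)\<^sup>2))) =
      (\<Sum>s\<in>TT0. if s = 0 then MM (\<lambda>y. e_pi (v / 2 ^ (k + 2) * y\<^sup>2)) else 0)"
  proof (intro sum.cong refl)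
    fix s assume s: "s \<in> TT0"
      and *: "\<And>s. s \<in> TT0 \<Longrightarrow> s \<noteq> 0 \<Longrightarrow> MM (\<lambda>y. e_pi (v / 2 ^ (k + 4) * (s + 2 * y)\<^sup>2)) = 0"
    have "v / 2 ^ (k + 4) * (0 + 2 * y)\<^sup>2 = v / 2 ^ (k + 2) * y\<^sup>2" for y
      by (simp add: power2_eq_square power_add field_simps)
    then show "MM (\<lambda>y. e_pi (v / 2 ^ (k + 4) * (s + 2 * y)\<^sup>2)) =
        (if s = 0 then MM (\<lambda>y. e_pi (v / 2 ^ (k + 2) * y\<^sup>2)) else 0)"
      using *[OF s] by (cases "s = 0") (simp_all only: if_True if_False simp_thms)
  qed
  then show ?thesis unfolding MM_split[OF lc_e_pi_sq[of "v / 2 ^ (k + 4)"]] by simp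
qed

lemma q_pos: "0 < real q"
  by simp

lemma powr_minus_half: "0 < x \<Longrightarrow> x powr (- 1 / 2) = 1 / sqrt x"
  using powr_minus_divide[of x "1 / 2"] powr_half_sqrt[of x] by simp

lemma powr_minus_one': "0 < x \<Longrightarrow> x powr (- 1) = 1 / x" for x :: real
  using powr_minus_divide[of x 1] by simp

text \<open>Denominators 4 and 8 are the base cases and the recursion moves in steps of two, so the
  parity of k decides which of the two shapes persists.\<close>

lemma gauss_integral:
  assumes \<alpha>: "\<alpha> \<in> TT" and w: "pu w"
  shows "MM (\<lambda>x. e_pi (\<alpha> * w / 2 ^ (k + 2) * x\<^sup>2)) =
    complex_of_real (real q powr (- (real k + 1) / 2)) *
      (if even k then (- 1) ^ (f - 1) * et w else 1) * e_pi (w / 8)"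
proof (induction k rule: induct_nat_012)
  case 0
  have e: "\<alpha> * w / 2 ^ (0 + 2) = \<alpha> * (w / 4)" "- (real 0 + 1) / 2 = - 1 / 2" by simp_all
  show ?case
    unfolding e gauss_integral_teich[OF \<alpha>] gauss_integral_2[OF w] powr_minus_half[OF q_pos]
      of_real_divide of_real_1
    by (simp only: even_zero if_True mult.assoc times_divide_eq_left times_divide_eq_right mult_1_left)
next
  case 1
  have e: "\<alpha> * w / 2 ^ (Suc 0 + 2) = \<alpha> * (w / 8)" "- (real (Suc 0) + 1) / 2 = - 1" by simp_all
  have o: "even (Suc 0) \<longleftrightarrow> False" by simp
  show ?case
    unfolding e gauss_integral_teich[OF \<alpha>] gauss_integral_3[OF w] powr_minus_one'[OF q_pos]
      of_real_divide of_real_1 o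
    by (simp only: if_False mult_1_right mult_1_left times_divide_eq_left of_real_of_nat_eq)
next
  case (ge2 k)
  have v: "\<alpha> * w \<in> RR" "\<alpha> * w \<notin> pp 1"
    using RR_unit_mult[OF RR_UU[OF \<alpha>] UU_notin_pp[OF \<alpha>] pu_RR[OF w] pu_notin_pp[OF w]] by blast+
  have "real q powr (- (real (Suc (Suc k)) + 1) / 2) = real q powr (- (real k + 1) / 2 + - 1)"
    by (rule arg_cong[where f = "\<lambda>z. real q powr z"]) (simp add: field_simps)
  also have "\<dots> = real q powr (- (real k + 1) / 2) / real q"
    unfolding powr_add powr_minus_one'[OF q_pos] by (simp only: times_divide_eq_right mult_1_right)
  finally have pw: "complex_of_real (real q powr (- (real (Suc (Suc k)) + 1) / 2)) =
      complex_of_real (real q powr (- (real k + 1) / 2)) / of_nat q"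
    by (simp only: of_real_divide of_real_of_nat_eq)
  have k4: "Suc (Suc k) + 2 = k + 4" by simp
  have "MM (\<lambda>x. e_pi (\<alpha> * w / 2 ^ (Suc (Suc k) + 2) * x\<^sup>2)) =
      MM (\<lambda>x. e_pi (\<alpha> * w / 2 ^ (k + 2) * x\<^sup>2)) / of_nat q"
    unfolding k4 by (rule gauss_integral_rec[OF v])
  then show ?case unfolding pw ge2(1)
    by (simp only: times_divide_eq_left times_divide_eq_right even_Suc_Suc_iff)
qed

end

context unram
begin

section \<open>The normalized valuation\<close>

definition uni :: "'k \<Rightarrow> bool" where "uni v \<longleftrightarrow> v \<in> RR \<and> v \<notin> pp 1"

lemma uni_neq_0: "uni v \<Longrightarrow> v \<noteq> 0"
  by (auto simp: uni_def)

lemma uni_inverse: "uni v \<Longrightarrow> inverse v \<in> RR"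
  by (simp add: uni_def RR_unit)

lemma uni_mult: "uni v \<Longrightarrow> uni v' \<Longrightarrow> uni (v * v')"
  unfolding uni_def using RR_unit_mult by blast

lemma uni_UU: "u \<in> TT \<Longrightarrow> uni u" and uni_pu: "pu w \<Longrightarrow> uni w"
  by (simp_all only: uni_def RR_UU UU_notin_pp pu_RR pu_notin_pp simp_thms)

lemma uni_inverse_uni: "uni v \<Longrightarrow> uni (inverse v)"
proof -
  assume v: "uni v"
  have "inverse v \<notin> pp 1"
  proof
    assume "inverse v \<in> pp 1"
    then have "v * inverse v \<in> pp 1" using v unfolding uni_def by blast
    then show False using uni_neq_0[OF v] one_notin_pp by simp
  qed
  then show ?thesis using uni_inverse[OF v] by (simp add: uni_def)
qed

lemma unit_group_iff: "x \<in> unit_group \<longleftrightarrow> uni x"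
proof
  assume "x \<in> unit_group"
  then have x: "x \<in> RR" "x \<noteq> 0" "inverse x \<in> RR" by (auto simp: unit_group_def int_ring_eq)
  have "x \<notin> pp 1"
  proof
    assume "x \<in> pp 1"
    then have "inverse x * x \<in> pp 1" using x(3) by blast
    then show False using x(2) one_notin_pp by simp
  qed
  then show "uni x" using x by (simp add: uni_def)
next
  assume "uni x"
  then show "x \<in> unit_group" using uni_neq_0 uni_inverse by (auto simp: unit_group_def int_ring_eq uni_def)
qed

lemma powi2_neq_0 [simp]: "(2 :: 'k) powi k \<noteq> 0"
  by (simp add: power_int_eq_0_iff)

lemma unit_shell_iff: "x \<in> unit_shell k \<longleftrightarrow> uni (x / 2 powi k)"
proof
  assume "x \<in> unit_shell k"
  then show "uni (x / 2 powi k)" by (auto simp: unit_shell_def unit_group_iff)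
next
  assume "uni (x / 2 powi k)"
  then show "x \<in> unit_shell k"
    unfolding unit_shell_def by (intro image_eqI[of _ _ "x / 2 powi k"]) (simp_all add: unit_group_iff)
qed

lemma powi2_add: "(2 :: 'k) powi (k + l) = 2 powi k * 2 powi l"
  by (rule power_int_add) simp

lemma powi2_diff: "(2 :: 'k) powi (k - l) = 2 powi k / 2 powi l"
  by (rule power_int_diff) simp

lemma powi2_RR: "k \<ge> 0 \<Longrightarrow> 2 powi k \<in> RR"
  by (metis RR_numeral_power power_int_of_nat zero_le_imp_eq_int)

lemma uni_powi_RR_iff: "uni v \<Longrightarrow> 2 powi k * v \<in> RR \<longleftrightarrow> k \<ge> 0"
proof
  assume v: "uni v" and *: "2 powi k * v \<in> RR"
  show "k \<ge> 0"
  proof (rule ccontr)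
    assume "\<not> k \<ge> 0"
    define n where "n = nat (- k - 1)"
    have k: "k = - int n - 1" using \<open>\<not> k \<ge> 0\<close> by (simp add: n_def)
    have "2 ^ n * (2 powi k * v * inverse v) \<in> RR"
      by (intro RR_closed(5) RR_numeral_power * uni_inverse v)
    also have "2 ^ n * (2 powi k * v * inverse v) = 1 / 2"
      using uni_neq_0[OF v] by (simp add: k powi2_diff power_int_minus field_simps)
    finally show False using one_notin_pp unfolding pp_1_half by simp
  qed
next
  assume "uni v" "k \<ge> 0"
  then show "2 powi k * v \<in> RR" using powi2_RR unfolding uni_def by blast
qed

lemma ord_decomp:
  assumes "x \<noteq> 0"
  obtains k v where "uni v" "x = 2 powi k * v" "ord_p x = ereal (of_int k)"
proof -
  have ex: "\<exists>k v. uni v \<and> x = 2 powi k * v"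
  proof -
    obtain n where n: "x * 2 ^ n \<in> RR" using field_eq by blast
    have "x * 2 ^ n \<noteq> 0" using assms by simp
    then obtain l v where v: "x * 2 ^ n = 2 ^ l * v" "v \<in> RR" "v \<notin> pp 1" using RR_decomp[OF n] by blast
    have "x = 2 powi (int l - int n) * v" using v(1) by (simp add: powi2_diff field_simps)
    then show ?thesis using v unfolding uni_def by blast
  qed
  then obtain k v where v: "uni v" "x = 2 powi k * v" by blast
  \<comment> \<open>Uniqueness of the exponent, required by the definite description in
    \<open>ord_p\<close>.\<close>
  have "l = k" if "x \<in> unit_shell l" for l
  proof -
    define v' where "v' = x / 2 powi l"
    have v': "uni v'" using that by (simp add: unit_shell_iff v'_def)
    have "2 powi (k - l) * v = v'" "2 powi (l - k) * v' = v" by (simp_all add: v'_def v(2) powi2_diff)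
    then have "k - l \<ge> 0" "l - k \<ge> 0" using v v' uni_powi_RR_iff unfolding uni_def by metis+
    then show ?thesis by simp
  qed
  moreover have "x \<in> unit_shell k" using v by (simp add: unit_shell_iff)
  ultimately have "(THE k. x \<in> unit_shell k) = k" by blast
  then have "ord_p x = ereal (of_int k)" using assms by (simp add: ord_p_def)
  then show ?thesis using v that by blast
qed

lemma ord_p_ge_iff: "ereal (of_int k) \<le> ord_p x \<longleftrightarrow> x / 2 powi k \<in> RR"
proof (cases "x = 0")
  case True
  then show ?thesis by (simp add: ord_p_def)
next
  case False
  then obtain l v where l: "uni v" "x = 2 powi l * v" "ord_p x = ereal (of_int l)" by (rule ord_decomp)
  have "x / 2 powi k = 2 powi (l - k) * v" by (simp add: l powi2_diff)
  then show ?thesis using uni_powi_RR_iff[OF l(1), of "l - k"] l(3) by simp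
qed

lemma ord_p_gt_iff: "ereal (of_int k) < ord_p x \<longleftrightarrow> x / 2 powi (k + 1) \<in> RR"
proof -
  have "ereal (of_int k) < ord_p x \<longleftrightarrow> ereal (of_int (k + 1)) \<le> ord_p x"
  proof (cases "x = 0")
    case False
    then obtain l v where "ord_p x = ereal (of_int l)" using ord_decomp by metis
    then show ?thesis by (auto simp del: of_int_add)
  qed (simp add: ord_p_def)
  then show ?thesis by (simp only: ord_p_ge_iff)
qed

section \<open>Integrals of the blocks\<close>

lemma MM_e_pi_RR: "A \<in> RR \<Longrightarrow> B \<in> RR \<Longrightarrow> MM (\<lambda>x. e_pi (A * x\<^sup>2 + B * x)) = 1"
proof -
  assume "A \<in> RR" "B \<in> RR"
  then have "MM (\<lambda>x. e_pi (A * x\<^sup>2 + B * x)) = MM (\<lambda>x. 1)"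
    by (intro MM_cong e_pi_RR RR_closed(3,5) RR_power)
  then show ?thesis by simp
qed

text \<open>Translating x by 2^k r changes the phase by \<beta> r / 2 up to integers; the two
  conditions on A make the contributions of the quadratic term integral.\<close>

lemma linear_dominant:
  assumes \<beta>: "uni \<beta>" and B: "B = \<beta> / 2 ^ (k + 1)" and A: "A * 2 ^ (k + 1) \<in> RR" "A * 2 ^ (2 * k) \<in> RR"
  shows "MM (\<lambda>x. e_pi (A * x\<^sup>2 + B * x + C)) = 0"
proof -
  obtain r where r: "r \<in> RR" "e_pi (\<beta> * r / 2) \<noteq> 1" using half_char_witness \<beta> unfolding uni_def by blast
  show ?thesis
  proof (rule MM_eq_0[OF lc_e_pi_quad _ _ r(2)])
    show "2 ^ k * r \<in> RR" by (intro RR_closed(5) RR_numeral_power r)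
    fix x assume x: "x \<in> RR"
    define z :: 'k where "z = 2 ^ k"
    have z: "2 ^ (k + 1) = 2 * z" "2 ^ (2 * k) = z * z"
      by (simp add: z_def) (simp only: z_def power_add[symmetric] mult_2)
    have Bz: "B * z = \<beta> / 2" by (simp add: B z_def)
    have "A * (x + z * r)\<^sup>2 + B * (x + z * r) + C - (\<beta> * r / 2 + (A * x\<^sup>2 + B * x + C)) =
        (A * (2 * z)) * (x * r) + (A * (z * z)) * r\<^sup>2 + (B * z - \<beta> / 2) * r"
      by (simp add: power2_eq_square algebra_simps)
    then have "A * (x + 2 ^ k * r)\<^sup>2 + B * (x + 2 ^ k * r) + C - (\<beta> * r / 2 + (A * x\<^sup>2 + B * x + C)) =
        (A * 2 ^ (k + 1)) * (x * r) + (A * 2 ^ (2 * k)) * r\<^sup>2"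
      unfolding Bz z(1) z(2) by (simp add: z_def)
    also have "\<dots> \<in> RR" by (rule RR_closed(3)[OF RR_closed(5)[OF A(1) RR_closed(5)[OF x r(1)]]
        RR_closed(5)[OF A(2) RR_power[OF r(1)]]])
    finally show "e_pi (A * (x + 2 ^ k * r)\<^sup>2 + B * (x + 2 ^ k * r) + C) =
        e_pi (\<beta> * r / 2) * e_pi (A * x\<^sup>2 + B * x + C)"
      unfolding e_pi_add[symmetric, of "\<beta> * r / 2"] by (rule e_pi_cong)
  qed
qed

text \<open>At denominator 2 the quadratic term is linear with coefficient \<kappa>, a square root
  of \<alpha> modulo 2. The mean is 1 exactly when \<kappa> + \<beta> is even, that is, when
  \<alpha> is congruent to \<beta>^2; this is the origin of the condition in
  \<open>U_set\<close>.\<close>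

lemma linear_balanced:
  assumes \<alpha>: "\<alpha> \<in> RR" and \<beta>: "\<beta> \<in> RR"
  shows "MM (\<lambda>x. e_pi (\<alpha> / 2 * x\<^sup>2 + \<beta> / 2 * x)) = (if \<alpha> - \<beta>\<^sup>2 \<in> pp 1 then 1 else 0)"
proof -
  obtain \<kappa> where k: "\<kappa> \<in> TT0" "\<alpha> - \<kappa>\<^sup>2 \<in> pp 1" using sqrt_mod_2[OF \<alpha>] by blast
  note kR = RR_UU0[OF k(1)]
  have "e_pi (\<alpha> / 2 * x\<^sup>2 + \<beta> / 2 * x) = e_pi ((\<kappa> + \<beta>) * x / 2)" if "x \<in> RR" for x
  proof -
    have "e_pi (\<alpha> / 2 * x\<^sup>2 + \<beta> / 2 * x) = e_pi (\<kappa> * x / 2) * e_pi (\<beta> / 2 * x)"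
      using e_pi_half_unit_square[OF kR k(2) that] by (simp add: e_pi_add)
    also have "\<dots> = e_pi ((\<kappa> + \<beta>) * x / 2)"
      unfolding e_pi_add[symmetric] by (rule arg_cong[where f = e_pi]) (simp add: field_simps)
    finally show ?thesis .
  qed
  then have "MM (\<lambda>x. e_pi (\<alpha> / 2 * x\<^sup>2 + \<beta> / 2 * x)) = MM (\<lambda>x. e_pi ((\<kappa> + \<beta>) * x / 2))" by (rule MM_cong)
  also have "\<dots> = (if \<kappa> + \<beta> \<in> pp 1 then 1 else 0)" using kR \<beta> by (intro MM_char_half RR_closed)
  also have "\<kappa> + \<beta> \<in> pp 1 \<longleftrightarrow> \<alpha> - \<beta>\<^sup>2 \<in> pp 1"
  proof
    assume "\<kappa> + \<beta> \<in> pp 1"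
    then have "(\<kappa> - \<beta>) * (\<kappa> + \<beta>) \<in> pp 1" using kR \<beta> by (intro pp_mult_left RR_closed(4))
    then have "(\<alpha> - \<kappa>\<^sup>2) + (\<kappa> - \<beta>) * (\<kappa> + \<beta>) \<in> pp 1" using k(2) by (rule pp_closed(2)[rotated])
    then show "\<alpha> - \<beta>\<^sup>2 \<in> pp 1" by (simp add: power2_eq_square algebra_simps)
  next
    assume "\<alpha> - \<beta>\<^sup>2 \<in> pp 1"
    then have "(\<alpha> - \<beta>\<^sup>2) - (\<alpha> - \<kappa>\<^sup>2) + 2 * (\<beta> * (\<kappa> + \<beta>)) \<in> pp 1"
      by (rule pp_closed(2)[OF pp_closed(3)[OF _ k(2)] pp_two]) (intro RR_closed(3,5) kR \<beta>)
    then have "(\<kappa> + \<beta>) * (\<kappa> + \<beta>) \<in> pp 1" by (simp add: power2_eq_square algebra_simps)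
    then show "\<kappa> + \<beta> \<in> pp 1" using pp_prime[of "\<kappa> + \<beta>" "\<kappa> + \<beta>"] kR \<beta> by blast
  qed
  finally show ?thesis .
qed

lemma complete_square:
  assumes "x0 \<in> RR"
  shows "MM (\<lambda>x. e_pi (A * x\<^sup>2 + 2 * A * x0 * x)) = e_pi (- (A * x0\<^sup>2)) * MM (\<lambda>x. e_pi (A * x\<^sup>2))"
proof -
  have "e_pi (A * x\<^sup>2 + 2 * A * x0 * x) = e_pi (- (A * x0\<^sup>2)) * e_pi (A * (x + x0)\<^sup>2)" for x
    unfolding e_pi_add[symmetric]
    by (rule arg_cong[where f = e_pi]) (simp add: power2_eq_square algebra_simps)
  then have "MM (\<lambda>x. e_pi (A * x\<^sup>2 + 2 * A * x0 * x)) = e_pi (- (A * x0\<^sup>2)) * MM (\<lambda>x. e_pi (A * (x + x0)\<^sup>2))"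
    by (simp only: MM_cmult)
  then show ?thesis using MM_shift[OF lc_e_pi_sq[of A] assms] by simp
qed

lemma lc_MM_e_pi_const:
  "lc (\<lambda>y. MM (\<lambda>x. e_pi (a * x\<^sup>2 + b * x * y + c * y\<^sup>2 + d * x + h * y + l)))"
proof -
  have "lc (\<lambda>y. e_pi l * MM (\<lambda>x. e_pi (a * x\<^sup>2 + b * x * y + c * y\<^sup>2 + d * x + h * y)))"
    by (intro lc_mult lc_const lc_MM_e_pi)
  then show ?thesis by (simp only: MM_cmult[symmetric] e_pi_add mult_ac)
qed

text \<open>The mean over x restricts y to multiples of 2^k.\<close>

lemma hyperbolic_integral:
  assumes "uni v"
  shows "MM (\<lambda>y. MM (\<lambda>x. e_pi (v / 2 ^ k * (x * y)))) = 1 / of_nat q ^ k"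
proof -
  have "MM (\<lambda>x. e_pi (v / 2 ^ k * (x * y))) = (if y \<in> pp k then 1 else 0)" if y: "y \<in> RR" for y
  proof -
    have "MM (\<lambda>x. e_pi (v / 2 ^ k * (x * y))) = MM (\<lambda>x. e_pi ((v * (y / 2 ^ k)) * x))" by (simp add: mult_ac)
    also have "\<dots> = (if v * (y / 2 ^ k) \<in> RR then 1 else 0)" by (rule MM_char)
    also have "v * (y / 2 ^ k) \<in> RR \<longleftrightarrow> y \<in> pp k"
    proof
      assume "v * (y / 2 ^ k) \<in> RR"
      then have "inverse v * (v * (y / 2 ^ k)) \<in> RR" by (rule RR_closed(5)[OF uni_inverse[OF assms]])
      moreover have "inverse v * (v * (y / 2 ^ k)) = y / 2 ^ k" using uni_neq_0[OF assms] by simp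
      ultimately show "y \<in> pp k" by (simp only: pp_def mem_Collect_eq)
    next
      assume "y \<in> pp k"
      then have "y / 2 ^ k \<in> RR" by (simp only: pp_def mem_Collect_eq)
      then show "v * (y / 2 ^ k) \<in> RR" using assms RR_closed(5) by (simp only: uni_def)
    qed
    finally show ?thesis .
  qed
  then have "MM (\<lambda>y. MM (\<lambda>x. e_pi (v / 2 ^ k * (x * y)))) = MM (\<lambda>y. if y \<in> pp k then 1 else 0)"
    by (rule MM_cong)
  then show ?thesis by (simp only: MM_indicator_pp)
qed

lemma lc_add: "lc g \<Longrightarrow> lc h \<Longrightarrow> lc (\<lambda>x. g x + h x)" and MM_add: "lc g \<Longrightarrow> lc h \<Longrightarrow> MM (\<lambda>x. g x + h x) = MM g + MM h"
proof -
  assume "lc g" "lc h"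
  then obtain T T' where "per T g" "per T' h" by (auto simp: lc_def)
  then have p: "per (max T T') g" "per (max T T') h" by (auto intro: per_mono[rotated])
  then have p2: "per (max T T') (\<lambda>x. g x + h x)" by (simp add: per_def)
  then show "lc (\<lambda>x. g x + h x)" by (auto simp: lc_def)
  show "MM (\<lambda>x. g x + h x) = MM g + MM h"
    unfolding MM_eq[OF p(1)] MM_eq[OF p(2)] MM_eq[OF p2] by (simp add: mean_def sum.distrib add_divide_distrib)
qed

lemma MM_sum:
  assumes "finite A" "\<And>i. lc (g i)"
  shows "MM (\<lambda>x. \<Sum>i\<in>A. g i x) = (\<Sum>i\<in>A. MM (g i))"
proof -
  have "lc (\<lambda>x. \<Sum>i\<in>A. g i x) \<and> MM (\<lambda>x. \<Sum>i\<in>A. g i x) = (\<Sum>i\<in>A. MM (g i))"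
    using assms(1) by (induction A rule: finite_induct) (simp_all add: assms(2) lc_add MM_add)
  then show ?thesis by blast
qed

lemma lc_indicator_pp: "lc (\<lambda>x. if x \<in> pp k then 1 else 0)"
proof -
  have "per k (\<lambda>x. if x \<in> pp k then 1 else 0)"
    unfolding per_def
  proof (intro ballI)
    fix x y assume "x \<in> RR" "y \<in> RR"
    then have "2 ^ k * y \<in> pp k" by blast
    then have "x + 2 ^ k * y \<in> pp k \<longleftrightarrow> x \<in> pp k"
      using pp_closed(2)[of x k "2 ^ k * y"] pp_closed(3)[of "x + 2 ^ k * y" k "2 ^ k * y"] by auto
    then show "(if x + 2 ^ k * y \<in> pp k then 1 else 0) = (if x \<in> pp k then 1 else 0 :: complex)" by simp
  qed
  then show ?thesis by (auto simp: lc_def)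
qed

section \<open>The anisotropic binary form\<close>

definition nf :: "'k \<Rightarrow> 'k \<Rightarrow> 'k \<Rightarrow> 'k" where "nf \<rho> x y = x\<^sup>2 + x * y + \<rho> * y\<^sup>2"

text \<open>For fixed y the phase is linear in x, so the mean over x vanishes unless y is congruent
  to \<kappa> / v, where \<kappa>^2 is v modulo 2; on that class v\<rho>y^2 is congruent to
  \<rho>.\<close>

lemma norm_form_integral_1:
  assumes v: "uni v" and \<rho>: "\<rho> \<in> RR"
  shows "MM (\<lambda>y. MM (\<lambda>x. e_pi (v / 2 * nf \<rho> x y))) = e_pi (\<rho> / 2) / of_nat q"
proof -
  have vR: "v \<in> RR" "v \<notin> pp 1" using v by (auto simp: uni_def)
  obtain \<kappa> where k: "\<kappa> \<in> TT0" "v - \<kappa>\<^sup>2 \<in> pp 1" "\<kappa> \<in> TT" using sqrt_mod_2[OF vR(1)] vR(2) by blast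
  note kR = RR_UU0[OF k(1)]
  define y0 where "y0 = \<kappa> * inverse v"
  have y0: "y0 \<in> RR" unfolding y0_def by (intro RR_closed(5) kR uni_inverse v)
  have vy0: "v * y0 = \<kappa>" using uni_neq_0[OF v] by (simp add: y0_def)
  have inner: "MM (\<lambda>x. e_pi (v / 2 * nf \<rho> x y)) = e_pi (\<rho> / 2) * (if y + y0 \<in> pp 1 then 1 else 0)"
    if y: "y \<in> RR" for y
  proof -
    have "e_pi (v / 2 * nf \<rho> x y) = e_pi (v * \<rho> * y\<^sup>2 / 2) * e_pi ((v * (y + y0)) * x / 2)" if x: "x \<in> RR" for x
    proof -
      have "v / 2 * nf \<rho> x y = v * x\<^sup>2 / 2 + (v * y) * x / 2 + v * \<rho> * y\<^sup>2 / 2"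
        by (simp add: nf_def field_simps)
      then have "e_pi (v / 2 * nf \<rho> x y) = e_pi (\<kappa> * x / 2) * e_pi ((v * y) * x / 2) * e_pi (v * \<rho> * y\<^sup>2 / 2)"
        by (simp only: e_pi_add e_pi_half_unit_square[OF kR k(2) x])
      also have "e_pi (\<kappa> * x / 2) * e_pi ((v * y) * x / 2) = e_pi ((v * (y + y0)) * x / 2)"
        unfolding e_pi_add[symmetric] by (rule arg_cong[where f = e_pi]) (simp add: distrib_left vy0 field_simps)
      finally show ?thesis by (simp only: mult.commute)
    qed
    then have "MM (\<lambda>x. e_pi (v / 2 * nf \<rho> x y)) =
        MM (\<lambda>x. e_pi (v * \<rho> * y\<^sup>2 / 2) * e_pi ((v * (y + y0)) * x / 2))" by (rule MM_cong)
    also have "\<dots> = e_pi (v * \<rho> * y\<^sup>2 / 2) * (if v * (y + y0) \<in> pp 1 then 1 else 0)"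
      unfolding MM_cmult using MM_char_half[OF RR_closed(5)[OF vR(1) RR_closed(3)[OF y y0]]] by simp
    also have "v * (y + y0) \<in> pp 1 \<longleftrightarrow> y + y0 \<in> pp 1"
      using pp_prime[OF vR(1) RR_closed(3)[OF y y0]] vR pp_mult_left[OF vR(1)] by blast
    also have "e_pi (v * \<rho> * y\<^sup>2 / 2) * (if y + y0 \<in> pp 1 then 1 else 0) =
        e_pi (\<rho> / 2) * (if y + y0 \<in> pp 1 then 1 else 0)"
    proof (cases "y + y0 \<in> pp 1")
      case True
      have "y - y0 \<in> pp 1" using pp_closed(3)[OF True pp_two[OF y0]] by (simp add: algebra_simps)
      have "v * \<rho> * ((y - y0) * (y + y0)) \<in> pp 1" using True vR \<rho> y y0 by (intro pp_mult_left RR_closed(4,5))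
      moreover have "\<rho> * (inverse v * (v - \<kappa>\<^sup>2)) \<in> pp 1" by (intro pp_mult_left \<rho> uni_inverse v k(2))
      ultimately have "v * \<rho> * ((y - y0) * (y + y0)) - \<rho> * (inverse v * (v - \<kappa>\<^sup>2)) \<in> pp 1" by (rule pp_closed(3))
      moreover have "v * \<rho> * ((y - y0) * (y + y0)) - \<rho> * (inverse v * (v - \<kappa>\<^sup>2)) = v * \<rho> * y\<^sup>2 - \<rho>"
        using uni_neq_0[OF v] by (simp add: y0_def power2_eq_square field_simps)
      ultimately have "(v * \<rho> * y\<^sup>2 - \<rho>) / 2 \<in> RR" unfolding pp_1_half by (simp only:)
      then have "e_pi (v * \<rho> * y\<^sup>2 / 2) = e_pi (\<rho> / 2)" by (intro e_pi_cong) (simp only: diff_divide_distrib)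
      then show ?thesis by simp
    qed simp
    finally show ?thesis .
  qed
  then have "MM (\<lambda>y. MM (\<lambda>x. e_pi (v / 2 * nf \<rho> x y))) =
      MM (\<lambda>y. e_pi (\<rho> / 2) * (if y + y0 \<in> pp 1 then 1 else 0))" by (rule MM_cong)
  also have "\<dots> = e_pi (\<rho> / 2) * MM (\<lambda>y. if y \<in> pp 1 then 1 else 0)"
    unfolding MM_cmult MM_shift[OF lc_indicator_pp y0] ..
  finally show ?thesis by (simp only: MM_indicator_pp) simp
qed

lemma lc_norm_form: "lc (\<lambda>y. MM (\<lambda>x. e_pi (A * nf \<rho> x y)))"
proof -
  have "A * nf \<rho> x y = A * x\<^sup>2 + A * x * y + (A * \<rho>) * y\<^sup>2 + 0 * x + 0 * y" for x y
    by (simp add: nf_def algebra_simps)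
  then show ?thesis by (simp only: lc_MM_e_pi)
qed

text \<open>If y is a unit, the mixed term dominates in x (\<open>linear_dominant\<close>). If y is
  even and x a unit, a translation of y gives zero. Only x and y both even contribute, which removes
  two powers of 2 and costs a factor q for each variable.\<close>

lemma norm_form_integral_rec:
  assumes v: "uni v" and \<rho>: "\<rho> \<in> RR"
  shows "MM (\<lambda>y. MM (\<lambda>x. e_pi (v / 2 ^ (k + 2) * nf \<rho> x y))) =
    MM (\<lambda>y. MM (\<lambda>x. e_pi (v / 2 ^ k * nf \<rho> x y))) / of_nat q ^ 2"
proof -
  have vR: "v \<in> RR" "v \<notin> pp 1" using v by (auto simp: uni_def)
  define A where "A = v / 2 ^ (k + 2)"
  define F where "F y = MM (\<lambda>x. e_pi (A * nf \<rho> x y))" for y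
  have lcF: "lc F" unfolding F_def[abs_def] by (rule lc_norm_form)
  have F0: "F (s + 2 * y) = 0" if s: "s \<in> TT" and y: "y \<in> RR" for s y
  proof -
    have "uni (v * (s + 2 * y))"
    proof (intro uni_mult v)
      have "s + 2 * y \<notin> pp 1"
      proof
        assume "s + 2 * y \<in> pp 1"
        then have "s + 2 * y - 2 * y \<in> pp 1" by (rule pp_closed(3)[OF _ pp_two[OF y]])
        then show False using UU_notin_pp[OF s] by simp
      qed
      moreover have "s + 2 * y \<in> RR" by (intro RR_closed(3,5) RR_UU s y RR_numeral)
      ultimately show "uni (s + 2 * y)" by (simp only: uni_def simp_thms)
    qed
    moreover have "A * (s + 2 * y) = v * (s + 2 * y) / 2 ^ ((k + 1) + 1)" by (simp add: A_def)
    moreover have "A * 2 ^ ((k + 1) + 1) \<in> RR" using vR by (simp add: A_def)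
    moreover have "A * 2 ^ (2 * (k + 1)) \<in> RR"
    proof -
      have "2 * (k + 1) = (k + 2) + k" by simp
      then have "A * 2 ^ (2 * (k + 1)) = v * 2 ^ k" unfolding A_def by (simp only: power_add) simp
      then show ?thesis using vR(1) RR_closed(5)[OF vR(1) RR_numeral_power] by (simp only:)
    qed
    ultimately have "MM (\<lambda>x. e_pi (A * x\<^sup>2 + A * (s + 2 * y) * x + A * \<rho> * (s + 2 * y)\<^sup>2)) = 0"
      by (rule linear_dominant)
    moreover have "A * nf \<rho> x (s + 2 * y) = A * x\<^sup>2 + A * (s + 2 * y) * x + A * \<rho> * (s + 2 * y)\<^sup>2" for x
      by (simp add: nf_def algebra_simps)
    ultimately show ?thesis by (simp only: F_def)
  qed
  have "MM F = (\<Sum>s\<in>TT0. if s = 0 then MM (\<lambda>y. F (2 * y)) else 0) / of_nat q"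
    unfolding MM_split[OF lcF]
  proof (intro arg_cong2[where f = "(/)"] sum.cong refl)
    fix s assume s: "s \<in> TT0"
    show "MM (\<lambda>y. F (s + 2 * y)) = (if s = 0 then MM (\<lambda>y. F (2 * y)) else 0)"
    proof (cases "s = 0")
      case False
      then have "s \<in> TT" using s by (simp add: UU_iff_UU0)
      then have "MM (\<lambda>y. F (s + 2 * y)) = MM (\<lambda>y. 0)" by (intro MM_cong F0)
      then show ?thesis using False by simp
    qed simp
  qed
  then have 1: "MM F = MM (\<lambda>y. F (2 * y)) / of_nat q" by simp
  define H where "H s y = MM (\<lambda>x. e_pi (A * nf \<rho> (s + 2 * x) (2 * y)))" for s y
  have lcx: "lc (\<lambda>x. e_pi (A * nf \<rho> x y))" for y
  proof -
    have "A * nf \<rho> x y = A * x\<^sup>2 + A * y * x + A * \<rho> * y\<^sup>2" for x by (simp add: nf_def algebra_simps)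
    then show ?thesis by (simp only: lc_e_pi_quad)
  qed
  have F2: "F (2 * y) = (\<Sum>s\<in>TT0. H s y) / of_nat q" for y
    unfolding F_def H_def by (rule MM_split[OF lcx])
  have Hexp: "A * nf \<rho> (s + 2 * x) (2 * y) =
      (4 * A) * x\<^sup>2 + (4 * A) * x * y + (4 * A * \<rho>) * y\<^sup>2 + (4 * A * s) * x + (2 * A * s) * y + A * s\<^sup>2" for s x y
    by (simp add: nf_def power2_eq_square algebra_simps)
  have lcH: "lc (H s)" for s unfolding H_def[abs_def] Hexp by (rule lc_MM_e_pi_const)
  have H0: "MM (H s) = 0" if s: "s \<in> TT" for s
  proof -
    obtain r where r: "r \<in> RR" "e_pi (v * s * r / 2) \<noteq> 1"
      using half_char_witness[OF RR_unit_mult[OF vR RR_UU[OF s] UU_notin_pp[OF s]]] .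
    show ?thesis
    proof (rule MM_eq_0[OF lcH _ _ r(2)])
      show "2 ^ k * r \<in> RR" by (intro RR_closed(5) RR_numeral_power r)
      fix y assume y: "y \<in> RR"
      have "e_pi (A * nf \<rho> (s + 2 * x) (2 * (y + 2 ^ k * r))) =
          e_pi (v * s * r / 2) * e_pi (A * nf \<rho> (s + 2 * x) (2 * y))" if x: "x \<in> RR" for x
      proof -
        define z :: 'k where "z = 2 ^ k"
        have Az: "A * (4 * z) = v" "A * (2 * z) = v / 2" by (simp_all add: A_def z_def field_simps)
        have "A * nf \<rho> (s + 2 * x) (2 * (y + z * r)) - (v * s * r / 2 + A * nf \<rho> (s + 2 * x) (2 * y)) =
            (A * (4 * z)) * (x * r + \<rho> * (2 * y * r + z * r\<^sup>2)) + (A * (2 * z)) * (s * r) - v * s * r / 2"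
          by (simp add: nf_def power2_eq_square algebra_simps)
        then have "A * nf \<rho> (s + 2 * x) (2 * (y + 2 ^ k * r)) -
            (v * s * r / 2 + A * nf \<rho> (s + 2 * x) (2 * y)) =
            v * x * r + v * \<rho> * (2 * y * r + 2 ^ k * r\<^sup>2)"
          unfolding Az by (simp add: z_def algebra_simps)
        also have "\<dots> \<in> RR" by (intro RR_closed(3,5) RR_power vR x r \<rho> y RR_numeral RR_numeral_power)
        finally show ?thesis unfolding e_pi_add[symmetric] by (rule e_pi_cong)
      qed
      then have "H s (y + 2 ^ k * r) = MM (\<lambda>x. e_pi (v * s * r / 2) * e_pi (A * nf \<rho> (s + 2 * x) (2 * y)))"
        unfolding H_def by (rule MM_cong)
      then show "H s (y + 2 ^ k * r) = e_pi (v * s * r / 2) * H s y" by (simp only: MM_cmult H_def)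
    qed
  qed
  have H0f: "H 0 = (\<lambda>y. MM (\<lambda>x. e_pi (v / 2 ^ k * nf \<rho> x y)))"
  proof (rule ext)
    fix y
    have "A * nf \<rho> (0 + 2 * x) (2 * y) = v / 2 ^ k * nf \<rho> x y" for x
      by (simp add: nf_def A_def power2_eq_square field_simps power_add)
    then show "H 0 y = MM (\<lambda>x. e_pi (v / 2 ^ k * nf \<rho> x y))" by (simp only: H_def)
  qed
  have "MM (\<lambda>y. \<Sum>s\<in>TT0. H s y) = (\<Sum>s\<in>TT0. MM (H s))" by (rule MM_sum[OF _ lcH]) simp
  also have "(\<Sum>s\<in>TT0. MM (H s)) = (\<Sum>s\<in>TT0. if s = 0 then MM (H 0) else 0)"
    by (intro sum.cong refl) (use H0 in \<open>auto simp: UU_iff_UU0\<close>)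
  also have "\<dots> = MM (H 0)" by simp
  finally have "MM (\<lambda>y. \<Sum>s\<in>TT0. H s y) = MM (\<lambda>y. MM (\<lambda>x. e_pi (v / 2 ^ k * nf \<rho> x y)))"
    by (simp only: H0f)
  then have "MM (\<lambda>y. F (2 * y)) = MM (\<lambda>y. MM (\<lambda>x. e_pi (v / 2 ^ k * nf \<rho> x y))) / of_nat q"
    unfolding F2 divide_inverse MM_cmult_right by (simp only:)
  then have "MM F = MM (\<lambda>y. MM (\<lambda>x. e_pi (v / 2 ^ k * nf \<rho> x y))) / of_nat q ^ 2"
    unfolding 1 by (simp add: power2_eq_square)
  then show ?thesis by (simp only: F_def[abs_def] A_def)
qed

lemma norm_form_integral:
  assumes v: "uni v" and \<rho>: "\<rho> \<in> RR"
  shows "MM (\<lambda>y. MM (\<lambda>x. e_pi (v / 2 ^ k * nf \<rho> x y))) =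
    (if odd k then e_pi (\<rho> / 2) else 1) / of_nat q ^ k"
proof (induction k rule: induct_nat_012)
  case 0
  have "MM (\<lambda>y. MM (\<lambda>x. e_pi (v / 2 ^ 0 * nf \<rho> x y))) = MM (\<lambda>y. MM (\<lambda>x. 1))"
    using v \<rho> unfolding nf_def uni_def
    by (intro MM_cong e_pi_RR) (simp only: power_0 div_by_1, intro RR_closed(3,5) RR_power, simp_all)
  then show ?case by simp
next
  case 1
  then show ?case using norm_form_integral_1[OF v \<rho>] by simp
next
  case (ge2 k)
  have k2: "Suc (Suc k) = k + 2" by simp
  show ?case unfolding k2 norm_form_integral_rec[OF v \<rho>] ge2(1) by (simp add: power_add power2_eq_square)
qed

end

section \<open>Binary blocks with linear terms\<close>

context unram
begin

lemma powi_RR: "k \<ge> 0 \<Longrightarrow> x \<in> RR \<Longrightarrow> 2 powi k * x \<in> RR"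
  by (intro RR_closed(5) powi2_RR)

lemma pow2_powi: "(2 :: 'k) ^ m = 2 powi int m"
  by simp

lemma powi2_neg: "(2 :: 'k) powi (- int m) = 1 / 2 ^ m"
  by (simp only: power_int_minus power_int_of_nat inverse_eq_divide)

abbreviation "bf \<alpha> \<beta> x y \<equiv> \<alpha> * x\<^sup>2 + x * y + \<beta> * y\<^sup>2"
abbreviation "qf \<alpha> \<beta> b c d x y \<equiv> b * bf \<alpha> \<beta> x y + c * x + d * y"

text \<open>One definition covers both kinds of binary blocks: \<alpha> = \<beta> = 0 is the
  hyperbolic one, \<alpha> = 1 and \<beta> = \<rho> the anisotropic one.\<close>

definition JG :: "'k \<Rightarrow> 'k \<Rightarrow> 'k \<Rightarrow> 'k \<Rightarrow> 'k \<Rightarrow> 'k \<Rightarrow> complex"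
  where "JG \<alpha> \<beta> b c d s =
    MM (\<lambda>y. MM (\<lambda>x. e_pi (s * qf \<alpha> \<beta> b c d x y)))"

lemma min_ord_decomp:
  assumes "min (ord_p c) (ord_p d) < ereal (of_int \<tau>)"
  obtains \<gamma> where "\<gamma> < \<tau>" "min (ord_p c) (ord_p d) = ereal (of_int \<gamma>)"
    "c / 2 powi \<gamma> \<in> RR" "d / 2 powi \<gamma> \<in> RR" "uni (c / 2 powi \<gamma>) \<or> uni (d / 2 powi \<gamma>)"
proof -
  define m where "m = min (ord_p c) (ord_p d)"
  have "\<exists>x\<in>{c, d}. m = ord_p x" by (auto simp: m_def min_def)
  then obtain x where x: "x \<in> {c, d}" "m = ord_p x" by blast
  have "x \<noteq> 0" using assms x by (auto simp: ord_p_def m_def)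
  then obtain \<gamma> v where v: "uni v" "x = 2 powi \<gamma> * v" "ord_p x = ereal (of_int \<gamma>)" by (rule ord_decomp)
  have "m \<le> ord_p c" "m \<le> ord_p d" by (simp_all add: m_def)
  then have "ereal (of_int \<gamma>) \<le> ord_p c" "ereal (of_int \<gamma>) \<le> ord_p d" unfolding x(2) v(3) .
  then have "c / 2 powi \<gamma> \<in> RR" "d / 2 powi \<gamma> \<in> RR" by (simp_all only: ord_p_ge_iff)
  moreover have "uni (x / 2 powi \<gamma>)" using v by simp
  moreover have "\<gamma> < \<tau>" using assms x v by (simp add: m_def)
  moreover have "min (ord_p c) (ord_p d) = ereal (of_int \<gamma>)" using x v by (simp add: m_def)
  ultimately show ?thesis using that x by blast
qed

text \<open>Beyond the threshold, if c has the minimal order \<gamma>, the mean over x vanishes for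
  each y; otherwise d has it, and a translation of y gives zero.\<close>

lemma JG_D:
  assumes a: "uni a" and b: "uni u" "b = 2 powi \<tau> * u" and \<alpha>: "\<alpha> \<in> RR" and \<beta>: "\<beta> \<in> RR"
    and g: "\<gamma> < \<tau>" "c / 2 powi \<gamma> \<in> RR" "d / 2 powi \<gamma> \<in> RR"
      "uni (c / 2 powi \<gamma>) \<or> uni (d / 2 powi \<gamma>)"
  shows "JG \<alpha> \<beta> b c d (a / 2 powi t) = (if t \<le> \<gamma> then 1 else 0)"
proof -
  define c' d' where "c' = c / 2 powi \<gamma>" and "d' = d / 2 powi \<gamma>"
  have cd: "c = 2 powi \<gamma> * c'" "d = 2 powi \<gamma> * d'" by (simp_all add: c'_def d'_def)
  have cdR: "c' \<in> RR" "d' \<in> RR" using g by (simp_all add: c'_def d'_def)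
  have aR: "a \<in> RR" and uR: "u \<in> RR" using a b by (simp_all add: uni_def)
  define s where "s = a / 2 powi t"
  have sb: "s * b = 2 powi (\<tau> - t) * (a * u)" by (simp add: s_def b powi2_diff)
  have sc: "s * c = 2 powi (\<gamma> - t) * (a * c')" "s * d = 2 powi (\<gamma> - t) * (a * d')"
    by (simp_all add: s_def cd powi2_diff)
  have expand: "s * qf \<alpha> \<beta> b c d x y =
      (s * b * \<alpha>) * x\<^sup>2 + (s * b * y + s * c) * x + (s * b * \<beta> * y\<^sup>2 + s * d * y)" for x y
    by (simp add: algebra_simps)
  show ?thesis
  proof (cases "t \<le> \<gamma>")
    case True
    have R: "s * b \<in> RR" "s * c \<in> RR" "s * d \<in> RR"
      unfolding sb sc using True g(1) by (intro powi_RR RR_closed(5) aR uR cdR; simp)+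
    have "e_pi (s * qf \<alpha> \<beta> b c d x y) = 1" if "x \<in> RR" "y \<in> RR" for x y
    proof -
      have "A * \<alpha> * x\<^sup>2 + (A * y + C) * x + (A * \<beta> * y\<^sup>2 + D * y) \<in> RR"
        if "A \<in> RR" "C \<in> RR" "D \<in> RR" for A C D
        using that \<alpha> \<beta> \<open>x \<in> RR\<close> \<open>y \<in> RR\<close> by (intro RR_closed(3,5) RR_power)
      from this[OF R] show ?thesis unfolding expand by (rule e_pi_RR)
    qed
    then have "JG \<alpha> \<beta> b c d s = MM (\<lambda>y. MM (\<lambda>x. 1))" unfolding JG_def by (intro MM_cong)
    then show ?thesis using True by (simp add: s_def)
  next
    case False
    define k where "k = nat (t - \<gamma> - 1)"
    have t: "t = \<gamma> + int k + 1" using False by (simp add: k_def)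
    \<comment> \<open>Chosen so that s b = A / 2^k with A integral: the quadratic part has a smaller
      denominator than the linear one.\<close>
    define A where "A = 2 powi (\<tau> - \<gamma> - 1) * (a * u)"
    have AR: "A \<in> RR" unfolding A_def using g(1) by (intro powi_RR RR_closed(5) aR uR) simp
    have "2 powi (\<tau> - t) = (2 powi (\<tau> - \<gamma> - 1) / 2 ^ k :: 'k)"
      unfolding t pow2_powi by (simp add: powi2_diff powi2_add field_simps)
    then have sbA: "s * b = A / 2 ^ k" unfolding sb A_def by simp
    have "2 powi (\<gamma> - t) = (1 / 2 ^ (k + 1) :: 'k)"
      unfolding t by (simp add: powi2_diff powi2_add field_simps)
    then have sck: "s * c = (a * c') / 2 ^ (k + 1)" "s * d = (a * d') / 2 ^ (k + 1)" unfolding sc by simp_all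
    have "JG \<alpha> \<beta> b c d s = 0"
    proof (cases "uni c'")
      case True
      have "MM (\<lambda>x. e_pi (s * qf \<alpha> \<beta> b c d x y)) = 0" if y: "y \<in> RR" for y
        unfolding expand
      proof (rule linear_dominant[where k = k])
        \<comment> \<open>The mixed term only adds an even amount to the unit a c'.\<close>
        show "s * b * y + s * c = (a * c' + 2 * (A * y)) / 2 ^ (k + 1)"
          unfolding sbA sck by (simp add: field_simps)
        have "a * c' + 2 * (A * y) \<notin> pp 1"
        proof
          assume "a * c' + 2 * (A * y) \<in> pp 1"
          then have "a * c' + 2 * (A * y) - 2 * (A * y) \<in> pp 1"
            by (rule pp_closed(3)[OF _ pp_two[OF RR_closed(5)[OF AR y]]])
          then show False using uni_mult[OF a True] by (simp add: uni_def)
        qed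
        moreover have "a * c' + 2 * (A * y) \<in> RR" by (intro RR_closed(3,5) aR cdR RR_numeral AR y)
        ultimately show "uni (a * c' + 2 * (A * y))" by (simp only: uni_def simp_thms)
        have "s * b * \<alpha> * 2 ^ (k + 1) = 2 * (A * \<alpha>)" unfolding sbA by simp
        then show "s * b * \<alpha> * 2 ^ (k + 1) \<in> RR"
          using RR_closed(5)[OF RR_numeral RR_closed(5)[OF AR \<alpha>]] by (simp only:)
        have "s * b * \<alpha> * 2 ^ (2 * k) = 2 ^ k * (A * \<alpha>)" unfolding sbA by (simp only: mult_2 power_add) simp
        then show "s * b * \<alpha> * 2 ^ (2 * k) \<in> RR"
          using RR_closed(5)[OF RR_numeral_power RR_closed(5)[OF AR \<alpha>]] by (simp only:)
      qed
      then have "JG \<alpha> \<beta> b c d s = MM (\<lambda>y. 0)" unfolding JG_def by (rule MM_cong)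
      then show ?thesis by simp
    next
      case False
      then have d': "uni d'" using g(4) by (simp add: c'_def d'_def)
      obtain r where r: "r \<in> RR" "e_pi (a * d' * r / 2) \<noteq> 1"
        using half_char_witness uni_mult[OF a d'] unfolding uni_def by blast
      have lcy: "lc (\<lambda>y. MM (\<lambda>x. e_pi (s * qf \<alpha> \<beta> b c d x y)))"
      proof -
        have "s * qf \<alpha> \<beta> b c d x y =
          (s * b * \<alpha>) * x\<^sup>2 + (s * b) * x * y + (s * b * \<beta>) * y\<^sup>2 + (s * c) * x + (s * d) * y" for x y
          by (simp add: algebra_simps)
        then show ?thesis by (simp only: lc_MM_e_pi)
      qed
      show ?thesis
        unfolding JG_def
      proof (rule MM_eq_0[OF lcy _ _ r(2)])
        show "2 ^ k * r \<in> RR" by (intro RR_closed(5) RR_numeral_power r)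
        fix y assume y: "y \<in> RR"
        define z :: 'k where "z = 2 ^ k"
        have sbz: "s * b * z = A" unfolding sbA z_def by simp
        have sdz: "s * d * z = a * d' / 2" unfolding sck z_def by simp
        have "e_pi (s * (b * (\<alpha> * x\<^sup>2 + x * (y + 2 ^ k * r) + \<beta> * (y + 2 ^ k * r)\<^sup>2) + c * x + d * (y + 2 ^ k * r))) =
          e_pi (a * d' * r / 2) * e_pi (s * qf \<alpha> \<beta> b c d x y)"
          if x: "x \<in> RR" for x
        proof -
          have "s * (b * (\<alpha> * x\<^sup>2 + x * (y + z * r) + \<beta> * (y + z * r)\<^sup>2) + c * x + d * (y + z * r)) -
              (a * d' * r / 2 + s * qf \<alpha> \<beta> b c d x y) =
              (s * b * z) * (x * r + \<beta> * (2 * y * r + z * r\<^sup>2)) + (s * d * z) * r - a * d' * r / 2"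
            by (simp add: power2_eq_square algebra_simps)
          also have "\<dots> = A * (x * r + \<beta> * (2 * y * r + z * r\<^sup>2))" unfolding sbz sdz by simp
          also have "\<dots> \<in> RR" unfolding z_def
            by (intro RR_closed(3,5) RR_power AR x r \<beta> y RR_numeral RR_numeral_power)
          finally show ?thesis unfolding e_pi_add[symmetric] z_def by (rule e_pi_cong)
        qed
        then have "MM (\<lambda>x. e_pi (s * (b * (\<alpha> * x\<^sup>2 + x * (y + 2 ^ k * r) + \<beta> * (y + 2 ^ k * r)\<^sup>2) + c * x + d * (y + 2 ^ k * r)))) =
          MM (\<lambda>x. e_pi (a * d' * r / 2) * e_pi (s * qf \<alpha> \<beta> b c d x y))"
          by (rule MM_cong)
        then show "MM (\<lambda>x. e_pi (s * (b * (\<alpha> * x\<^sup>2 + x * (y + 2 ^ k * r) + \<beta> * (y + 2 ^ k * r)\<^sup>2) + c * x + d * (y + 2 ^ k * r)))) =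
          e_pi (a * d' * r / 2) * MM (\<lambda>x. e_pi (s * qf \<alpha> \<beta> b c d x y))"
          by (simp only: MM_cmult)
      qed
    qed
    then show ?thesis using False by (simp add: s_def)
  qed
qed

text \<open>The point (x0, y0) is the centre to be moved to the origin: c and d are b times the
  partial derivatives of the form there.\<close>

lemma JG_complete:
  assumes x0: "x0 \<in> RR" and y0: "y0 \<in> RR"
    and c: "c = b * (2 * \<alpha> * x0 + y0)" and d: "d = b * (x0 + 2 * \<beta> * y0)"
    and lcx: "\<And>y. lc (\<lambda>x. e_pi (s * b * bf \<alpha> \<beta> x y))"
  shows "JG \<alpha> \<beta> b c d s = e_pi (- (s * b * (\<alpha> * x0\<^sup>2 + x0 * y0 + \<beta> * y0\<^sup>2))) *
    MM (\<lambda>y. MM (\<lambda>x. e_pi (s * b * bf \<alpha> \<beta> x y)))"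
proof -
  define E where "E x y = e_pi (s * b * bf \<alpha> \<beta> x y)" for x y
  define C where "C = e_pi (- (s * b * (\<alpha> * x0\<^sup>2 + x0 * y0 + \<beta> * y0\<^sup>2)))"
  have "e_pi (s * qf \<alpha> \<beta> b c d x y) = C * E (x + x0) (y + y0)" for x y
    unfolding E_def C_def e_pi_add[symmetric]
    by (rule arg_cong[where f = e_pi]) (simp add: c d power2_eq_square algebra_simps)
  then have "JG \<alpha> \<beta> b c d s = C * MM (\<lambda>y. MM (\<lambda>x. E (x + x0) (y + y0)))"
    unfolding JG_def by (simp only: MM_cmult)
  also have "MM (\<lambda>y. MM (\<lambda>x. E (x + x0) (y + y0))) = MM (\<lambda>y. MM (\<lambda>x. E x (y + y0)))"
    by (rule MM_cong, rule MM_shift[OF _ x0]) (simp only: E_def lcx)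
  also have "\<dots> = MM (\<lambda>y. MM (\<lambda>x. E x y))"
  proof (rule MM_shift[of "\<lambda>y. MM (\<lambda>x. E x y)", OF _ y0])
    have "s * b * bf \<alpha> \<beta> x y =
        (s * b * \<alpha>) * x\<^sup>2 + (s * b) * x * y + (s * b * \<beta>) * y\<^sup>2 + 0 * x + 0 * y" for x y
      by (simp add: algebra_simps)
    then show "lc (\<lambda>y. MM (\<lambda>x. E x y))" unfolding E_def by (simp only: lc_MM_e_pi)
  qed
  finally show ?thesis by (simp only: E_def C_def)
qed

lemma lc_inner: "lc (\<lambda>x. e_pi (A * bf \<alpha> \<beta> x y))"
proof -
  have "A * bf \<alpha> \<beta> x y = (A * \<alpha>) * x\<^sup>2 + (A * y) * x + A * \<beta> * y\<^sup>2" for x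
    by (simp add: algebra_simps)
  then show ?thesis by (simp only: lc_e_pi_quad)
qed

lemma floor_ord [simp]: "\<lfloor>real_of_ereal (ereal (of_int k))\<rfloor> = k"
  by simp

lemma q_powr_int: "real q powr (of_int (- int k)) = 1 / real q ^ k"
  using powr_minus_divide[of "real q" "real k"] powr_realpow[OF q_pos, of k] by simp

end

section \<open>The Gauss integrals of the blocks of Q\<close>

locale unram_poly = unram f \<zeta> for f and \<zeta> :: "'k :: q2_field" +
  fixes \<rho> n :: 'k and Q :: "'k qpoly"
  assumes rho: "\<rho> \<in> unit_group" and n: "n \<in> int_ring" and ok: "coeffs_ok Q"
begin

lemma rho_RR: "\<rho> \<in> RR"
  using rho by (simp add: unit_group_iff uni_def)

lemma X_ok: "i \<in> {1..rX Q} \<Longrightarrow> bX Q i \<in> RR" "i \<in> {1..rX Q} \<Longrightarrow> bX Q i \<noteq> 0" "i \<in> {1..rX Q} \<Longrightarrow> cX Q i \<in> RR"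
  and Y_ok: "j \<in> {1..rY Q} \<Longrightarrow> bY Q j \<in> RR" "j \<in> {1..rY Q} \<Longrightarrow> bY Q j \<noteq> 0"
    "j \<in> {1..rY Q} \<Longrightarrow> cY Q j 1 \<in> RR" "j \<in> {1..rY Q} \<Longrightarrow> cY Q j 2 \<in> RR"
  and Z_ok: "k \<in> {1..rZ Q} \<Longrightarrow> bZ Q k \<in> RR" "k \<in> {1..rZ Q} \<Longrightarrow> bZ Q k \<noteq> 0"
    "k \<in> {1..rZ Q} \<Longrightarrow> cZ Q k 1 \<in> RR" "k \<in> {1..rZ Q} \<Longrightarrow> cZ Q k 2 \<in> RR"
  using ok unfolding coeffs_ok_def int_ring_eq by auto

definition JX :: "nat \<Rightarrow> 'k \<Rightarrow> complex"
  where "JX i s = MM (\<lambda>x. e_pi (s * (bX Q i * x\<^sup>2 + cX Q i * x)))"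

definition JY :: "nat \<Rightarrow> 'k \<Rightarrow> complex"
  where "JY j s = JG 0 0 (bY Q j) (cY Q j 1) (cY Q j 2) s"

definition JZ :: "nat \<Rightarrow> 'k \<Rightarrow> complex"
  where "JZ k s = JG 1 \<rho> (bZ Q k) (cZ Q k 1) (cZ Q k 2) s"

lemma JX_alt: "JX i s = MM (\<lambda>x. e_pi ((s * bX Q i) * x\<^sup>2 + (s * cX Q i) * x))"
  by (simp only: JX_def distrib_left mult.assoc)

lemma JX_D:
  assumes i: "i \<in> DpX Q" and a: "uni a"
  shows "JX i (a / 2 powi t) = (if t \<le> tX Q i then 1 else 0)"
proof -
  have iX: "i \<in> {1..rX Q}" and lt: "ord_p (cX Q i) < ord_p (bX Q i)" using i by (auto simp: DpX_def)
  obtain \<tau> u where u: "uni u" "bX Q i = 2 powi \<tau> * u" "ord_p (bX Q i) = ereal (of_int \<tau>)"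
    using ord_decomp[OF X_ok(2)[OF iX]] .
  have "cX Q i \<noteq> 0" using lt by (auto simp: ord_p_def)
  then obtain \<gamma> c where c: "uni c" "cX Q i = 2 powi \<gamma> * c" "ord_p (cX Q i) = ereal (of_int \<gamma>)"
    by (rule ord_decomp)
  have g: "\<gamma> < \<tau>" using lt u c by simp
  have tX: "tX Q i = \<gamma>" using u c g by (simp add: tX_def min_def)
  define s where "s = a / 2 powi t"
  have sb: "s * bX Q i = 2 powi (\<tau> - t) * (a * u)" by (simp add: s_def u powi2_diff)
  have sc: "s * cX Q i = 2 powi (\<gamma> - t) * (a * c)" by (simp add: s_def c powi2_diff)
  have au: "uni (a * u)" "uni (a * c)" using a u c by (auto intro: uni_mult)
  show ?thesis
  proof (cases "t \<le> \<gamma>")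
    case True
    have "s * bX Q i \<in> RR" "s * cX Q i \<in> RR" unfolding sb sc using True g au by (simp_all add: uni_powi_RR_iff)
    then show ?thesis using True by (simp add: JX_alt tX MM_e_pi_RR flip: s_def)
  next
    case False
    define k where "k = nat (t - \<gamma> - 1)"
    have t: "t = \<gamma> + int k + 1" using False by (simp add: k_def)
    have "MM (\<lambda>x. e_pi ((s * bX Q i) * x\<^sup>2 + (s * cX Q i) * x + 0)) = 0"
    proof (rule linear_dominant[OF au(2), where k = k])
      show "s * cX Q i = a * c / 2 ^ (k + 1)" unfolding sc t by (simp add: powi2_diff powi2_add field_simps)
      have "s * bX Q i * 2 ^ (k + 1) = 2 powi (\<tau> - t + int (k + 1)) * (a * u)"
        unfolding sb pow2_powi powi2_add by (simp only: mult_ac)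
      then show "s * bX Q i * 2 ^ (k + 1) \<in> RR" using uni_powi_RR_iff[OF au(1)] g t by simp
      have "s * bX Q i * 2 ^ (2 * k) = 2 powi (\<tau> - t + int (2 * k)) * (a * u)"
        unfolding sb pow2_powi powi2_add by (simp only: mult_ac)
      then show "s * bX Q i * 2 ^ (2 * k) \<in> RR" using uni_powi_RR_iff[OF au(1)] g t by simp
    qed
    then show ?thesis using False by (simp add: JX_alt tX flip: s_def)
  qed
qed

text \<open>At \<open>t = tX Q i + 1\<close> both coefficients have denominator exactly 2 and
  \<open>linear_balanced\<close> applies; the factor w is 1 modulo 2 and drops out of the condition.
  For larger t the linear term dominates.\<close>

lemma JX_E:
  assumes i: "i \<in> EpX Q" and u: "u \<in> TT" and w: "pu w"
  shows "JX i (u * w / 2 powi t) = (if t \<le> tX Q i then 1 else if t = tX Q i + 1 then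
    (if bX Q i / 2 powi (t - 1) - u * (cX Q i)\<^sup>2 / 2 powi (2 * t - 2) \<in> p_pow 1 then 1 else 0) else 0)"
proof -
  have iX: "i \<in> {1..rX Q}" and eq: "ord_p (bX Q i) = ord_p (cX Q i)" using i by (auto simp: EpX_def)
  obtain \<tau> v where v: "uni v" "bX Q i = 2 powi \<tau> * v" "ord_p (bX Q i) = ereal (of_int \<tau>)"
    using ord_decomp[OF X_ok(2)[OF iX]] .
  have "cX Q i \<noteq> 0" using eq v by (auto simp: ord_p_def)
  then obtain \<gamma> c where c: "uni c" "cX Q i = 2 powi \<gamma> * c" "ord_p (cX Q i) = ereal (of_int \<gamma>)"
    by (rule ord_decomp)
  have g: "\<gamma> = \<tau>" using eq v c by simp
  have tX: "tX Q i = \<tau>" using v c g by (simp add: tX_def)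
  define a where "a = u * w"
  have a: "uni a" unfolding a_def by (intro uni_mult uni_UU u uni_pu w)
  define s where "s = a / 2 powi t"
  have sb: "s * bX Q i = 2 powi (\<tau> - t) * (a * v)" by (simp add: s_def v powi2_diff)
  have sc: "s * cX Q i = 2 powi (\<tau> - t) * (a * c)" by (simp add: s_def c g powi2_diff)
  have au: "uni (a * v)" "uni (a * c)" using a v c by (auto intro: uni_mult)
  have J: "JX i (u * w / 2 powi t) = JX i s" by (simp add: s_def a_def)
  consider "t \<le> \<tau>" | "t = \<tau> + 1" | "t > \<tau> + 1" by linarith
  then show ?thesis
  proof cases
    case 1
    have "s * bX Q i \<in> RR" "s * cX Q i \<in> RR" unfolding sb sc using 1 au by (simp_all add: uni_powi_RR_iff)
    then have "JX i s = 1" unfolding JX_alt by (rule MM_e_pi_RR)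
    then show ?thesis unfolding J tX using 1 by simp
  next
    case 2
    have p1: "2 powi (\<tau> - t) = (1 / 2 :: 'k)" unfolding 2 by (simp add: power_int_minus field_simps)
    have e: "s * bX Q i = (a * v) / 2" "s * cX Q i = (a * c) / 2" unfolding sb sc p1 by simp_all
    have "JX i s = (if a * v - (a * c)\<^sup>2 \<in> pp 1 then 1 else 0)"
      unfolding JX_alt e using au by (intro linear_balanced) (simp_all add: uni_def)
    also have "a * v - (a * c)\<^sup>2 \<in> pp 1 \<longleftrightarrow> v - u * c\<^sup>2 \<in> pp 1"
    proof -
      have aR: "a \<in> RR" "a \<notin> pp 1" and vR: "v \<in> RR" and cR: "c \<in> RR" using a v c by (auto simp: uni_def)
      have in1: "v - a * c\<^sup>2 \<in> RR" by (intro RR_closed(4,5) RR_power vR aR cR)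
      have "a * v - (a * c)\<^sup>2 = a * (v - a * c\<^sup>2)" by (simp add: power2_eq_square algebra_simps)
      then have "a * v - (a * c)\<^sup>2 \<in> pp 1 \<longleftrightarrow> v - a * c\<^sup>2 \<in> pp 1"
        using pp_prime[OF aR(1) in1] aR pp_mult_left[OF aR(1)] by auto
      moreover have d: "u * c\<^sup>2 * (w - 1) \<in> pp 1"
        using w unfolding pu_def by (intro pp_mult_left RR_closed(5) RR_UU u RR_power cR)
      have "v - a * c\<^sup>2 \<in> pp 1 \<longleftrightarrow> v - u * c\<^sup>2 \<in> pp 1"
      proof
        assume "v - a * c\<^sup>2 \<in> pp 1"
        then have "v - a * c\<^sup>2 + u * c\<^sup>2 * (w - 1) \<in> pp 1" using d by (rule pp_closed(2))
        then show "v - u * c\<^sup>2 \<in> pp 1" by (simp add: a_def algebra_simps)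
      next
        assume "v - u * c\<^sup>2 \<in> pp 1"
        then have "v - u * c\<^sup>2 - u * c\<^sup>2 * (w - 1) \<in> pp 1" using d by (rule pp_closed(3))
        then show "v - a * c\<^sup>2 \<in> pp 1" by (simp add: a_def algebra_simps)
      qed
      ultimately show ?thesis by blast
    qed
    also have "v - u * c\<^sup>2 = bX Q i / 2 powi (t - 1) - u * (cX Q i)\<^sup>2 / 2 powi (2 * t - 2)"
    proof -
      have "(2 :: 'k) powi (2 * t - 2) = 2 powi \<tau> * 2 powi \<tau>" unfolding 2 powi2_add[symmetric] by simp
      then show ?thesis unfolding v(2) c(2) g 2 by (simp add: power2_eq_square)
    qed
    finally show ?thesis unfolding J tX p_pow_numeral using 2 by simp
  next
    case 3
    define k where "k = nat (t - \<tau> - 2)"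
    have t: "t = \<tau> + int k + 2" using 3 by (simp add: k_def)
    have "MM (\<lambda>x. e_pi ((s * bX Q i) * x\<^sup>2 + (s * cX Q i) * x + 0)) = 0"
    proof (rule linear_dominant[OF au(2), where k = "k + 1"])
      have "\<tau> - t = - int (k + 1 + 1)" unfolding t by simp
      then have "2 powi (\<tau> - t) = (1 / 2 ^ (k + 1 + 1) :: 'k)" by (simp only: powi2_neg)
      then show "s * cX Q i = a * c / 2 ^ (k + 1 + 1)" unfolding sc by simp
      have "s * bX Q i * 2 ^ (k + 1 + 1) = 2 powi (\<tau> - t + int (k + 1 + 1)) * (a * v)"
        unfolding sb pow2_powi powi2_add by (simp only: mult_ac)
      then show "s * bX Q i * 2 ^ (k + 1 + 1) \<in> RR" using au(1) t by (simp add: uni_def)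
      have "s * bX Q i * 2 ^ (2 * (k + 1)) = 2 powi (\<tau> - t + int (2 * (k + 1))) * (a * v)"
        unfolding sb pow2_powi powi2_add by (simp only: mult_ac)
      moreover have "2 powi (\<tau> - t + int (2 * (k + 1))) * (a * v) \<in> RR"
        unfolding uni_powi_RR_iff[OF au(1)] using t by simp
      ultimately show "s * bX Q i * 2 ^ (2 * (k + 1)) \<in> RR" by (simp only:)
    qed
    then have "JX i s = 0" unfolding JX_alt by (simp only: add_0_right)
    then show ?thesis unfolding J tX using 3 by simp
  qed
qed

text \<open>The strict inequality between the orders is what makes the centre c / (2b) integral, so
  that the square can be completed.\<close>

lemma NpX_data:
  assumes i: "i \<in> NpX Q"
  shows "uni (uX Q i)" "bX Q i = 2 powi tX Q i * uX Q i" "cX Q i / (2 * bX Q i) \<in> RR"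
    "ord_p (bX Q i) = ereal (of_int (tX Q i))" "0 \<le> tX Q i"
proof -
  have iX: "i \<in> {1..rX Q}" and lt: "ord_p (bX Q i) < ord_p (cX Q i)" using i by (auto simp: NpX_def)
  obtain \<tau> v where v: "uni v" "bX Q i = 2 powi \<tau> * v" "ord_p (bX Q i) = ereal (of_int \<tau>)"
    using ord_decomp[OF X_ok(2)[OF iX]] .
  have "min (ord_p (bX Q i)) (ord_p (cX Q i)) = ereal (of_int \<tau>)"
    using min_absorb1[OF less_imp_le[OF lt]] v(3) by simp
  then have tX: "tX Q i = \<tau>" unfolding tX_def by simp
  have uX: "uX Q i = v" by (simp add: uX_def v(3)) (simp add: v(2) power_int_minus)
  show "uni (uX Q i)" "bX Q i = 2 powi tX Q i * uX Q i" "ord_p (bX Q i) = ereal (of_int (tX Q i))"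
    using v by (simp_all add: tX uX)
  show "0 \<le> tX Q i" using uni_powi_RR_iff[OF v(1), of \<tau>] X_ok(1)[OF iX] by (simp add: v(2) tX)
  have "cX Q i / 2 powi (\<tau> + 1) \<in> RR" using lt v(3) ord_p_gt_iff[of \<tau> "cX Q i"] by simp
  then have "cX Q i / 2 powi (\<tau> + 1) * inverse v \<in> RR" by (rule RR_closed(5)[OF _ uni_inverse[OF v(1)]])
  moreover have "cX Q i / 2 powi (\<tau> + 1) * inverse v = cX Q i / (2 * bX Q i)"
    by (simp add: v(2) powi2_add field_simps)
  ultimately show "cX Q i / (2 * bX Q i) \<in> RR" by (simp only:)
qed

text \<open>After completing the square, the unit \<open>uX Q i\<close> of the leading coefficient
  is a root of unity times a principal unit \<open>wi\<close>; \<open>e_pi_eighth_power\<close>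
  replaces \<open>wi\<close> in the phase by the power of \<open>uX Q i\<close> with exponent q - 1,
  from which the root of unity has disappeared.\<close>

lemma JX_N:
  assumes i: "i \<in> NpX Q" and u: "u \<in> TT" and w: "pu w"
  shows "JX i (u * w / 2 powi t) = e_pi (- (u * w / 2 powi t * ((cX Q i)\<^sup>2 / (4 * bX Q i)))) *
    (if t \<le> tX Q i then 1 else if t = tX Q i + 1 then 0 else
      complex_of_real (real q powr (of_int (tX Q i - t + 1) / 2)) *
      (if odd (tX Q i - t + 1) then (- 1) ^ (f - 1) * eta \<zeta> (uX Q i) * et w else 1) *
      e_pi (w * uX Q i ^ (2 ^ f - 1) / 8))"
proof -
  note N = NpX_data[OF i]
  define a where "a = u * w"
  have a: "uni a" unfolding a_def by (intro uni_mult uni_UU u uni_pu w)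
  define s where "s = a / 2 powi t"
  define b c x0 where "b = bX Q i" and "c = cX Q i" and "x0 = cX Q i / (2 * bX Q i)"
  have b0: "b \<noteq> 0" using N(2) uni_neq_0[OF N(1)] by (simp add: b_def)
  have cb: "c = 2 * b * x0" using b0 by (simp add: c_def b_def x0_def)
  have "JX i s = MM (\<lambda>x. e_pi ((s * b) * x\<^sup>2 + 2 * (s * b) * x0 * x))"
    unfolding JX_alt c_def[symmetric] b_def[symmetric] cb by (simp only: mult_ac)
  also have "\<dots> = e_pi (- ((s * b) * x0\<^sup>2)) * MM (\<lambda>x. e_pi ((s * b) * x\<^sup>2))"
    by (rule complete_square) (use N(3) in \<open>simp add: x0_def\<close>)
  also have "(s * b) * x0\<^sup>2 = s * (c\<^sup>2 / (4 * b))"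
    using b0 by (simp add: cb power2_eq_square field_simps)
  finally have J: "JX i s = e_pi (- (s * (c\<^sup>2 / (4 * b)))) * MM (\<lambda>x. e_pi ((s * b) * x\<^sup>2))" .
  have sb: "s * b = 2 powi (tX Q i - t) * (a * uX Q i)" by (simp add: s_def b_def N(2) powi2_diff)
  have au: "uni (a * uX Q i)" using a N(1) by (rule uni_mult)
  have "MM (\<lambda>x. e_pi ((s * b) * x\<^sup>2)) = (if t \<le> tX Q i then 1 else if t = tX Q i + 1 then 0 else
      complex_of_real (real q powr (of_int (tX Q i - t + 1) / 2)) *
      (if odd (tX Q i - t + 1) then (- 1) ^ (f - 1) * eta \<zeta> (uX Q i) * et w else 1) *
      e_pi (w * uX Q i ^ (2 ^ f - 1) / 8))"
  proof -
    consider "t \<le> tX Q i" | "t = tX Q i + 1" | "t > tX Q i + 1" by linarith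
    then show ?thesis
    proof cases
      case 1
      then have "s * b \<in> RR" unfolding sb using au by (simp add: uni_powi_RR_iff)
      then show ?thesis using 1 by (simp add: gauss_integral_RR)
    next
      case 2
      have "s * b = (a * uX Q i) / 2" unfolding sb 2 by (simp add: power_int_minus field_simps)
      moreover have "MM (\<lambda>x. e_pi ((a * uX Q i) / 2 * x\<^sup>2)) = 0"
        using au unfolding uni_def by (intro gauss_integral_1) blast+
      ultimately have "MM (\<lambda>x. e_pi ((s * b) * x\<^sup>2)) = 0" by (simp only:)
      then show ?thesis using 2 by simp
    next
      case 3
      define k where "k = nat (t - tX Q i - 2)"
      have t: "t = tX Q i + int k + 2" using 3 by (simp add: k_def)
      obtain \<alpha> wi where wi: "\<alpha> \<in> TT" "pu wi" "uX Q i = \<alpha> * wi"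
        using unit_decomp N(1) unfolding uni_def by blast
      have "tX Q i - t = - int (k + 2)" unfolding t by simp
      then have "2 powi (tX Q i - t) = (1 / 2 ^ (k + 2) :: 'k)" by (simp only: powi2_neg)
      then have sb2: "s * b = (u * \<alpha>) * (w * wi) / 2 ^ (k + 2)" unfolding sb a_def wi(3) by simp
      have ph: "e_pi (w * wi / 8) = e_pi (w * uX Q i ^ (2 ^ f - 1) / 8)"
      proof -
        have "\<alpha> ^ (q - 1) = 1" using wi(1) by (simp add: UU_eq_roots)
        then have "uX Q i ^ (q - 1) = wi ^ (q - 1)" unfolding wi(3) power_mult_distrib by simp
        then show ?thesis using e_pi_eighth_power[OF wi(2) pu_RR[OF w]] w by simp
      qed
      have ee: "et (w * wi) = eta \<zeta> (uX Q i) * et w"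
        unfolding wi(3) eta_eq[OF wi(1,2)] et_mult[OF w wi(2)] by (rule mult.commute)
      have pw: "- (real k + 1) / 2 = of_int (tX Q i - t + 1) / 2" unfolding t by simp
      have od: "even k \<longleftrightarrow> odd (tX Q i - t + 1)" unfolding t by simp
      have cnd: "\<not> t \<le> tX Q i" "t \<noteq> tX Q i + 1" using 3 by simp_all
      have "MM (\<lambda>x. e_pi ((s * b) * x\<^sup>2)) = complex_of_real (real q powr (- (real k + 1) / 2)) *
          (if even k then (- 1) ^ (f - 1) * et (w * wi) else 1) * e_pi (w * wi / 8)"
        unfolding sb2 by (rule gauss_integral[OF UU_mult[OF u wi(1)] pu_mult[OF w wi(2)]])
      then show ?thesis unfolding pw od ee ph using cnd by (simp only: if_False simp_thms mult.assoc)
    qed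
  qed
  then show ?thesis using J by (simp only: s_def a_def b_def c_def)
qed

lemma JY_D:
  assumes j: "j \<in> DpY Q" and a: "uni a"
  shows "JY j (a / 2 powi t) = (if t \<le> tY Q j then 1 else 0)"
proof -
  have jY: "j \<in> {1..rY Q}" and lt: "min (ord_p (cY Q j 1)) (ord_p (cY Q j 2)) < ord_p (bY Q j)"
    using j by (auto simp: DpY_def)
  obtain \<tau> u where u: "uni u" "bY Q j = 2 powi \<tau> * u" "ord_p (bY Q j) = ereal (of_int \<tau>)"
    using ord_decomp[OF Y_ok(2)[OF jY]] .
  obtain \<gamma> where g: "\<gamma> < \<tau>" "min (ord_p (cY Q j 1)) (ord_p (cY Q j 2)) = ereal (of_int \<gamma>)"
    "cY Q j 1 / 2 powi \<gamma> \<in> RR" "cY Q j 2 / 2 powi \<gamma> \<in> RR"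
    "uni (cY Q j 1 / 2 powi \<gamma>) \<or> uni (cY Q j 2 / 2 powi \<gamma>)"
    using min_ord_decomp lt unfolding u(3) by blast
  have "tY Q j = \<gamma>" using g(1) unfolding tY_def g(2) u(3) by (simp add: min_def)
  then show ?thesis
    unfolding JY_def using JG_D[OF a u(1,2) _ _ g(1,3,4,5), of 0 0] by simp
qed

lemma JZ_D:
  assumes j: "j \<in> DpZ Q" and a: "uni a"
  shows "JZ j (a / 2 powi t) = (if t \<le> tZ Q j then 1 else 0)"
proof -
  have jZ: "j \<in> {1..rZ Q}" and lt: "min (ord_p (cZ Q j 1)) (ord_p (cZ Q j 2)) < ord_p (bZ Q j)"
    using j by (auto simp: DpZ_def)
  obtain \<tau> u where u: "uni u" "bZ Q j = 2 powi \<tau> * u" "ord_p (bZ Q j) = ereal (of_int \<tau>)"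
    using ord_decomp[OF Z_ok(2)[OF jZ]] .
  obtain \<gamma> where g: "\<gamma> < \<tau>" "min (ord_p (cZ Q j 1)) (ord_p (cZ Q j 2)) = ereal (of_int \<gamma>)"
    "cZ Q j 1 / 2 powi \<gamma> \<in> RR" "cZ Q j 2 / 2 powi \<gamma> \<in> RR"
    "uni (cZ Q j 1 / 2 powi \<gamma>) \<or> uni (cZ Q j 2 / 2 powi \<gamma>)"
    using min_ord_decomp lt unfolding u(3) by blast
  have "tZ Q j = \<gamma>" using g(1) unfolding tZ_def g(2) u(3) by (simp add: min_def)
  then show ?thesis
    unfolding JZ_def using JG_D[OF a u(1,2) _ rho_RR g(1,3,4,5), of 1] by simp
qed

text \<open>In contrast to a single square, equality of the orders is allowed: the mixed term has
  coefficient 1, so finding the centre involves no division by 2.\<close>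

lemma N_pair_data:
  assumes b: "b \<in> RR" "b \<noteq> 0" and le: "ord_p b \<le> min (ord_p c) (ord_p d)"
  obtains \<tau> u where "uni u" "b = 2 powi \<tau> * u" "0 \<le> \<tau>" "c / b \<in> RR" "d / b \<in> RR"
    "min (ord_p b) (min (ord_p c) (ord_p d)) = ereal (of_int \<tau>)"
proof -
  obtain \<tau> u where u: "uni u" "b = 2 powi \<tau> * u" "ord_p b = ereal (of_int \<tau>)" using ord_decomp[OF b(2)] .
  have "ereal (of_int \<tau>) \<le> ord_p c" "ereal (of_int \<tau>) \<le> ord_p d" using le u(3) by simp_all
  then have cd: "c / 2 powi \<tau> \<in> RR" "d / 2 powi \<tau> \<in> RR" by (simp_all only: ord_p_ge_iff)
  have "c / b = c / 2 powi \<tau> * inverse u" "d / b = d / 2 powi \<tau> * inverse u"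
    unfolding u(2) using uni_neq_0[OF u(1)] by (simp_all add: field_simps)
  then have "c / b \<in> RR" "d / b \<in> RR"
    using RR_closed(5)[OF cd(1) uni_inverse[OF u(1)]] RR_closed(5)[OF cd(2) uni_inverse[OF u(1)]] by (simp_all only:)
  moreover have "0 \<le> \<tau>" using uni_powi_RR_iff[OF u(1), of \<tau>] b(1) u(2) by simp
  moreover have "min (ord_p b) (min (ord_p c) (ord_p d)) = ereal (of_int \<tau>)" using le u(3) by (simp add: min_absorb1)
  ultimately show ?thesis using that u by blast
qed

lemma JY_N:
  assumes j: "j \<in> NpY Q" and a: "uni a"
  shows "JY j (a / 2 powi t) = e_pi (- (a / 2 powi t * (cY Q j 1 * cY Q j 2 / bY Q j))) *
    (if t \<le> tY Q j then 1 else complex_of_real (real q powr of_int (tY Q j - t)))"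
proof -
  have jY: "j \<in> {1..rY Q}" and le: "ord_p (bY Q j) \<le> min (ord_p (cY Q j 1)) (ord_p (cY Q j 2))"
    using j by (auto simp: NpY_def)
  define b c d where "b = bY Q j" and "c = cY Q j 1" and "d = cY Q j 2"
  obtain \<tau> u where u: "uni u" "b = 2 powi \<tau> * u" "0 \<le> \<tau>" "c / b \<in> RR" "d / b \<in> RR"
    "min (ord_p b) (min (ord_p c) (ord_p d)) = ereal (of_int \<tau>)"
    using N_pair_data[OF Y_ok(1)[OF jY] Y_ok(2)[OF jY] le] unfolding b_def c_def d_def by blast
  have tY: "tY Q j = \<tau>" unfolding tY_def b_def[symmetric] c_def[symmetric] d_def[symmetric] u(6) by simp
  have b0: "b \<noteq> 0" using Y_ok(2)[OF jY] by (simp add: b_def)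
  define s where "s = a / 2 powi t"
  \<comment> \<open>The centre is (d / b, c / b): the coefficient of x determines the second
    coordinate and vice versa.\<close>
  have J1: "JY j s = e_pi (- (s * b * (0 * (d / b)\<^sup>2 + d / b * (c / b) + 0 * (c / b)\<^sup>2))) *
      MM (\<lambda>y. MM (\<lambda>x. e_pi (s * b * (0 * x\<^sup>2 + x * y + 0 * y\<^sup>2))))"
    unfolding JY_def b_def[symmetric] c_def[symmetric] d_def[symmetric]
    by (rule JG_complete[OF u(5) u(4) _ _ lc_inner]) (use b0 in simp_all)
  have "s * b * (0 * (d / b)\<^sup>2 + d / b * (c / b) + 0 * (c / b)\<^sup>2) = s * (c * d / b)" using b0 by simp
  moreover have "s * b * (0 * x\<^sup>2 + x * y + 0 * y\<^sup>2) = s * b * (x * y)" for x y by simp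
  ultimately have J: "JY j s = e_pi (- (s * (c * d / b))) * MM (\<lambda>y. MM (\<lambda>x. e_pi (s * b * (x * y))))"
    using J1 by (simp only:)
  have sb: "s * b = 2 powi (\<tau> - t) * (a * u)" by (simp add: s_def u(2) powi2_diff)
  have au: "uni (a * u)" using a u(1) by (rule uni_mult)
  have "MM (\<lambda>y. MM (\<lambda>x. e_pi (s * b * (x * y)))) =
      (if t \<le> \<tau> then 1 else complex_of_real (real q powr of_int (\<tau> - t)))"
  proof (cases "t \<le> \<tau>")
    case True
    then have "s * b \<in> RR" unfolding sb using au by (simp add: uni_powi_RR_iff)
    then have "MM (\<lambda>y. MM (\<lambda>x. e_pi (s * b * (x * y)))) = MM (\<lambda>y. MM (\<lambda>x. 1))"
      by (intro MM_cong e_pi_RR RR_closed(5)[OF \<open>s * b \<in> RR\<close>] RR_closed(5))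
    then show ?thesis using True by simp
  next
    case False
    define k where "k = nat (t - \<tau>)"
    have t: "t = \<tau> + int k" using False by (simp add: k_def)
    have e: "\<tau> - t = - int k" unfolding t by simp
    have sb2: "s * b = (a * u) / 2 ^ k" unfolding sb e powi2_neg by simp
    have "complex_of_real (real q powr of_int (\<tau> - t)) = 1 / of_nat q ^ k"
      unfolding e q_powr_int by (simp only: of_real_divide of_real_1 of_real_power of_real_of_nat_eq)
    then show ?thesis unfolding sb2 hyperbolic_integral[OF au] using False by (simp only: if_False)
  qed
  then show ?thesis using J by (simp only: tY s_def b_def c_def d_def)
qed

lemma four_rho: "uni (4 * \<rho> - 1)"
proof -
  have "pu (1 + 2 * (- (2 * \<rho>)))" by (intro pu_I RR_closed(5,6) rho_RR RR_numeral)
  then have "uni (1 + 2 * (- (2 * \<rho>)))" by (rule uni_pu)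
  moreover have "- (4 * \<rho> - 1) = 1 + 2 * (- (2 * \<rho>))" by simp
  ultimately have "uni (- (4 * \<rho> - 1))" by (simp only:)
  then show ?thesis unfolding uni_def using RR_closed(6)[of "- (4 * \<rho> - 1)"] pp_closed(4)[of "4 * \<rho> - 1" 1] by auto
qed

lemma JZ_N:
  assumes j: "j \<in> NpZ Q" and a: "uni a"
  shows "JZ j (a / 2 powi t) = e_pi (- (a / 2 powi t * ((\<rho> * (cZ Q j 1)\<^sup>2 + (cZ Q j 2)\<^sup>2 - cZ Q j 1 * cZ Q j 2) /
        ((4 * \<rho> - 1) * bZ Q j)))) *
    (if t \<le> tZ Q j then 1 else complex_of_real (real q powr of_int (tZ Q j - t)) *
      (if odd (tZ Q j - t) then neg_one_pow (q2_trace \<rho>) else 1))"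
proof -
  have jZ: "j \<in> {1..rZ Q}" and le: "ord_p (bZ Q j) \<le> min (ord_p (cZ Q j 1)) (ord_p (cZ Q j 2))"
    using j by (auto simp: NpZ_def)
  define b c d where "b = bZ Q j" and "c = cZ Q j 1" and "d = cZ Q j 2"
  obtain \<tau> u where u: "uni u" "b = 2 powi \<tau> * u" "0 \<le> \<tau>" "c / b \<in> RR" "d / b \<in> RR"
    "min (ord_p b) (min (ord_p c) (ord_p d)) = ereal (of_int \<tau>)"
    using N_pair_data[OF Z_ok(1)[OF jZ] Z_ok(2)[OF jZ] le] unfolding b_def c_def d_def by blast
  have tZ: "tZ Q j = \<tau>" unfolding tZ_def b_def[symmetric] c_def[symmetric] d_def[symmetric] u(6) by simp
  have b0: "b \<noteq> 0" using Z_ok(2)[OF jZ] by (simp add: b_def)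
  define D where "D = 4 * \<rho> - 1"
  have D0: "D \<noteq> 0" using uni_neq_0[OF four_rho] by (simp add: D_def)
  have iD: "inverse D \<in> RR" using uni_inverse[OF four_rho] by (simp add: D_def)
  define s where "s = a / 2 powi t"
  \<comment> \<open>Cramer's rule for 2 x0 + y0 = c / b and x0 + 2 \<rho> y0 = d / b, whose
    determinant D is a unit.\<close>
  define x0 y0 where "x0 = inverse D * (2 * \<rho> * (c / b) - d / b)" and "y0 = inverse D * (2 * (d / b) - c / b)"
  have xy0: "x0 \<in> RR" "y0 \<in> RR"
    unfolding x0_def y0_def by (intro RR_closed(4,5) iD rho_RR u RR_numeral)+
  have Dxy: "D * x0 = 2 * \<rho> * (c / b) - d / b" "D * y0 = 2 * (d / b) - c / b"
    using D0 by (simp_all add: x0_def y0_def)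
  have "D * (2 * 1 * x0 + y0) = 2 * (D * x0) + D * y0" by (simp add: algebra_simps)
  also have "\<dots> = D * (c / b)" unfolding Dxy by (simp add: D_def algebra_simps)
  finally have c': "2 * 1 * x0 + y0 = c / b" by (simp only: mult_left_cancel[OF D0])
  have "D * (x0 + 2 * \<rho> * y0) = D * x0 + 2 * \<rho> * (D * y0)" by (simp add: algebra_simps)
  also have "\<dots> = D * (d / b)" unfolding Dxy by (simp add: D_def algebra_simps)
  finally have d': "x0 + 2 * \<rho> * y0 = d / b" by (simp only: mult_left_cancel[OF D0])
  have J1: "JZ j s = e_pi (- (s * b * (1 * x0\<^sup>2 + x0 * y0 + \<rho> * y0\<^sup>2))) *
      MM (\<lambda>y. MM (\<lambda>x. e_pi (s * b * (1 * x\<^sup>2 + x * y + \<rho> * y\<^sup>2))))"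
    unfolding JZ_def b_def[symmetric] c_def[symmetric] d_def[symmetric]
    by (rule JG_complete[OF xy0 _ _ lc_inner]) (use b0 in \<open>simp_all only: c' d' nonzero_mult_div_cancel_left times_divide_eq_right simp_thms\<close>)
  have val: "b * (1 * x0\<^sup>2 + x0 * y0 + \<rho> * y0\<^sup>2) = (\<rho> * c\<^sup>2 + d\<^sup>2 - c * d) / (D * b)"
  proof -
    define C E where "C = c / b" and "E = d / b"
    have cd: "c = b * C" "d = b * E" using b0 by (simp_all add: C_def E_def)
    \<comment> \<open>Multiplying by D twice leaves only D x0 and D y0, which are polynomials in
      \<rho>, C and E.\<close>
    have "D * (1 * x0\<^sup>2 + x0 * y0 + \<rho> * y0\<^sup>2) * D = (D * x0)\<^sup>2 + (D * x0) * (D * y0) + \<rho> * (D * y0)\<^sup>2"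
      by (simp add: power2_eq_square algebra_simps)
    also have "\<dots> = D * (\<rho> * C\<^sup>2 + E\<^sup>2 - C * E)"
      unfolding Dxy C_def[symmetric] E_def[symmetric] by (simp add: D_def power2_eq_square algebra_simps)
    finally have "(1 * x0\<^sup>2 + x0 * y0 + \<rho> * y0\<^sup>2) * D = \<rho> * C\<^sup>2 + E\<^sup>2 - C * E"
      by (simp only: mult.assoc mult_left_cancel[OF D0])
    then have "1 * x0\<^sup>2 + x0 * y0 + \<rho> * y0\<^sup>2 = (\<rho> * C\<^sup>2 + E\<^sup>2 - C * E) / D"
      by (simp only: nonzero_eq_divide_eq[OF D0])
    then have "b * (1 * x0\<^sup>2 + x0 * y0 + \<rho> * y0\<^sup>2) = b * ((\<rho> * C\<^sup>2 + E\<^sup>2 - C * E) / D)" by (simp only:)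
    also have "\<dots> = (\<rho> * c\<^sup>2 + d\<^sup>2 - c * d) / (D * b)"
      unfolding cd using b0 D0 by (simp add: power2_eq_square field_simps)
    finally show ?thesis .
  qed
  have J: "JZ j s = e_pi (- (s * ((\<rho> * c\<^sup>2 + d\<^sup>2 - c * d) / (D * b)))) *
      MM (\<lambda>y. MM (\<lambda>x. e_pi (s * b * nf \<rho> x y)))"
    using J1 unfolding mult.assoc[of s b] val nf_def by (simp only: mult_1_left)
  have sb: "s * b = 2 powi (\<tau> - t) * (a * u)" by (simp add: s_def u(2) powi2_diff)
  have au: "uni (a * u)" using a u(1) by (rule uni_mult)
  have "MM (\<lambda>y. MM (\<lambda>x. e_pi (s * b * nf \<rho> x y))) =
      (if t \<le> \<tau> then 1 else complex_of_real (real q powr of_int (\<tau> - t)) *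
        (if odd (\<tau> - t) then neg_one_pow (q2_trace \<rho>) else 1))"
  proof (cases "t \<le> \<tau>")
    case True
    then have "s * b \<in> RR" unfolding sb using au by (simp add: uni_powi_RR_iff)
    then have "MM (\<lambda>y. MM (\<lambda>x. e_pi (s * b * nf \<rho> x y))) = MM (\<lambda>y. MM (\<lambda>x. 1))"
      unfolding nf_def
      by (intro MM_cong e_pi_RR RR_closed(5)[OF \<open>s * b \<in> RR\<close>] RR_closed(3,5) RR_power rho_RR)
    then show ?thesis using True by simp
  next
    case False
    define k where "k = nat (t - \<tau>)"
    have t: "t = \<tau> + int k" using False by (simp add: k_def)
    have e: "\<tau> - t = - int k" unfolding t by simp
    have sb2: "s * b = (a * u) / 2 ^ k" unfolding sb e powi2_neg by simp
    have "complex_of_real (real q powr of_int (\<tau> - t)) = 1 / of_nat q ^ k"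
      unfolding e q_powr_int by (simp only: of_real_divide of_real_1 of_real_power of_real_of_nat_eq)
    moreover have "odd (\<tau> - t) \<longleftrightarrow> odd k" unfolding e by simp
    ultimately show ?thesis unfolding sb2 norm_form_integral[OF au rho_RR] using False
      by (simp only: if_False neg_one_pow_trace[OF rho_RR] times_divide_eq_left mult_1_left)
  qed
  then show ?thesis using J by (simp only: tZ s_def b_def c_def d_def D_def)
qed

end

section \<open>Character sums over the units\<close>

context unram
begin

lemma pp_2_quarter: "x \<in> pp 2 \<longleftrightarrow> x / 4 \<in> RR"
  by (simp add: pp_def)

lemma norm_p_eq: "norm_p TYPE('k) = q"
proof -
  have c: "(+) x ` pp 1 = (+) y ` pp 1 \<longleftrightarrow> x - y \<in> pp 1" for x y
  proof
    assume "(+) x ` pp 1 = (+) y ` pp 1"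
    moreover have "x \<in> (+) x ` pp 1" by (rule image_eqI[of _ _ 0]) (simp_all add: pp_closed(1))
    ultimately obtain z where "z \<in> pp 1" "x = y + z" by blast
    then show "x - y \<in> pp 1" by simp
  next
    have *: "(+) x ` pp 1 \<subseteq> (+) y ` pp 1" if "x - y \<in> pp 1" for x y
    proof
      fix z assume "z \<in> (+) x ` pp 1"
      then obtain v where v: "v \<in> pp 1" "z = x + v" by blast
      have "x - y + v \<in> pp 1" using that v(1) by (rule pp_closed(2))
      then show "z \<in> (+) y ` pp 1" by (rule image_eqI[rotated]) (simp add: v(2))
    qed
    assume "x - y \<in> pp 1"
    then show "(+) x ` pp 1 = (+) y ` pp 1" using * pp_cong_sym by (intro equalityI) blast+
  qed
  have "(\<lambda>x. (+) x ` pp 1) ` RR = (\<lambda>x. (+) x ` pp 1) ` TT0"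
  proof
    show "(\<lambda>x. (+) x ` pp 1) ` RR \<subseteq> (\<lambda>x. (+) x ` pp 1) ` TT0"
    proof
      fix A assume "A \<in> (\<lambda>x. (+) x ` pp 1) ` RR"
      then obtain x where x: "x \<in> RR" "A = (+) x ` pp 1" by blast
      obtain s where "s \<in> TT0" "x - s \<in> pp 1" using teichmueller_ex[OF x(1)] .
      then show "A \<in> (\<lambda>x. (+) x ` pp 1) ` TT0" using c[of x s] x(2) by blast
    qed
  qed (use RR_UU0 in blast)
  moreover have "inj_on (\<lambda>x. (+) x ` pp 1) TT0"
    by (rule inj_onI) (simp only: c teichmueller_unique)
  ultimately show ?thesis unfolding norm_p_def int_ring_eq p_pow_numeral by (simp only: card_image card_UU0)
qed

lemma two_digits_eq:
  assumes "a \<in> TT0" "b \<in> TT0" "x - (a + 2 * b) \<in> pp 2"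
  shows "two_digits \<zeta> x = (a, b)"
  unfolding two_digits_def p_pow_numeral
proof (rule the_equality)
  fix d assume d: "fst d \<in> TT0 \<and> snd d \<in> TT0 \<and> x - (fst d + 2 * snd d) \<in> pp 2"
  obtain a' b' where ab: "d = (a', b')" by (cases d)
  have "x - (a' + 2 * b') \<in> pp 2" using d by (simp add: ab)
  then have "x - (a' + 2 * b') - (x - (a + 2 * b)) \<in> pp 2" using assms(3) by (rule pp_closed(3))
  then have D: "(a + 2 * b) - (a' + 2 * b') \<in> pp 2" by (simp add: algebra_simps)
  then have "(a + 2 * b) - (a' + 2 * b') \<in> pp 1" by (rule pp_antimono[rotated]) simp
  then have a: "a = a'" by (rule digit_unique[rotated -1]) (use assms d ab in \<open>simp_all add: RR_UU0\<close>)
  have "((a + 2 * b) - (a' + 2 * b')) / 4 \<in> RR" using D by (simp only: pp_2_quarter)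
  moreover have "((a + 2 * b) - (a' + 2 * b')) / 4 = (b - b') / 2" unfolding a by (simp add: field_simps)
  ultimately have "b - b' \<in> pp 1" by (simp only: pp_1_half)
  then have "b = b'" by (rule teichmueller_unique[rotated -1]) (use assms d ab in simp_all)
  then show "d = (a, b)" by (simp add: ab a)
qed (use assms in simp)

lemma two_digits_ex:
  assumes "x \<in> RR"
  obtains a b r where "a \<in> TT0" "b \<in> TT0" "r \<in> RR" "x = a + 2 * b + 4 * r" "two_digits \<zeta> x = (a, b)"
proof -
  obtain a where a: "a \<in> TT0" "x - a \<in> pp 1" using teichmueller_ex[OF assms] .
  obtain y where y: "y \<in> RR" "x - a = 2 ^ 1 * y" using pp_obtain[OF a(2)] .
  obtain b where b: "b \<in> TT0" "y - b \<in> pp 1" using teichmueller_ex[OF y(1)] .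
  obtain r where r: "r \<in> RR" "y - b = 2 ^ 1 * r" using pp_obtain[OF b(2)] .
  have "y = b + 2 * r" using r(2) by (simp add: algebra_simps)
  then have x: "x = a + 2 * b + 4 * r" using y(2) by (simp add: algebra_simps)
  have "x - (a + 2 * b) \<in> pp 2" using r(1) by (simp add: x pp_2_quarter)
  then show ?thesis using that a(1) b(1) r(1) x two_digits_eq by blast
qed

text \<open>Orthogonality over all of \<open>TT0\<close>, minus the term at 0.\<close>

lemma sum_UU_char:
  assumes d: "d \<in> RR"
  shows "(\<Sum>u\<in>TT. e_pi (u * d / 2)) = (if d \<in> pp 1 then of_nat q else 0) - 1"
proof -
  have per: "per 1 (\<lambda>x. e_pi (d * x / 2))"
    unfolding per_def
  proof (intro ballI e_pi_cong)
    fix x y assume "x \<in> RR" "y \<in> RR"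
    moreover have "d * (x + 2 ^ 1 * y) / 2 - d * x / 2 = d * y" by (simp add: field_simps)
    ultimately show "d * (x + 2 ^ 1 * y) / 2 - d * x / 2 \<in> RR" using RR_closed(5)[OF d] by (simp only:)
  qed
  have "(\<Sum>s\<in>TT0. e_pi (d * s / 2)) / of_nat q = mean 1 (\<lambda>x. e_pi (d * x / 2))"
    using mean_Suc[of 0 "\<lambda>x. e_pi (d * x / 2)"] by (simp add: mean_0)
  also have "\<dots> = (if d \<in> pp 1 then 1 else 0)"
    using MM_eq[OF per] MM_char_half[OF d] by (simp only:)
  finally have "(\<Sum>s\<in>TT0. e_pi (d * s / 2)) = (if d \<in> pp 1 then of_nat q else 0)"
    by (simp add: field_simps split: if_splits)
  moreover have "(\<Sum>s\<in>TT0. e_pi (d * s / 2)) = 1 + (\<Sum>s\<in>TT. e_pi (d * s / 2))"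
    unfolding UU0_def by (subst sum.insert) simp_all
  ultimately show ?thesis by (simp add: mult.commute)
qed

text \<open>The phase is M / 8 plus the linear term M y / 4, whose character is trivial only if 4
  divides M.\<close>

lemma MM_twisted_even:
  "MM (\<lambda>y. e_pi (M * (1 + 2 * y) / 8)) = (if M \<in> pp 2 then e_pi (M / 8) else 0)"
proof -
  have "M * (1 + 2 * y) / 8 = M / 8 + M / 4 * y" for y by (simp add: field_simps)
  then have "MM (\<lambda>y. e_pi (M * (1 + 2 * y) / 8)) = e_pi (M / 8) * (if M / 4 \<in> RR then 1 else 0)"
    by (simp only: e_pi_add MM_cmult MM_char)
  then show ?thesis by (simp add: pp_2_quarter)
qed

text \<open>The factor \<open>et\<close> is itself an exponential, of -(y^2 + y) / 4, so the
  integrand is a quadratic exponential. If M = 1 + 2r it is a square centred at r, giving the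
  conjugate of \<open>MM_psi\<close>; otherwise translation by 2r, for a suitable r, gives
  zero.\<close>

lemma MM_twisted_odd:
  "MM (\<lambda>y. et (1 + 2 * y) * e_pi (M * (1 + 2 * y) / 8)) =
    (if pu M then (- 1) ^ (f - 1) / rootq * et M else 0)"
proof -
  have g: "et (1 + 2 * y) * e_pi (M * (1 + 2 * y) / 8) = e_pi ((- 1 / 4) * y\<^sup>2 + (M - 1) / 4 * y + M / 8)" for y
    unfolding et_eq e_pi_add[symmetric] by (rule arg_cong[where f = e_pi]) (simp add: field_simps)
  show ?thesis
  proof (cases "pu M")
    case True
    obtain r where r: "r \<in> RR" "M = 1 + 2 * r" using pu_obtain[OF True] .
    have "(- 1 / 4) * y\<^sup>2 + (M - 1) / 4 * y + M / 8 = - ((y + - r)\<^sup>2 / 4) + (r\<^sup>2 / 4 + M / 8)" for y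
      unfolding r(2) by (simp add: power2_eq_square field_simps)
    then have "MM (\<lambda>y. et (1 + 2 * y) * e_pi (M * (1 + 2 * y) / 8)) =
        MM (\<lambda>y. cnj (e_pi ((y + - r)\<^sup>2 / 4)) * e_pi (r\<^sup>2 / 4 + M / 8))"
      unfolding g by (simp only: e_pi_add e_pi_minus)
    also have "\<dots> = cnj (MM (\<lambda>y. e_pi ((y + - r)\<^sup>2 / 4))) * e_pi (r\<^sup>2 / 4 + M / 8)"
      by (simp only: MM_cmult_right MM_cnj)
    also have "MM (\<lambda>y. e_pi ((y + - r)\<^sup>2 / 4)) = MM (\<lambda>y. e_pi (y\<^sup>2 / 4))"
      by (rule MM_shift[of "\<lambda>y. e_pi (y\<^sup>2 / 4)"])
        (use lc_e_pi_sq[of "1 / 4"] RR_closed(6)[OF r(1)] in simp_all)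
    also have "cnj \<dots> = (- 1) ^ (f - 1) / rootq * e_pi (- (1 / 8) :: 'k)"
      unfolding MM_psi e_pi_minus by simp
    also have "\<dots> * e_pi (r\<^sup>2 / 4 + M / 8) =
        (- 1) ^ (f - 1) / rootq * e_pi (- (1 / 8) + (r\<^sup>2 / 4 + M / 8))"
      by (simp only: e_pi_add mult.assoc)
    also have "- (1 / 8) + (r\<^sup>2 / 4 + M / 8) = - (- (r\<^sup>2 + r) / 4)" unfolding r(2) by (simp add: field_simps)
    also have "e_pi \<dots> = et M" unfolding e_pi_minus et_eq[symmetric] r(2)[symmetric] by (rule et_cnj[OF True])
    finally show ?thesis using True by simp
  next
    case False
    then have "(M - 1) / 2 \<notin> RR" by (simp only: pu_def pp_1_half simp_thms)
    then obtain r where r: "r \<in> RR" "e_pi ((M - 1) / 2 * r) \<noteq> 1" using e_pi_nondeg by blast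
    have "MM (\<lambda>y. e_pi ((- 1 / 4) * y\<^sup>2 + (M - 1) / 4 * y + M / 8)) = 0"
    proof (rule MM_eq_0[OF lc_e_pi_quad _ _ r(2)])
      show "2 * r \<in> RR" by (intro RR_closed(5) RR_numeral r)
      fix y assume y: "y \<in> RR"
      have "- 1 / 4 * (y + 2 * r)\<^sup>2 + (M - 1) / 4 * (y + 2 * r) + M / 8 -
          ((M - 1) / 2 * r + (- 1 / 4 * y\<^sup>2 + (M - 1) / 4 * y + M / 8)) = - (y * r + r\<^sup>2)"
        by (simp add: power2_eq_square field_simps)
      also have "\<dots> \<in> RR" by (intro RR_closed(3,5,6) RR_power r y)
      finally show "e_pi (- 1 / 4 * (y + 2 * r)\<^sup>2 + (M - 1) / 4 * (y + 2 * r) + M / 8) =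
          e_pi ((M - 1) / 2 * r) * e_pi (- 1 / 4 * y\<^sup>2 + (M - 1) / 4 * y + M / 8)"
        unfolding e_pi_add[symmetric] by (rule e_pi_cong)
    qed
    then show ?thesis using False unfolding g by simp
  qed
qed

text \<open>The mean of \<open>et w ^ l\<close> times \<open>e_pi (M w / 8)\<close> over principal
  units w, where P says that l is even; see \<open>MM_twisted_even\<close>,
  \<open>MM_twisted_odd\<close> and \<open>shell_mean\<close>.\<close>

definition shell_term :: "bool \<Rightarrow> 'k \<Rightarrow> complex" where
  "shell_term P M = (if P then if M \<in> pp 2 then e_pi (M / 8) else 0
    else if pu M then (- 1) ^ (f - 1) / rootq * et M else 0)"

section \<open>Sums of the shell means over the roots of unity\<close>

lemma pu_add_pp: "pu M \<Longrightarrow> x \<in> pp 1 \<Longrightarrow> pu (M + x)"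
proof -
  assume "pu M" "x \<in> pp 1"
  then have "M - 1 + x \<in> pp 1" unfolding pu_def by (rule pp_closed(2))
  then show ?thesis unfolding pu_def by (simp add: algebra_simps)
qed

lemma pu_add_iff:
  assumes "pu m"
  shows "pu (m + x) \<longleftrightarrow> x \<in> pp 1"
proof
  assume "pu (m + x)"
  then have "m + x - 1 - (m - 1) \<in> pp 1" using assms unfolding pu_def by (rule pp_closed(3))
  then show "x \<in> pp 1" by (simp add: algebra_simps)
qed (rule pu_add_pp[OF assms])

lemma UU_times_pp_iff:
  assumes u: "u \<in> TT"
  shows "u * x \<in> pp k \<longleftrightarrow> x \<in> pp k"
proof
  assume "u * x \<in> pp k"
  then have "inverse u * (u * x) \<in> pp k" by (rule pp_mult_left[OF RR_UU[OF UU_inverse[OF u]]])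
  then show "x \<in> pp k" using UU_neq_0[OF u] by (simp add: mult.assoc[symmetric])
qed (rule pp_mult_left[OF RR_UU[OF u]])

lemma pu_UU_times_iff:
  assumes u: "u \<in> TT" and n0: "n0 \<in> TT0" and y: "y \<in> RR"
  shows "pu (u * (n0 + 2 * y)) \<longleftrightarrow> u * n0 = 1"
proof -
  have d: "u * (2 * y) \<in> pp 1" by (intro pp_mult_left RR_UU u pp_two y)
  have "pu (u * (n0 + 2 * y)) \<longleftrightarrow> u * n0 - 1 \<in> pp 1"
  proof
    assume "pu (u * (n0 + 2 * y))"
    then have "u * (n0 + 2 * y) - 1 - u * (2 * y) \<in> pp 1" unfolding pu_def using d by (rule pp_closed(3))
    then show "u * n0 - 1 \<in> pp 1" by (simp add: algebra_simps)
  next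
    assume "u * n0 - 1 \<in> pp 1"
    then have "u * n0 - 1 + u * (2 * y) \<in> pp 1" using d by (rule pp_closed(2))
    then show "pu (u * (n0 + 2 * y))" by (simp add: pu_def algebra_simps)
  qed
  also have "\<dots> \<longleftrightarrow> u * n0 = 1"
    using teichmueller_unique[of "u * n0" 1] UU0_mult[OF UU_sub_UU0[OF u] n0] by (auto simp: pp_closed(1))
  finally show ?thesis .
qed

text \<open>In the exponent of \<open>et (m + u \<nu>)\<close>, with \<open>\<nu> = 2 (n1 + 2 r)\<close>, the terms quadratic in \<open>u n1\<close> are made
  linear by \<open>e_pi (s\<^sup>2 / 4) = e_pi (s / 4)\<close> for \<open>s \<in> UU0\<close>.\<close>

lemma et_add_even:
  assumes m: "pu m" and u: "u \<in> TT" and n1: "n1 \<in> TT0" and r: "r \<in> RR"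
  shows "et (m + u * (2 * n1 + 4 * r)) = et m * e_pi (n1 * u * m / 4 + u * (2 * n1 + 4 * r) / 8)"
proof -
  define s y where "s = u * n1" and "y = u * r"
  have s: "s \<in> TT0" unfolding s_def by (rule UU0_mult[OF UU_sub_UU0[OF u] n1])
  have sR: "s \<in> RR" and yR: "y \<in> RR" unfolding y_def using s by (simp_all add: RR_UU0 RR_closed(5) RR_UU u r)
  obtain k where k: "k \<in> RR" "m = 1 + 2 * k" using pu_obtain[OF m] .
  define A where "A = s\<^sup>2 / 4"
  have e4: "e_pi (s\<^sup>2 / 4) = e_pi (s / 4)" using e_pi_div_pow2_square[OF s, of 2] by simp
  have "(1 - (m + u * (2 * n1 + 4 * r))\<^sup>2) / 16 -
      ((1 - m\<^sup>2) / 16 + (n1 * u * m / 4 + u * (2 * n1 + 4 * r) / 8) - s\<^sup>2 / 4 - 3 * (s / 4)) =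
      - (k * s + y * 1 + k * y + s * y + y\<^sup>2)"
    unfolding k(2) s_def y_def by (simp add: power2_eq_square field_simps)
  also have "\<dots> \<in> RR" by (intro RR_closed(2,3,5,6) RR_power k sR yR)
  finally have "et (m + u * (2 * n1 + 4 * r)) =
      e_pi ((1 - m\<^sup>2) / 16 + (n1 * u * m / 4 + u * (2 * n1 + 4 * r) / 8) - s\<^sup>2 / 4 - 3 * (s / 4))"
    unfolding et_def by (rule e_pi_cong)
  also have "\<dots> = et m * e_pi (n1 * u * m / 4 + u * (2 * n1 + 4 * r) / 8) * (cnj (e_pi (s / 4)) * cnj (e_pi (3 * (s / 4))))"
    unfolding e_pi_diff e4 by (simp only: e_pi_add et_def mult.assoc)
  also have "cnj (e_pi (s / 4)) * cnj (e_pi (3 * (s / 4))) = e_pi (- (s / 4) + - (3 * (s / 4)))"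
    by (simp only: e_pi_add e_pi_minus)
  also have "- (s / 4) + - (3 * (s / 4)) = - s" by (simp add: field_simps)
  also have "e_pi (- s) = 1" by (intro e_pi_RR RR_closed(6) sR)
  finally show ?thesis by simp
qed

text \<open>The factor \<open>e_pi (m1 n1 / (2 n0))\<close> measures by how much \<open>et (m + w)\<close> differs from
  \<open>et (w (1 + m))\<close>.\<close>

lemma et_add_pp:
  assumes a: "a \<in> RR" and y: "y \<in> RR"
  shows "et (2 * a + (1 + 2 * y)) = et ((1 + 2 * y) * (1 + 2 * a)) * e_pi (a * y / 2)"
proof -
  have "(1 - (2 * a + (1 + 2 * y))\<^sup>2) / 16 - ((1 - ((1 + 2 * y) * (1 + 2 * a))\<^sup>2) / 16 + a * y / 2) =
      a * y * (a + y + a * y)"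
  proof -
    have "(1 - A\<^sup>2) / 16 - ((1 - B\<^sup>2) / 16 + a * y / 2) = (B\<^sup>2 - A\<^sup>2 - 8 * (a * y)) / 16" for A B :: 'k
      by (simp add: field_simps)
    moreover have "((1 + 2 * y) * (1 + 2 * a))\<^sup>2 - (2 * a + (1 + 2 * y))\<^sup>2 - 8 * (a * y) =
      16 * (a * y * (a + y + a * y))"
      by (simp add: power2_eq_square algebra_simps)
    ultimately show ?thesis by (simp only: nonzero_mult_div_cancel_left[OF q2_field_numeral_neq_0])
  qed
  also have "\<dots> \<in> RR" by (intro RR_closed(3,5) a y)
  finally show ?thesis unfolding et_def e_pi_add[symmetric] by (rule e_pi_cong)
qed

lemma sum_single:
  assumes "finite A" "\<And>u. u \<in> A \<Longrightarrow> u \<noteq> a \<Longrightarrow> g u = 0"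
  shows "(\<Sum>u\<in>A. g u) = (if a \<in> A then g a else 0 :: complex)"
proof -
  have "(\<Sum>u\<in>A. g u) = (\<Sum>u\<in>A. if u = a then g u else 0)" by (intro sum.cong) (use assms in auto)
  then show ?thesis using assms(1) by simp
qed

lemma inverse_digit:
  assumes "n0 \<in> TT0" "u \<in> TT" "u * n0 = 1"
  shows "u = inverse n0"
  using assms UU_neq_0[OF assms(2)] by (metis inverse_unique mult.commute)

text \<open>A nonzero term needs m + u\<nu> even, and m is 1 modulo 2, so u\<nu> is 1 modulo 2 as
  well; this leaves only the inverse of the leading digit n0.\<close>

lemma shell_even_unit:
  assumes m: "pu m" and \<nu>: "n0 \<in> TT0" "y \<in> RR"
  shows "(\<Sum>u\<in>TT. shell_term True (m + u * (n0 + 2 * y))) =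
    (if n0 = 0 then 0 else if n0 * m + (n0 + 2 * y) \<in> pp 2 then e_pi (m / 8 + (n0 + 2 * y) / n0 / 8) else 0)"
proof -
  have z: "shell_term True (m + u * (n0 + 2 * y)) = 0" if u: "u \<in> TT" "u \<noteq> inverse n0" for u
  proof -
    have "m + u * (n0 + 2 * y) \<notin> pp 2"
    proof
      assume "m + u * (n0 + 2 * y) \<in> pp 2"
      then have "m + u * (n0 + 2 * y) \<in> pp 1" by (rule pp_antimono[rotated]) simp
      then have "m + u * (n0 + 2 * y) - (m - 1) - 2 * 1 \<in> pp 1"
        using m unfolding pu_def by (intro pp_closed(3)[OF pp_closed(3)] pp_two RR_closed(2))
      then have "pu (u * (n0 + 2 * y))" by (simp add: pu_def algebra_simps)
      then show False using pu_UU_times_iff[OF u(1) \<nu>] inverse_digit[OF \<nu>(1) u(1)] u(2) by blast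
    qed
    then show ?thesis by (simp add: shell_term_def)
  qed
  have "(\<Sum>u\<in>TT. shell_term True (m + u * (n0 + 2 * y))) =
      (if inverse n0 \<in> TT then shell_term True (m + inverse n0 * (n0 + 2 * y)) else 0)"
    by (rule sum_single) (use z in auto)
  also have "\<dots> = (if n0 = 0 then 0 else if n0 * m + (n0 + 2 * y) \<in> pp 2 then e_pi (m / 8 + (n0 + 2 * y) / n0 / 8) else 0)"
  proof (cases "n0 = 0")
    case False
    then have U: "n0 \<in> TT" using \<nu>(1) by (simp add: UU_iff_UU0)
    define M where "M = m + inverse n0 * (n0 + 2 * y)"
    have "n0 * m + (n0 + 2 * y) = n0 * M" using False by (simp add: M_def field_simps)
    then have 1: "n0 * m + (n0 + 2 * y) \<in> pp 2 \<longleftrightarrow> M \<in> pp 2" by (simp only: UU_times_pp_iff[OF U])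
    have "M / 8 = m / 8 + (n0 + 2 * y) / n0 / 8" using False by (simp add: M_def field_simps)
    then show ?thesis using False UU_inverse[OF U] 1 unfolding M_def[symmetric] shell_term_def by (simp only: if_True if_False)
  qed simp
  finally show ?thesis .
qed

text \<open>The divisibility by 4 concerns m alone, and u enters only through the character at u d /
  2.\<close>

lemma shell_even_pp:
  assumes m: "m \<in> RR" and d: "d \<in> RR"
  shows "(\<Sum>u\<in>TT. shell_term True (m + u * (4 * d))) =
    (if m \<in> pp 2 then 1 else 0) * e_pi (m / 8) * ((if d \<in> pp 1 then of_nat q else 0) - 1)"
proof -
  have "shell_term True (m + u * (4 * d)) = (if m \<in> pp 2 then 1 else 0) * e_pi (m / 8) * e_pi (u * d / 2)"
    if u: "u \<in> TT" for u
  proof -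
    have "(m + u * (4 * d)) / 4 = m / 4 + u * d" by (simp add: field_simps)
    moreover have "m / 4 + u * d \<in> RR \<longleftrightarrow> m / 4 \<in> RR"
      using RR_closed(3)[of "m / 4" "u * d"] RR_closed(4)[of "m / 4 + u * d" "u * d"] RR_closed(5)[OF RR_UU[OF u] d] by auto
    ultimately have 1: "m + u * (4 * d) \<in> pp 2 \<longleftrightarrow> m \<in> pp 2" by (simp only: pp_2_quarter)
    have "(m + u * (4 * d)) / 8 = m / 8 + u * d / 2" by (simp add: field_simps)
    then have 2: "e_pi ((m + u * (4 * d)) / 8) = e_pi (m / 8) * e_pi (u * d / 2)" by (simp only: e_pi_add)
    show ?thesis unfolding shell_term_def 1 2 by simp
  qed
  then have "(\<Sum>u\<in>TT. shell_term True (m + u * (4 * d))) =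
      (\<Sum>u\<in>TT. (if m \<in> pp 2 then 1 else 0) * e_pi (m / 8) * e_pi (u * d / 2))"
    by (intro sum.cong refl)
  also have "\<dots> = (if m \<in> pp 2 then 1 else 0) * e_pi (m / 8) * (\<Sum>u\<in>TT. e_pi (u * d / 2))"
    by (simp only: sum_distrib_left)
  finally show ?thesis by (simp only: sum_UU_char[OF d])
qed

lemma half_uni_iff:
  assumes "n1 \<in> TT0" "r \<in> RR"
  shows "n1 + 2 * r \<in> pp 1 \<longleftrightarrow> n1 = 0"
proof
  assume "n1 + 2 * r \<in> pp 1"
  then have "n1 + 2 * r - (0 + 2 * 0) \<in> pp 1" by simp
  then show "n1 = 0" by (rule digit_unique[rotated -1]) (use assms in \<open>simp_all add: RR_closed(1)\<close>)
qed (use pp_two[OF assms(2)] in simp)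

text \<open>Divisibility of m + u\<nu> by 4 requires n0 = 0 and then m1 = u n1 for the second
  digits. Since 4 does not divide \<nu>, n1 is then nonzero, so there is a single such u if m1 is
  nonzero and none otherwise; the same dichotomy decides whether \<nu> / m is a unit.\<close>

lemma shell_even_middle:
  assumes m: "m = 2 * m1 + 4 * k" "m1 \<in> TT0" "k \<in> RR"
    and \<nu>: "\<nu> = n0 + 2 * n1 + 4 * r" "n0 \<in> TT0" "n1 \<in> TT0" "r \<in> RR" and nu2: "\<nu> \<notin> pp 2"
  shows "(\<Sum>u\<in>TT. shell_term True (m + u * \<nu>)) =
    (if uni (- \<nu> / m) then e_pi (m / 8 + m1 * \<nu> / n1 / 8) else 0)"
proof (cases "n0 = 0 \<and> m1 \<noteq> 0")
  case True
  have n1: "n1 \<noteq> 0"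
  proof
    assume "n1 = 0"
    then have "\<nu> / 4 = r" using \<nu>(1) True by simp
    then show False using nu2 \<nu>(4) by (simp only: pp_2_quarter simp_thms)
  qed
  have U: "m1 / n1 \<in> TT" using True n1 m(2) \<nu>(3) by (intro UU_divide) (simp_all add: UU_iff_UU0)
  have pp2: "m + u * \<nu> \<in> pp 2 \<longleftrightarrow> u = m1 / n1" if u: "u \<in> TT" for u
  proof -
    have "(m + u * \<nu>) / 4 = (m1 - u * n1) / 2 + (u * n1 + k + u * r)" using True \<nu>(1) m(1) by (simp add: field_simps)
    moreover have R: "u * n1 + k + u * r \<in> RR" by (intro RR_closed(3,5) RR_UU[OF u] RR_UU0[OF \<nu>(3)] m \<nu>)
    moreover have "x + z \<in> RR \<longleftrightarrow> x \<in> RR" if "z \<in> RR" for x z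
      using RR_closed(3)[of x z] RR_closed(4)[of "x + z" z] that by auto
    ultimately have "m + u * \<nu> \<in> pp 2 \<longleftrightarrow> m1 - u * n1 \<in> pp 1" by (simp only: pp_2_quarter pp_1_half)
    also have "\<dots> \<longleftrightarrow> m1 = u * n1"
      using teichmueller_unique[OF m(2) UU0_mult[OF UU_sub_UU0[OF u] \<nu>(3)]] by (auto simp: pp_closed(1))
    finally show ?thesis using n1 by (auto simp: field_simps)
  qed
  have "(\<Sum>u\<in>TT. shell_term True (m + u * \<nu>)) = (if m1 / n1 \<in> TT then shell_term True (m + m1 / n1 * \<nu>) else 0)"
    by (rule sum_single) (use pp2 in \<open>auto simp: shell_term_def\<close>)
  also have "\<dots> = e_pi ((m + m1 / n1 * \<nu>) / 8)" using U pp2[OF U] by (simp only: shell_term_def if_True simp_thms)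
  also have "(m + m1 / n1 * \<nu>) / 8 = m / 8 + m1 * \<nu> / n1 / 8" by (simp add: field_simps)
  finally have S: "(\<Sum>u\<in>TT. shell_term True (m + u * \<nu>)) = e_pi (m / 8 + m1 * \<nu> / n1 / 8)" .
  have u1: "uni (n1 + 2 * r)" "uni (m1 + 2 * k)"
    unfolding uni_def using n1 True half_uni_iff[OF \<nu>(3,4)] half_uni_iff[OF m(2,3)]
    by (simp_all add: RR_closed(3,5) RR_UU0 \<nu> m)
  have "uni (- 1 * ((n1 + 2 * r) * inverse (m1 + 2 * k)))"
    by (intro uni_mult u1 uni_inverse_uni) (simp add: uni_pu pu_def pp_def RR_closed)
  moreover have "- \<nu> / m = - 1 * ((n1 + 2 * r) * inverse (m1 + 2 * k))"
  proof -
    have "\<nu> = 2 * (n1 + 2 * r)" "m = 2 * (m1 + 2 * k)" using True \<nu>(1) m(1) by simp_all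
    then have "- \<nu> / m = - (n1 + 2 * r) / (m1 + 2 * k)" by (simp only: minus_mult_right mult_divide_mult_cancel_left[OF two_neq_0])
    then show ?thesis by (simp only: divide_inverse mult_minus_left mult_1_left)
  qed
  ultimately have "uni (- \<nu> / m)" by (simp only:)
  then show ?thesis using S by simp
next
  case False
  have "m = 2 * (m1 + 2 * k)" by (simp add: m(1))
  then have mp: "m \<in> pp 1"
    using pp_two[OF RR_closed(3)[OF RR_UU0[OF m(2)] RR_closed(5)[OF RR_numeral m(3)]]] by (simp only:)
  have "m + u * \<nu> \<notin> pp 2" if u: "u \<in> TT" for u
  proof
    assume a: "m + u * \<nu> \<in> pp 2"
    have "m + u * \<nu> \<in> pp 1" using a by (rule pp_antimono[rotated]) simp
    then have "m + u * \<nu> - m \<in> pp 1" using mp by (rule pp_closed(3))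
    then have "\<nu> \<in> pp 1" using UU_times_pp_iff[OF u] by simp
    then have "n0 + 2 * (n1 + 2 * r) \<in> pp 1" using \<nu>(1) by (simp add: algebra_simps)
    then have "n0 = 0" using half_uni_iff[OF \<nu>(2) RR_closed(3)[OF RR_UU0[OF \<nu>(3)] RR_closed(5)[OF RR_numeral \<nu>(4)]]] by blast
    then have "m1 = 0" using False by blast
    then have "m \<in> pp 2" using m by (simp add: pp_2_quarter)
    then have "m + u * \<nu> - m \<in> pp 2" using a by (intro pp_closed(3)[of "m + u * \<nu>"])
    then show False using UU_times_pp_iff[OF u] nu2 by simp
  qed
  then have S: "(\<Sum>u\<in>TT. shell_term True (m + u * \<nu>)) = 0" by (intro sum.neutral ballI) (simp add: shell_term_def)
  have "\<not> uni (- \<nu> / m)"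
  proof
    assume un: "uni (- \<nu> / m)"
    then have m0: "m \<noteq> 0" using uni_neq_0 by fastforce
    then have "- \<nu> = - \<nu> / m * m" by simp
    moreover have "- \<nu> / m \<in> RR" using un by (simp only: uni_def)
    ultimately have nm: "- \<nu> \<in> pp j" if "m \<in> pp j" for j using pp_mult_left[OF _ that, of "- \<nu> / m"] by (simp only:)
    have "\<nu> \<in> pp 1" using pp_closed(4)[OF nm[OF mp]] by simp
    then have "n0 + 2 * (n1 + 2 * r) \<in> pp 1" using \<nu>(1) by (simp add: algebra_simps)
    then have "n0 = 0" using half_uni_iff[OF \<nu>(2) RR_closed(3)[OF RR_UU0[OF \<nu>(3)] RR_closed(5)[OF RR_numeral \<nu>(4)]]] by blast
    then have "m1 = 0" using False by blast
    then have "m \<in> pp 2" using m by (simp add: pp_2_quarter)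
    then show False using pp_closed(4)[OF nm] nu2 by simp
  qed
  then show ?thesis using S by simp
qed

lemma shell_odd_unit_term:
  assumes m: "pu m" and u: "u \<in> TT" and \<nu>: "\<nu> = n0 + 2 * n1 + 4 * r" "n0 \<in> TT0" "n1 \<in> TT0" "r \<in> RR"
  shows "shell_term False (m + u * \<nu>) = (if \<nu> \<in> pp 1 then 1 else 0) * (- 1) ^ (f - 1) * eta \<zeta> m /
    rootq * e_pi (n1 * u * m / 4 + u * \<nu> / 8)"
proof -
  have 1: "pu (m + u * \<nu>) \<longleftrightarrow> \<nu> \<in> pp 1" by (simp only: pu_add_iff[OF m] UU_times_pp_iff[OF u])
  show ?thesis
  proof (cases "\<nu> \<in> pp 1")
    case True
    then have "n0 + 2 * (n1 + 2 * r) \<in> pp 1" using \<nu>(1) by (simp add: algebra_simps)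
    then have "n0 = 0" using half_uni_iff[OF \<nu>(2) RR_closed(3)[OF RR_UU0[OF \<nu>(3)] RR_closed(5)[OF RR_numeral \<nu>(4)]]] by blast
    then have nu: "\<nu> = 2 * n1 + 4 * r" using \<nu>(1) by simp
    have "et (m + u * \<nu>) = eta \<zeta> m * e_pi (n1 * u * m / 4 + u * \<nu> / 8)"
      unfolding nu eta_pu[OF m] by (rule et_add_even[OF m u \<nu>(3,4)])
    then show ?thesis unfolding shell_term_def 1 using True by simp
  next
    case False
    then show ?thesis unfolding shell_term_def 1 by simp
  qed
qed

text \<open>If \<nu> is even, then n1 m + \<nu> / 2 = 2d for an integral d, and the phases in
  \<open>shell_odd_unit_term\<close> become u d / 2, so the sum over u is a character sum.\<close>

lemma shell_odd_unit:
  assumes m: "pu m" and \<nu>: "\<nu> = n0 + 2 * n1 + 4 * r" "n0 \<in> TT0" "n1 \<in> TT0" "r \<in> RR"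
  shows "(\<Sum>u\<in>TT. shell_term False (m + u * \<nu>)) = (if \<nu> \<in> pp 1 then 1 else 0) * (- 1) ^ (f - 1) * eta \<zeta> m /
    rootq * ((if n1 * m + \<nu> / 2 \<in> pp 2 then of_nat q else 0) - 1)"
proof (cases "\<nu> \<in> pp 1")
  case True
  then have "n0 + 2 * (n1 + 2 * r) \<in> pp 1" using \<nu>(1) by (simp add: algebra_simps)
  then have "n0 = 0" using half_uni_iff[OF \<nu>(2) RR_closed(3)[OF RR_UU0[OF \<nu>(3)] RR_closed(5)[OF RR_numeral \<nu>(4)]]] by blast
  then have nu: "\<nu> = 2 * n1 + 4 * r" using \<nu>(1) by simp
  obtain k where k: "k \<in> RR" "m = 1 + 2 * k" using pu_obtain[OF m] .
  define d where "d = n1 * (1 + k) + r"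
  have d: "d \<in> RR" unfolding d_def by (intro RR_closed(2,3,5) RR_UU0 \<nu> k)
  have nd: "n1 * m + \<nu> / 2 = 2 * d" unfolding nu k d_def by (simp add: field_simps)
  have "n1 * u * m / 4 + u * \<nu> / 8 = u * (n1 * m + \<nu> / 2) / 4" for u by (simp add: field_simps)
  moreover have "u * (2 * d) / 4 = u * d / 2" for u by (simp add: field_simps)
  ultimately have e: "n1 * u * m / 4 + u * \<nu> / 8 = u * d / 2" for u by (simp only: nd)
  have p: "n1 * m + \<nu> / 2 \<in> pp 2 \<longleftrightarrow> d \<in> pp 1" 
  proof -
    have "2 * d / 4 = d / 2" by (simp add: field_simps)
    then show ?thesis by (simp only: nd pp_2_quarter pp_1_half)
  qed
  have "(\<Sum>u\<in>TT. shell_term False (m + u * \<nu>)) = (\<Sum>u\<in>TT. (if \<nu> \<in> pp 1 then 1 else 0) * (- 1) ^ (f - 1) * eta \<zeta> m /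
    rootq * e_pi (u * d / 2))"
    by (intro sum.cong refl) (simp only: shell_odd_unit_term[OF m _ \<nu>] e)
  then show ?thesis by (simp only: sum_distrib_left[symmetric] sum_UU_char[OF d] p)
next
  case False
  then show ?thesis using shell_odd_unit_term[OF m _ \<nu>] by simp
qed

text \<open>As m is even, m + u\<nu> is a principal unit only for the inverse u of n0. The sum is
  over an arbitrary V because this case of \<open>omega\<close> does not distinguish the size of the
  set of admissible u.\<close>

lemma shell_odd_pp:
  assumes m: "m = 2 * m1 + 4 * k" "m1 \<in> TT0" "k \<in> RR"
    and \<nu>: "\<nu> = n0 + 2 * n1 + 4 * r" "n0 \<in> TT0" "n1 \<in> TT0" "r \<in> RR"
    and V: "V \<subseteq> TT"
  shows "(\<Sum>u\<in>V. shell_term False (m + u * \<nu>)) = (if inverse n0 \<notin> V then 0 else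
    (if uni (- \<nu>) then 1 else 0) * (- 1) ^ (f - 1) / rootq *
      eta \<zeta> (- \<nu> * (1 + m)) * e_pi (m1 * n1 / (2 * n0)))"
proof -
  have nR: "n1 + 2 * r \<in> RR" by (intro RR_closed(3,5) RR_UU0 \<nu> RR_numeral)
  have aR: "m1 + 2 * k \<in> RR" by (intro RR_closed(3,5) RR_UU0 m RR_numeral)
  have nu: "\<nu> = n0 + 2 * (n1 + 2 * r)" and ma: "m = 2 * (m1 + 2 * k)" using \<nu>(1) m(1) by (simp_all add: algebra_simps)
  have mp: "m \<in> pp 1" unfolding ma by (rule pp_two[OF aR])
  have pu_iff: "pu (m + u * \<nu>) \<longleftrightarrow> u = inverse n0" if u: "u \<in> TT" for u
  proof -
    have "pu (m + u * \<nu>) \<longleftrightarrow> pu (u * \<nu>)"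
      using pu_add_pp[of "u * \<nu>" m] pu_add_pp[of "m + u * \<nu>" "- m"] mp pp_closed(4)[OF mp] by (auto simp: add.commute)
    also have "\<dots> \<longleftrightarrow> u * n0 = 1" unfolding nu by (rule pu_UU_times_iff[OF u \<nu>(2) nR])
    also have "\<dots> \<longleftrightarrow> u = inverse n0" using inverse_digit[OF \<nu>(2) u] UU_neq_0[OF u] by auto
    finally show ?thesis .
  qed
  have "finite V" using V by (rule finite_subset) simp
  then have "(\<Sum>u\<in>V. shell_term False (m + u * \<nu>)) =
      (if inverse n0 \<in> V then shell_term False (m + inverse n0 * \<nu>) else 0)"
    by (rule sum_single) (use pu_iff V in \<open>auto simp: shell_term_def\<close>)
  also have "\<dots> = (if inverse n0 \<notin> V then 0 else
    (if uni (- \<nu>) then 1 else 0) * (- 1) ^ (f - 1) / rootq *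
      eta \<zeta> (- \<nu> * (1 + m)) * e_pi (m1 * n1 / (2 * n0)))"
  proof (cases "inverse n0 \<in> V")
    case True
    then have inU: "inverse n0 \<in> TT" using V by blast
    then have n0U: "n0 \<in> TT" using UU_inverse by fastforce
    then have n00: "n0 \<noteq> 0" by (rule UU_neq_0)
    define y where "y = inverse n0 * (n1 + 2 * r)"
    have y: "y \<in> RR" unfolding y_def by (intro RR_closed(5) RR_UU inU nR)
    have w: "inverse n0 * \<nu> = 1 + 2 * y" unfolding nu y_def using n00 by (simp add: field_simps)
    have "- \<nu> * (1 + m) = n0 * ((- 1 * (1 + 2 * y)) * (1 + m))"
      unfolding w[symmetric] using n00 by (simp add: field_simps)
    also have "eta \<zeta> \<dots> = et ((- 1 * (1 + 2 * y)) * (1 + m))"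
    proof (rule eta_eq[OF n0U])
      have "pu (- 1)" by (simp add: pu_def pp_def RR_closed)
      then show "pu ((- 1 * (1 + 2 * y)) * (1 + m))" unfolding ma by (intro pu_mult pu_I y aR)
    qed
    also have "- 1 * (1 + 2 * y) * (1 + m) = - ((1 + 2 * y) * (1 + m))" by (simp only: mult_minus_left mult_1_left)
    also have "et \<dots> = et ((1 + 2 * y) * (1 + m))" by (simp only: et_def power2_minus)
    finally have et1: "eta \<zeta> (- \<nu> * (1 + m)) = et ((1 + 2 * y) * (1 + m))" .
    have et2: "et (m + inverse n0 * \<nu>) = et ((1 + 2 * y) * (1 + m)) * e_pi ((m1 + 2 * k) * y / 2)"
      unfolding w ma by (rule et_add_pp[OF aR y])
    have "(m1 + 2 * k) * y / 2 - m1 * n1 / (2 * n0) = k * y + m1 * (inverse n0 * r)"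
      unfolding y_def using n00 by (simp add: field_simps)
    also have "\<dots> \<in> RR" by (intro RR_closed(3,5) y RR_UU[OF inU] RR_UU0 m \<nu>)
    finally have et3: "e_pi ((m1 + 2 * k) * y / 2) = e_pi (m1 * n1 / (2 * n0))" by (rule e_pi_cong)
    have "uni (n0 * (- 1 * (1 + 2 * y)))"
      by (intro uni_mult uni_UU n0U uni_pu pu_mult pu_I y) (simp add: pu_def pp_def RR_closed)
    moreover have "- \<nu> = n0 * (- 1 * (1 + 2 * y))" unfolding w[symmetric] using n00 by simp
    ultimately have un: "uni (- \<nu>)" by (simp only:)
    have "pu (m + inverse n0 * \<nu>)" using pu_iff[OF inU] by blast
    then show ?thesis using True un unfolding shell_term_def et2 et3 et1 by simp
  qed simp
  finally show ?thesis .
qed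

end

section \<open>Assembling the shells: the origin of \<open>omega\<close>\<close>

context unram
begin

lemma sum_pu:
  assumes "finite A" "\<And>i. i \<in> A \<Longrightarrow> pu (g i)"
  shows "sum g A \<in> RR \<and> (sum g A \<in> pp 1 \<or> pu (sum g A))"
  using assms
proof (induction A rule: finite_induct)
  case empty
  then show ?case by (simp add: RR_closed(1) pp_closed(1))
next
  case (insert i A)
  have i: "pu (g i)" and A: "sum g A \<in> RR" "sum g A \<in> pp 1 \<or> pu (sum g A)" using insert by simp_all
  have "g i + sum g A \<in> RR" by (rule RR_closed(3)[OF pu_RR[OF i] A(1)])
  moreover have "g i + sum g A \<in> pp 1 \<or> pu (g i + sum g A)"
    using A(2)
  proof
    assume "pu (sum g A)"
    then have "g i - 1 + (sum g A - 1) + 2 * 1 \<in> pp 1"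
      using i unfolding pu_def by (intro pp_closed(2)[OF pp_closed(2)] pp_two RR_closed(2))
    then show ?thesis by (simp add: algebra_simps)
  qed (simp only: pu_add_pp[OF i] simp_thms)
  ultimately show ?case using insert by simp
qed

lemma pu_power: "pu w \<Longrightarrow> pu (w ^ k)"
  by (induction k) (simp_all add: pu_mult)

lemma ord_p_add_ge_iff: "ereal (of_int t) \<le> ord_p x + ereal (of_int c) \<longleftrightarrow> x / 2 powi (t - c) \<in> RR"
proof (cases "x = 0")
  case False
  then obtain k v where "ord_p x = ereal (of_int k)" using ord_decomp by metis
  then show ?thesis unfolding ord_p_ge_iff[symmetric] by (auto simp: algebra_simps)
qed (simp add: ord_p_def RR_closed(1))

lemma prod_indicator: "finite A \<Longrightarrow> (\<Prod>i\<in>A. if P i then 1 else 0) = (if \<forall>i\<in>A. P i then 1 else 0 :: complex)"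
  by (induction A rule: finite_induct) auto

end

context unram_poly
begin

abbreviation "nn \<equiv> frak_n \<rho> Q n"
abbreviation "nu t \<equiv> - 8 * nn / 2 powi t"
abbreviation "mm t \<equiv> m_fun f Q t"

lemma finite_index [simp]: "finite (DpX Q)" "finite (EpX Q)" "finite (NpX Q)" "finite (DpY Q)" "finite (NpY Q)"
    "finite (DpZ Q)" "finite (NpZ Q)"
  by (simp_all add: DpX_def EpX_def NpX_def DpY_def NpY_def DpZ_def NpZ_def)

lemma prod_X: "(\<Prod>i\<in>{1..rX Q}. g i) = (\<Prod>i\<in>DpX Q. g i) * (\<Prod>i\<in>EpX Q. g i) * (\<Prod>i\<in>NpX Q. g i)"
    for g :: "nat \<Rightarrow> complex"
proof -
  have "{1..rX Q} = DpX Q \<union> EpX Q \<union> NpX Q" "(DpX Q \<union> EpX Q) \<inter> NpX Q = {}" "DpX Q \<inter> EpX Q = {}"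
    by (auto simp: DpX_def EpX_def NpX_def neq_iff)
  then show ?thesis by (simp only: prod.union_disjoint finite_Un finite_index simp_thms)
qed

lemma prod_Y: "(\<Prod>j\<in>{1..rY Q}. g j) = (\<Prod>j\<in>DpY Q. g j) * (\<Prod>j\<in>NpY Q. g j)" for g :: "nat \<Rightarrow> complex"
proof -
  have "{1..rY Q} = DpY Q \<union> NpY Q" "DpY Q \<inter> NpY Q = {}"
    unfolding DpY_def NpY_def not_less[symmetric] by blast+
  then show ?thesis by (simp only: prod.union_disjoint finite_index)
qed

lemma prod_Z: "(\<Prod>k\<in>{1..rZ Q}. g k) = (\<Prod>k\<in>DpZ Q. g k) * (\<Prod>k\<in>NpZ Q. g k)" for g :: "nat \<Rightarrow> complex"
proof -
  have "{1..rZ Q} = DpZ Q \<union> NpZ Q" "DpZ Q \<inter> NpZ Q = {}"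
    unfolding DpZ_def NpZ_def not_less[symmetric] by blast+
  then show ?thesis by (simp only: prod.union_disjoint finite_index)
qed

lemma t_d_iff: "ereal (of_int t) \<le> t_d Q \<longleftrightarrow> (\<forall>i\<in>DpX Q. t \<le> tX Q i) \<and> (\<forall>i\<in>EpX Q. t \<le> tX Q i + 1) \<and>
    (\<forall>j\<in>DpY Q. t \<le> tY Q j) \<and> (\<forall>k\<in>DpZ Q. t \<le> tZ Q k)"
  unfolding t_d_def le_Inf_iff image_Un ball_Un image_image Ball_image_comp comp_def ball_simps
  by (simp only: ereal_less_eq of_int_le_iff conj_assoc)

text \<open>The inner integral of the density at s (\<open>inner_integral\<close>), already factored
  into blocks.\<close>

definition Gf :: "'k \<Rightarrow> complex" where
  "Gf s = (\<Prod>i\<in>{1..rX Q}. JX i s) * (\<Prod>j\<in>{1..rY Q}. JY j s) * (\<Prod>k\<in>{1..rZ Q}. JZ k s) * e_pi (- (s * n))"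

lemma prod_powr:
  assumes "finite A"
  shows "(\<Prod>i\<in>A. if P i then complex_of_real (real q powr g i) else 1) =
    complex_of_real (real q powr (\<Sum>i | i \<in> A \<and> P i. g i))"
proof -
  have "(\<Prod>i\<in>A. if P i then complex_of_real (real q powr g i) else 1) = (\<Prod>i | i \<in> A \<and> P i. complex_of_real (real q powr g i))"
    using assms by (simp only: prod.inter_filter)
  also have "\<dots> = complex_of_real (\<Prod>i | i \<in> A \<and> P i. real q powr g i)" by (simp only: of_real_prod)
  also have "(\<Prod>i | i \<in> A \<and> P i. real q powr g i) = real q powr (\<Sum>i | i \<in> A \<and> P i. g i)"
    using assms q_pos by (intro powr_sum[symmetric]) simp_all
  finally show ?thesis .
qed

lemma prod_e_pi_neg: "finite A \<Longrightarrow> (\<Prod>i\<in>A. e_pi (- (s * g i))) = e_pi (- (s * (\<Sum>i\<in>A. g i)))" for s :: 'k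
proof -
  assume A: "finite A"
  have "- (s * (\<Sum>i\<in>A. g i)) = (\<Sum>i\<in>A. - (s * g i))" by (simp only: sum_negf sum_distrib_left)
  then show ?thesis by (simp only: e_pi_sum[OF A])
qed

lemma NX_prod:
  assumes u: "u \<in> TT" and w: "pu w" and t: "\<forall>i\<in>NpX Q. t \<noteq> tX Q i + 1"
  shows "(\<Prod>i\<in>NpX Q. JX i (u * w / 2 powi t)) =
    e_pi (- (u * w / 2 powi t * (\<Sum>i\<in>NpX Q. (cX Q i)\<^sup>2 / (4 * bX Q i)))) *
    complex_of_real (real q powr (\<Sum>i | i \<in> NpX Q \<and> tX Q i + 1 < t. of_int (tX Q i - t + 1) / 2)) *
    ((\<Prod>i\<in>LL Q t. (- 1) ^ (f - 1) * eta \<zeta> (uX Q i)) * et w ^ ell Q t) * e_pi (w * mm t / 8)"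
proof -
  define s where "s = u * w / 2 powi t"
  have "JX i s = e_pi (- (s * ((cX Q i)\<^sup>2 / (4 * bX Q i)))) *
      (if tX Q i + 1 < t then complex_of_real (real q powr (of_int (tX Q i - t + 1) / 2)) else 1) *
      (if tX Q i - t + 1 < 0 \<and> odd (tX Q i - t + 1) then (- 1) ^ (f - 1) * eta \<zeta> (uX Q i) * et w else 1) *
      (if tX Q i + 1 < t then e_pi (w * uX Q i ^ (2 ^ f - 1) / 8) else 1)" if i: "i \<in> NpX Q" for i
  proof -
    consider "t \<le> tX Q i" | "tX Q i + 1 < t" using t i by fastforce
    then show ?thesis
    proof cases
      case 1
      then show ?thesis using JX_N[OF i u w, of t] unfolding s_def by simp
    next
      case 2
      then have c: "(t \<le> tX Q i) = False" "(t = tX Q i + 1) = False" "(tX Q i + 1 < t) = True" "(tX Q i - t + 1 < 0) = True" by auto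
      show ?thesis using JX_N[OF i u w, of t] unfolding s_def[symmetric] by (simp only: c if_True if_False simp_thms mult.assoc)
    qed
  qed
  then have "(\<Prod>i\<in>NpX Q. JX i s) = (\<Prod>i\<in>NpX Q. e_pi (- (s * ((cX Q i)\<^sup>2 / (4 * bX Q i))))) *
      (\<Prod>i\<in>NpX Q. if tX Q i + 1 < t then complex_of_real (real q powr (of_int (tX Q i - t + 1) / 2)) else 1) *
      (\<Prod>i\<in>NpX Q. if tX Q i - t + 1 < 0 \<and> odd (tX Q i - t + 1) then (- 1) ^ (f - 1) * eta \<zeta> (uX Q i) * et w else 1) *
      (\<Prod>i\<in>NpX Q. if tX Q i + 1 < t then e_pi (w * uX Q i ^ (2 ^ f - 1) / 8) else 1)"
    by (simp only: prod.distrib cong: prod.cong)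
  also have "(\<Prod>i\<in>NpX Q. if tX Q i - t + 1 < 0 \<and> odd (tX Q i - t + 1) then (- 1) ^ (f - 1) * eta \<zeta> (uX Q i) * et w else 1) =
      (\<Prod>i\<in>LL Q t. (- 1) ^ (f - 1) * eta \<zeta> (uX Q i)) * et w ^ ell Q t"
    unfolding LL_def ell_def by (simp only: prod.inter_filter[symmetric] finite_index prod.distrib prod_constant)
  also have "(\<Prod>i\<in>NpX Q. if tX Q i + 1 < t then e_pi (w * uX Q i ^ (2 ^ f - 1) / 8) else 1) = e_pi (w * mm t / 8)"
  proof -
    have "(\<Prod>i\<in>NpX Q. if tX Q i + 1 < t then e_pi (w * uX Q i ^ (2 ^ f - 1) / 8) else 1) =
        e_pi (\<Sum>i | i \<in> NpX Q \<and> tX Q i + 1 < t. w * uX Q i ^ (2 ^ f - 1) / 8)"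
      by (subst e_pi_sum) (simp_all add: prod.inter_filter[symmetric] del: prod.inter_filter)
    also have "(\<Sum>i | i \<in> NpX Q \<and> tX Q i + 1 < t. w * uX Q i ^ (2 ^ f - 1) / 8) = w * mm t / 8"
      by (simp only: m_fun_def sum_distrib_left sum_divide_distrib)
    finally show ?thesis .
  qed
  finally show ?thesis unfolding s_def by (simp only: prod_powr finite_index prod_e_pi_neg)
qed

lemma NY_prod:
  assumes a: "uni a"
  shows "(\<Prod>j\<in>NpY Q. JY j (a / 2 powi t)) = e_pi (- (a / 2 powi t * (\<Sum>j\<in>NpY Q. cY Q j 1 * cY Q j 2 / bY Q j))) *
    complex_of_real (real q powr (\<Sum>j | j \<in> NpY Q \<and> tY Q j < t. of_int (tY Q j - t)))"
proof -
  have "(\<Prod>j\<in>NpY Q. JY j (a / 2 powi t)) = (\<Prod>j\<in>NpY Q. e_pi (- (a / 2 powi t * (cY Q j 1 * cY Q j 2 / bY Q j))) *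
      (if tY Q j < t then complex_of_real (real q powr of_int (tY Q j - t)) else 1))"
    by (intro prod.cong refl) (auto simp: JY_N[OF _ a])
  then show ?thesis by (simp only: prod.distrib prod_powr finite_index prod_e_pi_neg)
qed

lemma NZ_prod:
  assumes a: "uni a"
  shows "(\<Prod>k\<in>NpZ Q. JZ k (a / 2 powi t)) = e_pi (- (a / 2 powi t * (\<Sum>k\<in>NpZ Q.
      (\<rho> * (cZ Q k 1)\<^sup>2 + (cZ Q k 2)\<^sup>2 - cZ Q k 1 * cZ Q k 2) / ((4 * \<rho> - 1) * bZ Q k)))) *
    complex_of_real (real q powr (\<Sum>k | k \<in> NpZ Q \<and> tZ Q k < t. of_int (tZ Q k - t))) *
    (\<Prod>k | k \<in> NpZ Q \<and> tZ Q k - t < 0 \<and> odd (tZ Q k - t). neg_one_pow (q2_trace \<rho>))"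
proof -
  have "(\<Prod>k\<in>NpZ Q. JZ k (a / 2 powi t)) = (\<Prod>k\<in>NpZ Q. e_pi (- (a / 2 powi t *
      ((\<rho> * (cZ Q k 1)\<^sup>2 + (cZ Q k 2)\<^sup>2 - cZ Q k 1 * cZ Q k 2) / ((4 * \<rho> - 1) * bZ Q k)))) *
      (if tZ Q k < t then complex_of_real (real q powr of_int (tZ Q k - t)) else 1) *
      (if tZ Q k - t < 0 \<and> odd (tZ Q k - t) then neg_one_pow (q2_trace \<rho>) else 1))"
  proof (intro prod.cong refl)
    fix k assume k: "k \<in> NpZ Q"
    have c: "(t \<le> tZ Q k) = (\<not> tZ Q k < t)" "(tZ Q k - t < 0) = (tZ Q k < t)" by auto
    show "JZ k (a / 2 powi t) = e_pi (- (a / 2 powi t *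
      ((\<rho> * (cZ Q k 1)\<^sup>2 + (cZ Q k 2)\<^sup>2 - cZ Q k 1 * cZ Q k 2) / ((4 * \<rho> - 1) * bZ Q k)))) *
      (if tZ Q k < t then complex_of_real (real q powr of_int (tZ Q k - t)) else 1) *
      (if tZ Q k - t < 0 \<and> odd (tZ Q k - t) then neg_one_pow (q2_trace \<rho>) else 1)"
      unfolding JZ_N[OF k a] c by (cases "tZ Q k < t") (simp_all only: if_True if_False simp_thms mult.assoc mult_1_right)
  qed
  then show ?thesis by (simp only: prod.distrib prod_powr finite_index prod_e_pi_neg prod.inter_filter[symmetric])
qed

lemma U_set_iff: "u \<in> U_set \<zeta> Q t \<longleftrightarrow> u \<in> TT \<and> (\<forall>i\<in>EpX Q. tX Q i + 1 = t \<longrightarrow>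
    bX Q i / 2 powi (t - 1) - u * (cX Q i)\<^sup>2 / 2 powi (2 * t - 2) \<in> p_pow 1)"
  by (simp only: U_set_def mem_Collect_eq)

abbreviation "adm t \<equiv> ereal (of_int t) \<le> t_d Q \<and> (\<forall>i\<in>NpX Q. t \<noteq> tX Q i + 1)"

text \<open>The constants from completing the squares and n add up to \<open>nn\<close>, and -s
  \<open>nn\<close> = u \<nu> w / 8 because \<nu> contains the factor -8; this merges all phases
  into one.\<close>

lemma Gf_value:
  assumes u: "u \<in> TT" and w: "pu w"
  shows "Gf (u * w / 2 powi t) =
    (if adm t \<and> u \<in> U_set \<zeta> Q t then
      complex_of_real (real q powr (tau Q t - of_int t)) * delta f \<zeta> \<rho> Q t * et w ^ ell Q t *
        e_pi ((mm t + u * nu t) * w / 8) else 0)"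
proof -
  define s where "s = u * w / 2 powi t"
  have a: "uni (u * w)" by (intro uni_mult uni_UU u uni_pu w)
  have DX: "(\<Prod>i\<in>DpX Q. JX i s) = (if \<forall>i\<in>DpX Q. t \<le> tX Q i then 1 else 0)"
    unfolding s_def by (simp only: JX_D[OF _ a] prod_indicator finite_index cong: prod.cong)
  have DY: "(\<Prod>i\<in>DpY Q. JY i s) = (if \<forall>i\<in>DpY Q. t \<le> tY Q i then 1 else 0)"
    unfolding s_def by (simp only: JY_D[OF _ a] prod_indicator finite_index cong: prod.cong)
  have DZ: "(\<Prod>i\<in>DpZ Q. JZ i s) = (if \<forall>i\<in>DpZ Q. t \<le> tZ Q i then 1 else 0)"
    unfolding s_def by (simp only: JZ_D[OF _ a] prod_indicator finite_index cong: prod.cong)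
  have "JX i s = (if t \<le> tX Q i + 1 \<and> (tX Q i + 1 = t \<longrightarrow>
    bX Q i / 2 powi (t - 1) - u * (cX Q i)\<^sup>2 / 2 powi (2 * t - 2) \<in> p_pow 1) then 1 else 0)" if "i \<in> EpX Q" for i
    unfolding s_def JX_E[OF that u w] by auto
  then have "(\<Prod>i\<in>EpX Q. JX i s) = (\<Prod>i\<in>EpX Q. if t \<le> tX Q i + 1 \<and> (tX Q i + 1 = t \<longrightarrow>
    bX Q i / 2 powi (t - 1) - u * (cX Q i)\<^sup>2 / 2 powi (2 * t - 2) \<in> p_pow 1) then 1 else 0)"
    by (intro prod.cong refl)
  also have "\<dots> = (if (\<forall>i\<in>EpX Q. t \<le> tX Q i + 1) \<and> u \<in> U_set \<zeta> Q t then 1 else 0)"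
    using u by (simp only: prod_indicator finite_index U_set_iff ball_conj_distrib simp_thms)
  finally have EX: "(\<Prod>i\<in>EpX Q. JX i s) = (if (\<forall>i\<in>EpX Q. t \<le> tX Q i + 1) \<and> u \<in> U_set \<zeta> Q t then 1 else 0)" .
  show ?thesis
  proof (cases "ereal (of_int t) \<le> t_d Q \<and> u \<in> U_set \<zeta> Q t")
    case False
    then have "(\<Prod>i\<in>DpX Q. JX i s) = 0 \<or> (\<Prod>i\<in>EpX Q. JX i s) = 0 \<or> (\<Prod>i\<in>DpY Q. JY i s) = 0 \<or> (\<Prod>i\<in>DpZ Q. JZ i s) = 0"
      unfolding t_d_iff DX DY DZ EX by auto
    then have "Gf s = 0" unfolding Gf_def prod_X prod_Y prod_Z by auto
    then show ?thesis using False unfolding s_def by auto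
  next
    case True
    then have one: "(\<Prod>i\<in>DpX Q. JX i s) = 1" "(\<Prod>i\<in>EpX Q. JX i s) = 1" "(\<Prod>i\<in>DpY Q. JY i s) = 1" "(\<Prod>i\<in>DpZ Q. JZ i s) = 1"
      unfolding t_d_iff DX DY DZ EX by simp_all
    have G: "Gf s = (\<Prod>i\<in>NpX Q. JX i s) * (\<Prod>j\<in>NpY Q. JY j s) * (\<Prod>k\<in>NpZ Q. JZ k s) * e_pi (- (s * n))"
      unfolding Gf_def prod_X prod_Y prod_Z one by (simp only: mult_1_left)
    show ?thesis
    proof (cases "\<forall>i\<in>NpX Q. t \<noteq> tX Q i + 1")
      case False
      then obtain i where i: "i \<in> NpX Q" "t = tX Q i + 1" by blast
      have "JX i s = 0" unfolding s_def JX_N[OF i(1) u w] using i(2) by simp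
      then have "(\<Prod>i\<in>NpX Q. JX i s) = 0" using i(1) by (intro prod_zero) auto
      then show ?thesis using False unfolding s_def[symmetric] G by auto
    next
      case N: True
      define AX AY AZ where "AX = (\<Sum>i\<in>NpX Q. (cX Q i)\<^sup>2 / (4 * bX Q i))"
        and "AY = (\<Sum>j\<in>NpY Q. cY Q j 1 * cY Q j 2 / bY Q j)"
        and "AZ = (\<Sum>k\<in>NpZ Q. (\<rho> * (cZ Q k 1)\<^sup>2 + (cZ Q k 2)\<^sup>2 - cZ Q k 1 * cZ Q k 2) / ((4 * \<rho> - 1) * bZ Q k))"
      define TX TY TZ where "TX = (\<Sum>i | i \<in> NpX Q \<and> tX Q i + 1 < t. of_int (tX Q i - t + 1) / 2 :: real)"
        and "TY = (\<Sum>j | j \<in> NpY Q \<and> tY Q j < t. of_int (tY Q j - t) :: real)"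
        and "TZ = (\<Sum>k | k \<in> NpZ Q \<and> tZ Q k < t. of_int (tZ Q k - t) :: real)"
      define P1 P2 where "P1 = (\<Prod>i\<in>LL Q t. (- 1) ^ (f - 1) * eta \<zeta> (uX Q i))"
        and "P2 = (\<Prod>k | k \<in> NpZ Q \<and> tZ Q k - t < 0 \<and> odd (tZ Q k - t). neg_one_pow (q2_trace \<rho>))"
      have X: "(\<Prod>i\<in>NpX Q. JX i s) = e_pi (- (s * AX)) * complex_of_real (real q powr TX) *
          (P1 * et w ^ ell Q t) * e_pi (w * mm t / 8)"
        unfolding s_def AX_def TX_def P1_def by (rule NX_prod[OF u w N])
      have Y: "(\<Prod>j\<in>NpY Q. JY j s) = e_pi (- (s * AY)) * complex_of_real (real q powr TY)"
        unfolding s_def AY_def TY_def by (rule NY_prod[OF a])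
      have Z: "(\<Prod>j\<in>NpZ Q. JZ j s) = e_pi (- (s * AZ)) * complex_of_real (real q powr TZ) * P2"
        unfolding s_def AZ_def TZ_def P2_def by (rule NZ_prod[OF a])
      have nn: "nn = n + AX + AY + AZ" by (simp only: frak_n_def AX_def AY_def AZ_def)
      have ta: "tau Q t - of_int t = TX + TY + TZ" by (simp add: tau_def TX_def TY_def TZ_def)
      have de: "delta f \<zeta> \<rho> Q t = P1 * P2" by (simp only: delta_def P1_def P2_def)
      have "u * nu t * w = - 8 * (s * nn)" unfolding s_def by simp
      then have "(mm t + u * nu t) * w / 8 = w * mm t / 8 + - (s * nn)"
        unfolding distrib_right by (simp add: add_divide_distrib mult.commute)
      also have "\<dots> = - (s * AX) + w * mm t / 8 + - (s * AY) + - (s * AZ) + - (s * n)"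
        unfolding nn by (simp add: algebra_simps)
      finally have ph: "e_pi ((mm t + u * nu t) * w / 8) =
        e_pi (- (s * AX)) * e_pi (w * mm t / 8) * e_pi (- (s * AY)) * e_pi (- (s * AZ)) * e_pi (- (s * n))"
        by (simp only: e_pi_add)
      have "Gf s = complex_of_real (real q powr (tau Q t - of_int t)) * delta f \<zeta> \<rho> Q t * et w ^ ell Q t *
        e_pi ((mm t + u * nu t) * w / 8)"
        unfolding G X Y Z ph ta de powr_add of_real_mult by (simp only: mult_ac)
      then show ?thesis using True N unfolding s_def by simp
    qed
  qed
qed

text \<open>The exponent q - 1 removes the root of unity from each \<open>uX Q i\<close>, so m is a
  sum of principal units.\<close>

lemma mm_props: "mm t \<in> RR" "mm t \<in> pp 1 \<or> pu (mm t)"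
proof -
  have "pu (uX Q i ^ (2 ^ f - 1))" if i: "i \<in> NpX Q" for i
  proof -
    obtain \<alpha> w where w: "\<alpha> \<in> TT" "pu w" "uX Q i = \<alpha> * w"
      using unit_decomp NpX_data(1)[OF i] unfolding uni_def by blast
    have "\<alpha> ^ (q - 1) = 1" using w(1) by (simp add: UU_eq_roots)
    then show ?thesis unfolding w(3) power_mult_distrib using pu_power[OF w(2)] by simp
  qed
  then have "mm t \<in> RR \<and> (mm t \<in> pp 1 \<or> pu (mm t))" unfolding m_fun_def by (intro sum_pu) auto
  then show "mm t \<in> RR" "mm t \<in> pp 1 \<or> pu (mm t)" by blast+
qed

text \<open>If some index constrains u at all, its linear coefficient is a unit c after scaling, and
  two solutions satisfy (u' - u) c^2 = 0 modulo 2, hence coincide.\<close>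

lemma U_set_cases: "U_set \<zeta> Q t = TT \<or> card (U_set \<zeta> Q t) \<le> 1"
proof (cases "\<exists>i\<in>EpX Q. tX Q i + 1 = t")
  case False
  then show ?thesis by (auto simp: U_set_def)
next
  case True
  then obtain i where i: "i \<in> EpX Q" "tX Q i + 1 = t" by blast
  have eq: "ord_p (bX Q i) = ord_p (cX Q i)" and iX: "i \<in> {1..rX Q}" using i(1) by (auto simp: EpX_def)
  obtain \<tau> v where v: "ord_p (bX Q i) = ereal (of_int \<tau>)" using ord_decomp[OF X_ok(2)[OF iX]] by metis
  have "cX Q i \<noteq> 0" using eq v by (auto simp: ord_p_def)
  then obtain \<gamma> c where c: "uni c" "cX Q i = 2 powi \<gamma> * c" "ord_p (cX Q i) = ereal (of_int \<gamma>)" by (rule ord_decomp)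
  have g: "\<gamma> = \<tau>" using eq v c by simp
  have t: "t = \<gamma> + 1" using v c g i(2) by (simp add: tX_def)
  have C: "u * (cX Q i)\<^sup>2 / 2 powi (2 * t - 2) = u * c\<^sup>2" for u
  proof -
    have "(2 :: 'k) powi (2 * t - 2) = 2 powi \<gamma> * 2 powi \<gamma>" unfolding t powi2_add[symmetric] by simp
    then show ?thesis unfolding c(2) by (simp add: power2_eq_square)
  qed
  have "u = u'" if u: "u \<in> U_set \<zeta> Q t" and u': "u' \<in> U_set \<zeta> Q t" for u u'
  proof -
    define b where "b = bX Q i / 2 powi (t - 1)"
    have UU: "u \<in> TT" "u' \<in> TT" using u u' unfolding U_set_iff by blast+
    have "b - v * c\<^sup>2 \<in> pp 1" if "v \<in> U_set \<zeta> Q t" for v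
    proof -
      have "\<forall>i\<in>EpX Q. tX Q i + 1 = t \<longrightarrow> bX Q i / 2 powi (t - 1) - v * (cX Q i)\<^sup>2 / 2 powi (2 * t - 2) \<in> p_pow 1"
        using that unfolding U_set_iff by (rule conjunct2)
      from bspec[OF this i(1), THEN mp, OF i(2)] show ?thesis by (simp only: C p_pow_numeral b_def)
    qed
    from this[OF u] this[OF u'] have "b - u * c\<^sup>2 - (b - u' * c\<^sup>2) \<in> pp 1" by (rule pp_closed(3))
    moreover have "b - u * c\<^sup>2 - (b - u' * c\<^sup>2) = (u' - u) * c\<^sup>2" by (simp add: algebra_simps)
    ultimately have "(u' - u) * c\<^sup>2 \<in> pp 1" by (simp only:)
    moreover have "c\<^sup>2 \<in> RR" "c\<^sup>2 \<notin> pp 1" using uni_mult[OF c(1,1)] unfolding uni_def power2_eq_square by blast+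
    ultimately have "u' - u \<in> pp 1"
      using pp_prime[OF RR_closed(4)[OF RR_UU[OF UU(2)] RR_UU[OF UU(1)]], of "c\<^sup>2"] by blast
    then have "u' = u" by (rule teichmueller_unique[rotated -1]) (use UU UU_sub_UU0 in auto)
    then show ?thesis by simp
  qed
  then have "card (U_set \<zeta> Q t) \<le> Suc 0" by (subst card_le_Suc0_iff_eq) (auto intro: finite_subset[of _ "TT"] simp: U_set_def)
  then show ?thesis by simp
qed

text \<open>All indicator conditions in \<open>omega\<close> are first rewritten in terms of \<nu> =
  -8 \<open>nn\<close> / 2^t and its digits; after that each branch is the value of one of the shell
  lemmas.\<close>

lemma omega_eq:
  assumes nuR: "nu t \<in> RR"
  shows "omega f \<zeta> \<rho> Q n t = (\<Sum>u\<in>U_set \<zeta> Q t. shell_term (even (ell Q t)) (mm t + u * nu t))"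
proof -
  define x where "x = nn"
  define \<nu> where "\<nu> = - 8 * x / 2 powi t"
  define m where "m = mm t"
  define V where "V = U_set \<zeta> Q t"
  have \<nu>R: "\<nu> \<in> RR" using nuR by (simp only: \<nu>_def x_def)
  obtain n0 n1 r where d: "n0 \<in> TT0" "n1 \<in> TT0" "r \<in> RR" "\<nu> = n0 + 2 * n1 + 4 * r" "two_digits \<zeta> \<nu> = (n0, n1)"
    using two_digits_ex[OF \<nu>R] .
  have mR: "m \<in> RR" unfolding m_def by (rule mm_props)
  obtain m0 m1 k where md: "m0 \<in> TT0" "m1 \<in> TT0" "k \<in> RR" "m = m0 + 2 * m1 + 4 * k" "two_digits \<zeta> m = (m0, m1)"
    using two_digits_ex[OF mR] .
  note \<nu>d = d(4,1,2,3)
  have f1: "8 * x / 2 powi t = - \<nu>" "x / 2 powi t = - \<nu> / 8" unfolding \<nu>_def by simp_all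
  have f2: "8 * u * x / 2 powi t = - (u * \<nu>)" "u * x / 2 powi t = - (u * \<nu> / 8)" for u
    unfolding \<nu>_def by simp_all
  have om: "omega f \<zeta> \<rho> Q n t = (if card V = 0 then 0
      else if even (ell Q t) then
        (if card V = 1 then
           indicator (pp 2) (m + the_elem V * \<nu>) * e_pi ((m + the_elem V * \<nu>) / 8)
         else if pu m then
           (if n0 = 0 then 0 else indicator (pp 2) (n0 * m + \<nu>) * e_pi (m / 8 + \<nu> / n0 / 8))
         else if \<nu> \<in> pp 2 then
           indicator (pp 2) m * e_pi (m / 8) * ((if \<nu> / 4 \<in> pp 1 then of_nat q else 0) - 1)
         else (if uni (- \<nu> / m) then 1 else 0) * e_pi (m / 8 + m1 * \<nu> / n1 / 8))
      else if pu m then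
        (if card V = 1 then
           (if \<nu> \<in> pp 1 then 1 else 0) * (- 1) ^ (f - 1) * eta \<zeta> m / rootq *
             e_pi (n1 * the_elem V * m / 4 + the_elem V * \<nu> / 8)
         else
           (if \<nu> \<in> pp 1 then 1 else 0) * (- 1) ^ (f - 1) * eta \<zeta> m / rootq *
             ((if n1 * m + \<nu> / 2 \<in> pp 2 then of_nat q else 0) - 1))
      else (if inverse n0 \<notin> V then 0
         else (if uni (- \<nu>) then 1 else 0) * (- 1) ^ (f - 1) / rootq *
             eta \<zeta> (- \<nu> * (1 + m)) * e_pi (m1 * n1 / (2 * n0))))"
  proof -
    have pu: "m \<in> (+) 1 ` p_pow 1 \<longleftrightarrow> pu m"
    proof -
      have "m \<in> (+) 1 ` pp 1 \<longleftrightarrow> m - 1 \<in> pp 1" by (auto intro: image_eqI[of _ _ "m - 1"])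
      then show ?thesis by (simp only: pu_def p_pow_numeral)
    qed
    have p4: "(2 :: 'k) powi (t - 1) = 2 powi t / 2" "(2 :: 'k) powi (t - 2) = 2 powi t / 4" "(2 :: 'k) powi (t - 3) = 2 powi t / 8"
      by (simp_all add: powi2_diff)
    \<comment> \<open>The boundary between the two branches with even m is the divisibility of \<nu>
      by 4.\<close>
    have tn: "ereal (of_int t) \<le> t_n \<rho> Q n + 1 \<longleftrightarrow> \<nu> \<in> pp 2"
    proof -
      have "ereal (of_int t) \<le> t_n \<rho> Q n + 1 \<longleftrightarrow> x / 2 powi (t - 1) \<in> RR"
        using ord_p_add_ge_iff[of t x 1] by (simp only: t_n_def x_def of_int_1 one_ereal_def)
      also have "x / 2 powi (t - 1) = - (\<nu> / 4)" unfolding p4 \<nu>_def by (simp add: field_simps)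
      also have "- (\<nu> / 4) \<in> RR \<longleftrightarrow> \<nu> / 4 \<in> RR" using RR_closed(6)[of "\<nu> / 4"] RR_closed(6)[of "- (\<nu> / 4)"] by auto
      finally show ?thesis by (simp only: pp_2_quarter)
    qed
    have neg: "- z \<in> RR \<longleftrightarrow> z \<in> RR" for z using RR_closed(6)[of z] RR_closed(6)[of "- z"] by auto
    have i1: "indicator (p_pow t) x * of_nat q = (if \<nu> / 4 \<in> pp 1 then of_nat q else 0 :: complex)"
    proof -
      have "x / 2 powi t = - (\<nu> / 4 / 2)" unfolding f1 by simp
      then have "x \<in> p_pow t \<longleftrightarrow> \<nu> / 4 \<in> pp 1" unfolding p_pow_iff pp_1_half by (simp only: neg)
      then show ?thesis by (simp add: indicator_def)
    qed
    have i2: "indicator (p_pow (t - 2)) x = (if \<nu> \<in> pp 1 then 1 else 0 :: complex)"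
    proof -
      have "x / 2 powi (t - 2) = - (\<nu> / 2)" unfolding p4 \<nu>_def by (simp add: field_simps)
      then have "x \<in> p_pow (t - 2) \<longleftrightarrow> \<nu> \<in> pp 1" unfolding p_pow_iff pp_1_half by (simp only: neg)
      then show ?thesis by (simp add: indicator_def)
    qed
    have i3: "indicator (unit_shell (t - 3)) (x / z) = (if uni (- \<nu> / z) then 1 else 0 :: complex)" for z
    proof -
      have "x / z / 2 powi (t - 3) = - \<nu> / z" unfolding p4 \<nu>_def by (simp add: field_simps)
      then have "x / z \<in> unit_shell (t - 3) \<longleftrightarrow> uni (- \<nu> / z)" unfolding unit_shell_iff by (simp only:)
      then show ?thesis by (simp add: indicator_def)
    qed
    have i3': "indicator (unit_shell (t - 3)) x = (if uni (- \<nu>) then 1 else 0 :: complex)" using i3[of 1] by (simp only: div_by_1)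
    have i4: "indicator (pp 2) (n1 * m - 4 * x / 2 powi t) * of_nat q = (if n1 * m + \<nu> / 2 \<in> pp 2 then of_nat q else 0 :: complex)"
    proof -
      have e: "n1 * m - 4 * x / 2 powi t = n1 * m + \<nu> / 2" unfolding \<nu>_def by (simp add: field_simps)
      show ?thesis unfolding e by (simp add: indicator_def)
    qed
    have g1: "m - 8 * u * x / 2 powi t = m + u * \<nu>" "m / 8 - u * x / 2 powi t = (m + u * \<nu>) / 8" for u
      unfolding f2 by (simp_all add: add_divide_distrib)
    have g2: "n0 * m - 8 * x / 2 powi t = n0 * m + \<nu>" unfolding f1 by simp
    have g3: "m / 8 - x / (n0 * 2 powi t) = m / 8 + \<nu> / n0 / 8" unfolding \<nu>_def by (simp add: field_simps)
    have g4: "m / 8 - m1 * x / (n1 * 2 powi t) = m / 8 + m1 * \<nu> / n1 / 8" unfolding \<nu>_def by (simp add: field_simps)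
    have g5: "n1 * u * m / 4 - u * x / 2 powi t = n1 * u * m / 4 + u * \<nu> / 8" for u unfolding f2 by simp
    have g6: "8 * x * (1 + m) / 2 powi t = - \<nu> * (1 + m)" unfolding \<nu>_def by simp
    show ?thesis
      unfolding omega_def Let_def norm_p_eq x_def[symmetric] m_def[symmetric] V_def[symmetric] \<nu>_def[symmetric]
        d(5) md(5) fst_conv snd_conv p_pow_numeral(1) tn
      unfolding pu g1 g2 g3 g4 g5 g6 i1 i2 i3 i3' i4 ..
  qed
  have mu: "\<not> pu m \<longleftrightarrow> m0 = 0"
  proof -
    have h: "m0 + 2 * (m1 + 2 * k) \<in> pp 1 \<longleftrightarrow> m0 = 0"
      by (rule half_uni_iff[OF md(1)]) (intro RR_closed(3,5) RR_UU0 md RR_numeral)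
    have "m0 + 2 * (m1 + 2 * k) = m" unfolding md(4) by (simp add: algebra_simps)
    then have "m \<in> pp 1 \<longleftrightarrow> m0 = 0" using h by (simp only:)
    then show ?thesis using mm_props(2)[of t] pu_notin_pp[of m] unfolding m_def[symmetric] by blast
  qed
  have VU: "V \<subseteq> TT" unfolding V_def U_set_def by blast
  then have finV: "finite V" by (rule finite_subset) simp
  have "omega f \<zeta> \<rho> Q n t = (\<Sum>u\<in>V. shell_term (even (ell Q t)) (m + u * \<nu>))"
  proof (cases "card V = 0")
    case True
    then have "V = {}" using finV by simp
    then show ?thesis unfolding om using True by simp
  next
    case V0: False
    show ?thesis
    \<comment> \<open>The last branch of \<open>omega\<close> is split off before the size of V is
      inspected, as it treats every nonempty V alike.\<close>
    proof (cases "\<not> pu m \<and> odd (ell Q t)")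
      case True
      then have m': "m = 2 * m1 + 4 * k" using mu md(4) by simp
      have "(\<Sum>u\<in>V. shell_term False (m + u * \<nu>)) = (if inverse n0 \<notin> V then 0 else
        (if uni (- \<nu>) then 1 else 0) * (- 1) ^ (f - 1) / rootq *
        eta \<zeta> (- \<nu> * (1 + m)) * e_pi (m1 * n1 / (2 * n0)))"
        by (rule shell_odd_pp[OF m' md(2,3) \<nu>d VU])
      then show ?thesis unfolding om using V0 True by (simp only: if_True if_False simp_thms)
    next
      case not8: False
      show ?thesis
      \<comment> \<open>For f = 1 this includes V = \<open>TT\<close>, in agreement with the order
        of the tests in \<open>omega\<close>.\<close>
      proof (cases "card V = 1")
        case True
        then obtain v where v: "V = {v}" by (rule card_1_singletonE)
        then have vU: "v \<in> TT" using VU by blast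
        have te: "the_elem V = v" by (simp add: v)
        show ?thesis
        proof (cases "even (ell Q t)")
          case ev: True
          then show ?thesis unfolding om te using True unfolding v by (simp add: shell_term_def indicator_def)
        next
          case od: False
          then have m: "pu m" using not8 by blast
          have "(\<Sum>u\<in>V. shell_term (even (ell Q t)) (m + u * \<nu>)) = shell_term False (m + v * \<nu>)"
            using od by (simp add: v)
          also note shell_odd_unit_term[OF m vU \<nu>d]
          finally show ?thesis unfolding om te using True od m by (simp only: if_True if_False simp_thms one_neq_zero)
        qed
      next
        case V1: False
        then have V: "V = TT" using U_set_cases[of t] V0 unfolding V_def by linarith
        show ?thesis
        proof (cases "even (ell Q t)")
          case od: False
          then have m: "pu m" using not8 by blast
          show ?thesis unfolding om using V0 V1 od m shell_odd_unit[OF m \<nu>d, folded V] by (simp only: if_True if_False simp_thms)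
        next
          case ev: True
          show ?thesis
          proof (cases "pu m")
            case True
            have nu': "\<nu> = n0 + 2 * (n1 + 2 * r)" unfolding d(4) by (simp add: algebra_simps)
            have y: "n1 + 2 * r \<in> RR" by (intro RR_closed(3,5) RR_UU0 d RR_numeral)
            have "(\<Sum>u\<in>V. shell_term True (m + u * \<nu>)) =
              (if n0 = 0 then 0 else if n0 * m + \<nu> \<in> pp 2 then e_pi (m / 8 + \<nu> / n0 / 8) else 0)"
              unfolding nu' V by (rule shell_even_unit[OF True d(1) y])
            then show ?thesis unfolding om using V0 V1 ev True by (simp add: indicator_def)
          next
            case mp: False
            then have m': "m = 2 * m1 + 4 * k" using mu md(4) by simp
            show ?thesis
            proof (cases "\<nu> \<in> pp 2")
              case True
              then have dR: "\<nu> / 4 \<in> RR" by (simp only: pp_2_quarter)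
              have e: "4 * (\<nu> / 4) = \<nu>" by simp
              have "(\<Sum>u\<in>V. shell_term True (m + u * \<nu>)) =
                (if m \<in> pp 2 then 1 else 0) * e_pi (m / 8) * ((if \<nu> / 4 \<in> pp 1 then of_nat q else 0) - 1)"
                using shell_even_pp[OF mR dR] unfolding e V .
              then show ?thesis unfolding om using V0 V1 ev mp True by (simp only: if_True if_False simp_thms indicator_def of_bool_def)
            next
              case False
              show ?thesis unfolding om using V0 V1 ev mp False shell_even_middle[OF m' md(2,3) \<nu>d False, folded V] by simp
            qed
          qed
        qed
      qed
    qed
  qed
  then show ?thesis by (simp only: V_def m_def \<nu>_def x_def)
qed

lemma t_n_iff: "ereal (of_int t) \<le> t_n \<rho> Q n + 3 \<longleftrightarrow> nu t \<in> RR"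
proof -
  have "ereal (of_int t) \<le> t_n \<rho> Q n + 3 \<longleftrightarrow> nn / 2 powi (t - 3) \<in> RR"
    using ord_p_add_ge_iff[of t nn 3] by (simp add: t_n_def)
  also have "nn / 2 powi (t - 3) = - nu t" by (simp add: powi2_diff)
  also have "- nu t \<in> RR \<longleftrightarrow> nu t \<in> RR" using RR_closed(6)[of "nu t"] RR_closed(6)[of "- nu t"] by auto
  finally show ?thesis .
qed

text \<open>The square of \<open>et\<close> is 1 on principal units, so only the parity of
  \<open>ell Q t\<close> matters when averaging over w = 1 + 2y.\<close>

lemma shell_mean:
  assumes u: "u \<in> TT"
  shows "MM (\<lambda>y. Gf (u * (1 + 2 * y) / 2 powi t)) =
    (if adm t \<and> u \<in> U_set \<zeta> Q t then
      complex_of_real (real q powr (tau Q t - of_int t)) * delta f \<zeta> \<rho> Q t *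
        shell_term (even (ell Q t)) (mm t + u * nu t) else 0)"
proof (cases "adm t \<and> u \<in> U_set \<zeta> Q t")
  case True
  define C where "C = complex_of_real (real q powr (tau Q t - of_int t)) * delta f \<zeta> \<rho> Q t"
  define M where "M = mm t + u * nu t"
  have "MM (\<lambda>y. Gf (u * (1 + 2 * y) / 2 powi t)) = MM (\<lambda>y. C * (et (1 + 2 * y) ^ ell Q t * e_pi (M * (1 + 2 * y) / 8)))"
    unfolding C_def M_def by (intro MM_cong) (simp only: Gf_value[OF u pu_I] eqTrueI[OF True] if_True mult.assoc)
  also have "\<dots> = C * MM (\<lambda>y. et (1 + 2 * y) ^ ell Q t * e_pi (M * (1 + 2 * y) / 8))" by (rule MM_cmult)
  also have "MM (\<lambda>y. et (1 + 2 * y) ^ ell Q t * e_pi (M * (1 + 2 * y) / 8)) = shell_term (even (ell Q t)) M"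
  proof (cases "even (ell Q t)")
    case True
    then obtain l where l: "ell Q t = 2 * l" by blast
    have "et (1 + 2 * y) ^ ell Q t = 1" if "y \<in> RR" for y
      unfolding l power_mult power2_eq_square et_square[OF pu_I[OF that]] by (rule power_one)
    then have "MM (\<lambda>y. et (1 + 2 * y) ^ ell Q t * e_pi (M * (1 + 2 * y) / 8)) = MM (\<lambda>y. e_pi (M * (1 + 2 * y) / 8))"
      by (intro MM_cong) (simp only: mult_1_left)
    then show ?thesis using True by (simp only: MM_twisted_even shell_term_def if_True)
  next
    case False
    then obtain l where l: "ell Q t = Suc (2 * l)" by (auto elim: oddE)
    have "et (1 + 2 * y) ^ ell Q t = et (1 + 2 * y)" if "y \<in> RR" for y
      unfolding l power_Suc power_mult power2_eq_square et_square[OF pu_I[OF that]] by (simp only: power_one mult_1_right)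
    then have "MM (\<lambda>y. et (1 + 2 * y) ^ ell Q t * e_pi (M * (1 + 2 * y) / 8)) = MM (\<lambda>y. et (1 + 2 * y) * e_pi (M * (1 + 2 * y) / 8))"
      by (intro MM_cong) (simp only:)
    then show ?thesis using False by (simp only: MM_twisted_odd shell_term_def if_False)
  qed
  finally show ?thesis unfolding C_def M_def by (simp only: eqTrueI[OF True] if_True)
next
  case False
  then have "MM (\<lambda>y. Gf (u * (1 + 2 * y) / 2 powi t)) = MM (\<lambda>y. 0)"
    by (intro MM_cong) (simp only: Gf_value[OF u pu_I] if_False)
  then show ?thesis using False by (simp only: MM_const if_False)
qed

definition dterm :: "int \<Rightarrow> complex" where
  "dterm t = omega f \<zeta> \<rho> Q n t * delta f \<zeta> \<rho> Q t * complex_of_real (real (norm_p TYPE('k)) powr (tau Q t - 1))"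

text \<open>The weight q^(t-1) counts the classes of w. If \<nu> is not integral, neither is m +
  u\<nu> for any u, and every term vanishes; this is the cutoff of t by the order of
  \<open>nn\<close> plus 3.\<close>

lemma shell_sum:
  assumes t: "1 \<le> t"
  shows "complex_of_real (real q powr (of_int t - 1)) * (\<Sum>u\<in>TT. MM (\<lambda>y. Gf (u * (1 + 2 * y) / 2 powi t))) =
    (if t \<in> t_range \<rho> Q n then dterm t else 0)"
proof (cases "adm t")
  case True
  define C where "C = complex_of_real (real q powr (tau Q t - of_int t)) * delta f \<zeta> \<rho> Q t"
  define S where "S = (\<Sum>u\<in>U_set \<zeta> Q t. shell_term (even (ell Q t)) (mm t + u * nu t))"
  have "(\<Sum>u\<in>TT. MM (\<lambda>y. Gf (u * (1 + 2 * y) / 2 powi t))) =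
      (\<Sum>u\<in>TT. if u \<in> U_set \<zeta> Q t then C * shell_term (even (ell Q t)) (mm t + u * nu t) else 0)"
  proof (intro sum.cong refl)
    fix u assume u: "u \<in> TT"
    have c: "(adm t \<and> u \<in> U_set \<zeta> Q t) = (u \<in> U_set \<zeta> Q t)"
      using True by blast
    show "MM (\<lambda>y. Gf (u * (1 + 2 * y) / 2 powi t)) =
      (if u \<in> U_set \<zeta> Q t then C * shell_term (even (ell Q t)) (mm t + u * nu t) else 0)"
      by (simp only: shell_mean[OF u] c C_def)
  qed
  also have "\<dots> = (\<Sum>u\<in>TT \<inter> U_set \<zeta> Q t. C * shell_term (even (ell Q t)) (mm t + u * nu t))"
    by (simp only: sum.inter_restrict finite_UU)
  also have "TT \<inter> U_set \<zeta> Q t = U_set \<zeta> Q t" by (auto simp: U_set_def)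
  finally have S: "(\<Sum>u\<in>TT. MM (\<lambda>y. Gf (u * (1 + 2 * y) / 2 powi t))) = C * S"
    by (simp only: S_def sum_distrib_left)
  show ?thesis
  proof (cases "nu t \<in> RR")
    case nR: True
    then have "t \<in> t_range \<rho> Q n" using True t t_n_iff by (simp add: t_range_def)
    moreover have "complex_of_real (real q powr (of_int t - 1)) * complex_of_real (real q powr (tau Q t - of_int t)) =
      complex_of_real (real q powr (tau Q t - 1))"
      unfolding of_real_mult[symmetric] powr_add[symmetric] by simp
    ultimately show ?thesis unfolding S dterm_def omega_eq[OF nR] norm_p_eq C_def S_def by (simp add: mult_ac)
  next
    case False
    then have "t \<notin> t_range \<rho> Q n" using t_n_iff by (simp add: t_range_def)
    moreover have "S = 0"
      unfolding S_def
    proof (rule sum.neutral, rule ballI)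
      fix u assume "u \<in> U_set \<zeta> Q t"
      then have u: "u \<in> TT" by (simp add: U_set_def)
      have "mm t + u * nu t \<notin> RR"
      proof
        assume "mm t + u * nu t \<in> RR"
        then have "inverse u * (mm t + u * nu t - mm t) \<in> RR"
          by (rule RR_closed(5)[OF RR_UU[OF UU_inverse[OF u]] RR_closed(4)[OF _ mm_props(1)]])
        moreover have "inverse u * (mm t + u * nu t - mm t) = nu t" using UU_neq_0[OF u] by simp
        ultimately show False using False by (simp only: simp_thms)
      qed
      then show "shell_term (even (ell Q t)) (mm t + u * nu t) = 0"
        using pp_RR pu_RR unfolding shell_term_def by meson
    qed
    ultimately show ?thesis unfolding S by simp
  qed
next
  case False
  have "(\<Sum>u\<in>TT. MM (\<lambda>y. Gf (u * (1 + 2 * y) / 2 powi t))) = 0"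
  proof (intro sum.neutral ballI)
    fix u assume u: "u \<in> TT"
    have "\<not> (adm t \<and> u \<in> U_set \<zeta> Q t)" using False by blast
    then show "MM (\<lambda>y. Gf (u * (1 + 2 * y) / 2 powi t)) = 0" by (simp only: shell_mean[OF u] if_False)
  qed
  moreover have "t \<notin> t_range \<rho> Q n" using False by (auto simp: t_range_def)
  ultimately show ?thesis by simp
qed

end

section \<open>The truncated densities\<close>

text \<open>On A the integrand is a finite combination of indicator functions. Both integrals of the
  truncated density are evaluated through this lemma.\<close>

lemma set_integral_finite_cover:
  fixes g :: "'a \<Rightarrow> complex"
  assumes fin: "finite I" and B: "\<And>i. i \<in> I \<Longrightarrow> B i \<in> sets M"
    and m: "\<And>i. i \<in> I \<Longrightarrow> emeasure M (B i) = ennreal m" "0 \<le> m"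
    and disj: "disjoint_family_on B I" and A: "A = (\<Union>i\<in>I. B i)"
    and g: "\<And>i x. i \<in> I \<Longrightarrow> x \<in> B i \<Longrightarrow> g x = c i"
  shows "set_lebesgue_integral M A g = complex_of_real m * (\<Sum>i\<in>I. c i)"
proof -
  have "indicator A x *\<^sub>R g x = (\<Sum>i\<in>I. indicator (B i) x *\<^sub>R c i)" for x
  proof (cases "x \<in> A")
    case True
    then obtain j where j: "j \<in> I" "x \<in> B j" unfolding A by blast
    have "indicator (B i) x *\<^sub>R c i = (if i = j then c j else 0)" if "i \<in> I" for i
      using that j disj by (auto simp: disjoint_family_on_def indicator_def)
    then have "(\<Sum>i\<in>I. indicator (B i) x *\<^sub>R c i) = (\<Sum>i\<in>I. if i = j then c j else 0)" by (intro sum.cong refl)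
    also have "\<dots> = g x" using fin j g[OF j] by simp
    finally show ?thesis using True by simp
  next
    case False
    then show ?thesis unfolding A by (auto simp: indicator_def intro!: sum.neutral)
  qed
  moreover have "has_bochner_integral M (\<lambda>x. \<Sum>i\<in>I. indicator (B i) x *\<^sub>R c i) (\<Sum>i\<in>I. measure M (B i) *\<^sub>R c i)"
    using B m by (intro has_bochner_integral_sum has_bochner_integral_indicator) auto
  ultimately have "set_lebesgue_integral M A g = (\<Sum>i\<in>I. measure M (B i) *\<^sub>R c i)"
    unfolding set_lebesgue_integral_def by (simp only: has_bochner_integral_integral_eq)
  also have "\<dots> = (\<Sum>i\<in>I. complex_of_real m * c i)"
    by (intro sum.cong refl) (simp add: measure_eq_emeasure_eq_ennreal[OF m(2,1)] scaleR_conv_of_real)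
  finally show ?thesis by (simp only: sum_distrib_left)
qed

lemma vars_I: "i \<in> {1..rX Q} \<Longrightarrow> VX i \<in> vars Q"
    "j \<in> {1..rY Q} \<Longrightarrow> VY j 1 \<in> vars Q" "j \<in> {1..rY Q} \<Longrightarrow> VY j 2 \<in> vars Q"
    "k \<in> {1..rZ Q} \<Longrightarrow> VZ k 1 \<in> vars Q" "k \<in> {1..rZ Q} \<Longrightarrow> VZ k 2 \<in> vars Q"
  unfolding vars_def by blast+

lemma vars_cases:
  assumes "v \<in> vars Q"
  obtains i where "i \<in> {1..rX Q}" "v = VX i"
    | j where "j \<in> {1..rY Q}" "v = VY j 1" | j where "j \<in> {1..rY Q}" "v = VY j 2"
    | k where "k \<in> {1..rZ Q}" "v = VZ k 1" | k where "k \<in> {1..rZ Q}" "v = VZ k 2"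
  using assms unfolding vars_def by blast

text \<open>An assignment to the variables is the same as a triple of functions, with values in R
  for the unary blocks and in pairs over R for the binary ones (\<open>split\<close> and
  \<open>join\<close>); sums of products then factor blockwise.\<close>

lemma sum_vars_factor:
  fixes gX :: "nat \<Rightarrow> 'k \<Rightarrow> complex" and gY gZ :: "nat \<Rightarrow> 'k \<Rightarrow> 'k \<Rightarrow> complex" and Q :: "'k qpoly"
  assumes R: "finite R"
  shows "(\<Sum>w\<in>vars Q \<rightarrow>\<^sub>E R. (\<Prod>i\<in>{1..rX Q}. gX i (w (VX i))) *
      (\<Prod>j\<in>{1..rY Q}. gY j (w (VY j 1)) (w (VY j 2))) * (\<Prod>k\<in>{1..rZ Q}. gZ k (w (VZ k 1)) (w (VZ k 2)))) =
    (\<Prod>i\<in>{1..rX Q}. \<Sum>x\<in>R. gX i x) * (\<Prod>j\<in>{1..rY Q}. \<Sum>(x, y)\<in>R \<times> R. gY j x y) *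
      (\<Prod>k\<in>{1..rZ Q}. \<Sum>(x, y)\<in>R \<times> R. gZ k x y)" (is "?L = _")
proof -
  define AX AY AZ where "AX = {1..rX Q} \<rightarrow>\<^sub>E R" and "AY = {1..rY Q} \<rightarrow>\<^sub>E R \<times> R" and "AZ = {1..rZ Q} \<rightarrow>\<^sub>E R \<times> R"
  define FX where "FX x = (\<Prod>i\<in>{1..rX Q}. gX i (x i))" for x
  define FY where "FY y = (\<Prod>j\<in>{1..rY Q}. case_prod (gY j) (y j))" for y
  define FZ where "FZ z = (\<Prod>k\<in>{1..rZ Q}. case_prod (gZ k) (z k))" for z
  define split where "split w = (restrict (\<lambda>i. w (VX i)) {1..rX Q}, restrict (\<lambda>j. (w (VY j 1), w (VY j 2))) {1..rY Q},
    restrict (\<lambda>k. (w (VZ k 1), w (VZ k 2))) {1..rZ Q})" for w :: "var \<Rightarrow> 'k"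
  define join where "join = (\<lambda>(x, y, z). restrict (\<lambda>v. case v of VX i \<Rightarrow> x i
    | VY j s \<Rightarrow> if s = 1 then fst (y j) else snd (y j) | VZ k s \<Rightarrow> if s = 1 then fst (z k) else snd (z k)) (vars Q)
      :: var \<Rightarrow> 'k)"
  have join: "i \<in> {1..rX Q} \<Longrightarrow> join (x, y, z) (VX i) = x i"
    "j \<in> {1..rY Q} \<Longrightarrow> join (x, y, z) (VY j 1) = fst (y j)" "j \<in> {1..rY Q} \<Longrightarrow> join (x, y, z) (VY j 2) = snd (y j)"
    "k \<in> {1..rZ Q} \<Longrightarrow> join (x, y, z) (VZ k 1) = fst (z k)" "k \<in> {1..rZ Q} \<Longrightarrow> join (x, y, z) (VZ k 2) = snd (z k)"
    for x y z i j k
    unfolding join_def by (simp_all only: prod.case restrict_apply vars_I if_True var.case fst_conv snd_conv) simp_all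
  have "?L = (\<Sum>(x, y, z)\<in>AX \<times> AY \<times> AZ. FX x * FY y * FZ z)"
  proof (rule sum.reindex_bij_witness[of _ join split])
    fix w assume w: "w \<in> vars Q \<rightarrow>\<^sub>E R"
    then have mem: "v \<in> vars Q \<Longrightarrow> w v \<in> R" for v by (rule PiE_mem)
    show "join (split w) = w"
    proof
      fix v show "join (split w) v = w v"
      proof (cases "v \<in> vars Q")
        case True
        then show ?thesis
          by (cases rule: vars_cases) (simp_all only: split_def join restrict_apply if_True fst_conv snd_conv)
      next
        case False
        then show ?thesis using PiE_arb[OF w False] unfolding join_def split_def by (simp only: prod.case restrict_apply if_False)
      qed
    qed
    show "split w \<in> AX \<times> AY \<times> AZ"
      unfolding split_def AX_def AY_def AZ_def by (intro SigmaI restrict_PiE_iff[THEN iffD2] ballI mem vars_I)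
    show "(case split w of (x, y, z) \<Rightarrow> FX x * FY y * FZ z) = (\<Prod>i\<in>{1..rX Q}. gX i (w (VX i))) *
      (\<Prod>j\<in>{1..rY Q}. gY j (w (VY j 1)) (w (VY j 2))) * (\<Prod>k\<in>{1..rZ Q}. gZ k (w (VZ k 1)) (w (VZ k 2)))"
      unfolding split_def FX_def FY_def FZ_def prod.case
      by (intro arg_cong2[where f = "(*)"] prod.cong refl) (simp_all only: restrict_apply if_True prod.case)
  next
    fix p assume p: "p \<in> AX \<times> AY \<times> AZ"
    obtain x y z where xyz: "p = (x, y, z)" by (cases p)
    have x: "x \<in> AX" and y: "y \<in> AY" and z: "z \<in> AZ" using p by (auto simp: xyz)
    show "split (join p) = p"
    proof -
      have ext: "restrict h A = g" if "g \<in> A \<rightarrow>\<^sub>E S" "\<And>a. a \<in> A \<Longrightarrow> h a = g a" for h g :: "nat \<Rightarrow> 'b" and A S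
        using that by (auto simp: restrict_def PiE_def extensional_def fun_eq_iff)
      have "restrict (\<lambda>i. join p (VX i)) {1..rX Q} = x"
        using x unfolding AX_def xyz by (rule ext) (rule join)
      moreover have "restrict (\<lambda>j. (join p (VY j 1), join p (VY j 2))) {1..rY Q} = y"
        using y unfolding AY_def xyz by (rule ext) (simp only: join prod.collapse)
      moreover have "restrict (\<lambda>j. (join p (VZ j 1), join p (VZ j 2))) {1..rZ Q} = z"
        using z unfolding AZ_def xyz by (rule ext) (simp only: join prod.collapse)
      ultimately show ?thesis unfolding split_def xyz by (simp only:)
    qed
    have yR: "fst (y j) \<in> R" "snd (y j) \<in> R" if "j \<in> {1..rY Q}" for j
      using PiE_mem[OF y[unfolded AY_def] that] by (simp_all only: mem_Times_iff)
    have zR: "fst (z j) \<in> R" "snd (z j) \<in> R" if "j \<in> {1..rZ Q}" for j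
      using PiE_mem[OF z[unfolded AZ_def] that] by (simp_all only: mem_Times_iff)
    have xR: "x j \<in> R" if "j \<in> {1..rX Q}" for j using x that unfolding AX_def by (rule PiE_mem)
    show "join p \<in> vars Q \<rightarrow>\<^sub>E R"
    proof (rule PiE_I)
      show "join p v \<in> R" if "v \<in> vars Q" for v
        using that unfolding xyz by (cases rule: vars_cases) (simp_all only: join xR yR zR)
      show "join p v = undefined" if "v \<notin> vars Q" for v
        using that unfolding xyz join_def by (simp only: prod.case restrict_apply if_False)
    qed
  qed
  also have "\<dots> = (\<Sum>x\<in>AX. \<Sum>y\<in>AY. \<Sum>z\<in>AZ. FX x * FY y * FZ z)" by (simp only: sum.cartesian_product)
  also have "\<dots> = (\<Sum>x\<in>AX. \<Sum>y\<in>AY. FX x * FY y) * (\<Sum>z\<in>AZ. FZ z)"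
    by (simp only: sum_distrib_left[symmetric] sum_distrib_right[symmetric])
  also have "(\<Sum>x\<in>AX. \<Sum>y\<in>AY. FX x * FY y) = (\<Sum>x\<in>AX. FX x) * (\<Sum>y\<in>AY. FY y)"
    by (simp only: sum_product)
  also have "(\<Sum>x\<in>AX. FX x) = (\<Prod>i\<in>{1..rX Q}. \<Sum>x\<in>R. gX i x)"
    unfolding AX_def FX_def by (rule prod_sum_PiE[symmetric]) (simp_all add: R)
  also have "(\<Sum>y\<in>AY. FY y) = (\<Prod>j\<in>{1..rY Q}. \<Sum>(x, y)\<in>R \<times> R. gY j x y)"
    unfolding AY_def FY_def by (rule prod_sum_PiE[symmetric]) (simp_all add: R)
  also have "(\<Sum>z\<in>AZ. FZ z) = (\<Prod>k\<in>{1..rZ Q}. \<Sum>(x, y)\<in>R \<times> R. gZ k x y)"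
    unfolding AZ_def FZ_def by (rule prod_sum_PiE[symmetric]) (simp_all add: R)
  finally show ?thesis .
qed

lemma finite_vars: "finite (vars Q)"
proof -
  have "vars Q \<subseteq> VX ` {1..rX Q} \<union> (\<lambda>(j, s). VY j s) ` ({1..rY Q} \<times> {1, 2}) \<union> (\<lambda>(j, s). VZ j s) ` ({1..rZ Q} \<times> {1, 2})"
    by (auto simp: vars_def)
  then show ?thesis by (rule finite_subset) simp
qed

section \<open>Haar measure of cosets\<close>

locale unram_haar = unram f \<zeta> for f and \<zeta> :: "'k :: q2_field" +
  fixes \<mu> :: "'k measure"
  assumes haar: "normalized_haar \<mu>"
begin

lemma coset_iff: "x \<in> (+) a ` p_pow k \<longleftrightarrow> (x - a) / 2 powi k \<in> RR"
proof -
  have "x \<in> (+) a ` p_pow k \<longleftrightarrow> x - a \<in> p_pow k" by (auto intro: image_eqI[of _ _ "x - a"])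
  then show ?thesis by (simp only: p_pow_iff)
qed

lemma coset_sets: "(+) a ` p_pow k \<in> sets \<mu>"
proof -
  have "p_open ((+) a ` p_pow k)"
    unfolding p_open_def
  proof (intro ballI exI subsetI)
    fix x y assume "x \<in> (+) a ` p_pow k" "y \<in> (+) x ` p_pow k"
    then have "(x - a) / 2 powi k + (y - x) / 2 powi k \<in> RR" unfolding coset_iff by (rule RR_closed(3))
    then show "y \<in> (+) a ` p_pow k" unfolding coset_iff by (simp add: add_divide_distrib[symmetric])
  qed
  then show ?thesis using haar unfolding normalized_haar_def by (auto intro: sigma_sets.Basic)
qed

lemma p_pow_sets: "p_pow k \<in> sets \<mu>"
  using coset_sets[of 0 k] by simp

lemma emeasure_coset: "emeasure \<mu> ((+) a ` p_pow k) = emeasure \<mu> (p_pow k)"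
  using haar p_pow_sets[of k] unfolding normalized_haar_def by blast

lemma p_pow_0: "p_pow 0 = RR"
  by (auto simp: p_pow_iff)

lemma emeasure_RR: "emeasure \<mu> RR = 1"
  using haar unfolding normalized_haar_def int_ring_eq by blast

lemma emeasure_RR_coset: "emeasure \<mu> ((+) a ` RR) = 1"
  using emeasure_coset[of a 0] by (simp only: p_pow_0 emeasure_RR)

lemma disjoint_cosets:
  assumes "\<And>a b. a \<in> I \<Longrightarrow> b \<in> I \<Longrightarrow> (h a - h b) / 2 powi k \<in> RR \<Longrightarrow> a = b"
  shows "disjoint_family_on (\<lambda>a. (+) (h a) ` p_pow k) I"
proof -
  have False if "a \<in> I" "b \<in> I" "a \<noteq> b" "x \<in> (+) (h a) ` p_pow k" "x \<in> (+) (h b) ` p_pow k" for a b x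
  proof -
    have "(x - h b) / 2 powi k - (x - h a) / 2 powi k \<in> RR"
      using that(4,5) unfolding coset_iff by (intro RR_closed(4)[of "(x - h b) / 2 powi k"])
    then have "(h a - h b) / 2 powi k \<in> RR" by (simp add: diff_divide_distrib[symmetric])
    then show False using assms that by blast
  qed
  then show ?thesis unfolding disjoint_family_on_def by blast
qed

lemma reps_disjoint: "disjoint_family_on (\<lambda>a. (+) a ` p_pow (int T)) (reps T)"
  by (rule disjoint_cosets[of _ "\<lambda>a. a"]) (rule reps_unique, simp_all add: pp_def)

lemma reps_cover: "RR = (\<Union>a\<in>reps T. (+) a ` p_pow (int T))"
proof (intro equalityI subsetI)
  fix x assume "x \<in> RR"
  then obtain a where "a \<in> reps T" "x - a \<in> pp T" using reps_ex by blast
  then show "x \<in> (\<Union>a\<in>reps T. (+) a ` p_pow (int T))" by (auto simp: coset_iff pp_def)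
next
  fix x assume "x \<in> (\<Union>a\<in>reps T. (+) a ` p_pow (int T))"
  then obtain a where a: "a \<in> reps T" "x - a \<in> pp T" unfolding p_pow_nat by auto
  have "x - a + a \<in> RR" by (rule RR_closed(3)[OF pp_RR[OF a(2)] reps_RR[OF a(1)]])
  then show "x \<in> RR" by simp
qed

text \<open>q^T translates of equal measure cover the integers, which have measure 1.\<close>

lemma emeasure_pp: "emeasure \<mu> ((+) a ` p_pow (int T)) = ennreal (1 / real q ^ T)"
proof -
  define x where "x = emeasure \<mu> (p_pow (int T))"
  have "(\<Sum>a\<in>reps T. emeasure \<mu> ((+) a ` p_pow (int T))) = emeasure \<mu> RR"
    unfolding reps_cover[of T] by (rule sum_emeasure) (auto simp: coset_sets reps_disjoint)
  then have "(\<Sum>a\<in>reps T. x) = 1" by (simp only: emeasure_coset x_def emeasure_RR)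
  then have *: "of_nat (q ^ T) * x = 1" by (simp only: sum_constant card_reps)
  have "x = ennreal (1 / real q ^ T)"
  proof (cases x)
    case (real y)
    then have "ennreal (real (q ^ T) * y) = ennreal 1" using * by (simp add: ennreal_of_nat_eq_real_of_nat ennreal_mult' del: of_nat_power)
    then have "real q ^ T * y = 1" using real by (simp add: ennreal_inj del: ennreal_1)
    then have "y = 1 / real q ^ T" using q_pos by (simp add: field_simps)
    then show ?thesis using real by simp
  next
    case top
    then show ?thesis using * by (simp add: ennreal_mult_top)
  qed
  then show ?thesis by (simp add: emeasure_coset x_def)
qed

lemma fractional_cover: "p_pow (- int T) = (\<Union>a\<in>reps T. (+) (a / 2 ^ T) ` p_pow 0)"
proof (intro equalityI subsetI)
  fix x :: 'k assume "x \<in> p_pow (- int T)"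
  then have "x * 2 ^ T \<in> RR" by (simp add: p_pow_iff power_int_minus divide_inverse)
  then obtain a where a: "a \<in> reps T" "x * 2 ^ T - a \<in> pp T" using reps_ex by blast
  have "(x * 2 ^ T - a) / 2 ^ T = (x - a / 2 ^ T) / 2 powi 0" by (simp add: field_simps)
  then show "x \<in> (\<Union>a\<in>reps T. (+) (a / 2 ^ T) ` p_pow 0)" using a unfolding pp_def by (auto simp: coset_iff)
next
  fix x :: 'k assume "x \<in> (\<Union>a\<in>reps T. (+) (a / 2 ^ T) ` p_pow 0)"
  then obtain a where a: "a \<in> reps T" "x - a / 2 ^ T \<in> RR" by (auto simp: p_pow_0)
  have "2 ^ T * (x - a / 2 ^ T) + a \<in> RR" by (rule RR_closed(3)[OF RR_closed(5)[OF RR_numeral_power a(2)] reps_RR[OF a(1)]])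
  then show "x \<in> p_pow (- int T)" by (simp add: p_pow_iff power_int_minus field_simps)
qed

lemma fractional_disjoint: "disjoint_family_on (\<lambda>a. (+) (a / 2 ^ T) ` p_pow 0) (reps T)"
proof (rule disjoint_cosets)
  fix a b assume *: "a \<in> reps T" "b \<in> reps T" "(a / 2 ^ T - b / 2 ^ T) / 2 powi 0 \<in> RR"
  then have "a - b \<in> pp T" by (simp add: pp_def diff_divide_distrib)
  then show "a = b" using *(1,2) reps_unique by blast
qed

text \<open>Required for the product measure: the fractional ideals \<open>p_pow (- int T)\<close>
  exhaust the field, and each is a finite union of cosets of measure 1.\<close>

lemma sigma_finite: "sigma_finite_measure \<mu>"
proof
  show "\<exists>A. countable A \<and> A \<subseteq> sets \<mu> \<and> \<Union> A = space \<mu> \<and> (\<forall>a\<in>A. emeasure \<mu> a \<noteq> \<infinity>)"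
  proof (intro exI[of _ "range (\<lambda>T. p_pow (- int T))"] conjI ballI)
    have "x \<in> \<Union> (range (\<lambda>T. p_pow (- int T)))" for x :: 'k
    proof -
      obtain T where "x * 2 ^ T \<in> RR" using field_eq[of x] ..
      then have "x \<in> p_pow (- int T)" by (simp add: p_pow_iff power_int_minus divide_inverse)
      then show ?thesis by (intro UnionI[OF rangeI])
    qed
    then have "\<Union> (range (\<lambda>T. p_pow (- int T))) = (UNIV :: 'k set)" by (intro UNIV_eq_I[symmetric])
    then show "\<Union> (range (\<lambda>T. p_pow (- int T))) = space \<mu>" using haar unfolding normalized_haar_def by simp
    fix A assume "A \<in> range (\<lambda>T. p_pow (- int T) :: 'k set)"
    then obtain T where A: "A = p_pow (- int T)" by blast
    have "emeasure \<mu> A = (\<Sum>a\<in>reps T. emeasure \<mu> ((+) (a / 2 ^ T) ` p_pow 0))"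
      unfolding A fractional_cover by (rule sum_emeasure[symmetric]) (auto simp: coset_sets fractional_disjoint)
    also have "\<dots> = of_nat (q ^ T)" by (simp add: p_pow_0 emeasure_RR_coset card_reps)
    finally show "emeasure \<mu> A \<noteq> \<infinity>" by (simp add: ennreal_of_nat_eq_real_of_nat)
  qed (auto simp: p_pow_sets)
qed

end

section \<open>From integrals to finite sums\<close>

locale unram_density = unram_poly f \<zeta> \<rho> n Q + unram_haar f \<zeta> \<mu>
  for f and \<zeta> \<rho> n :: "'k :: q2_field" and Q and \<mu>
begin

definition hX :: "'k \<Rightarrow> nat \<Rightarrow> 'k \<Rightarrow> complex"
  where "hX s i x = e_pi (s * (bX Q i * x\<^sup>2 + cX Q i * x))"

definition hG :: "'k \<Rightarrow> 'k \<Rightarrow> 'k \<Rightarrow> 'k \<Rightarrow> 'k \<Rightarrow> 'k \<Rightarrow> 'k \<Rightarrow> 'k \<Rightarrow> complex"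
  where "hG s \<alpha> \<beta> b c d x y = e_pi (s * qf \<alpha> \<beta> b c d x y)"

abbreviation "hY s j \<equiv> hG s 0 0 (bY Q j) (cY Q j 1) (cY Q j 2)"
abbreviation "hZ s k \<equiv> hG s 1 \<rho> (bZ Q k) (cZ Q k 1) (cZ Q k 2)"

lemma e_pi_scaled_cong:
  assumes s: "s * 2 ^ T \<in> RR" and AB: "A - B \<in> pp T"
  shows "e_pi (s * A) = e_pi (s * B)"
proof (rule e_pi_cong)
  obtain c where c: "c \<in> RR" "A - B = 2 ^ T * c" using pp_obtain[OF AB] .
  have "s * A - s * B = s * 2 ^ T * c" by (simp only: right_diff_distrib[symmetric] c(2) mult.assoc)
  then show "s * A - s * B \<in> RR" using RR_closed(5)[OF s c(1)] by (simp only:)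
qed

lemma cong_mult:
  assumes "x - x' \<in> pp T" "y - y' \<in> pp T" "x \<in> RR" "y' \<in> RR"
  shows "x * y - x' * y' \<in> pp T"
proof -
  have "x * (y - y') + (x - x') * y' \<in> pp T"
    by (rule pp_closed(2)[OF pp_mult_left[OF assms(3,2)] pp_mult_right[OF assms(1,4)]])
  then show ?thesis by (simp add: algebra_simps)
qed

lemma cong_const_mult: "a \<in> RR \<Longrightarrow> x - x' \<in> pp T \<Longrightarrow> a * x - a * x' \<in> pp T"
  by (simp only: right_diff_distrib[symmetric] pp_mult_left)

lemma cong_add: "x - x' \<in> pp T \<Longrightarrow> y - y' \<in> pp T \<Longrightarrow> (x + y) - (x' + y') \<in> pp T"
  using pp_closed(2)[of "x - x'" T "y - y'"] by (simp only: add_diff_add)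

lemma hX_cong:
  assumes s: "s * 2 ^ T \<in> RR" and i: "i \<in> {1..rX Q}" and x: "x - x' \<in> pp T" "x \<in> RR" "x' \<in> RR"
  shows "hX s i x = hX s i x'"
  unfolding hX_def power2_eq_square
  by (rule e_pi_scaled_cong[OF s]) (intro cong_add cong_const_mult cong_mult x X_ok[OF i])

lemma hG_cong:
  assumes s: "s * 2 ^ T \<in> RR" and R: "\<alpha> \<in> RR" "\<beta> \<in> RR" "b \<in> RR" "c \<in> RR" "d \<in> RR"
    and x: "x - x' \<in> pp T" "x \<in> RR" "x' \<in> RR" and y: "y - y' \<in> pp T" "y \<in> RR" "y' \<in> RR"
  shows "hG s \<alpha> \<beta> b c d x y = hG s \<alpha> \<beta> b c d x' y'"
  unfolding hG_def power2_eq_square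
  by (rule e_pi_scaled_cong[OF s]) (intro cong_add cong_const_mult[OF R(1)] cong_const_mult[OF R(2)]
    cong_const_mult[OF R(3)] cong_const_mult[OF R(4)] cong_const_mult[OF R(5)] cong_mult x y)

lemma per_cong_intro:
  assumes "\<And>x x'. x - x' \<in> pp T \<Longrightarrow> x \<in> RR \<Longrightarrow> x' \<in> RR \<Longrightarrow> g x = g x'"
  shows "per T g"
  unfolding per_def
proof (intro ballI)
  fix x y assume xy: "x \<in> RR" "y \<in> RR"
  have "x + 2 ^ T * y - x \<in> pp T" using pp_pow2[OF xy(2)] by simp
  then show "g (x + 2 ^ T * y) = g x" by (rule assms) (intro RR_closed(3,5) xy RR_numeral_power)+
qed

lemma JX_sum:
  assumes s: "s * 2 ^ T \<in> RR" and i: "i \<in> {1..rX Q}"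
  shows "JX i s = (\<Sum>x\<in>reps T. hX s i x) / of_nat (q ^ T)"
proof -
  have "per T (hX s i)" by (rule per_cong_intro) (rule hX_cong[OF s i])
  then have "MM (hX s i) = mean T (hX s i)" by (rule MM_eq)
  then show ?thesis unfolding JX_def hX_def mean_def by simp
qed

lemma JG_sum:
  assumes s: "s * 2 ^ T \<in> RR" and R: "\<alpha> \<in> RR" "\<beta> \<in> RR" "b \<in> RR" "c \<in> RR" "d \<in> RR"
  shows "JG \<alpha> \<beta> b c d s = (\<Sum>(x, y)\<in>reps T \<times> reps T. hG s \<alpha> \<beta> b c d x y) / (of_nat (q ^ T) * of_nat (q ^ T))"
proof -
  define h where "h = hG s \<alpha> \<beta> b c d"
  have cong: "h x y = h x' y'" if "x - x' \<in> pp T" "x \<in> RR" "x' \<in> RR" "y - y' \<in> pp T" "y \<in> RR" "y' \<in> RR" for x x' y y'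
    unfolding h_def by (rule hG_cong[OF s R that])
  have z: "x - x \<in> pp T" for x by (simp add: pp_closed(1))
  have "per T (\<lambda>x. h x y)" if "y \<in> RR" for y by (rule per_cong_intro) (rule cong[OF _ _ _ z that that])
  then have inner: "MM (\<lambda>x. h x y) = mean T (\<lambda>x. h x y)" if "y \<in> RR" for y using that by (intro MM_eq)
  have "per T (\<lambda>y. MM (\<lambda>x. h x y))"
    by (rule lc_MM, rule per_cong_intro) (rule cong[OF z])
  then have "MM (\<lambda>y. MM (\<lambda>x. h x y)) = mean T (\<lambda>y. MM (\<lambda>x. h x y))" by (rule MM_eq)
  also have "\<dots> = mean T (\<lambda>y. mean T (\<lambda>x. h x y))"
    unfolding mean_def[of T "\<lambda>y. MM (\<lambda>x. h x y)"] mean_def[of T "\<lambda>y. mean T (\<lambda>x. h x y)"]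
    by (intro arg_cong2[where f = "(/)"] sum.cong refl inner reps_RR)
  also have "\<dots> = (\<Sum>y\<in>reps T. \<Sum>x\<in>reps T. h x y) / (of_nat (q ^ T) * of_nat (q ^ T))"
    unfolding mean_def by (simp add: sum_divide_distrib[symmetric])
  also have "(\<Sum>y\<in>reps T. \<Sum>x\<in>reps T. h x y) = (\<Sum>x\<in>reps T. \<Sum>y\<in>reps T. h x y)" by (rule sum.swap)
  also have "\<dots> = (\<Sum>(x, y)\<in>reps T \<times> reps T. h x y)" by (rule sum.cartesian_product)
  finally show ?thesis unfolding JG_def h_def hG_def by simp
qed

lemma integrand_factor:
  "e_pi (s * (qeval \<rho> Q w - n)) = (\<Prod>i\<in>{1..rX Q}. hX s i (w (VX i))) *
    (\<Prod>j\<in>{1..rY Q}. hY s j (w (VY j 1)) (w (VY j 2))) *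
    (\<Prod>k\<in>{1..rZ Q}. hZ s k (w (VZ k 1)) (w (VZ k 2))) * e_pi (- (s * n))"
proof -
  define A B C where "A i = bX Q i * (w (VX i))\<^sup>2 + cX Q i * w (VX i)"
    and "B j = bY Q j * (0 * (w (VY j 1))\<^sup>2 + w (VY j 1) * w (VY j 2) + 0 * (w (VY j 2))\<^sup>2) +
       cY Q j 1 * w (VY j 1) + cY Q j 2 * w (VY j 2)"
    and "C k = bZ Q k * (1 * (w (VZ k 1))\<^sup>2 + w (VZ k 1) * w (VZ k 2) + \<rho> * (w (VZ k 2))\<^sup>2) +
       cZ Q k 1 * w (VZ k 1) + cZ Q k 2 * w (VZ k 2)" for i j k
  have "qeval \<rho> Q w = (\<Sum>i=1..rX Q. A i) + (\<Sum>j=1..rY Q. B j) + (\<Sum>k=1..rZ Q. C k)"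
    unfolding qeval_def A_def B_def C_def by (simp add: mult.assoc)
  then have "s * (qeval \<rho> Q w - n) = (\<Sum>i=1..rX Q. s * A i) + (\<Sum>j=1..rY Q. s * B j) + (\<Sum>k=1..rZ Q. s * C k) + - (s * n)"
    by (simp add: algebra_simps sum_distrib_left)
  then have "e_pi (s * (qeval \<rho> Q w - n)) = (\<Prod>i\<in>{1..rX Q}. e_pi (s * A i)) * (\<Prod>j\<in>{1..rY Q}. e_pi (s * B j)) *
      (\<Prod>k\<in>{1..rZ Q}. e_pi (s * C k)) * e_pi (- (s * n))"
    by (simp only: e_pi_add e_pi_sum finite_atLeastAtMost)
  then show ?thesis unfolding A_def B_def C_def hX_def hG_def .
qed

text \<open>For T clearing the denominator of s, the integrand is constant on products of cosets
  modulo 2^T, and the sum over their representatives factors by blocks.\<close>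

lemma inner_integral:
  "(LINT w:(vars Q \<rightarrow>\<^sub>E int_ring)|(\<Pi>\<^sub>M v\<in>vars Q. \<mu>). e_pi (s * (qeval \<rho> Q w - n))) = Gf s"
proof -
  obtain T where s: "s * 2 ^ T \<in> RR" using field_eq[of s] ..
  interpret product_sigma_finite "\<lambda>_ :: var. \<mu>"
    by (simp add: product_sigma_finite_def sigma_finite)
  define K :: complex where "K = of_nat (q ^ T)"
  define B where "B r = (\<Pi>\<^sub>E v\<in>vars Q. (+) (r v) ` p_pow (int T))" for r :: "var \<Rightarrow> 'k"
  define I where "I = vars Q \<rightarrow>\<^sub>E reps T"
  have finI: "finite I" unfolding I_def by (intro finite_PiE finite_vars) simp
  have frac: "1 / (a * b * c) * (x * y * z * e) = x / a * (y / b) * (z / c) * e" for a b c x y z e :: complex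
    by simp
  have mem: "w v - r v \<in> pp T" "w v \<in> RR" "r v \<in> RR" if "r \<in> I" "w \<in> B r" "v \<in> vars Q" for r w v
  proof -
    have r: "r v \<in> reps T" using that unfolding I_def by blast
    then show "r v \<in> RR" by (rule reps_RR)
    have w: "w v \<in> (+) (r v) ` p_pow (int T)" using that unfolding B_def by blast
    then show "w v \<in> RR" unfolding reps_cover[of T] using r by blast
    show "w v - r v \<in> pp T" using w by (simp add: coset_iff pp_def)
  qed
  have "(LINT w:(vars Q \<rightarrow>\<^sub>E RR)|(\<Pi>\<^sub>M v\<in>vars Q. \<mu>). e_pi (s * (qeval \<rho> Q w - n))) =
      complex_of_real ((1 / real q ^ T) ^ card (vars Q)) * (\<Sum>r\<in>I. e_pi (s * (qeval \<rho> Q r - n)))"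
  proof (rule set_integral_finite_cover[OF finI, of B])
    show "B r \<in> sets (\<Pi>\<^sub>M v\<in>vars Q. \<mu>)" for r
      unfolding B_def by (intro sets_PiM_I_finite finite_vars coset_sets)
    show "emeasure (\<Pi>\<^sub>M v\<in>vars Q. \<mu>) (B r) = ennreal ((1 / real q ^ T) ^ card (vars Q))" for r
      unfolding B_def by (subst emeasure_PiM[OF finite_vars coset_sets]) (simp add: emeasure_pp ennreal_power)
    show "0 \<le> (1 / real q ^ T) ^ card (vars Q)" by simp
    show "disjoint_family_on B I"
      unfolding disjoint_family_on_def
    proof (intro ballI impI)
      fix r r' assume r: "r \<in> I" "r' \<in> I" "r \<noteq> r'"
      have "r v = r' v" if v: "v \<in> vars Q" and w: "w \<in> B r" "w \<in> B r'" for v w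
      proof (rule reps_unique)
        show "r v \<in> reps T" "r' v \<in> reps T" using r v unfolding I_def by blast+
        have "w v - r' v - (w v - r v) \<in> pp T" using mem[OF r(2) w(2) v] mem[OF r(1) w(1) v] by (intro pp_closed(3)[of "w v - r' v"])
        then show "r v - r' v \<in> pp T" by simp
      qed
      then have "r = r'" if "w \<in> B r" "w \<in> B r'" for w
        using r that unfolding I_def by (intro PiE_ext[of r "vars Q" _ r']) auto
      then show "B r \<inter> B r' = {}" using r(3) by blast
    qed
    show "(vars Q \<rightarrow>\<^sub>E RR) = (\<Union>r\<in>I. B r)"
    proof (intro equalityI subsetI)
      fix w assume w: "w \<in> vars Q \<rightarrow>\<^sub>E RR"
      then have "\<forall>v\<in>vars Q. \<exists>a\<in>reps T. w v \<in> (+) a ` p_pow (int T)" using reps_cover[of T] by blast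
      then obtain r where r: "\<forall>v\<in>vars Q. r v \<in> reps T \<and> w v \<in> (+) (r v) ` p_pow (int T)" by metis
      have "restrict r (vars Q) \<in> I" using r by (simp add: I_def)
      moreover have "w \<in> B (restrict r (vars Q))" using r w unfolding B_def by (auto simp: PiE_iff)
      ultimately show "w \<in> (\<Union>r\<in>I. B r)" by blast
    next
      fix w assume "w \<in> (\<Union>r\<in>I. B r)"
      then obtain r where r: "r \<in> I" "w \<in> B r" by blast
      then show "w \<in> vars Q \<rightarrow>\<^sub>E RR" using mem(2)[OF r] unfolding B_def by (auto simp: PiE_iff)
    qed
    fix r w assume r: "r \<in> I" "w \<in> B r"
    have "hX s i (w (VX i)) = hX s i (r (VX i))" if i: "i \<in> {1..rX Q}" for i
      by (rule hX_cong[OF s i mem[OF r vars_I(1)[OF i]]])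
    moreover have "hY s j (w (VY j 1)) (w (VY j 2)) = hY s j (r (VY j 1)) (r (VY j 2))" if j: "j \<in> {1..rY Q}" for j
      by (rule hG_cong[OF s RR_closed(1) RR_closed(1) Y_ok(1)[OF j] Y_ok(3)[OF j] Y_ok(4)[OF j]
        mem[OF r vars_I(2)[OF j]] mem[OF r vars_I(3)[OF j]]])
    moreover have "hZ s j (w (VZ j 1)) (w (VZ j 2)) = hZ s j (r (VZ j 1)) (r (VZ j 2))" if j: "j \<in> {1..rZ Q}" for j
      by (rule hG_cong[OF s RR_closed(2) rho_RR Z_ok(1)[OF j] Z_ok(3)[OF j] Z_ok(4)[OF j]
        mem[OF r vars_I(4)[OF j]] mem[OF r vars_I(5)[OF j]]])
    ultimately show "e_pi (s * (qeval \<rho> Q w - n)) = e_pi (s * (qeval \<rho> Q r - n))"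
      unfolding integrand_factor by (intro arg_cong2[where f = "(*)"] prod.cong refl)
  qed
  also have "complex_of_real ((1 / real q ^ T) ^ card (vars Q)) = 1 / K ^ card (vars Q)"
    by (simp add: K_def power_divide)
  also have "K ^ card (vars Q) = (\<Sum>r\<in>I. 1)"
    unfolding K_def I_def by (simp add: card_PiE finite_vars card_reps)
  \<comment> \<open>The factorisation with all factors equal to 1 counts the points of I, which
    distributes the normalising constant over the blocks.\<close>
  also have "\<dots> = (\<Prod>i\<in>{1..rX Q}. K) * (\<Prod>j\<in>{1..rY Q}. K * K) * (\<Prod>k\<in>{1..rZ Q}. K * K)"
    using sum_vars_factor[OF finite_reps[of T], where Q = Q and gX = "\<lambda>_ _. 1" and gY = "\<lambda>_ _ _. 1" and gZ = "\<lambda>_ _ _. 1"]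
    unfolding I_def K_def by (simp add: card_reps card_cartesian_product)
  also have "(\<Sum>r\<in>I. e_pi (s * (qeval \<rho> Q r - n))) = (\<Prod>i\<in>{1..rX Q}. \<Sum>x\<in>reps T. hX s i x) *
      (\<Prod>j\<in>{1..rY Q}. \<Sum>(x, y)\<in>reps T \<times> reps T. hY s j x y) * (\<Prod>k\<in>{1..rZ Q}. \<Sum>(x, y)\<in>reps T \<times> reps T. hZ s k x y) * e_pi (- (s * n))"
    unfolding integrand_factor I_def sum_distrib_right[symmetric] 
    by (simp only: sum_vars_factor[OF finite_reps[of T], where Q = Q and gX = "hX s" and gY = "\<lambda>j. hY s j" and gZ = "\<lambda>k. hZ s k"])
  also have "1 / ((\<Prod>i\<in>{1..rX Q}. K) * (\<Prod>j\<in>{1..rY Q}. K * K) * (\<Prod>k\<in>{1..rZ Q}. K * K)) *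
      ((\<Prod>i\<in>{1..rX Q}. \<Sum>x\<in>reps T. hX s i x) * (\<Prod>j\<in>{1..rY Q}. \<Sum>(x, y)\<in>reps T \<times> reps T. hY s j x y) *
        (\<Prod>k\<in>{1..rZ Q}. \<Sum>(x, y)\<in>reps T \<times> reps T. hZ s k x y) * e_pi (- (s * n))) =
      (\<Prod>i\<in>{1..rX Q}. (\<Sum>x\<in>reps T. hX s i x) / K) * (\<Prod>j\<in>{1..rY Q}. (\<Sum>(x, y)\<in>reps T \<times> reps T. hY s j x y) / (K * K)) *
        (\<Prod>k\<in>{1..rZ Q}. (\<Sum>(x, y)\<in>reps T \<times> reps T. hZ s k x y) / (K * K)) * e_pi (- (s * n))"
    unfolding prod_dividef by (rule frac)
  also have "\<dots> = Gf s"
    unfolding Gf_def JY_def JZ_def K_def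
    by (intro arg_cong2[where f = "(*)"] prod.cong refl JX_sum[OF s, symmetric]
      JG_sum[OF s RR_closed(1) RR_closed(1) Y_ok(1) Y_ok(3) Y_ok(4), symmetric]
      JG_sum[OF s RR_closed(2) rho_RR Z_ok(1) Z_ok(3) Z_ok(4), symmetric])
  finally show ?thesis unfolding int_ring_eq .
qed

text \<open>All coefficients are integral, so adding an integer to s changes every phase by an
  integer.\<close>

lemma Gf_shift:
  assumes r: "r \<in> RR"
  shows "Gf (s + r) = Gf s"
proof -
  have e: "e_pi ((s + r) * z) = e_pi (s * z)" if "z \<in> RR" for z
    using RR_closed(5)[OF r that] by (intro e_pi_cong) (simp add: algebra_simps)
  have 1: "JX i (s + r) = JX i s" if "i \<in> {1..rX Q}" for i
    unfolding JX_def by (intro MM_cong e RR_closed(3,5) RR_power X_ok[OF that])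
  have 2: "JG \<alpha> \<beta> b c d (s + r) = JG \<alpha> \<beta> b c d s" if "\<alpha> \<in> RR" "\<beta> \<in> RR" "b \<in> RR" "c \<in> RR" "d \<in> RR" for \<alpha> \<beta> b c d
    unfolding JG_def by (intro MM_cong e RR_closed(3,5) RR_power that)
  have "n \<in> RR" using n by (simp only: int_ring_eq)
  then have "e_pi ((s + r) * - n) = e_pi (s * - n)" by (intro e RR_closed(6))
  then have 3: "e_pi (- ((s + r) * n)) = e_pi (- (s * n))" by (simp only: mult_minus_right)
  show ?thesis
    unfolding Gf_def JY_def JZ_def 3
    by (intro arg_cong2[where f = "(*)"] prod.cong refl 1
      2[OF RR_closed(1) RR_closed(1) Y_ok(1) Y_ok(3) Y_ok(4)] 2[OF RR_closed(2) rho_RR Z_ok(1) Z_ok(3) Z_ok(4)])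
qed

lemma truncated_density_sum:
  "truncated_density \<mu> (vars Q) (qeval \<rho> Q) n T = (\<Sum>a\<in>reps T. Gf (a / 2 ^ T))"
proof -
  have "truncated_density \<mu> (vars Q) (qeval \<rho> Q) n T = (LINT \<sigma>:p_pow (- int T)|\<mu>. Gf \<sigma>)"
    unfolding truncated_density_def inner_integral ..
  also have "\<dots> = complex_of_real 1 * (\<Sum>a\<in>reps T. Gf (a / 2 ^ T))"
  proof (rule set_integral_finite_cover[OF finite_reps coset_sets _ _ fractional_disjoint fractional_cover])
    show "emeasure \<mu> ((+) (a / 2 ^ T) ` p_pow 0) = ennreal 1" for a
      by (simp add: p_pow_0 emeasure_RR_coset)
    fix a \<sigma> :: 'k assume "\<sigma> \<in> (+) (a / 2 ^ T) ` p_pow 0"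
    then obtain r where "r \<in> RR" "\<sigma> = a / 2 ^ T + r" unfolding p_pow_0 by blast
    then show "Gf \<sigma> = Gf (a / 2 ^ T)" by (simp add: Gf_shift)
  qed simp
  finally show ?thesis by simp
qed

lemma Gf_0: "Gf 0 = 1"
  by (simp add: Gf_def JX_def JY_def JZ_def JG_def)

text \<open>The lowest digit of a is split off: the digit 0 gives the previous truncation, and the
  nonzero digits u form the shell of exponent \<open>Suc T\<close>.\<close>

lemma truncated_density_Suc:
  "(\<Sum>a\<in>reps (Suc T). Gf (a / 2 ^ Suc T)) = (\<Sum>a\<in>reps T. Gf (a / 2 ^ T)) +
    (if int (Suc T) \<in> t_range \<rho> Q n then dterm (int (Suc T)) else 0)"
proof -
  have U: "(\<Sum>y\<in>reps T. Gf ((u + 2 * y) / 2 ^ Suc T)) =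
      of_nat (q ^ T) * MM (\<lambda>y. Gf (u * (1 + 2 * y) / 2 powi (int (Suc T))))" if u: "u \<in> TT" for u
  proof -
    define g where "g y = Gf ((u + 2 * y) / 2 ^ Suc T)" for y
    have per: "per T g"
      unfolding per_def g_def
    proof (intro ballI)
      fix x y assume "x \<in> RR" "y \<in> RR"
      have "(u + 2 * (x + 2 ^ T * y)) / 2 ^ Suc T = (u + 2 * x) / 2 ^ Suc T + y" by (simp add: field_simps)
      then show "Gf ((u + 2 * (x + 2 ^ T * y)) / 2 ^ Suc T) = Gf ((u + 2 * x) / 2 ^ Suc T)"
        by (simp only: Gf_shift[OF \<open>y \<in> RR\<close>])
    qed
    then have lc: "lc g" unfolding lc_def by blast
    \<comment> \<open>Replacing y by u y turns u + 2y into u (1 + 2y), which separates the root of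
      unity from the principal unit.\<close>
    have "g (u * y) = Gf (u * (1 + 2 * y) / 2 powi (int (Suc T)))" for y
      unfolding g_def by (rule arg_cong[where f = Gf]) (simp only: power_int_of_nat distrib_left mult_1_right mult.left_commute)
    then have "MM (\<lambda>y. Gf (u * (1 + 2 * y) / 2 powi (int (Suc T)))) = MM g"
      using MM_scale[OF lc RR_UU[OF u] UU_notin_pp[OF u]] by (simp only:)
    also have "\<dots> = (\<Sum>y\<in>reps T. g y) / of_nat (q ^ T)" using MM_eq[OF per] by (simp add: mean_def)
    finally show ?thesis by (simp add: g_def)
  qed
  have "(\<Sum>a\<in>reps (Suc T). Gf (a / 2 ^ Suc T)) = (\<Sum>s\<in>TT0. \<Sum>y\<in>reps T. Gf ((s + 2 * y) / 2 ^ Suc T))"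
    by (rule sum_reps_Suc)
  also have "\<dots> = (\<Sum>y\<in>reps T. Gf ((0 + 2 * y) / 2 ^ Suc T)) + (\<Sum>u\<in>TT. \<Sum>y\<in>reps T. Gf ((u + 2 * y) / 2 ^ Suc T))"
    unfolding UU0_def by (rule sum.insert) simp_all
  also have "(\<Sum>u\<in>TT. \<Sum>y\<in>reps T. Gf ((u + 2 * y) / 2 ^ Suc T)) =
      complex_of_real (real q powr (of_int (int (Suc T)) - 1)) * (\<Sum>u\<in>TT. MM (\<lambda>y. Gf (u * (1 + 2 * y) / 2 powi (int (Suc T)))))"
  proof -
    have e: "of_int (int (Suc T)) - 1 = real T" by simp
    have "complex_of_real (real q powr (of_int (int (Suc T)) - 1)) = of_nat (q ^ T)"
      unfolding e powr_realpow[OF q_pos] by simp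
    then show ?thesis by (simp only: sum_distrib_left U cong: sum.cong)
  qed
  also have "\<dots> = (if int (Suc T) \<in> t_range \<rho> Q n then dterm (int (Suc T)) else 0)"
    by (rule shell_sum) simp
  also have "(\<Sum>y\<in>reps T. Gf ((0 + 2 * y) / 2 ^ Suc T)) = (\<Sum>y\<in>reps T. Gf (y / 2 ^ T))" by simp
  finally show ?thesis .
qed

lemma truncated_density_eq:
  "truncated_density \<mu> (vars Q) (qeval \<rho> Q) n T =
    1 + (\<Sum>t<T. if int (Suc t) \<in> t_range \<rho> Q n then dterm (int (Suc t)) else 0)"
  unfolding truncated_density_sum
  by (induction T) (simp_all only: truncated_density_Suc sum.lessThan_Suc add.assoc, simp add: Gf_0)

end

section \<open>Convergence\<close>

text \<open>For C < 1 the terms are bounded by a geometric sequence of ratio sqrt C. For C \<ge> 1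
  the norms do not decrease along steps of two, so tending to 0 forces all of them to
  vanish.\<close>

lemma summable_norm_two_step:
  fixes a :: "nat \<Rightarrow> complex" and C :: real
  assumes C: "0 < C" and step: "\<And>j. a (j + 2) = of_real C * a j" and lim: "a \<longlonglongrightarrow> 0"
  shows "summable (\<lambda>j. norm (a j))"
proof (cases "C < 1")
  case True
  define d where "d = sqrt C"
  have d: "0 < d" "d < 1" "d * d = C" using C True by (simp_all add: d_def)
  \<comment> \<open>Chosen so that the bound holds for j = 0 and j = 1.\<close>
  define K where "K = max (norm (a 0)) (norm (a 1) / d)"
  have bound: "norm (a j) \<le> K * d ^ j" for j
  proof (induction j rule: less_induct)
    case (less j)
    consider "j = 0" | "j = 1" | i where "j = i + 2" by (metis One_nat_def add_2_eq_Suc' not0_implies_Suc)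
    then show ?case
    proof cases
      case 2
      have "norm (a 1) / d \<le> K" by (simp add: K_def)
      then show ?thesis using d 2 by (simp add: field_simps)
    next
      case 3
      have "norm (a j) = C * norm (a i)" unfolding 3 step using C by (simp add: norm_mult)
      also have "\<dots> \<le> C * (K * d ^ i)" using less[of i] C 3 by simp
      also have "\<dots> = K * d ^ j" unfolding 3 power_add power2_eq_square d(3) by simp
      finally show ?thesis .
    qed (simp add: K_def)
  qed
  have "summable (\<lambda>j. K * d ^ j)" using d by (intro summable_mult summable_geometric) simp
  then show ?thesis by (rule summable_comparison_test') (use bound in simp)
next
  case False
  have ge: "norm (a j) \<le> norm (a (j + 2 * k))" for j k
  proof (induction k)
    case (Suc k)
    have "norm (a (j + 2 * k)) \<le> C * norm (a (j + 2 * k))" using False by (simp add: mult_le_cancel_right1)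
    also have "\<dots> = norm (a (j + 2 * Suc k))" using step[of "j + 2 * k"] C by (simp add: norm_mult algebra_simps)
    finally show ?case using Suc by linarith
  qed simp
  have lim: "(\<lambda>k. norm (a (j + 2 * k))) \<longlonglongrightarrow> 0" for j
  proof -
    have "strict_mono (\<lambda>k. j + 2 * k)" by (rule strict_monoI) simp
    from LIMSEQ_subseq_LIMSEQ[OF lim this] show ?thesis by (simp add: comp_def tendsto_norm_zero)
  qed
  have "norm (a j) \<le> 0" for j by (rule LIMSEQ_le_const[OF lim[of j]]) (use ge in blast)
  then show ?thesis by simp
qed

section \<open>From convergent partial sums to unconditional summability\<close>

context unram_density
begin

abbreviation "sterm t \<equiv> (if int (Suc t) \<in> t_range \<rho> Q n then dterm (int (Suc t)) else 0)"

text \<open>The range starts at 1, hence the shift by \<open>Suc\<close>; exponents outside the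
  range become zero terms.\<close>

lemma sterm_sum:
  "dterm summable_on t_range \<rho> Q n \<longleftrightarrow> sterm summable_on UNIV" (is ?A)
  "infsum dterm (t_range \<rho> Q n) = infsum sterm UNIV" (is ?B)
proof -
  define N where "N = {t. int (Suc t) \<in> t_range \<rho> Q n}"
  have tN: "t_range \<rho> Q n = (\<lambda>t. int (Suc t)) ` N"
  proof (intro equalityI subsetI)
    fix t assume t: "t \<in> t_range \<rho> Q n"
    then have "t = int (Suc (nat (t - 1)))" by (simp add: t_range_def)
    then show "t \<in> (\<lambda>t. int (Suc t)) ` N" using t unfolding N_def by (metis (mono_tags, lifting) imageI mem_Collect_eq)
  qed (auto simp: N_def)
  have inj: "inj_on (\<lambda>t. int (Suc t)) N" by (auto intro: inj_onI)
  have "dterm summable_on t_range \<rho> Q n \<longleftrightarrow> (dterm \<circ> (\<lambda>t. int (Suc t))) summable_on N"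
    unfolding tN by (rule summable_on_reindex[OF inj])
  also have "\<dots> \<longleftrightarrow> sterm summable_on UNIV" by (rule summable_on_cong_neutral) (auto simp: N_def)
  finally show ?A .
  have "infsum dterm (t_range \<rho> Q n) = infsum (dterm \<circ> (\<lambda>t. int (Suc t))) N"
    unfolding tN by (rule infsum_reindex[OF inj])
  also have "\<dots> = infsum sterm UNIV" by (rule infsum_cong_neutral) (auto simp: N_def)
  finally show ?B .
qed

text \<open>Beyond all thresholds \<open>omega\<close> and \<open>delta\<close> see t only through
  parities, hence the step of two. The exponent is the increment of \<open>tau\<close>: t
  contributes 2, each square takes away 1 and each binary block 2.\<close>

lemma dterm_two_step:
  assumes E: "EpX Q = {}" and nn0: "nn = 0"
    and B: "\<And>i. i \<in> NpX Q \<Longrightarrow> tX Q i + 1 < t" "\<And>j. j \<in> NpY Q \<Longrightarrow> tY Q j < t" "\<And>k. k \<in> NpZ Q \<Longrightarrow> tZ Q k < t"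
  shows "dterm (t + 2) = complex_of_real (real q powr (2 - real (card (NpX Q)) - 2 * real (card (NpY Q)) -
    2 * real (card (NpZ Q)))) * dterm t"
proof -
  have sets: "{i. i \<in> NpX Q \<and> tX Q i + 1 < s} = NpX Q" "{j. j \<in> NpY Q \<and> tY Q j < s} = NpY Q"
    "{k. k \<in> NpZ Q \<and> tZ Q k < s} = NpZ Q" if "s \<in> {t, t + 2}" for s
    using that B by fastforce+
  have LL: "LL Q (t + 2) = LL Q t"
    unfolding LL_def using B(1) by (intro Collect_cong conj_cong refl) (fastforce, presburger)
  have LZ: "{k \<in> NpZ Q. tZ Q k - (t + 2) < 0 \<and> odd (tZ Q k - (t + 2))} = {k \<in> NpZ Q. tZ Q k - t < 0 \<and> odd (tZ Q k - t)}"
    using B(3) by (intro Collect_cong conj_cong refl) (fastforce, presburger)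
  have de: "delta f \<zeta> \<rho> Q (t + 2) = delta f \<zeta> \<rho> Q t" unfolding delta_def LL LZ ..
  have m: "mm (t + 2) = mm t" unfolding m_fun_def by (simp only: sets insert_iff simp_thms)
  have om: "omega f \<zeta> \<rho> Q n s = (\<Sum>u\<in>TT. shell_term (even (ell Q s)) (mm s))" for s
  proof -
    have "nu s \<in> RR" by (simp add: nn0 RR_closed(1))
    then show ?thesis by (subst omega_eq) (simp_all add: nn0 U_set_def E)
  qed
  have "omega f \<zeta> \<rho> Q n (t + 2) = omega f \<zeta> \<rho> Q n t" unfolding om m ell_def LL ..
  moreover have "tau Q (t + 2) - 1 = (2 - real (card (NpX Q)) - 2 * real (card (NpY Q)) - 2 * real (card (NpZ Q))) + (tau Q t - 1)"
    unfolding tau_def using sets[of t] sets[of "t + 2"]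
    by (simp add: sum.distrib sum_subtractf sum_divide_distrib[symmetric] field_simps)
  ultimately show ?thesis unfolding dterm_def de norm_p_eq by (simp only: powr_add of_real_mult mult_ac)
qed

text \<open>\<open>summable_on\<close> is unconditional, whereas partial sums might converge
  conditionally. For an infinite range the tail satisfies the recursion of
  \<open>summable_norm_two_step\<close>, which excludes this.\<close>

lemma summable_on_if_convergent:
  assumes "summable sterm"
  shows "sterm summable_on UNIV"
proof (cases "finite (t_range \<rho> Q n)")
  case True
  then show ?thesis using sterm_sum(1) summable_on_finite by blast
next
  case False
  have unb: "\<exists>t\<in>t_range \<rho> Q n. B < t" for B
  proof (rule ccontr)
    assume "\<not> (\<exists>t\<in>t_range \<rho> Q n. B < t)"
    then have "t_range \<rho> Q n \<subseteq> {1..B}" by (auto simp: t_range_def not_less)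
    then show False using False finite_subset by blast
  qed
  have td: "ereal (of_int t) \<le> t_d Q" and tn: "nu t \<in> RR" if "t \<in> t_range \<rho> Q n" for t
    using that t_n_iff[of t] by (auto simp: t_range_def)
  \<comment> \<open>Each such index would bound \<open>t_d Q\<close>, and with it the range.\<close>
  have D: "DpX Q = {}" and E: "EpX Q = {}" and DY: "DpY Q = {}" and DZ: "DpZ Q = {}"
    using unb td unfolding t_d_iff by (meson all_not_in_conv not_less)+
  have nn0: "nn = 0"
  proof (rule ccontr)
    assume "nn \<noteq> 0"
    then obtain k v where k: "ord_p nn = ereal (of_int k)" using ord_decomp by metis
    obtain t where t: "t \<in> t_range \<rho> Q n" "k + 3 < t" using unb by blast
    then have "ereal (of_int t) \<le> ereal (of_int k) + 3" using k by (simp add: t_range_def t_n_def)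
    then show False using t(2) by simp
  qed
  \<comment> \<open>Including 0 keeps the maximum defined and non-negative even if no index is of
    type N.\<close>
  define S where "S = insert 0 (tX Q ` NpX Q \<union> tY Q ` NpY Q \<union> tZ Q ` NpZ Q)"
  define B where "B = Max S"
  have "finite S" by (simp add: S_def)
  then have SB: "x \<le> B" if "x \<in> S" for x using that by (simp add: B_def)
  have B0: "0 \<le> B" by (rule SB) (simp add: S_def)
  have big: "i \<in> NpX Q \<Longrightarrow> tX Q i + 1 < t" "j \<in> NpY Q \<Longrightarrow> tY Q j < t" "k \<in> NpZ Q \<Longrightarrow> tZ Q k < t"
    if "B + 1 < t" for i j k t
    using SB[of "tX Q i"] SB[of "tY Q j"] SB[of "tZ Q k"] that by (auto simp: S_def)
  have range: "t \<in> t_range \<rho> Q n" if "B + 1 < t" for t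
  proof -
    have "ereal (of_int t) \<le> t_d Q" by (simp add: t_d_iff D E DY DZ)
    moreover have "ereal (of_int t) \<le> t_n \<rho> Q n + 3" unfolding t_n_iff nn0 by (simp add: RR_closed(1))
    ultimately show ?thesis using that B0 big(1)[OF that] by (fastforce simp: t_range_def)
  qed
  define s0 where "s0 = nat (B + 1)"
  have s0: "B + 1 < int (Suc (j + s0))" for j using B0 by (simp add: s0_def)
  have "summable (\<lambda>j. norm (sterm (j + s0)))"
  proof (rule summable_norm_two_step)
    show "0 < real q powr (2 - real (card (NpX Q)) - 2 * real (card (NpY Q)) - 2 * real (card (NpZ Q)))"
      using q_pos by simp
    have "int (Suc (j + 2 + s0)) = int (Suc (j + s0)) + 2" for j by simp
    then show "sterm (j + 2 + s0) = complex_of_real (real q powr (2 - real (card (NpX Q)) - 2 * real (card (NpY Q)) -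
      2 * real (card (NpZ Q)))) * sterm (j + s0)" for j
      using range[OF s0[of "j + 2"]] range[OF s0[of j]] dterm_two_step[OF E nn0 big[OF s0[of j]]] by (simp only: if_True)
    show "(\<lambda>j. sterm (j + s0)) \<longlonglongrightarrow> 0"
      by (rule LIMSEQ_ignore_initial_segment[OF summable_LIMSEQ_zero[OF assms]])
  qed
  then have "summable (\<lambda>j. norm (sterm j))" by (subst (asm) summable_iff_shift)
  then show ?thesis by (rule norm_summable_imp_summable_on)
qed

lemma density_expansion:
  "(convergent (truncated_density \<mu> (vars Q) (qeval \<rho> Q) n) \<longleftrightarrow> dterm summable_on t_range \<rho> Q n) \<and>
   (convergent (truncated_density \<mu> (vars Q) (qeval \<rho> Q) n) \<longrightarrow>
      local_density \<mu> (vars Q) (qeval \<rho> Q) n = 1 + infsum dterm (t_range \<rho> Q n))"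
proof -
  define D where "D = truncated_density \<mu> (vars Q) (qeval \<rho> Q) n"
  have D: "D = (\<lambda>T. 1 + (\<Sum>t<T. sterm t))" unfolding D_def by (rule ext) (rule truncated_density_eq)
  have limit: "D \<longlonglongrightarrow> 1 + infsum dterm (t_range \<rho> Q n)" if "dterm summable_on t_range \<rho> Q n"
  proof -
    have "sterm sums infsum sterm UNIV"
      using that unfolding sterm_sum(1) by (intro has_sum_imp_sums has_sum_infsum)
    then show ?thesis unfolding D sterm_sum(2) sums_def by (intro tendsto_add tendsto_const)
  qed
  have "dterm summable_on t_range \<rho> Q n" if "convergent D"
  proof -
    obtain L where "D \<longlonglongrightarrow> L" using \<open>convergent D\<close> unfolding convergent_def by blast
    then have "(\<lambda>T. D T - 1) \<longlonglongrightarrow> L - 1" by (intro tendsto_diff tendsto_const)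
    then have "sterm sums (L - 1)" unfolding D sums_def by simp
    then have "summable sterm" by (rule sums_summable)
    then show ?thesis unfolding sterm_sum(1) by (rule summable_on_if_convergent)
  qed
  moreover have "convergent D" if "dterm summable_on t_range \<rho> Q n" using limit[OF that] by (rule convergentI)
  moreover have "local_density \<mu> (vars Q) (qeval \<rho> Q) n = lim D" by (simp only: local_density_def D_def)
  ultimately show ?thesis using limit limI unfolding D_def by metis
qed

end

theorem theorem4p11:
  fixes f :: nat and \<zeta> \<rho> n :: "'k :: q2_field" and \<mu> :: "'k measure" and Q :: "'k qpoly"
  assumes "1 \<le> f"
    and "primitive_root_of_unity (2 ^ f - 1) \<zeta>"
    and "(UNIV :: 'k set) = q2_adjoin \<zeta>"
    and "normalized_haar \<mu>"
    and "\<rho> \<in> unit_group"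
    and "quadratic_defect (1 + 4 * \<rho>) = (\<lambda>y. 4 * y) ` int_ring"
    and "n \<in> int_ring"
    and "coeffs_ok Q"
  shows "(convergent (truncated_density \<mu> (vars Q) (qeval \<rho> Q) n) \<longleftrightarrow>
      (\<lambda>t. omega f \<zeta> \<rho> Q n t * delta f \<zeta> \<rho> Q t *
        complex_of_real (real (norm_p TYPE('k)) powr (tau Q t - 1))) summable_on t_range \<rho> Q n) \<and>
    (convergent (truncated_density \<mu> (vars Q) (qeval \<rho> Q) n) \<longrightarrow>
      local_density \<mu> (vars Q) (qeval \<rho> Q) n =
        1 + (\<Sum>\<^sub>\<infinity>t\<in>t_range \<rho> Q n. omega f \<zeta> \<rho> Q n t * delta f \<zeta> \<rho> Q t *
              complex_of_real (real (norm_p TYPE('k)) powr (tau Q t - 1))))"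
proof -
  interpret unram_density f \<zeta> \<rho> n Q \<mu>
    using assms by unfold_locales
  show ?thesis
    using density_expansion unfolding dterm_def[abs_def] .
qed

end
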